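(* Let $(A_i)_i$ be a partition of $\mathbb N$ such that for every $n\in\mathbb N$ there exist $n$ sets in $(A_i)$ whose cardinality is at least $n$. For $0<p<\infty$ let $\Omega_p,\widetilde\Omega_p:\ell_p^0\to\ell_p$ be the centralizers $$\Omega_p(x)=\frac p2\,x\log\frac{\|x\|_p}{|x|},\qquad \widetilde\Omega_p(x)=\frac p2\sum_i x_i\log\frac{\|x\|_p}{\|x_i\|_p},\qquad x_i=x1_{A_i}.$$ Then the four-term sequence $\widetilde\Omega_p\,\Omega_p$, namely $0\to\ell_p\to Z(\widetilde\Omega_p)\to Z(\Omega_p)\to\ell_p\to0$, is a nontrivial element of $\operatorname{Ext}^2(\ell_p,\ell_p)$ for each $1\le p<\infty$, and a nontrivial element of $\operatorname{Ext}^2_{\ell_\infty}(\ell_p,\ell_p)$ for each $0<p<\infty$. In particular $\operatorname{Ext}^2_{\ell_\infty}(\ell_p,\ell_p)\neq0$ for all $0<p<\infty$.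
   Context: Scalars are $\mathbb K=\mathbb R$ or $\mathbb C$. A quasinorm is a function $\|\cdot\|:X\to[0,\infty)$ with $\|\lambda x\|=|\lambda|\|x\|$, $\|x\|=0$ iff $x=0$, and $\|x+y\|\le C(\|x\|+\|y\|)$ for some constant $C$. A quasi Banach space is a complete quasinormed space; operators are bounded linear maps. A quasi Banach ($\ell_\infty$-)module is a quasi Banach space with a jointly continuous module product $\ell_\infty\times X\to X$; homomorphisms are operators $f$ with $f(ax)=af(x)$. A sequence is exact if the kernel of each arrow equals the image of the preceding one. $\operatorname{Ext}^2$. Consider four-term exact sequences $\mathscr E:\ 0\to Y\to E_1\to E_2\to X\to0$ of quasi Banach spaces and operators. Write $\mathscr E\to\mathscr F$ if there are operators $u_1:E_1\to F_1$, $u_2:E_2\to F_2$ that, together with the identities of $Y$ and $X$, make the obvious diagram commute. $\operatorname{Ext}^2(X,Y)$ is the set of classes for the equivalence relation generated by $\to$; its zero element is the class of $0\to Y\xrightarrow{\mathbf I}Y\xrightarrow{0}X\xrightarrow{\mathbf I}X\to0$, and a sequence is trivial if it is equivalent to this one. $\operatorname{Ext}^2_{\ell_\infty}(X,Y)$ is defined in the same way with quasi Banach $\ell_\infty$-modules and homomorphisms throughout. Centralizers. $\ell_p^0$ is the subspace of finitely supported sequences of $\ell_p$; $\ell_\infty$ acts on $\ell_p$ by pointwise product. A centralizer $\Phi:\ell_p^0\to\ell_p$ is a homogeneous map with $\|\Phi(ax)-a\Phi(x)\|\le C\|a\|_\infty\|x\|$ for some $C$ and all $a\in\ell_\infty$,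 $x\in\ell_p^0$; it is automatically quasilinear, i.e. $\|\Phi(x+y)-\Phi(x)-\Phi(y)\|\le Q(\|x\|+\|y\|)$. In the formulas above a zero coordinate or zero piece $x_i$ contributes $0$. Induced and spliced sequences. For a quasilinear $\Phi:\ell_p^0\to\ell_p$, $Z(\Phi)$ is the completion of $\ell_p\times\ell_p^0$ with the quasinorm $\|(y,x)\|_\Phi=\|y-\Phi(x)\|+\|x\|$, and the induced exact sequence is $0\to\ell_p\xrightarrow{\imath}Z(\Phi)\xrightarrow{\pi}\ell_p\to0$, $\imath(y)=(y,0)$, $\pi(y,x)=x$. If $\Phi$ is a centralizer, $Z(\Phi)$ is a quasi Banach module under $a(y,x)=(ay,ax)$ and the induced sequence is one of modules. $\Phi\,\Psi$ denotes the four-term sequence $0\to\ell_p\to Z(\Phi)\to Z(\Psi)\to\ell_p\to0$ whose middle arrow is the composition $Z(\Phi)\to\ell_p\to Z(\Psi)$ of the quotient map and the inclusion. *)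

theory Defs
  imports "HOL-Analysis.Analysis"
begin

section \<open>Quasi Banach spaces and quasi Banach modules over bounded sequences\<close>

text \<open>The scalar field is a type variable \<open>'k\<close>. On the sort \<open>{real_normed_field, euclidean_space}\<close> it
  ranges, up to isometric isomorphism, over exactly the real and the complex numbers; the
  definitions only need \<open>real_normed_field\<close>.\<close>

record ('k, 'a) qspace =
  carr :: "'a set"
  zer :: "'a"
  add :: "'a \<Rightarrow> 'a \<Rightarrow> 'a"
  scl :: "'k \<Rightarrow> 'a \<Rightarrow> 'a"
  qnorm :: "'a \<Rightarrow> real"

record ('k, 'a) qmodule = "('k, 'a) qspace" +
  act :: "(nat \<Rightarrow> 'k) \<Rightarrow> 'a \<Rightarrow> 'a"

definition dif :: "('k::real_normed_field, 'a, 'm) qspace_scheme \<Rightarrow> 'a \<Rightarrow> 'a \<Rightarrow> 'a" where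
  "dif V x y = add V x (scl V (- 1) y)"

definition linear_space :: "('k::real_normed_field, 'a, 'm) qspace_scheme \<Rightarrow> bool" where
  "linear_space V \<longleftrightarrow>
     zer V \<in> carr V \<and>
     (\<forall>x\<in>carr V. \<forall>y\<in>carr V. add V x y \<in> carr V) \<and>
     (\<forall>c. \<forall>x\<in>carr V. scl V c x \<in> carr V) \<and>
     (\<forall>x\<in>carr V. \<forall>y\<in>carr V. \<forall>z\<in>carr V. add V (add V x y) z = add V x (add V y z)) \<and>
     (\<forall>x\<in>carr V. \<forall>y\<in>carr V. add V x y = add V y x) \<and>
     (\<forall>x\<in>carr V. add V (zer V) x = x) \<and>
     (\<forall>x\<in>carr V. dif V x x = zer V) \<and>
     (\<forall>c. \<forall>x\<in>carr V. \<forall>y\<in>carr V. scl V c (add V x y) = add V (scl V c x) (scl V c y)) \<and>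
     (\<forall>c d. \<forall>x\<in>carr V. scl V (c + d) x = add V (scl V c x) (scl V d x)) \<and>
     (\<forall>c d. \<forall>x\<in>carr V. scl V (c * d) x = scl V c (scl V d x)) \<and>
     (\<forall>x\<in>carr V. scl V 1 x = x)"

definition quasinormed :: "('k::real_normed_field, 'a, 'm) qspace_scheme \<Rightarrow> bool" where
  "quasinormed V \<longleftrightarrow>
     linear_space V \<and>
     (\<forall>x\<in>carr V. 0 \<le> qnorm V x) \<and>
     (\<forall>c. \<forall>x\<in>carr V. qnorm V (scl V c x) = norm c * qnorm V x) \<and>
     (\<forall>x\<in>carr V. qnorm V x = 0 \<longleftrightarrow> x = zer V) \<and>
     (\<exists>C. \<forall>x\<in>carr V. \<forall>y\<in>carr V. qnorm V (add V x y) \<le> C * (qnorm V x + qnorm V y))"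

definition cauchy_seq :: "('k::real_normed_field, 'a, 'm) qspace_scheme \<Rightarrow> (nat \<Rightarrow> 'a) \<Rightarrow> bool" where
  "cauchy_seq V s \<longleftrightarrow>
     range s \<subseteq> carr V \<and> (\<forall>e>0. \<exists>N. \<forall>m\<ge>N. \<forall>n\<ge>N. qnorm V (dif V (s m) (s n)) < e)"

definition quasi_banach :: "('k::real_normed_field, 'a, 'm) qspace_scheme \<Rightarrow> bool" where
  "quasi_banach V \<longleftrightarrow>
     quasinormed V \<and>
     (\<forall>s. cauchy_seq V s \<longrightarrow> (\<exists>x\<in>carr V. (\<lambda>n. qnorm V (dif V (s n) x)) \<longlonglongrightarrow> 0))"

definition bdd_operator ::
  "('k::real_normed_field, 'a, 'm) qspace_scheme \<Rightarrow> ('k, 'b, 'n) qspace_scheme \<Rightarrow> ('a \<Rightarrow> 'b) \<Rightarrow> bool" where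
  "bdd_operator V W f \<longleftrightarrow>
     (\<forall>x\<in>carr V. f x \<in> carr W) \<and>
     (\<forall>x\<in>carr V. \<forall>y\<in>carr V. f (add V x y) = add W (f x) (f y)) \<and>
     (\<forall>c. \<forall>x\<in>carr V. f (scl V c x) = scl W c (f x)) \<and>
     (\<exists>C. \<forall>x\<in>carr V. qnorm W (f x) \<le> C * qnorm V x)"

definition linf :: "(nat \<Rightarrow> 'k::real_normed_field) set" where
  "linf = {a. bounded (range a)}"

definition linf_norm :: "(nat \<Rightarrow> 'k::real_normed_field) \<Rightarrow> real" where
  "linf_norm a = (SUP n. norm (a n))"

definition quasi_banach_module :: "('k::real_normed_field, 'a, 'm) qmodule_scheme \<Rightarrow> bool" where
  "quasi_banach_module M \<longleftrightarrow>
     quasi_banach M \<and>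
     (\<forall>a\<in>linf. \<forall>x\<in>carr M. act M a x \<in> carr M) \<and>
     (\<forall>a\<in>linf. \<forall>x\<in>carr M. \<forall>y\<in>carr M. act M a (add M x y) = add M (act M a x) (act M a y)) \<and>
     (\<forall>a\<in>linf. \<forall>b\<in>linf. \<forall>x\<in>carr M. act M (\<lambda>n. a n + b n) x = add M (act M a x) (act M b x)) \<and>
     (\<forall>a\<in>linf. \<forall>b\<in>linf. \<forall>x\<in>carr M. act M (\<lambda>n. a n * b n) x = act M a (act M b x)) \<and>
     (\<forall>c. \<forall>x\<in>carr M. act M (\<lambda>n. c) x = scl M c x) \<and>
     (\<forall>a\<in>linf. \<forall>x\<in>carr M. \<forall>e>0. \<exists>d>0. \<forall>b\<in>linf. \<forall>y\<in>carr M.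
        linf_norm (\<lambda>n. b n - a n) < d \<longrightarrow> qnorm M (dif M y x) < d \<longrightarrow>
        qnorm M (dif M (act M b y) (act M a x)) < e)"

definition module_hom ::
  "('k::real_normed_field, 'a, 'm) qmodule_scheme \<Rightarrow> ('k, 'b, 'n) qmodule_scheme \<Rightarrow> ('a \<Rightarrow> 'b) \<Rightarrow> bool" where
  "module_hom M N f \<longleftrightarrow>
     bdd_operator M N f \<and> (\<forall>a\<in>linf. \<forall>x\<in>carr M. f (act M a x) = act N a (f x))"


section \<open>Four-term exact sequences and the second Ext\<close>

text \<open>A sequence \<open>0 \<rightarrow> Y \<rightarrow> mid1 \<rightarrow> mid2 \<rightarrow> X \<rightarrow> 0\<close>; the end objects are parameters. The definitions are
  relative to a class of objects and a class of arrows, so that spaces and modules are treated alike.\<close>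

record ('s, 'a) fourterm =
  mid1 :: 's
  mid2 :: 's
  arr1 :: "'a \<Rightarrow> 'a"
  arr2 :: "'a \<Rightarrow> 'a"
  arr3 :: "'a \<Rightarrow> 'a"

definition four_exact ::
  "(('k, 'a, 'm) qspace_scheme \<Rightarrow> bool) \<Rightarrow>
   (('k, 'a, 'm) qspace_scheme \<Rightarrow> ('k, 'a, 'm) qspace_scheme \<Rightarrow> ('a \<Rightarrow> 'a) \<Rightarrow> bool) \<Rightarrow>
   ('k, 'a, 'm) qspace_scheme \<Rightarrow> ('k, 'a, 'm) qspace_scheme \<Rightarrow>
   (('k, 'a, 'm) qspace_scheme, 'a) fourterm \<Rightarrow> bool" where
  "four_exact obj hom X Y E \<longleftrightarrow>
     obj Y \<and> obj (mid1 E) \<and> obj (mid2 E) \<and> obj X \<and>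
     hom Y (mid1 E) (arr1 E) \<and> hom (mid1 E) (mid2 E) (arr2 E) \<and> hom (mid2 E) X (arr3 E) \<and>
     {y \<in> carr Y. arr1 E y = zer (mid1 E)} = {zer Y} \<and>
     {e \<in> carr (mid1 E). arr2 E e = zer (mid2 E)} = arr1 E ` carr Y \<and>
     {e \<in> carr (mid2 E). arr3 E e = zer X} = arr2 E ` carr (mid1 E) \<and>
     carr X = arr3 E ` carr (mid2 E)"

definition four_arrow ::
  "(('k, 'a, 'm) qspace_scheme \<Rightarrow> bool) \<Rightarrow>
   (('k, 'a, 'm) qspace_scheme \<Rightarrow> ('k, 'a, 'm) qspace_scheme \<Rightarrow> ('a \<Rightarrow> 'a) \<Rightarrow> bool) \<Rightarrow>
   ('k, 'a, 'm) qspace_scheme \<Rightarrow> ('k, 'a, 'm) qspace_scheme \<Rightarrow>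
   (('k, 'a, 'm) qspace_scheme, 'a) fourterm \<Rightarrow> (('k, 'a, 'm) qspace_scheme, 'a) fourterm \<Rightarrow> bool" where
  "four_arrow obj hom X Y E F \<longleftrightarrow>
     four_exact obj hom X Y E \<and> four_exact obj hom X Y F \<and>
     (\<exists>u1 u2. hom (mid1 E) (mid1 F) u1 \<and> hom (mid2 E) (mid2 F) u2 \<and>
        (\<forall>y\<in>carr Y. u1 (arr1 E y) = arr1 F y) \<and>
        (\<forall>e\<in>carr (mid1 E). u2 (arr2 E e) = arr2 F (u1 e)) \<and>
        (\<forall>e\<in>carr (mid2 E). arr3 F (u2 e) = arr3 E e))"

definition four_class ::
  "(('k, 'a, 'm) qspace_scheme \<Rightarrow> bool) \<Rightarrow>
   (('k, 'a, 'm) qspace_scheme \<Rightarrow> ('k, 'a, 'm) qspace_scheme \<Rightarrow> ('a \<Rightarrow> 'a) \<Rightarrow> bool) \<Rightarrow>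
   ('k, 'a, 'm) qspace_scheme \<Rightarrow> ('k, 'a, 'm) qspace_scheme \<Rightarrow>
   (('k, 'a, 'm) qspace_scheme, 'a) fourterm \<Rightarrow> (('k, 'a, 'm) qspace_scheme, 'a) fourterm set" where
  "four_class obj hom X Y E = {F. equivclp (four_arrow obj hom X Y) E F}"

definition zero_seq ::
  "('k, 'a, 'm) qspace_scheme \<Rightarrow> ('k, 'a, 'm) qspace_scheme \<Rightarrow> (('k, 'a, 'm) qspace_scheme, 'a) fourterm" where
  "zero_seq X Y = \<lparr>mid1 = Y, mid2 = X, arr1 = id, arr2 = (\<lambda>_. zer X), arr3 = id\<rparr>"

definition Ext2_class ::
  "('k::real_normed_field, 'a) qspace \<Rightarrow> ('k, 'a) qspace \<Rightarrow>
   (('k, 'a) qspace, 'a) fourterm \<Rightarrow> (('k, 'a) qspace, 'a) fourterm set" where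
  "Ext2_class X Y E = four_class quasi_banach bdd_operator X Y E"

definition Ext2 ::
  "('k::real_normed_field, 'a) qspace \<Rightarrow> ('k, 'a) qspace \<Rightarrow> (('k, 'a) qspace, 'a) fourterm set set" where
  "Ext2 X Y = Ext2_class X Y ` {E. four_exact quasi_banach bdd_operator X Y E}"

definition Ext2_zero ::
  "('k::real_normed_field, 'a) qspace \<Rightarrow> ('k, 'a) qspace \<Rightarrow> (('k, 'a) qspace, 'a) fourterm set" where
  "Ext2_zero X Y = Ext2_class X Y (zero_seq X Y)"

definition Ext2_mod_class ::
  "('k::real_normed_field, 'a) qmodule \<Rightarrow> ('k, 'a) qmodule \<Rightarrow>
   (('k, 'a) qmodule, 'a) fourterm \<Rightarrow> (('k, 'a) qmodule, 'a) fourterm set" where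
  "Ext2_mod_class X Y E = four_class quasi_banach_module module_hom X Y E"

definition Ext2_mod ::
  "('k::real_normed_field, 'a) qmodule \<Rightarrow> ('k, 'a) qmodule \<Rightarrow> (('k, 'a) qmodule, 'a) fourterm set set" where
  "Ext2_mod X Y = Ext2_mod_class X Y ` {E. four_exact quasi_banach_module module_hom X Y E}"

definition Ext2_mod_zero ::
  "('k::real_normed_field, 'a) qmodule \<Rightarrow> ('k, 'a) qmodule \<Rightarrow> (('k, 'a) qmodule, 'a) fourterm set" where
  "Ext2_mod_zero X Y = Ext2_mod_class X Y (zero_seq X Y)"


section \<open>Completion of a quasinormed space\<close>

definition cauchy_class :: "('k::real_normed_field, 'a, 'm) qspace_scheme \<Rightarrow> (nat \<Rightarrow> 'a) \<Rightarrow> (nat \<Rightarrow> 'a) set" where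
  "cauchy_class V s = {t. cauchy_seq V t \<and> (\<lambda>n. qnorm V (dif V (t n) (s n))) \<longlonglongrightarrow> 0}"

text \<open>A quasinorm need not be continuous, so it does not extend to the completion by taking limits
  and is determined there only up to equivalence. The quasinorm below is the gauge of the closures
  of the balls of \<open>V\<close>.\<close>

definition completion :: "('k::real_normed_field, 'a) qspace \<Rightarrow> ('k, (nat \<Rightarrow> 'a) set) qspace" where
  "completion V =
     \<lparr>carr = cauchy_class V ` {s. cauchy_seq V s},
      zer = cauchy_class V (\<lambda>_. zer V),
      add = (\<lambda>c d. \<Union>s\<in>c. \<Union>t\<in>d. cauchy_class V (\<lambda>n. add V (s n) (t n))),
      scl = (\<lambda>k c. \<Union>s\<in>c. cauchy_class V (\<lambda>n. scl V k (s n))),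
      qnorm = (\<lambda>c. Inf {r. \<exists>s\<in>c. \<forall>n. qnorm V (s n) \<le> r})\<rparr>"


section \<open>The spaces of p-summable sequences, centralizers and induced sequences\<close>

definition lp :: "real \<Rightarrow> (nat \<Rightarrow> 'k::real_normed_field) set" where
  "lp p = {x. summable (\<lambda>n. norm (x n) powr p)}"

definition lp_norm :: "real \<Rightarrow> (nat \<Rightarrow> 'k::real_normed_field) \<Rightarrow> real" where
  "lp_norm p x = (\<Sum>n. norm (x n) powr p) powr (1 / p)"

definition fin_supp :: "(nat \<Rightarrow> 'k::real_normed_field) set" where
  "fin_supp = {x. finite {n. x n \<noteq> 0}}"

definition lp_module :: "real \<Rightarrow> ('k::real_normed_field, nat \<Rightarrow> 'k) qmodule" where
  "lp_module p =
     \<lparr>carr = lp p,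
      zer = (\<lambda>n. 0),
      add = (\<lambda>x y n. x n + y n),
      scl = (\<lambda>c x n. c * x n),
      qnorm = lp_norm p,
      act = (\<lambda>a x n. a n * x n)\<rparr>"

definition centralizer :: "real \<Rightarrow> ((nat \<Rightarrow> 'k::real_normed_field) \<Rightarrow> nat \<Rightarrow> 'k) \<Rightarrow> bool" where
  "centralizer p \<Phi> \<longleftrightarrow>
     (\<forall>x\<in>fin_supp. \<Phi> x \<in> lp p) \<and>
     (\<forall>c. \<forall>x\<in>fin_supp. \<Phi> (\<lambda>n. c * x n) = (\<lambda>n. c * \<Phi> x n)) \<and>
     (\<exists>C. \<forall>a\<in>linf. \<forall>x\<in>fin_supp.
        lp_norm p (\<lambda>n. \<Phi> (\<lambda>m. a m * x m) n - a n * \<Phi> x n) \<le> C * linf_norm a * lp_norm p x)"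

type_synonym 'k pair = "(nat \<Rightarrow> 'k) \<times> (nat \<Rightarrow> 'k)"

definition twisted_pairs ::
  "real \<Rightarrow> ((nat \<Rightarrow> 'k::real_normed_field) \<Rightarrow> nat \<Rightarrow> 'k) \<Rightarrow> ('k, 'k pair) qspace" where
  "twisted_pairs p \<Phi> =
     \<lparr>carr = lp p \<times> fin_supp,
      zer = (\<lambda>n. 0, \<lambda>n. 0),
      add = (\<lambda>v w. (\<lambda>n. fst v n + fst w n, \<lambda>n. snd v n + snd w n)),
      scl = (\<lambda>c v. (\<lambda>n. c * fst v n, \<lambda>n. c * snd v n)),
      qnorm = (\<lambda>v. lp_norm p (\<lambda>n. fst v n - \<Phi> (snd v) n) + lp_norm p (snd v))\<rparr>"

definition Z_space ::
  "real \<Rightarrow> ((nat \<Rightarrow> 'k::real_normed_field) \<Rightarrow> nat \<Rightarrow> 'k) \<Rightarrow> ('k, (nat \<Rightarrow> 'k pair) set) qspace" where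
  "Z_space p \<Phi> = completion (twisted_pairs p \<Phi>)"

definition Z_module ::
  "real \<Rightarrow> ((nat \<Rightarrow> 'k::real_normed_field) \<Rightarrow> nat \<Rightarrow> 'k) \<Rightarrow> ('k, (nat \<Rightarrow> 'k pair) set) qmodule" where
  "Z_module p \<Phi> = qspace.extend (Z_space p \<Phi>) (qmodule.fields
     (\<lambda>a c. \<Union>s\<in>c. cauchy_class (twisted_pairs p \<Phi>)
        (\<lambda>n. (\<lambda>m. a m * fst (s n) m, \<lambda>m. a m * snd (s n) m))))"

definition Z_incl ::
  "real \<Rightarrow> ((nat \<Rightarrow> 'k::real_normed_field) \<Rightarrow> nat \<Rightarrow> 'k) \<Rightarrow> (nat \<Rightarrow> 'k) \<Rightarrow> (nat \<Rightarrow> 'k pair) set" where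
  "Z_incl p \<Phi> y = cauchy_class (twisted_pairs p \<Phi>) (\<lambda>_. (y, \<lambda>n. 0))"

text \<open>The continuous extension of \<open>(y, x) \<mapsto> x\<close> to the completion.\<close>

definition Z_quot :: "real \<Rightarrow> (nat \<Rightarrow> 'k::real_normed_field pair) set \<Rightarrow> nat \<Rightarrow> 'k" where
  "Z_quot p c = (THE x. x \<in> lp p \<and> (\<forall>s\<in>c. (\<lambda>n. lp_norm p (\<lambda>m. snd (s n) m - x m)) \<longlonglongrightarrow> 0))"


section \<open>A universe for the spaces involved\<close>

text \<open>The equivalence relation defining the second Ext passes through arbitrary intermediate spaces,
  while a formula of HOL can only quantify over spaces carried by one type. The type below contains
  the spaces at hand together with an arbitrary type \<open>'u\<close>; statements with \<open>'u\<close> a free type variable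
  account for intermediate spaces of any size.\<close>

datatype ('k, 'u) univ =
    Sq (un_Sq: "nat \<Rightarrow> 'k")
  | Cl (un_Cl: "(nat \<Rightarrow> 'k pair) set")
  | Other 'u

text \<open>Transport of structure along an injection \<open>f\<close> with left inverse \<open>g\<close>.\<close>

definition copy_space :: "('a \<Rightarrow> 'b) \<Rightarrow> ('b \<Rightarrow> 'a) \<Rightarrow> ('k, 'a) qspace \<Rightarrow> ('k, 'b) qspace" where
  "copy_space f g V =
     \<lparr>carr = f ` carr V,
      zer = f (zer V),
      add = (\<lambda>x y. f (add V (g x) (g y))),
      scl = (\<lambda>c x. f (scl V c (g x))),
      qnorm = (\<lambda>x. qnorm V (g x))\<rparr>"

definition copy_module :: "('a \<Rightarrow> 'b) \<Rightarrow> ('b \<Rightarrow> 'a) \<Rightarrow> ('k, 'a) qmodule \<Rightarrow> ('k, 'b) qmodule" where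
  "copy_module f g M =
     qspace.extend (copy_space f g (qspace.truncate M)) (qmodule.fields (\<lambda>a x. f (act M a (g x))))"

definition ell_space :: "real \<Rightarrow> ('k::real_normed_field, ('k, 'u) univ) qspace" where
  "ell_space p = copy_space Sq un_Sq (qspace.truncate (lp_module p))"

definition ell_module :: "real \<Rightarrow> ('k::real_normed_field, ('k, 'u) univ) qmodule" where
  "ell_module p = copy_module Sq un_Sq (lp_module p)"

definition splice_space ::
  "real \<Rightarrow> ((nat \<Rightarrow> 'k::real_normed_field) \<Rightarrow> nat \<Rightarrow> 'k) \<Rightarrow> ((nat \<Rightarrow> 'k) \<Rightarrow> nat \<Rightarrow> 'k) \<Rightarrow>
   (('k, ('k, 'u) univ) qspace, ('k, 'u) univ) fourterm" where
  "splice_space p \<Phi> \<Psi> =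
     \<lparr>mid1 = copy_space Cl un_Cl (Z_space p \<Phi>),
      mid2 = copy_space Cl un_Cl (Z_space p \<Psi>),
      arr1 = (\<lambda>u. Cl (Z_incl p \<Phi> (un_Sq u))),
      arr2 = (\<lambda>u. Cl (Z_incl p \<Psi> (Z_quot p (un_Cl u)))),
      arr3 = (\<lambda>u. Sq (Z_quot p (un_Cl u)))\<rparr>"

definition splice_module ::
  "real \<Rightarrow> ((nat \<Rightarrow> 'k::real_normed_field) \<Rightarrow> nat \<Rightarrow> 'k) \<Rightarrow> ((nat \<Rightarrow> 'k) \<Rightarrow> nat \<Rightarrow> 'k) \<Rightarrow>
   (('k, ('k, 'u) univ) qmodule, ('k, 'u) univ) fourterm" where
  "splice_module p \<Phi> \<Psi> =
     \<lparr>mid1 = copy_module Cl un_Cl (Z_module p \<Phi>),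
      mid2 = copy_module Cl un_Cl (Z_module p \<Psi>),
      arr1 = (\<lambda>u. Cl (Z_incl p \<Phi> (un_Sq u))),
      arr2 = (\<lambda>u. Cl (Z_incl p \<Psi> (Z_quot p (un_Cl u)))),
      arr3 = (\<lambda>u. Sq (Z_quot p (un_Cl u)))\<rparr>"


section \<open>The two centralizers\<close>

definition Omega :: "real \<Rightarrow> (nat \<Rightarrow> 'k::real_normed_field) \<Rightarrow> nat \<Rightarrow> 'k" where
  "Omega p x = (\<lambda>n. of_real (p / 2 * ln (lp_norm p x / norm (x n))) * x n)"

definition piece :: "nat set \<Rightarrow> (nat \<Rightarrow> 'k::real_normed_field) \<Rightarrow> nat \<Rightarrow> 'k" where
  "piece B x = (\<lambda>n. if n \<in> B then x n else 0)"

text \<open>For finitely supported \<open>x\<close> only finitely many pieces are nonzero; the sum is restricted to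
  those because a sum over an infinite index set is \<open>0\<close> by convention.\<close>

definition Omega_tilde :: "nat set set \<Rightarrow> real \<Rightarrow> (nat \<Rightarrow> 'k::real_normed_field) \<Rightarrow> nat \<Rightarrow> 'k" where
  "Omega_tilde \<A> p x = (\<lambda>n. of_real (p / 2) *
     (\<Sum>B | B \<in> \<A> \<and> piece B x \<noteq> (\<lambda>_. 0).
        of_real (ln (lp_norm p x / lp_norm p (piece B x))) * piece B x n))"

definition large_partition :: "nat set set \<Rightarrow> bool" where
  "large_partition \<A> \<longleftrightarrow>
     partition_on UNIV \<A> \<and>
     (\<forall>n. \<exists>\<B>\<subseteq>\<A>. finite \<B> \<and> card \<B> = n \<and> (\<forall>B\<in>\<B>. infinite B \<or> n \<le> card B))"

end

theory Submission
  imports Defs "HOL-Library.Nat_Bijection"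
begin

text \<open>
  Lift every finitely supported \<open>x\<close> of \<open>X\<close> boundedly to the second middle term of a four-term sequence,
  and the failure of the lifts to commute with restriction to sets \<open>T\<close> boundedly to the first one. The
  identity \<open>1\<^sub>e 1\<^sub>T = 1\<^sub>e\<close> for \<open>e \<in> T\<close> then produces elements of \<open>Y\<close>, and whether these form a bounded
  coboundary is invariant under the equivalence defining Ext, by the open mapping theorem; it holds for
  the zero sequence. For the spliced sequence (after averaging over signs in the case of spaces, which needs
  \<open>p \<ge> 1\<close>) a bounded coboundary is a function \<open>\<psi>\<close> such that, for \<open>e \<in> T \<subseteq> S\<close>,
  \<open>\<psi> S e - \<psi> T e\<close> is \<open>ln (\<bar>S\<bar> / \<bar>T\<bar>) * ln (\<bar>T\<bar> / \<bar>T \<inter> A\<bar>) / 4\<close>, where \<open>A\<close> is the set of the partition containing \<open>e\<close>,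
  up to an error whose \<open>p\<close>-th powers sum over \<open>e \<in> T\<close> to \<open>O(\<bar>S\<bar>)\<close>. Descending from a large grid to a point along
  two different chains of sets, while avoiding the points where the error is big, yields two
  incompatible estimates of \<open>\<psi>\<close>.
\<close>

section \<open>Linear and quasinormed spaces on a carrier\<close>

text \<open>The predicted increment is a product of two logarithms and therefore depends on the
  path: shrinking is rewarded in proportion to the logarithm of the number of cells still in play.
  On a grid of \<open>2 ^ a\<close> cells, halving all cells at once pays a multiple of
  \<open>a\<close> per step, for \<open>32 * a\<close> steps. Discarding cells instead takes only
  about \<open>a\<close> steps, of comparable reward, and shrinking inside the last cell pays
  nothing. Both totals are quadratic in \<open>a\<close>; the proportions of the grid are chosen so
  that they differ. The obstacle is that the error is controlled only in the mean, so a chain cannot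
  prescribe the point at which it ends. Each descent is therefore proved for an arbitrary large set
  \<open>U\<close> of admissible points and ends in \<open>U\<close>. The points that satisfy the
  first estimate then form a set large enough to serve as \<open>U\<close> for the second, and some
  point satisfies both. In the algebraic part the lifts are bounded but not linear: the open mapping
  theorem, needed for quasi Banach spaces and closed ranges, supplies them with bounds uniform in
  \<open>x\<close> and \<open>T\<close>.\<close>

context
  fixes V :: "('k::real_normed_field, 'a, 'm) qspace_scheme"
  assumes lin: "linear_space V"
begin

lemma zer_in: "zer V \<in> carr V"
  and add_in: "x \<in> carr V \<Longrightarrow> y \<in> carr V \<Longrightarrow> add V x y \<in> carr V"
  and scl_in: "x \<in> carr V \<Longrightarrow> scl V c x \<in> carr V"
  and add_assoc: "x \<in> carr V \<Longrightarrow> y \<in> carr V \<Longrightarrow> z \<in> carr V \<Longrightarrow> add V (add V x y) z = add V x (add V y z)"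
  and add_commute: "x \<in> carr V \<Longrightarrow> y \<in> carr V \<Longrightarrow> add V x y = add V y x"
  and zer_add: "x \<in> carr V \<Longrightarrow> add V (zer V) x = x"
  and dif_self: "x \<in> carr V \<Longrightarrow> dif V x x = zer V"
  and scl_add: "x \<in> carr V \<Longrightarrow> y \<in> carr V \<Longrightarrow> scl V c (add V x y) = add V (scl V c x) (scl V c y)"
  and scl_plus: "x \<in> carr V \<Longrightarrow> scl V (c + d) x = add V (scl V c x) (scl V d x)"
  and scl_scl: "x \<in> carr V \<Longrightarrow> scl V c (scl V d x) = scl V (c * d) x"
  and scl_one: "x \<in> carr V \<Longrightarrow> scl V 1 x = x"
  using lin unfolding linear_space_def by auto

lemma dif_in: "x \<in> carr V \<Longrightarrow> y \<in> carr V \<Longrightarrow> dif V x y \<in> carr V"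
  by (simp add: dif_def add_in scl_in)

lemma add_left_commute:
  "x \<in> carr V \<Longrightarrow> y \<in> carr V \<Longrightarrow> z \<in> carr V \<Longrightarrow> add V x (add V y z) = add V y (add V x z)"
  by (metis add_assoc add_commute)

lemmas carr_add_ac = add_assoc add_commute add_left_commute

lemma add_zer: "x \<in> carr V \<Longrightarrow> add V x (zer V) = x"
  by (metis add_commute zer_add zer_in)

lemma scl_zero: "x \<in> carr V \<Longrightarrow> scl V 0 x = zer V"
  using scl_plus[of x 1 "-1"] dif_self[of x] by (simp add: dif_def scl_one)

lemma scl_zer: "scl V c (zer V) = zer V"
  by (metis mult_zero_right scl_scl scl_zero zer_in)

lemma dif_zer: "x \<in> carr V \<Longrightarrow> dif V x (zer V) = x"
  by (simp add: dif_def scl_zer add_zer)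

lemma scl_dif: "x \<in> carr V \<Longrightarrow> y \<in> carr V \<Longrightarrow> scl V c (dif V x y) = dif V (scl V c x) (scl V c y)"
  by (simp add: dif_def scl_add scl_in scl_scl)

lemma dif_add_add:
  "\<lbrakk>x \<in> carr V; y \<in> carr V; z \<in> carr V; w \<in> carr V\<rbrakk> \<Longrightarrow>
    dif V (add V x y) (add V z w) = add V (dif V x z) (dif V y w)"
  by (simp add: dif_def scl_add scl_in add_in carr_add_ac)

lemma dif_dif_dif:
  "\<lbrakk>x \<in> carr V; y \<in> carr V; z \<in> carr V; w \<in> carr V\<rbrakk> \<Longrightarrow>
    dif V (dif V x y) (dif V z w) = dif V (dif V x z) (dif V y w)"
  by (simp add: dif_def scl_add scl_in add_in carr_add_ac)

lemma dif_add_cancel: "x \<in> carr V \<Longrightarrow> y \<in> carr V \<Longrightarrow> add V (dif V x y) y = x"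
  using dif_self[of y] by (simp add: dif_def add_assoc scl_in add_commute[of "scl V (-1) y" y] add_zer)

lemma add_dif_cancel: "x \<in> carr V \<Longrightarrow> y \<in> carr V \<Longrightarrow> dif V (add V x y) y = x"
  using dif_self[of y] by (simp add: dif_def add_assoc scl_in add_zer)

lemma dif_eq_zer_iff: "x \<in> carr V \<Longrightarrow> y \<in> carr V \<Longrightarrow> dif V x y = zer V \<longleftrightarrow> x = y"
  by (metis dif_add_cancel dif_self zer_add)

lemma dif_add_dif:
  "\<lbrakk>x \<in> carr V; y \<in> carr V; z \<in> carr V\<rbrakk> \<Longrightarrow> add V (dif V x y) (dif V y z) = dif V x z"
  by (metis add_assoc dif_add_cancel dif_def dif_in scl_in)

lemma dif_swap: "x \<in> carr V \<Longrightarrow> y \<in> carr V \<Longrightarrow> dif V y x = scl V (- 1) (dif V x y)"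
  by (simp add: dif_def scl_add scl_in scl_scl scl_one add_commute)

end

lemma quasinormed_linear: "quasinormed V \<Longrightarrow> linear_space V"
  by (simp add: quasinormed_def)

lemma quasi_banach_quasinormed: "quasi_banach V \<Longrightarrow> quasinormed V"
  by (simp add: quasi_banach_def)

lemmas quasi_banach_linear = quasinormed_linear[OF quasi_banach_quasinormed]

lemma quasinormedI:
  assumes "linear_space V" "\<And>x. x \<in> carr V \<Longrightarrow> 0 \<le> qnorm V x"
    "\<And>c x. x \<in> carr V \<Longrightarrow> qnorm V (scl V c x) = norm c * qnorm V x"
    "\<And>x. x \<in> carr V \<Longrightarrow> qnorm V x = 0 \<Longrightarrow> x = zer V"
    "\<And>x y. x \<in> carr V \<Longrightarrow> y \<in> carr V \<Longrightarrow> qnorm V (add V x y) \<le> K * (qnorm V x + qnorm V y)"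
  shows "quasinormed V"
proof -
  have "qnorm V (zer V) = 0"
    using assms(3)[of "zer V" 0] by (simp add: zer_in scl_zer assms(1))
  then show ?thesis using assms unfolding quasinormed_def by blast
qed

context
  fixes V :: "('k::real_normed_field, 'a, 'm) qspace_scheme"
  assumes qn: "quasinormed V"
begin

lemma qnorm_nonneg: "x \<in> carr V \<Longrightarrow> 0 \<le> qnorm V x"
  and qnorm_scl: "x \<in> carr V \<Longrightarrow> qnorm V (scl V c x) = norm c * qnorm V x"
  and qnorm_eq_zero_iff: "x \<in> carr V \<Longrightarrow> qnorm V x = 0 \<longleftrightarrow> x = zer V"
  using qn by (simp_all add: quasinormed_def)

lemma qnorm_zer: "qnorm V (zer V) = 0"
  by (simp add: qnorm_eq_zero_iff zer_in quasinormed_linear[OF qn])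

lemma qnorm_dif_commute: "x \<in> carr V \<Longrightarrow> y \<in> carr V \<Longrightarrow> qnorm V (dif V x y) = qnorm V (dif V y x)"
  using dif_swap[OF quasinormed_linear[OF qn], of y x]
  by (simp add: qnorm_scl dif_in quasinormed_linear[OF qn])

text \<open>Replacing the constant by its maximum with 1 allows it to be inserted freely when
  estimates are combined. The last inequality is the form in which chains of approximations use
  it.\<close>

lemma quasi_triangle_obtain:
  obtains K where "K \<ge> 1"
    "\<And>x y. x \<in> carr V \<Longrightarrow> y \<in> carr V \<Longrightarrow> qnorm V (add V x y) \<le> K * (qnorm V x + qnorm V y)"
    "\<And>x y. x \<in> carr V \<Longrightarrow> y \<in> carr V \<Longrightarrow> qnorm V (dif V x y) \<le> K * (qnorm V x + qnorm V y)"
    "\<And>x y z. x \<in> carr V \<Longrightarrow> y \<in> carr V \<Longrightarrow> z \<in> carr V \<Longrightarrow>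
      qnorm V (dif V x z) \<le> K * (qnorm V (dif V x y) + qnorm V (dif V y z))"
proof -
  note l = quasinormed_linear[OF qn]
  obtain C where C: "\<forall>x\<in>carr V. \<forall>y\<in>carr V. qnorm V (add V x y) \<le> C * (qnorm V x + qnorm V y)"
    using qn by (auto simp: quasinormed_def)
  define K where "K = max C 1"
  have 1: "qnorm V (add V x y) \<le> K * (qnorm V x + qnorm V y)" if "x \<in> carr V" "y \<in> carr V" for x y
  proof -
    have "C * (qnorm V x + qnorm V y) \<le> K * (qnorm V x + qnorm V y)"
      using that by (intro mult_right_mono) (auto simp: K_def qnorm_nonneg)
    then show ?thesis using C that by fastforce
  qed
  have 2: "qnorm V (dif V x y) \<le> K * (qnorm V x + qnorm V y)" if "x \<in> carr V" "y \<in> carr V" for x y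
    using 1[of x "scl V (-1) y"] that by (simp add: dif_def scl_in l qnorm_scl)
  have 3: "qnorm V (dif V x z) \<le> K * (qnorm V (dif V x y) + qnorm V (dif V y z))"
    if "x \<in> carr V" "y \<in> carr V" "z \<in> carr V" for x y z
    using 1[of "dif V x y" "dif V y z"] that by (simp add: dif_add_dif dif_in l)
  show thesis using that[of K] 1 2 3 by (auto simp: K_def)
qed

text \<open>A quasinorm need not be continuous, so limits are always expressed by distances tending
  to 0; one quasi-triangle inequality through \<open>s n\<close> still separates two
  candidates.\<close>

lemma qlimit_unique:
  assumes "x \<in> carr V" "y \<in> carr V" "range s \<subseteq> carr V"
    "(\<lambda>n. qnorm V (dif V (s n) x)) \<longlonglongrightarrow> 0" "(\<lambda>n. qnorm V (dif V (s n) y)) \<longlonglongrightarrow> 0"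
  shows "x = y"
proof -
  note l = quasinormed_linear[OF qn]
  obtain K where K: "K \<ge> 1" "\<And>x y z. x \<in> carr V \<Longrightarrow> y \<in> carr V \<Longrightarrow> z \<in> carr V \<Longrightarrow>
      qnorm V (dif V x z) \<le> K * (qnorm V (dif V x y) + qnorm V (dif V y z))"
    using quasi_triangle_obtain by metis
  have "qnorm V (dif V x y) \<le> K * (qnorm V (dif V (s n) x) + qnorm V (dif V (s n) y))" for n
    using K(2)[of x "s n" y] assms by (auto simp: qnorm_dif_commute[of x "s n"])
  moreover have "(\<lambda>n. K * (qnorm V (dif V (s n) x) + qnorm V (dif V (s n) y))) \<longlonglongrightarrow> K * (0 + 0)"
    by (intro tendsto_intros assms)
  ultimately have "qnorm V (dif V x y) \<le> 0"
    by (intro LIMSEQ_le_const[where X = "\<lambda>n. K * (qnorm V (dif V (s n) x) + qnorm V (dif V (s n) y))"]) auto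
  then show ?thesis
    using assms qnorm_nonneg[of "dif V x y"] by (simp add: dif_in l qnorm_eq_zero_iff dif_eq_zer_iff)
qed

end

lemma bdd_operator_carr: "bdd_operator V W f \<Longrightarrow> x \<in> carr V \<Longrightarrow> f x \<in> carr W"
  and bdd_operator_add: "bdd_operator V W f \<Longrightarrow> x \<in> carr V \<Longrightarrow> y \<in> carr V \<Longrightarrow> f (add V x y) = add W (f x) (f y)"
  and bdd_operator_scl: "bdd_operator V W f \<Longrightarrow> x \<in> carr V \<Longrightarrow> f (scl V c x) = scl W c (f x)"
  by (auto simp: bdd_operator_def)

lemma bdd_operator_dif:
  "bdd_operator V W f \<Longrightarrow> linear_space V \<Longrightarrow> x \<in> carr V \<Longrightarrow> y \<in> carr V \<Longrightarrow> f (dif V x y) = dif W (f x) (f y)"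
  by (simp add: dif_def bdd_operator_add bdd_operator_scl scl_in)

lemma bdd_operator_zer:
  "bdd_operator V W f \<Longrightarrow> linear_space V \<Longrightarrow> linear_space W \<Longrightarrow> f (zer V) = zer W"
  by (metis bdd_operator_scl scl_zero zer_in bdd_operator_carr)

lemma bdd_operator_bound:
  assumes "bdd_operator V W f" "quasinormed V"
  obtains C where "C \<ge> 1" "\<And>x. x \<in> carr V \<Longrightarrow> qnorm W (f x) \<le> C * qnorm V x"
proof -
  obtain C where C: "\<forall>x\<in>carr V. qnorm W (f x) \<le> C * qnorm V x"
    using assms by (auto simp: bdd_operator_def)
  have "qnorm W (f x) \<le> max C 1 * qnorm V x" if "x \<in> carr V" for x
    using C that mult_right_mono[of C "max C 1" "qnorm V x"] qnorm_nonneg[OF assms(2) that] by fastforce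
  then show thesis using that[of "max C 1"] by auto
qed

section \<open>Approximate solutions and the open mapping theorem\<close>

lemma squeeze_zero:
  fixes a b :: "nat \<Rightarrow> real"
  assumes "b \<longlonglongrightarrow> 0" "\<And>n. 0 \<le> a n" "\<And>n. a n \<le> b n"
  shows "a \<longlonglongrightarrow> 0"
  by (rule tendsto_sandwich[OF _ _ tendsto_const assms(1)]) (use assms in auto)

text \<open>Each use of the quasi-triangle inequality costs a factor \<open>K\<close>, so the steps
  have to shrink faster than these factors accumulate; the condition
  \<open>2 * K * d (Suc n) \<le> d n\<close> lets the induction reproduce the bound
  \<open>2 * K * d m\<close> at every stage. The explicit distance to the limit is what both
  applications need.\<close>

lemma geometric_convergence:
  fixes V :: "('k::real_normed_field, 'a, 'm) qspace_scheme"
  assumes V: "quasi_banach V" and K: "K \<ge> 1"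
    "\<And>x y z. x \<in> carr V \<Longrightarrow> y \<in> carr V \<Longrightarrow> z \<in> carr V \<Longrightarrow>
      qnorm V (dif V x z) \<le> K * (qnorm V (dif V x y) + qnorm V (dif V y z))"
    and s: "\<And>n. s n \<in> carr V"
    and d: "\<And>n. 0 < d n" "\<And>n. qnorm V (dif V (s n) (s (Suc n))) \<le> d n" "\<And>n. 2 * K * d (Suc n) \<le> d n"
  obtains x where "x \<in> carr V" "(\<lambda>n. qnorm V (dif V (s n) x)) \<longlonglongrightarrow> 0"
    "\<And>n. qnorm V (dif V (s n) x) \<le> 3 * K\<^sup>2 * d n"
proof -
  note qn = quasi_banach_quasinormed[OF V] and l = quasi_banach_linear[OF V]
  have tail: "qnorm V (dif V (s m) (s (m + n))) \<le> 2 * K * d m" for m n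
  proof (induction n arbitrary: m)
    case 0
    show ?case using d(1)[of m] K(1) by (simp add: dif_self l s qnorm_zer qn)
  next
    case (Suc n)
    have "qnorm V (dif V (s m) (s (m + Suc n)))
        \<le> K * (qnorm V (dif V (s m) (s (Suc m))) + qnorm V (dif V (s (Suc m)) (s (Suc m + n))))"
      using K(2)[of "s m" "s (Suc m)" "s (m + Suc n)"] s by simp
    also have "\<dots> \<le> K * (d m + d m)"
      using Suc[of "Suc m"] d(2)[of m] d(3)[of m] K(1) by (intro mult_left_mono) auto
    finally show ?case by simp
  qed
  have dz: "d n \<le> d 0 * (1/2) ^ n" for n
  proof (induction n)
    case (Suc n)
    have "2 * d (Suc n) \<le> 2 * K * d (Suc n)" using K(1) d(1)[of "Suc n"] by simp
    then show ?case using Suc d(3)[of n] by simp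
  qed simp
  have "(\<lambda>n. d 0 * (1/2) ^ n) \<longlonglongrightarrow> d 0 * 0" by (intro tendsto_intros LIMSEQ_realpow_zero) auto
  then have d0: "d \<longlonglongrightarrow> 0"
    by - (rule squeeze_zero[of "\<lambda>n. d 0 * (1/2) ^ n" d], use dz d(1) in \<open>simp_all add: less_imp_le\<close>)
  have "cauchy_seq V s"
    unfolding cauchy_seq_def
  proof (intro conjI allI impI)
    show "range s \<subseteq> carr V" using s by auto
    fix e :: real assume e: "e > 0"
    have "(\<lambda>n. K * (2 * K * d n + 2 * K * d n)) \<longlonglongrightarrow> K * (2 * K * 0 + 2 * K * 0)"
      by (intro tendsto_intros d0)
    then obtain N where N: "K * (2 * K * d N + 2 * K * d N) < e"
      using order_tendstoD(2)[of _ "K * (2 * K * 0 + 2 * K * 0)" sequentially e] e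
      by (force simp: eventually_sequentially)
    show "\<exists>N. \<forall>m\<ge>N. \<forall>n\<ge>N. qnorm V (dif V (s m) (s n)) < e"
    proof (intro exI[of _ N] allI impI)
      fix m n assume mn: "m \<ge> N" "n \<ge> N"
      have "qnorm V (dif V (s m) (s n)) \<le> K * (qnorm V (dif V (s m) (s N)) + qnorm V (dif V (s N) (s n)))"
        by (intro K s)
      also have "\<dots> \<le> K * (2 * K * d N + 2 * K * d N)"
        using tail[of N "m - N"] tail[of N "n - N"] mn K(1) s
        by (intro mult_left_mono add_mono) (auto simp: qnorm_dif_commute[OF qn, of "s m"])
      finally show "qnorm V (dif V (s m) (s n)) < e" using N by simp
    qed
  qed
  then obtain x where x: "x \<in> carr V" "(\<lambda>n. qnorm V (dif V (s n) x)) \<longlonglongrightarrow> 0"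
    using V unfolding quasi_banach_def by blast
  have "qnorm V (dif V (s n) x) \<le> 3 * K\<^sup>2 * d n" for n
  proof -
    \<comment> \<open>A late term within \<open>d n\<close> of the limit connects the tail bound
      with the limit and gives \<open>K * (2 * K + K) * d n\<close>.\<close>
    obtain m where m: "m \<ge> n" "qnorm V (dif V (s m) x) < d n"
      using order_tendstoD(2)[OF x(2) d(1)[of n]] by (auto simp: eventually_sequentially) (metis nle_le)
    have "d n \<le> K * d n" using K(1) d(1)[of n] by simp
    then have m': "qnorm V (dif V (s m) x) \<le> K * d n" using m(2) by linarith
    have "qnorm V (dif V (s n) x) \<le> K * (qnorm V (dif V (s n) (s m)) + qnorm V (dif V (s m) x))"
      by (intro K s x)
    also have "\<dots> \<le> K * (2 * K * d n + K * d n)"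
      using tail[of n "m - n"] m m' K(1) by (intro mult_left_mono add_mono) auto
    finally show ?thesis by (simp add: power2_eq_square algebra_simps)
  qed
  with x show thesis using that by blast
qed


text \<open>Solve with a small relative error, then solve for the residual, and so on. Residuals
  have to stay in the set \<open>A\<close>. It is the range in the open mapping theorem, where
  preimages exist but without control of their size, and all of \<open>lp p\<close> for the quotient
  map of a twisted sum, where only a dense set of values is known to be attained.\<close>

lemma surjective_by_approximation:
  fixes V :: "('k::real_normed_field, 'a, 'm) qspace_scheme" and W :: "('k, 'b, 'n) qspace_scheme"
  assumes V: "quasi_banach V" and W: "quasinormed W" and f: "bdd_operator V W f"
    and A: "A \<subseteq> carr W" "\<And>w v. w \<in> A \<Longrightarrow> v \<in> carr V \<Longrightarrow> dif W w (f v) \<in> A"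
    and C: "C \<ge> 1" "\<And>w \<delta>. w \<in> A \<Longrightarrow> w \<noteq> zer W \<Longrightarrow> 0 < \<delta> \<Longrightarrow>
      \<exists>v\<in>carr V. qnorm V v \<le> C * qnorm W w \<and> qnorm W (dif W w (f v)) \<le> \<delta> * qnorm W w"
  obtains D where "D \<ge> 1" "\<And>w. w \<in> A \<Longrightarrow> \<exists>v\<in>carr V. f v = w \<and> qnorm V v \<le> D * qnorm W w"
proof -
  note qV = quasi_banach_quasinormed[OF V] and lV = quasi_banach_linear[OF V] and lW = quasinormed_linear[OF W]
  obtain K where K: "K \<ge> 1" "\<And>x y z. x \<in> carr V \<Longrightarrow> y \<in> carr V \<Longrightarrow> z \<in> carr V \<Longrightarrow>
      qnorm V (dif V x z) \<le> K * (qnorm V (dif V x y) + qnorm V (dif V y z))"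
    using quasi_triangle_obtain[OF qV] by metis
  obtain B where B: "B \<ge> 1" "\<And>x. x \<in> carr V \<Longrightarrow> qnorm W (f x) \<le> B * qnorm V x"
    using bdd_operator_bound[OF f qV] by metis
  define D where "D = 3 * K\<^sup>2 * C"
  have D1: "D \<ge> 1" using K(1) C(1) mult_mono[of 1 "K\<^sup>2" 1 C] one_le_power[of K 2] by (simp add: D_def)
  \<comment> \<open>With this ratio the corrections \<open>C * \<delta> ^ n * qnorm W w\<close>
    decrease by exactly \<open>2 * K\<close>, the rate that geometric convergence requires.\<close>
  define \<delta> where "\<delta> = 1 / (2 * K)"
  have \<delta>: "\<delta> > 0" "2 * K * \<delta> = 1" "\<delta> < 1" using K(1) by (auto simp: \<delta>_def field_simps)
  have "\<exists>v\<in>carr V. f v = w \<and> qnorm V v \<le> D * qnorm W w" if w: "w \<in> A" for w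
  proof (cases "w = zer W")
    case True
    then show ?thesis using bdd_operator_zer[OF f lV lW] zer_in[OF lV]
      by (intro bexI[of _ "zer V"]) (auto simp: qnorm_zer[OF W] qnorm_zer[OF qV])
  next
    case False
    have wW: "w \<in> carr W" using w A by auto
    have npos: "qnorm W w > 0"
      using False qnorm_nonneg[OF W wW] qnorm_eq_zero_iff[OF W wW] by linarith
    have "\<exists>v\<in>carr V. qnorm V v \<le> C * qnorm W u \<and> qnorm W (dif W u (f v)) \<le> \<delta> * qnorm W u" if "u \<in> A" for u
    proof (cases "u = zer W")
      case True
      then show ?thesis using bdd_operator_zer[OF f lV lW] zer_in[OF lV] zer_in[OF lW]
        by (intro bexI[of _ "zer V"]) (auto simp: qnorm_zer[OF W] qnorm_zer[OF qV] dif_self[OF lW])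
    next
      case False
      show ?thesis by (rule C(2)[OF that False \<delta>(1)])
    qed
    then obtain c where c: "\<And>u. u \<in> A \<Longrightarrow> c u \<in> carr V" "\<And>u. u \<in> A \<Longrightarrow> qnorm V (c u) \<le> C * qnorm W u"
      "\<And>u. u \<in> A \<Longrightarrow> qnorm W (dif W u (f (c u))) \<le> \<delta> * qnorm W u"
      by metis
    define s where "s = rec_nat (zer V) (\<lambda>_ v. add V v (c (dif W w (f v))))"
    have s0: "s 0 = zer V" and sS: "s (Suc n) = add V (s n) (c (dif W w (f (s n))))" for n
      by (simp_all add: s_def)
    have sV: "s n \<in> carr V" for n
      by (induction n) (auto simp: s0 sS zer_in[OF lV] intro!: add_in[OF lV] c A w)
    have fs: "f (s n) \<in> carr W" for n using sV f bdd_operator_carr by metis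
    define u where "u n = dif W w (f (s n))" for n
    have uA: "u n \<in> A" for n by (simp add: u_def A w sV)
    have uS: "u (Suc n) = dif W (u n) (f (c (u n)))" for n
    proof -
      have "u (Suc n) = dif W w (add W (f (s n)) (f (c (u n))))"
        unfolding u_def sS using bdd_operator_add[OF f sV c(1)[OF uA[unfolded u_def]]] by simp
      then show ?thesis
        using fs[of n] wW bdd_operator_carr[OF f c(1)[OF uA[of n]]]
        by (simp add: u_def dif_def scl_add[OF lW] scl_in[OF lW] add_in[OF lW] carr_add_ac[OF lW])
    qed
    have un: "qnorm W (u n) \<le> \<delta> ^ n * qnorm W w" for n
    proof (induction n)
      case 0
      then show ?case using bdd_operator_zer[OF f lV lW] dif_zer[OF lW wW] by (simp add: u_def s0)
    next
      case (Suc n)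
      have "qnorm W (u (Suc n)) \<le> \<delta> * qnorm W (u n)" unfolding uS by (rule c(3)[OF uA])
      also have "\<dots> \<le> \<delta> * (\<delta> ^ n * qnorm W w)" using Suc \<delta> by (intro mult_left_mono) auto
      finally show ?case by simp
    qed
    define d where "d n = C * (\<delta> ^ n * qnorm W w)" for n
    have d: "0 < d n" "2 * K * d (Suc n) \<le> d n" for n
      using C(1) npos \<delta> by (auto simp: d_def)
    have "qnorm V (dif V (s n) (s (Suc n))) \<le> d n" for n
    proof -
      have "qnorm V (dif V (s n) (s (Suc n))) = qnorm V (dif V (s (Suc n)) (s n))"
        using qnorm_dif_commute[OF qV sV sV] .
      also have "dif V (s (Suc n)) (s n) = c (u n)"
        using add_dif_cancel[OF lV c(1)[OF uA[of n]] sV[of n]] add_commute[OF lV c(1)[OF uA[of n]] sV[of n]]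
        by (simp add: sS u_def)
      also have "qnorm V \<dots> \<le> C * qnorm W (u n)" by (rule c(2)[OF uA])
      also have "\<dots> \<le> d n" unfolding d_def using un C(1) by (intro mult_left_mono) auto
      finally show ?thesis .
    qed
    then obtain x where x: "x \<in> carr V" "(\<lambda>n. qnorm V (dif V (s n) x)) \<longlonglongrightarrow> 0"
      "\<And>n. qnorm V (dif V (s n) x) \<le> 3 * K\<^sup>2 * d n"
      using geometric_convergence[where s = s and d = d, OF V K sV d(1) _ d(2)] by blast
    have "qnorm V x \<le> D * qnorm W w"
      using x(3)[of 0] qnorm_dif_commute[OF qV x(1) zer_in[OF lV]] x(1)
      by (simp add: s0 D_def d_def dif_zer[OF lV])
    moreover have "f x = w"
    proof (rule qlimit_unique[OF W])
      show "f x \<in> carr W" "w \<in> carr W" "range (\<lambda>n. f (s n)) \<subseteq> carr W"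
        using fs x wW bdd_operator_carr[OF f] by auto
      have "(\<lambda>n. B * qnorm V (dif V (s n) x)) \<longlonglongrightarrow> B * 0" by (intro tendsto_intros x)
      moreover have "qnorm W (dif W (f (s n)) (f x)) \<le> B * qnorm V (dif V (s n) x)" for n
        using B(2)[of "dif V (s n) x"] sV[of n] x(1) by (simp add: bdd_operator_dif[OF f lV] dif_in[OF lV])
      ultimately show "(\<lambda>n. qnorm W (dif W (f (s n)) (f x))) \<longlonglongrightarrow> 0"
        using qnorm_nonneg[OF W dif_in[OF lW fs bdd_operator_carr[OF f x(1)]]]
        by - (rule squeeze_zero[of "\<lambda>n. B * qnorm V (dif V (s n) x)"], simp_all)
      have "(\<lambda>n. \<delta> ^ n * qnorm W w) \<longlonglongrightarrow> 0 * qnorm W w"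
        using \<delta> by (intro tendsto_intros LIMSEQ_realpow_zero) auto
      moreover have "qnorm W (dif W (f (s n)) w) \<le> \<delta> ^ n * qnorm W w" for n
        using un[of n] qnorm_dif_commute[OF W fs[of n] wW] by (simp add: u_def)
      ultimately show "(\<lambda>n. qnorm W (dif W (f (s n)) w)) \<longlonglongrightarrow> 0"
        using qnorm_nonneg[OF W dif_in[OF lW fs wW]]
        by - (rule squeeze_zero[of "\<lambda>n. \<delta> ^ n * qnorm W w"], simp_all)
    qed
    ultimately show ?thesis using x(1) by blast
  qed
  then show thesis using that D1 by blast
qed

text \<open>Baire's theorem by hand: a quasinorm is not a metric, so the nested balls shrink by a factor
  that beats the quasitriangle constant.\<close>

lemma somewhere_dense_image:
  fixes V :: "('k::real_normed_field, 'a, 'm) qspace_scheme" and W :: "('k, 'b, 'n) qspace_scheme"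
  assumes W: "quasi_banach W" and f: "f ` carr V \<subseteq> carr W" and ne: "zer W \<in> f ` carr V"
    and closed: "\<And>s w. range s \<subseteq> f ` carr V \<Longrightarrow> w \<in> carr W \<Longrightarrow>
      (\<lambda>n. qnorm W (dif W (s n) w)) \<longlonglongrightarrow> 0 \<Longrightarrow> w \<in> f ` carr V"
  obtains n :: nat and w0 r where "w0 \<in> f ` carr V" "r > 0"
    "\<And>w \<eta>. w \<in> f ` carr V \<Longrightarrow> qnorm W (dif W w0 w) < r \<Longrightarrow> 0 < \<eta> \<Longrightarrow>
      \<exists>v\<in>carr V. qnorm V v \<le> n \<and> qnorm W (dif W (f v) w) < \<eta>"
proof (rule ccontr)
  assume contr: "\<not> thesis"
  note qW = quasi_banach_quasinormed[OF W] and lW = quasi_banach_linear[OF W]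
  obtain K where K: "K \<ge> 1" "\<And>x y z. x \<in> carr W \<Longrightarrow> y \<in> carr W \<Longrightarrow> z \<in> carr W \<Longrightarrow>
      qnorm W (dif W x z) \<le> K * (qnorm W (dif W x y) + qnorm W (dif W y z))"
    using quasi_triangle_obtain[OF qW] by metis
  let ?A = "f ` carr V"
  have "\<forall>(n::nat) w0 r. w0 \<in> ?A \<longrightarrow> r > 0 \<longrightarrow> (\<exists>w \<eta>. w \<in> ?A \<and> qnorm W (dif W w0 w) < r \<and> 0 < \<eta> \<and>
      (\<forall>v\<in>carr V. qnorm V v \<le> n \<longrightarrow> \<not> qnorm W (dif W (f v) w) < \<eta>))"
    using that contr by metis
  then obtain nx :: "nat \<Rightarrow> 'b \<Rightarrow> real \<Rightarrow> 'b" and ny :: "nat \<Rightarrow> 'b \<Rightarrow> real \<Rightarrow> real" where nxy: "\<And>(n::nat) w0 r. w0 \<in> ?A \<Longrightarrow> r > 0 \<Longrightarrow> nx n w0 r \<in> ?A \<and>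
      qnorm W (dif W w0 (nx n w0 r)) < r \<and> 0 < ny n w0 r \<and>
      (\<forall>v\<in>carr V. qnorm V v \<le> n \<longrightarrow> \<not> qnorm W (dif W (f v) (nx n w0 r)) < ny n w0 r)"
    by metis
  \<comment> \<open>The first bound makes the radii fit the convergence lemma. The second brings the
    limit within \<open>3 * K\<^sup>2 * d (Suc n)\<close> of \<open>s (Suc n)\<close>, which is less
    than \<open>ny\<close>, so that the limit cannot be the image of a vector of quasinorm at most
    \<open>n\<close>.\<close>
  define st where "st = rec_nat (zer W, 1::real)
    (\<lambda>n (w, r). (nx n w r, min (r / (2 * K)) (ny n w r / (4 * K\<^sup>2))))"
  define s where "s n = fst (st n)" for n
  define d where "d n = snd (st n)" for n
  have s0: "s 0 = zer W" "d 0 = 1" by (simp_all add: s_def d_def st_def)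
  have sS: "s (Suc n) = nx n (s n) (d n)" "d (Suc n) = min (d n / (2 * K)) (ny n (s n) (d n) / (4 * K\<^sup>2))" for n
    by (simp_all add: s_def d_def st_def case_prod_beta)
  have inv: "s n \<in> ?A \<and> d n > 0" for n
  proof (induction n)
    case 0
    show ?case using ne by (simp add: s0)
  next
    case (Suc n)
    then show ?case using nxy[of "s n" "d n" n] K(1) by (simp add: sS)
  qed
  have sW: "s n \<in> carr W" for n using inv f by auto
  have dS: "2 * K * d (Suc n) \<le> d n" for n
  proof -
    have "d (Suc n) \<le> d n / (2 * K)" by (simp add: sS)
    then show ?thesis using K(1) by (simp add: field_simps)
  qed
  have dpos: "0 < d n" and step: "qnorm W (dif W (s n) (s (Suc n))) \<le> d n" for n
    using inv[of n] nxy[of "s n" "d n" n] by (auto simp: sS)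
  obtain w where w: "w \<in> carr W" "(\<lambda>n. qnorm W (dif W (s n) w)) \<longlonglongrightarrow> 0"
      "\<And>n. qnorm W (dif W (s n) w) \<le> 3 * K\<^sup>2 * d n"
    using geometric_convergence[where s = s and d = d, OF W K sW dpos step dS] by blast
  have "w \<in> ?A" using closed[of s w] inv w by blast
  then obtain v where v: "v \<in> carr V" "f v = w" by auto
  obtain n :: nat where n: "qnorm V v \<le> n" using real_arch_simple by blast
  have "ny n (s n) (d n) \<le> qnorm W (dif W w (s (Suc n)))"
    using nxy[of "s n" "d n" n] inv v n by (fastforce simp: sS)
  also have "\<dots> \<le> 3 * K\<^sup>2 * d (Suc n)" using w(3)[of "Suc n"] qnorm_dif_commute[OF qW w(1) sW] by simp
  also have "\<dots> \<le> 3 * K\<^sup>2 * (ny n (s n) (d n) / (4 * K\<^sup>2))"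
    by (intro mult_left_mono) (auto simp: sS)
  also have "\<dots> < ny n (s n) (d n)" using K(1) nxy[of "s n" "d n" n] inv by simp
  finally show False by simp
qed

text \<open>The range is only assumed to be sequentially closed, since the arrows of an exact
  sequence map onto kernels. Density near some \<open>w0\<close> is moved to the origin by
  differences: if \<open>w0 + c w\<close> and \<open>w0\<close> are both approximated by images of
  vectors of quasinorm at most \<open>n\<close>, then \<open>c w\<close> is approximated by the
  image of their difference.\<close>

theorem open_mapping:
  fixes V :: "('k::real_normed_field, 'a, 'm) qspace_scheme" and W :: "('k, 'b, 'n) qspace_scheme"
  assumes V: "quasi_banach V" and W: "quasi_banach W" and f: "bdd_operator V W f"
    and closed: "\<And>s w. range s \<subseteq> f ` carr V \<Longrightarrow> w \<in> carr W \<Longrightarrow>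
      (\<lambda>n. qnorm W (dif W (s n) w)) \<longlonglongrightarrow> 0 \<Longrightarrow> w \<in> f ` carr V"
  obtains D where "D \<ge> 1" "\<And>w. w \<in> f ` carr V \<Longrightarrow> \<exists>v\<in>carr V. f v = w \<and> qnorm V v \<le> D * qnorm W w"
proof -
  note qV = quasi_banach_quasinormed[OF V] and lV = quasi_banach_linear[OF V]
  note qW = quasi_banach_quasinormed[OF W] and lW = quasi_banach_linear[OF W]
  let ?A = "f ` carr V"
  have AW: "?A \<subseteq> carr W" using bdd_operator_carr[OF f] by auto
  have "zer W \<in> ?A" using bdd_operator_zer[OF f lV lW] zer_in[OF lV] by (metis imageI)
  then obtain n :: nat and w0 r where b: "w0 \<in> ?A" "r > 0"
    "\<And>w \<eta>. w \<in> ?A \<Longrightarrow> qnorm W (dif W w0 w) < r \<Longrightarrow> 0 < \<eta> \<Longrightarrow>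
      \<exists>v\<in>carr V. qnorm V v \<le> n \<and> qnorm W (dif W (f v) w) < \<eta>"
    by (rule somewhere_dense_image[OF W AW]) (rule closed, assumption+, rule that)
  obtain K where K: "K \<ge> 1"
    "\<And>x y. x \<in> carr V \<Longrightarrow> y \<in> carr V \<Longrightarrow> qnorm V (dif V x y) \<le> K * (qnorm V x + qnorm V y)"
    using quasi_triangle_obtain[OF qV] by metis
  obtain L where L: "L \<ge> 1"
    "\<And>x y. x \<in> carr W \<Longrightarrow> y \<in> carr W \<Longrightarrow> qnorm W (dif W x y) \<le> L * (qnorm W x + qnorm W y)"
    using quasi_triangle_obtain[OF qW] by metis
  obtain v0 where v0: "v0 \<in> carr V" "f v0 = w0" using b by auto
  \<comment> \<open>A difference of two vectors of quasinorm at most \<open>n\<close> has size at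
    most \<open>2 * K * n\<close>, and it is divided by \<open>c = r / (2 * qnorm W w)\<close>; the
    summand 1 secures \<open>C \<ge> 1\<close>.\<close>
  define C where "C = 1 + 2 * K * n * 2 / r"
  have C1: "C \<ge> 1" using K(1) b(2) by (simp add: C_def)
  have "\<exists>v\<in>carr V. qnorm V v \<le> C * qnorm W w \<and> qnorm W (dif W w (f v)) \<le> \<delta> * qnorm W w"
    if w: "w \<in> ?A" "w \<noteq> zer W" and \<delta>: "0 < \<delta>" for w \<delta>
  proof -
    have wW: "w \<in> carr W" using w AW by auto
    have npos: "qnorm W w > 0"
      using w(2) qnorm_nonneg[OF qW wW] qnorm_eq_zero_iff[OF qW wW] by linarith
    define c where "c = r / (2 * qnorm W w)"
    have c: "c > 0" "c * qnorm W w = r / 2" using npos b(2) by (auto simp: c_def)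
    obtain vw where vw: "vw \<in> carr V" "f vw = w" using w by auto
    define x where "x = add W (scl W (of_real c) w) w0"
    have cw: "scl W (of_real c) w \<in> carr W" by (simp add: scl_in[OF lW] wW)
    have w0W: "w0 \<in> carr W" using b AW by auto
    have xA: "x \<in> ?A"
      by (intro image_eqI[of _ _ "add V (scl V (of_real c) vw) v0"])
        (simp_all add: x_def bdd_operator_add[OF f] bdd_operator_scl[OF f] scl_in[OF lV] vw v0 add_in[OF lV])
    have xw0: "dif W x w0 = scl W (of_real c) w" unfolding x_def by (rule add_dif_cancel[OF lW cw w0W])
    have xW: "x \<in> carr W" using xA AW by auto
    have "qnorm W (dif W w0 x) < r"
      using qnorm_dif_commute[OF qW w0W xW] xw0 c b(2) by (simp add: qnorm_scl[OF qW wW])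
    moreover have "qnorm W (dif W w0 w0) < r" using b(2) by (simp add: dif_self[OF lW w0W] qnorm_zer[OF qW])
    \<comment> \<open>Chosen so that \<open>1 / c * (L * (\<eta> + \<eta>))\<close> equals
      \<open>\<delta> * qnorm W w\<close>.\<close>
    moreover define \<eta> where "\<eta> = \<delta> * qnorm W w * c / (2 * L)"
    moreover have \<eta>: "\<eta> > 0" using \<delta> npos c L by (simp add: \<eta>_def)
    ultimately obtain v v' where v: "v \<in> carr V" "qnorm V v \<le> n" "qnorm W (dif W (f v) x) < \<eta>"
      and v': "v' \<in> carr V" "qnorm V v' \<le> n" "qnorm W (dif W (f v') w0) < \<eta>"
      using b(3)[OF xA] b(3)[OF b(1)] by metis
    define u where "u = scl V (of_real (1 / c)) (dif V v v')"
    have uV: "u \<in> carr V" by (simp add: u_def scl_in[OF lV] dif_in[OF lV] v v')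
    have nu: "norm (of_real (1 / c) :: 'k) = 1 / c" using c by (simp add: norm_divide)
    have "qnorm V u = 1 / c * qnorm V (dif V v v')"
      unfolding u_def using qnorm_scl[OF qV dif_in[OF lV v(1) v'(1)]] nu by metis
    also have "\<dots> \<le> 1 / c * (K * (n + n))"
      using K(2)[OF v(1) v'(1)] v(2) v'(2) K(1) c(1)
      by (intro mult_left_mono order_trans[OF K(2)[OF v(1) v'(1)]]) auto
    also have "\<dots> \<le> C * qnorm W w" using npos b(2) K(1) by (simp add: c_def C_def field_simps)
    finally have 1: "qnorm V u \<le> C * qnorm W w" .
    have fv: "f v \<in> carr W" "f v' \<in> carr W" using bdd_operator_carr[OF f] v v' by auto
    have sw: "scl W (of_real (1 / c)) (scl W (of_real c) w) = w"
      using c by (simp add: scl_scl[OF lW wW] scl_one[OF lW wW] flip: of_real_mult)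
    have "dif W w (f u) = scl W (of_real (1 / c)) (dif W (dif W x w0) (dif W (f v) (f v')))"
      unfolding u_def bdd_operator_scl[OF f dif_in[OF lV v(1) v'(1)]] bdd_operator_dif[OF f lV v(1) v'(1)] xw0
      using scl_dif[OF lW cw dif_in[OF lW fv], of "of_real (1 / c)"] sw by simp
    also have "\<dots> = scl W (of_real (1 / c)) (dif W (dif W x (f v)) (dif W w0 (f v')))"
      using dif_dif_dif[OF lW xW w0W fv] by simp
    finally have "qnorm W (dif W w (f u)) = 1 / c * qnorm W (dif W (dif W x (f v)) (dif W w0 (f v')))"
      using nu qnorm_scl[OF qW dif_in[OF lW dif_in[OF lW xW fv(1)] dif_in[OF lW w0W fv(2)]]] by metis
    also have "\<dots> \<le> 1 / c * (L * (\<eta> + \<eta>))"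
    proof -
      have "qnorm W (dif W (dif W x (f v)) (dif W w0 (f v')))
          \<le> L * (qnorm W (dif W x (f v)) + qnorm W (dif W w0 (f v')))"
        by (intro L(2) dif_in[OF lW] xW fv w0W)
      also have "\<dots> \<le> L * (\<eta> + \<eta>)"
        using v(3) v'(3) L(1) qnorm_dif_commute[OF qW xW fv(1)] qnorm_dif_commute[OF qW w0W fv(2)]
        by (intro mult_left_mono) auto
      finally show ?thesis using c(1) by (intro mult_left_mono) auto
    qed
    also have "\<dots> = \<delta> * qnorm W w" using L(1) c(1) by (simp add: \<eta>_def)
    finally show ?thesis using 1 uV by blast
  qed
  moreover have "dif W w (f v) \<in> ?A" if wA: "w \<in> ?A" "v \<in> carr V" for w v
  proof -
    obtain z where "z \<in> carr V" "w = f z" using wA by auto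
    then show ?thesis using bdd_operator_dif[OF f lV] dif_in[OF lV] wA by (metis imageI)
  qed
  ultimately obtain D where "D \<ge> 1" "\<And>w. w \<in> ?A \<Longrightarrow> \<exists>v\<in>carr V. f v = w \<and> qnorm V v \<le> D * qnorm W w"
    using surjective_by_approximation[OF V qW f AW _ C1] by metis
  then show thesis using that by blast
qed

section \<open>The completion is a quasi Banach space\<close>

lemma bdd_operator_scl_self: "quasinormed V \<Longrightarrow> bdd_operator V V (scl V c)"
  unfolding bdd_operator_def
  by (intro conjI exI[of _ "norm c"])
    (auto simp: qnorm_scl scl_in scl_add scl_scl quasinormed_linear mult.commute)

context
  fixes V :: "('k::real_normed_field, 'a) qspace"
  assumes qn: "quasinormed V"
begin

private lemmas l = quasinormed_linear[OF qn]

private abbreviation "close s t \<equiv> (\<lambda>n. qnorm V (dif V (s n) (t n))) \<longlonglongrightarrow> 0"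

lemma cauchy_seq_carr: "cauchy_seq V s \<Longrightarrow> s n \<in> carr V"
  by (auto simp: cauchy_seq_def)

lemma close_sym:
  assumes "cauchy_seq V s" "cauchy_seq V t" shows "close s t \<longleftrightarrow> close t s"
  using qnorm_dif_commute[OF qn cauchy_seq_carr[OF assms(1)] cauchy_seq_carr[OF assms(2)]] by simp

lemma close_trans:
  assumes "cauchy_seq V s" "cauchy_seq V t" "cauchy_seq V u" "close s t" "close t u"
  shows "close s u"
proof -
  obtain K where K: "K \<ge> 1" "\<And>x y z. x \<in> carr V \<Longrightarrow> y \<in> carr V \<Longrightarrow> z \<in> carr V \<Longrightarrow>
      qnorm V (dif V x z) \<le> K * (qnorm V (dif V x y) + qnorm V (dif V y z))"
    using quasi_triangle_obtain[OF qn] by metis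
  have "(\<lambda>n. K * (qnorm V (dif V (s n) (t n)) + qnorm V (dif V (t n) (u n)))) \<longlonglongrightarrow> K * (0 + 0)"
    by (intro tendsto_intros assms)
  then show ?thesis
    by - (rule squeeze_zero[of "\<lambda>n. K * (qnorm V (dif V (s n) (t n)) + qnorm V (dif V (t n) (u n)))"],
        auto intro!: K qnorm_nonneg[OF qn] dif_in[OF l] assms(1-3)[THEN cauchy_seq_carr])
qed

lemma cauchy_class_self: "cauchy_seq V s \<Longrightarrow> s \<in> cauchy_class V s"
  by (simp add: cauchy_class_def dif_self[OF l] cauchy_seq_carr qnorm_zer[OF qn])

lemma cauchy_class_eq_iff:
  assumes "cauchy_seq V s" "cauchy_seq V t"
  shows "cauchy_class V s = cauchy_class V t \<longleftrightarrow> close s t"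
proof
  assume "cauchy_class V s = cauchy_class V t"
  then show "close s t" using cauchy_class_self[OF assms(1)] by (simp add: cauchy_class_def)
next
  assume "close s t"
  then show "cauchy_class V s = cauchy_class V t"
    unfolding cauchy_class_def using close_trans close_sym assms by blast
qed

lemma cauchy_class_cong:
  "cauchy_seq V s \<Longrightarrow> t \<in> cauchy_class V s \<Longrightarrow> cauchy_seq V t \<and> cauchy_class V t = cauchy_class V s"
  using cauchy_class_eq_iff by (auto simp: cauchy_class_def)

lemma cauchy_seq_add:
  assumes "cauchy_seq V s" "cauchy_seq V t" shows "cauchy_seq V (\<lambda>n. add V (s n) (t n))"
  unfolding cauchy_seq_def
proof (intro conjI allI impI)
  show "range (\<lambda>n. add V (s n) (t n)) \<subseteq> carr V"
    using cauchy_seq_carr[OF assms(1)] cauchy_seq_carr[OF assms(2)] add_in[OF l] by auto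
  fix e :: real assume "e > 0"
  obtain K where K: "K \<ge> 1"
    "\<And>x y. x \<in> carr V \<Longrightarrow> y \<in> carr V \<Longrightarrow> qnorm V (add V x y) \<le> K * (qnorm V x + qnorm V y)"
    using quasi_triangle_obtain[OF qn] by metis
  define d where "d = e / (2 * K)"
  have "d > 0" using \<open>e > 0\<close> K by (simp add: d_def)
  then obtain M N where
    M: "\<forall>m\<ge>M. \<forall>n\<ge>M. qnorm V (dif V (s m) (s n)) < d" and N: "\<forall>m\<ge>N. \<forall>n\<ge>N. qnorm V (dif V (t m) (t n)) < d"
    using assms unfolding cauchy_seq_def by metis
  show "\<exists>N. \<forall>m\<ge>N. \<forall>n\<ge>N. qnorm V (dif V (add V (s m) (t m)) (add V (s n) (t n))) < e"
  proof (intro exI[of _ "max M N"] allI impI)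
    fix m n assume mn: "max M N \<le> m" "max M N \<le> n"
    have "qnorm V (dif V (add V (s m) (t m)) (add V (s n) (t n)))
        \<le> K * (qnorm V (dif V (s m) (s n)) + qnorm V (dif V (t m) (t n)))"
      by (simp add: dif_add_add[OF l] cauchy_seq_carr assms K dif_in[OF l])
    also have "\<dots> < K * (d + d)"
      using M N mn K(1) by (intro mult_strict_left_mono add_strict_mono) auto
    finally show "qnorm V (dif V (add V (s m) (t m)) (add V (s n) (t n))) < e"
      using K(1) by (simp add: d_def)
  qed
qed

lemma cauchy_seq_const: "v \<in> carr V \<Longrightarrow> cauchy_seq V (\<lambda>_. v)"
  by (auto simp: cauchy_seq_def dif_self[OF l] qnorm_zer[OF qn])

lemma bdd_operator_cauchy:
  fixes W :: "('k, 'b, 'n) qspace_scheme"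
  assumes "cauchy_seq V s" "bdd_operator V W f" shows "cauchy_seq W (\<lambda>n. f (s n))"
  unfolding cauchy_seq_def
proof (intro conjI allI impI)
  show "range (\<lambda>n. f (s n)) \<subseteq> carr W"
    using cauchy_seq_carr[OF assms(1)] bdd_operator_carr[OF assms(2)] by auto
  fix e :: real assume e: "e > 0"
  obtain B where B: "B \<ge> 1" "\<And>x. x \<in> carr V \<Longrightarrow> qnorm W (f x) \<le> B * qnorm V x"
    using bdd_operator_bound[OF assms(2) qn] by metis
  obtain N where N: "\<forall>m\<ge>N. \<forall>n\<ge>N. qnorm V (dif V (s m) (s n)) < e / B"
    using assms(1) e B(1) unfolding cauchy_seq_def by (metis divide_pos_pos less_le_trans zero_less_one)
  have "qnorm W (dif W (f (s m)) (f (s n))) < e" if "m \<ge> N" "n \<ge> N" for m n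
  proof -
    have "qnorm W (dif W (f (s m)) (f (s n))) \<le> B * qnorm V (dif V (s m) (s n))"
      using B(2)[of "dif V (s m) (s n)"]
      by (simp add: bdd_operator_dif[OF assms(2) l] cauchy_seq_carr assms(1) dif_in[OF l])
    also have "\<dots> < B * (e / B)" using N that B(1) by (intro mult_strict_left_mono) auto
    finally show ?thesis using B(1) by simp
  qed
  then show "\<exists>N. \<forall>m\<ge>N. \<forall>n\<ge>N. qnorm W (dif W (f (s m)) (f (s n))) < e" by blast
qed

lemma bdd_operator_close:
  fixes W :: "('k, 'b, 'n) qspace_scheme"
  assumes "quasinormed W" "cauchy_seq V s" "cauchy_seq V t" "bdd_operator V W f" "close s t"
  shows "(\<lambda>n. qnorm W (dif W (f (s n)) (f (t n)))) \<longlonglongrightarrow> 0"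
proof -
  obtain B where B: "B \<ge> 1" "\<And>x. x \<in> carr V \<Longrightarrow> qnorm W (f x) \<le> B * qnorm V x"
    using bdd_operator_bound[OF assms(4) qn] by metis
  have "(\<lambda>n. B * qnorm V (dif V (s n) (t n))) \<longlonglongrightarrow> B * 0" by (intro tendsto_intros assms)
  moreover have "qnorm W (dif W (f (s n)) (f (t n))) \<le> B * qnorm V (dif V (s n) (t n))" for n
    using B(2)[of "dif V (s n) (t n)"]
    by (simp add: bdd_operator_dif[OF assms(4) l] cauchy_seq_carr assms(2,3) dif_in[OF l])
  ultimately show ?thesis
    by - (rule squeeze_zero[of "\<lambda>n. B * qnorm V (dif V (s n) (t n))"],
      auto intro!: qnorm_nonneg assms dif_in quasinormed_linear bdd_operator_carr[OF assms(4)] cauchy_seq_carr)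
qed

lemma close_add:
  assumes "cauchy_seq V s" "cauchy_seq V t" "cauchy_seq V s'" "cauchy_seq V t'" "close s s'" "close t t'"
  shows "close (\<lambda>n. add V (s n) (t n)) (\<lambda>n. add V (s' n) (t' n))"
proof -
  obtain K where K: "K \<ge> 1"
    "\<And>x y. x \<in> carr V \<Longrightarrow> y \<in> carr V \<Longrightarrow> qnorm V (add V x y) \<le> K * (qnorm V x + qnorm V y)"
    using quasi_triangle_obtain[OF qn] by metis
  have "(\<lambda>n. K * (qnorm V (dif V (s n) (s' n)) + qnorm V (dif V (t n) (t' n)))) \<longlonglongrightarrow> K * (0 + 0)"
    by (intro tendsto_intros assms)
  moreover have "qnorm V (dif V (add V (s n) (t n)) (add V (s' n) (t' n)))
      \<le> K * (qnorm V (dif V (s n) (s' n)) + qnorm V (dif V (t n) (t' n)))" for n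
    by (simp add: dif_add_add[OF l] cauchy_seq_carr assms K dif_in[OF l])
  ultimately show ?thesis
    by - (rule squeeze_zero[of "\<lambda>n. K * (qnorm V (dif V (s n) (s' n)) + qnorm V (dif V (t n) (t' n)))"],
      auto intro!: qnorm_nonneg[OF qn] dif_in[OF l] add_in[OF l] assms(1-4)[THEN cauchy_seq_carr])
qed

text \<open>All members of the union over representatives coincide; the union in the definition is a
  way to express a choice-free quotient operation.\<close>

lemma completion_add:
  assumes "cauchy_seq V s" "cauchy_seq V t"
  shows "add (completion V) (cauchy_class V s) (cauchy_class V t) = cauchy_class V (\<lambda>n. add V (s n) (t n))"
proof -
  have "cauchy_class V (\<lambda>n. add V (s' n) (t' n)) = cauchy_class V (\<lambda>n. add V (s n) (t n))"
    if "s' \<in> cauchy_class V s" "t' \<in> cauchy_class V t" for s' t'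
    using that assms by (subst cauchy_class_eq_iff) (auto simp: cauchy_class_def intro!: cauchy_seq_add close_add)
  then have "(\<Union>s'\<in>cauchy_class V s. \<Union>t'\<in>cauchy_class V t. cauchy_class V (\<lambda>n. add V (s' n) (t' n)))
      = (\<Union>s'\<in>cauchy_class V s. \<Union>t'\<in>cauchy_class V t. cauchy_class V (\<lambda>n. add V (s n) (t n)))"
    by (intro SUP_cong refl)
  moreover have "cauchy_class V s \<noteq> {}" "cauchy_class V t \<noteq> {}" using cauchy_class_self assms by blast+
  ultimately show ?thesis by (simp add: completion_def)
qed

text \<open>Serves scalar multiplication as well as the module action, both of which are defined by
  unions over representatives.\<close>

lemma lift_operator_class:
  assumes "cauchy_seq V s" "bdd_operator V V f"
  shows "(\<Union>t\<in>cauchy_class V s. cauchy_class V (\<lambda>n. f (t n))) = cauchy_class V (\<lambda>n. f (s n))"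
proof -
  have "cauchy_class V (\<lambda>n. f (t n)) = cauchy_class V (\<lambda>n. f (s n))" if "t \<in> cauchy_class V s" for t
  proof -
    have t: "cauchy_seq V t" "close t s" using that by (simp_all add: cauchy_class_def)
    show ?thesis
      unfolding cauchy_class_eq_iff[OF bdd_operator_cauchy[OF t(1) assms(2)] bdd_operator_cauchy[OF assms]]
      by (rule bdd_operator_close[OF qn t(1) assms t(2)])
  qed
  then have "(\<Union>t\<in>cauchy_class V s. cauchy_class V (\<lambda>n. f (t n)))
      = (\<Union>t\<in>cauchy_class V s. cauchy_class V (\<lambda>n. f (s n)))"
    by (intro SUP_cong refl)
  moreover have "cauchy_class V s \<noteq> {}" using cauchy_class_self assms by blast
  ultimately show ?thesis by simp
qed

lemma completion_scl:
  "cauchy_seq V s \<Longrightarrow> scl (completion V) c (cauchy_class V s) = cauchy_class V (\<lambda>n. scl V c (s n))"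
  using lift_operator_class[of s "scl V c"] bdd_operator_scl_self[OF qn] by (simp add: completion_def)

lemma cauchy_seq_scl: "cauchy_seq V s \<Longrightarrow> cauchy_seq V (\<lambda>n. scl V c (s n))"
  using bdd_operator_cauchy bdd_operator_scl_self[OF qn] by blast

lemma cauchy_seq_dif: "cauchy_seq V s \<Longrightarrow> cauchy_seq V t \<Longrightarrow> cauchy_seq V (\<lambda>n. dif V (s n) (t n))"
  by (simp add: dif_def cauchy_seq_add cauchy_seq_scl)

lemma completion_dif:
  "cauchy_seq V s \<Longrightarrow> cauchy_seq V t \<Longrightarrow>
    dif (completion V) (cauchy_class V s) (cauchy_class V t) = cauchy_class V (\<lambda>n. dif V (s n) (t n))"
  by (simp add: dif_def completion_scl completion_add cauchy_seq_scl)

lemma completion_carr: "c \<in> carr (completion V) \<longleftrightarrow> (\<exists>s. cauchy_seq V s \<and> c = cauchy_class V s)"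
  by (auto simp: completion_def)

lemma completion_zer: "zer (completion V) = cauchy_class V (\<lambda>_. zer V)"
  by (simp add: completion_def)

lemma linear_space_completion: "linear_space (completion V)"
  unfolding linear_space_def
proof (intro conjI ballI allI)
  fix x assume "x \<in> carr (completion V)"
  then obtain s where s: "cauchy_seq V s" "x = cauchy_class V s" by (auto simp: completion_carr)
  note sc = cauchy_seq_carr[OF s(1)]
  show "scl (completion V) c x \<in> carr (completion V)" for c
    using cauchy_seq_scl[OF s(1)] by (auto simp: s completion_scl completion_carr)
  show "add (completion V) (zer (completion V)) x = x" "dif (completion V) x x = zer (completion V)"
    "scl (completion V) 1 x = x"
    by (simp_all add: s completion_zer completion_add completion_dif completion_scl cauchy_seq_const
        zer_in[OF l] zer_add[OF l] dif_self[OF l] scl_one[OF l] sc)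
  show "scl (completion V) (c + d) x = add (completion V) (scl (completion V) c x) (scl (completion V) d x)"
    "scl (completion V) (c * d) x = scl (completion V) c (scl (completion V) d x)" for c d
    by (simp_all add: s completion_add completion_scl cauchy_seq_scl scl_plus[OF l] scl_scl[OF l] sc)
  fix y assume "y \<in> carr (completion V)"
  then obtain t where t: "cauchy_seq V t" "y = cauchy_class V t" by (auto simp: completion_carr)
  note tc = cauchy_seq_carr[OF t(1)]
  show "add (completion V) x y \<in> carr (completion V)"
    using cauchy_seq_add[OF s(1) t(1)] by (auto simp: s t completion_add completion_carr)
  show "add (completion V) x y = add (completion V) y x"
    using add_commute[OF l sc tc] by (simp add: s t completion_add)
  show "scl (completion V) c (add (completion V) x y)
      = add (completion V) (scl (completion V) c x) (scl (completion V) c y)" for c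
    by (simp add: s t completion_add completion_scl cauchy_seq_scl cauchy_seq_add scl_add[OF l] sc tc)
  fix z assume "z \<in> carr (completion V)"
  then obtain u where u: "cauchy_seq V u" "z = cauchy_class V u" by (auto simp: completion_carr)
  show "add (completion V) (add (completion V) x y) z = add (completion V) x (add (completion V) y z)"
    by (simp add: s t u completion_add cauchy_seq_add add_assoc[OF l] sc tc cauchy_seq_carr[OF u(1)])
next
  show "zer (completion V) \<in> carr (completion V)"
    using cauchy_seq_const[OF zer_in[OF l]] by (auto simp: completion_carr completion_zer)
qed

section \<open>The gauge quasinorm and completeness\<close>

lemma cauchy_seq_bounded:
  assumes "cauchy_seq V s" shows "\<exists>r. \<forall>n. qnorm V (s n) \<le> r"
proof -
  obtain K where K: "K \<ge> 1"
    "\<And>x y. x \<in> carr V \<Longrightarrow> y \<in> carr V \<Longrightarrow> qnorm V (add V x y) \<le> K * (qnorm V x + qnorm V y)"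
    using quasi_triangle_obtain[OF qn] by metis
  obtain N where N: "\<forall>m\<ge>N. \<forall>n\<ge>N. qnorm V (dif V (s m) (s n)) < 1"
    using assms unfolding cauchy_seq_def by (metis zero_less_one)
  have "qnorm V (s n) \<le> Max ((\<lambda>n. qnorm V (s n)) ` {..N}) + K * (1 + qnorm V (s N))" for n
  proof (cases "n \<le> N")
    case True
    then have "qnorm V (s n) \<le> Max ((\<lambda>n. qnorm V (s n)) ` {..N})" by (intro Max_ge) auto
    moreover have "0 \<le> K * (1 + qnorm V (s N))"
      using K(1) qnorm_nonneg[OF qn cauchy_seq_carr[OF assms, of N]] by simp
    ultimately show ?thesis by simp
  next
    case False
    have "qnorm V (s n) \<le> K * (qnorm V (dif V (s n) (s N)) + qnorm V (s N))"
      using K(2)[of "dif V (s n) (s N)" "s N"] by (simp add: dif_add_cancel[OF l] dif_in[OF l] cauchy_seq_carr assms)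
    also have "\<dots> \<le> K * (1 + qnorm V (s N))"
      using N False K(1) by (intro mult_left_mono add_mono) (auto simp: less_imp_le)
    finally have "qnorm V (s n) \<le> K * (1 + qnorm V (s N))" .
    moreover have "0 \<le> Max ((\<lambda>n. qnorm V (s n)) ` {..N})"
      by (rule order_trans[OF qnorm_nonneg[OF qn cauchy_seq_carr[OF assms, of N]]]) (intro Max_ge, auto)
    ultimately show ?thesis by simp
  qed
  then show ?thesis by blast
qed

lemma completion_qnorm_le_uniform:
  assumes "cauchy_seq V s" "t \<in> cauchy_class V s" "\<And>n. qnorm V (t n) \<le> r"
  shows "qnorm (completion V) (cauchy_class V s) \<le> r"
  unfolding completion_def
proof (simp, rule cInf_lower)
  show "r \<in> {r. \<exists>s\<in>cauchy_class V s. \<forall>n. qnorm V (s n) \<le> r}" using assms by blast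
  show "bdd_below {r. \<exists>s\<in>cauchy_class V s. \<forall>n. qnorm V (s n) \<le> r}"
    using cauchy_class_cong[OF assms(1)] cauchy_seq_carr qnorm_nonneg[OF qn]
    by (intro bdd_belowI[of _ 0]) (blast intro: order_trans)
qed

lemma cauchy_class_shift:
  assumes "cauchy_seq V s" shows "(\<lambda>n. s (n + N)) \<in> cauchy_class V s"
proof -
  have "cauchy_seq V (\<lambda>n. s (n + N))"
    unfolding cauchy_seq_def
  proof (intro conjI allI impI)
    show "range (\<lambda>n. s (n + N)) \<subseteq> carr V" using cauchy_seq_carr[OF assms] by auto
    fix e :: real assume "e > 0"
    then obtain M where "\<forall>m\<ge>M. \<forall>n\<ge>M. qnorm V (dif V (s m) (s n)) < e"
      using assms unfolding cauchy_seq_def by blast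
    then show "\<exists>M. \<forall>m\<ge>M. \<forall>n\<ge>M. qnorm V (dif V (s (m + N)) (s (n + N))) < e"
      by (intro exI[of _ M]) simp
  qed
  moreover have "close (\<lambda>n. s (n + N)) s"
  proof (rule LIMSEQ_I)
    fix e :: real assume "e > 0"
    then obtain M where "\<forall>m\<ge>M. \<forall>n\<ge>M. qnorm V (dif V (s m) (s n)) < e"
      using assms unfolding cauchy_seq_def by blast
    then show "\<exists>no. \<forall>n\<ge>no. norm (qnorm V (dif V (s (n + N)) (s n)) - 0) < e"
      using qnorm_nonneg[OF qn dif_in[OF l]] cauchy_seq_carr[OF assms] by (intro exI[of _ M]) auto
  qed
  ultimately show ?thesis by (simp add: cauchy_class_def)
qed

text \<open>The gauge asks for a bound on every term of a representative; dropping the first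
  \<open>N\<close> terms stays in the class, so an eventual bound is enough.\<close>

lemma completion_qnorm_le:
  assumes "cauchy_seq V s" "\<And>n. n \<ge> N \<Longrightarrow> qnorm V (s n) \<le> r"
  shows "qnorm (completion V) (cauchy_class V s) \<le> r"
  by (rule completion_qnorm_le_uniform[OF assms(1) cauchy_class_shift[OF assms(1), of N]]) (simp add: assms)

lemma completion_qnorm_approx:
  assumes "cauchy_seq V s" "qnorm (completion V) (cauchy_class V s) < r"
  obtains t where "t \<in> cauchy_class V s" "\<And>n. qnorm V (t n) \<le> r"
proof -
  have "{r. \<exists>s\<in>cauchy_class V s. \<forall>n. qnorm V (s n) \<le> r} \<noteq> {}"
    using cauchy_seq_bounded[OF assms(1)] cauchy_class_self[OF assms(1)] by blast
  from cInf_lessD[OF this, of r] assms(2) obtain q t where "t \<in> cauchy_class V s" "\<forall>n. qnorm V (t n) \<le> q" "q < r"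
    by (auto simp: completion_def)
  then show thesis using that[of t] by (meson le_less_trans less_imp_le)
qed

lemma completion_qnorm_nonneg:
  assumes "cauchy_seq V s" shows "0 \<le> qnorm (completion V) (cauchy_class V s)"
proof (rule ccontr)
  assume "\<not> ?thesis"
  then have "qnorm (completion V) (cauchy_class V s) < 0" by simp
  then obtain r where "qnorm (completion V) (cauchy_class V s) < r" "r < 0" using dense by blast
  then obtain t where "t \<in> cauchy_class V s" "\<And>n. qnorm V (t n) \<le> r"
    using completion_qnorm_approx[OF assms] by metis
  then show False
    using \<open>r < 0\<close> qnorm_nonneg[OF qn cauchy_seq_carr[of t 0]] cauchy_class_cong[OF assms, of t]
    by (meson le_less_trans not_less)
qed

text \<open>Working with almost optimal representatives keeps the constant \<open>C\<close> of the
  operator, without an extra factor from the quasi-triangle inequality. The slack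
  \<open>e / (C + 1)\<close> also covers \<open>C = 0\<close>.\<close>

lemma lift_operator_bound:
  assumes "cauchy_seq V s" "bdd_operator V V f" "C \<ge> 0" "\<And>x. x \<in> carr V \<Longrightarrow> qnorm V (f x) \<le> C * qnorm V x"
  shows "qnorm (completion V) (cauchy_class V (\<lambda>n. f (s n))) \<le> C * qnorm (completion V) (cauchy_class V s)"
proof (rule field_le_epsilon)
  let ?q = "qnorm (completion V) (cauchy_class V s)"
  fix e :: real assume e: "e > 0"
  have "?q < ?q + e / (C + 1)" using e assms(3) by simp
  then obtain t where t: "t \<in> cauchy_class V s" "\<And>n. qnorm V (t n) \<le> ?q + e / (C + 1)"
    using completion_qnorm_approx[OF assms(1)] by metis
  have t': "cauchy_seq V t" using cauchy_class_cong[OF assms(1) t(1)] by simp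
  have "close (\<lambda>n. f (t n)) (\<lambda>n. f (s n))"
    using bdd_operator_close[OF qn t' assms(1,2)] t(1) by (simp add: cauchy_class_def)
  then have "(\<lambda>n. f (t n)) \<in> cauchy_class V (\<lambda>n. f (s n))"
    using bdd_operator_cauchy[OF t' assms(2)] by (simp add: cauchy_class_def)
  moreover have "qnorm V (f (t n)) \<le> C * (?q + e / (C + 1))" for n
    using assms(4)[OF cauchy_seq_carr[OF t', of n]] mult_left_mono[OF t(2)[of n] assms(3)] by linarith
  ultimately have "qnorm (completion V) (cauchy_class V (\<lambda>n. f (s n))) \<le> C * (?q + e / (C + 1))"
    by (rule completion_qnorm_le_uniform[OF bdd_operator_cauchy[OF assms(1,2)]])
  also have "\<dots> \<le> C * ?q + e"
  proof -
    have "C * (e / (C + 1)) \<le> e" using e assms(3) by (simp add: field_simps)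
    then show ?thesis by (simp add: algebra_simps)
  qed
  finally show "qnorm (completion V) (cauchy_class V (\<lambda>n. f (s n))) \<le> C * ?q + e" .
qed

lemma completion_qnorm_scl:
  assumes "cauchy_seq V s"
  shows "qnorm (completion V) (cauchy_class V (\<lambda>n. scl V c (s n))) = norm c * qnorm (completion V) (cauchy_class V s)"
proof (cases "c = 0")
  case True
  have "qnorm (completion V) (cauchy_class V (\<lambda>n. scl V c (s n))) \<le> 0"
    by (rule completion_qnorm_le[of _ 0]) (auto simp: True assms scl_zero[OF l] cauchy_seq_carr qnorm_zer[OF qn] cauchy_seq_const zer_in[OF l])
  then show ?thesis using completion_qnorm_nonneg[OF cauchy_seq_scl[OF assms, of c]] True by simp
next
  case False
  have 1: "qnorm (completion V) (cauchy_class V (\<lambda>n. scl V c (s n))) \<le> norm c * qnorm (completion V) (cauchy_class V s)"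
    if "cauchy_seq V s" for c s
    by (rule lift_operator_bound[OF that bdd_operator_scl_self[OF qn]]) (auto simp: qnorm_scl[OF qn])
  have "(\<lambda>n. scl V (1 / c) (scl V c (s n))) = s"
    using False by (simp add: scl_scl[OF l] cauchy_seq_carr assms scl_one[OF l])
  then have "qnorm (completion V) (cauchy_class V s)
      \<le> norm (1 / c) * qnorm (completion V) (cauchy_class V (\<lambda>n. scl V c (s n)))"
    using 1[OF cauchy_seq_scl[OF assms, of c], of "1 / c"] by simp
  then show ?thesis using 1[OF assms, of c] False by (simp add: norm_divide field_simps)
qed

text \<open>Equivalent Cauchy sequences may have quasinorms that differ in the limit, but only up to
  the factor \<open>K\<close>. This lower estimate makes the canonical map from \<open>V\<close>
  reflect Cauchy sequences, which completeness rests on.\<close>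

lemma completion_qnorm_ge:
  obtains K where "K \<ge> 1"
    "\<And>s N r. cauchy_seq V s \<Longrightarrow> (\<And>n. n \<ge> N \<Longrightarrow> r \<le> qnorm V (s n)) \<Longrightarrow>
      r \<le> K * qnorm (completion V) (cauchy_class V s)"
proof -
  obtain K where K: "K \<ge> 1"
    "\<And>x y. x \<in> carr V \<Longrightarrow> y \<in> carr V \<Longrightarrow> qnorm V (add V x y) \<le> K * (qnorm V x + qnorm V y)"
    using quasi_triangle_obtain[OF qn] by metis
  have "r \<le> K * qnorm (completion V) (cauchy_class V s)"
    if s: "cauchy_seq V s" "\<And>n. n \<ge> N \<Longrightarrow> r \<le> qnorm V (s n)" for s N r
  proof (rule field_le_epsilon)
    let ?q = "qnorm (completion V) (cauchy_class V s)"
    fix e :: real assume e: "e > 0"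
    have "?q < ?q + e / (2 * K)" using e K(1) by simp
    then obtain t where t: "t \<in> cauchy_class V s" "\<And>n. qnorm V (t n) \<le> ?q + e / (2 * K)"
      using completion_qnorm_approx[OF s(1)] by metis
    have t': "cauchy_seq V t" using cauchy_class_cong[OF s(1) t(1)] by simp
    have "close s t" using t(1) close_sym[OF s(1) t'] by (simp add: cauchy_class_def)
    then have "eventually (\<lambda>n. qnorm V (dif V (s n) (t n)) < e / (2 * K)) sequentially"
      using e K(1) by (intro order_tendstoD(2)) auto
    then obtain n where n: "n \<ge> N" "qnorm V (dif V (s n) (t n)) < e / (2 * K)"
      by (auto simp: eventually_sequentially) (metis nle_le)
    have "r \<le> qnorm V (s n)" using s(2) n(1) .
    also have "\<dots> \<le> K * (qnorm V (dif V (s n) (t n)) + qnorm V (t n))"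
      using K(2)[of "dif V (s n) (t n)" "t n"]
      by (simp add: dif_add_cancel[OF l] dif_in[OF l] cauchy_seq_carr s(1) t')
    also have "\<dots> \<le> K * (e / (2 * K) + (?q + e / (2 * K)))"
      using n(2) t(2)[of n] K(1) by (intro mult_left_mono add_mono) auto
    also have "\<dots> = K * ?q + e" using K(1) by (simp add: field_simps)
    finally show "r \<le> K * ?q + e" .
  qed
  then show thesis using that K(1) by blast
qed

lemma quasinormed_completion: "quasinormed (completion V)"
proof -
  obtain K where K: "K \<ge> 1"
    "\<And>x y. x \<in> carr V \<Longrightarrow> y \<in> carr V \<Longrightarrow> qnorm V (add V x y) \<le> K * (qnorm V x + qnorm V y)"
    using quasi_triangle_obtain[OF qn] by metis
  show ?thesis
  proof (rule quasinormedI[OF linear_space_completion])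
    fix x assume "x \<in> carr (completion V)"
    then obtain s where s: "cauchy_seq V s" "x = cauchy_class V s" by (auto simp: completion_carr)
    show "0 \<le> qnorm (completion V) x" by (simp add: s completion_qnorm_nonneg)
    show "qnorm (completion V) (scl (completion V) c x) = norm c * qnorm (completion V) x" for c
      by (simp add: s completion_scl completion_qnorm_scl)
    show "x = zer (completion V)" if "qnorm (completion V) x = 0"
    proof -
      obtain L where L: "L \<ge> 1" "\<And>x y. x \<in> carr V \<Longrightarrow> y \<in> carr V \<Longrightarrow> qnorm V (add V x y) \<le> L * (qnorm V x + qnorm V y)"
        using quasi_triangle_obtain[OF qn] by metis
      have "close s (\<lambda>_. zer V)"
      proof (rule LIMSEQ_I)
        fix e :: real assume e: "e > 0"
        define d where "d = e / (4 * L)"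
        have d: "d > 0" using e L(1) by (simp add: d_def)
        then obtain t where t: "t \<in> cauchy_class V s" "\<And>n. qnorm V (t n) \<le> d"
          using completion_qnorm_approx[OF s(1), of d] \<open>qnorm (completion V) x = 0\<close> s(2) by auto
        have t': "cauchy_seq V t" using cauchy_class_cong[OF s(1) t(1)] by simp
        have "close s t" using t(1) close_sym[OF s(1) t'] by (simp add: cauchy_class_def)
        then have "eventually (\<lambda>n. qnorm V (dif V (s n) (t n)) < d) sequentially"
          using d by (intro order_tendstoD(2)) auto
        then obtain N where N: "\<And>n. n \<ge> N \<Longrightarrow> qnorm V (dif V (s n) (t n)) < d"
          by (auto simp: eventually_sequentially)
        have "qnorm V (s n) < e" if "n \<ge> N" for n
        proof -
          have "qnorm V (s n) \<le> L * (qnorm V (dif V (s n) (t n)) + qnorm V (t n))"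
            using L(2)[of "dif V (s n) (t n)" "t n"]
            by (simp add: dif_add_cancel[OF l] dif_in[OF l] cauchy_seq_carr s(1) t')
          also have "\<dots> \<le> L * (d + d)"
            using N[OF that] t(2)[of n] L(1) by (intro mult_left_mono add_mono) auto
          also have "\<dots> < e" using e L(1) by (simp add: d_def)
          finally show ?thesis .
        qed
        then show "\<exists>no. \<forall>n\<ge>no. norm (qnorm V (dif V (s n) (zer V)) - 0) < e"
          using qnorm_nonneg[OF qn cauchy_seq_carr[OF s(1)]]
          by (intro exI[of _ N]) (auto simp: dif_zer[OF l] cauchy_seq_carr s(1))
      qed
      then show ?thesis
        using cauchy_class_eq_iff[OF s(1) cauchy_seq_const[OF zer_in[OF l]]] by (simp add: s completion_zer)
    qed
    fix y assume "y \<in> carr (completion V)"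
    then obtain t where t: "cauchy_seq V t" "y = cauchy_class V t" by (auto simp: completion_carr)
    show "qnorm (completion V) (add (completion V) x y) \<le> K * (qnorm (completion V) x + qnorm (completion V) y)"
    proof (rule field_le_epsilon)
      fix e :: real assume e: "e > 0"
      define d where "d = e / (2 * K)"
      have d: "d > 0" using e K(1) by (simp add: d_def)
      have "qnorm (completion V) x < qnorm (completion V) x + d"
        "qnorm (completion V) y < qnorm (completion V) y + d" using d by auto
      then obtain s' t' where s': "s' \<in> cauchy_class V s" "\<And>n. qnorm V (s' n) \<le> qnorm (completion V) x + d"
        and t': "t' \<in> cauchy_class V t" "\<And>n. qnorm V (t' n) \<le> qnorm (completion V) y + d"
        using completion_qnorm_approx s t by metis
      have c: "cauchy_seq V s'" "cauchy_class V s' = x" "cauchy_seq V t'" "cauchy_class V t' = y"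
        using cauchy_class_cong[OF s(1) s'(1)] cauchy_class_cong[OF t(1) t'(1)] s(2) t(2) by simp_all
      have "qnorm (completion V) (add (completion V) x y)
          \<le> K * ((qnorm (completion V) x + d) + (qnorm (completion V) y + d))"
        unfolding c(2)[symmetric] c(4)[symmetric] completion_add[OF c(1) c(3)]
      proof (rule completion_qnorm_le[of _ 0])
        fix n
        have "qnorm V (add V (s' n) (t' n)) \<le> K * (qnorm V (s' n) + qnorm V (t' n))"
          by (intro K cauchy_seq_carr c)
        also have "\<dots> \<le> K * ((qnorm (completion V) x + d) + (qnorm (completion V) y + d))"
          using s'(2)[of n] t'(2)[of n] K(1) by (intro mult_left_mono) auto
        finally show "qnorm V (add V (s' n) (t' n)) \<le> K * (qnorm (completion V) (cauchy_class V s') + d +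
          (qnorm (completion V) (cauchy_class V t') + d))" by (simp add: c)
      qed (intro cauchy_seq_add c)
      also have "\<dots> = K * (qnorm (completion V) x + qnorm (completion V) y) + e"
        using K(1) by (simp add: d_def field_simps)
      finally show "qnorm (completion V) (add (completion V) x y)
          \<le> K * (qnorm (completion V) x + qnorm (completion V) y) + e" .
    qed
  qed
qed

lemma dense_in_completion:
  assumes "c \<in> carr (completion V)" "e > 0"
  obtains v where "v \<in> carr V" "qnorm (completion V) (dif (completion V) c (cauchy_class V (\<lambda>_. v))) < e"
proof -
  obtain s where s: "cauchy_seq V s" "c = cauchy_class V s" using assms by (auto simp: completion_carr)
  obtain N where N: "\<forall>m\<ge>N. \<forall>n\<ge>N. qnorm V (dif V (s m) (s n)) < e / 2"
    using s(1) assms(2) unfolding cauchy_seq_def by (metis half_gt_zero)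
  have sN: "s N \<in> carr V" by (rule cauchy_seq_carr[OF s(1)])
  have "qnorm (completion V) (dif (completion V) c (cauchy_class V (\<lambda>_. s N))) \<le> e / 2"
    unfolding s(2) completion_dif[OF s(1) cauchy_seq_const[OF sN]]
    by (rule completion_qnorm_le[where N = N]) (use N s sN in \<open>auto intro!: cauchy_seq_dif cauchy_seq_const less_imp_le\<close>)
  then show thesis using that[OF sN] assms(2) by simp
qed

text \<open>Diagonal argument: the \<open>n\<close>-th member of a Cauchy sequence of classes is
  approximated within \<open>1 / (n + 1)\<close> by the class of a constant sequence with value
  \<open>v n\<close>; then \<open>v\<close> is Cauchy in \<open>V\<close>, and its class is the
  limit.\<close>

theorem quasi_banach_completion: "quasi_banach (completion V)"
  unfolding quasi_banach_def
proof (intro conjI allI impI)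
  show "quasinormed (completion V)" by (rule quasinormed_completion)
  fix S assume S: "cauchy_seq (completion V) S"
  note qC = quasinormed_completion and lC = linear_space_completion
  let ?C = "completion V"
  let ?i = "\<lambda>v. cauchy_class V (\<lambda>_. v)"
  have SC: "S n \<in> carr ?C" for n using S by (auto simp: cauchy_seq_def)
  have "\<exists>v\<in>carr V. qnorm ?C (dif ?C (S n) (?i v)) < inverse (real (Suc n))" for n
    by (rule dense_in_completion[OF SC[of n], of "inverse (real (Suc n))"]) auto
  then obtain v where v: "\<And>n. v n \<in> carr V" "\<And>n. qnorm ?C (dif ?C (S n) (?i (v n))) < inverse (real (Suc n))"
    by metis
  have iC: "?i x \<in> carr ?C" if "x \<in> carr V" for x using that cauchy_seq_const by (auto simp: completion_carr)
  obtain K where K: "K \<ge> 1" "\<And>x y z. x \<in> carr ?C \<Longrightarrow> y \<in> carr ?C \<Longrightarrow> z \<in> carr ?C \<Longrightarrow>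
      qnorm ?C (dif ?C x z) \<le> K * (qnorm ?C (dif ?C x y) + qnorm ?C (dif ?C y z))"
    using quasi_triangle_obtain[OF qC] by metis
  obtain L where L: "L \<ge> 1" "\<And>s N r. cauchy_seq V s \<Longrightarrow> (\<And>n. n \<ge> N \<Longrightarrow> r \<le> qnorm V (s n)) \<Longrightarrow>
      r \<le> L * qnorm ?C (cauchy_class V s)" using completion_qnorm_ge by metis
  have il: "qnorm V (dif V x y) \<le> L * qnorm ?C (dif ?C (?i x) (?i y))" if "x \<in> carr V" "y \<in> carr V" for x y
    using L(2)[OF cauchy_seq_const[OF dif_in[OF l that]], of 0 "qnorm V (dif V x y)"]
    by (simp add: completion_dif[OF cauchy_seq_const cauchy_seq_const] that)
  have inv0: "(\<lambda>n. inverse (real (Suc n))) \<longlonglongrightarrow> 0" by (rule LIMSEQ_inverse_real_of_nat)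
  have vc: "cauchy_seq V v"
    unfolding cauchy_seq_def
  proof (intro conjI allI impI)
    show "range v \<subseteq> carr V" using v by auto
    fix e :: real assume e: "e > 0"
    \<comment> \<open>\<open>v m\<close> and \<open>v n\<close> are joined through
      \<open>S m\<close> and \<open>S n\<close> at the cost \<open>K * (1 + K * 2)\<close>, and
      \<open>L\<close> is paid for returning from the completion to \<open>V\<close>.\<close>
    define d where "d = e / (L * (K * (1 + K * 2)))"
    have d: "d > 0" using e L(1) K(1) by (auto simp: d_def intro!: divide_pos_pos mult_pos_pos)
    obtain N where N: "\<forall>m\<ge>N. \<forall>n\<ge>N. qnorm ?C (dif ?C (S m) (S n)) < d"
      using S d unfolding cauchy_seq_def by blast
    obtain M where M: "\<And>n. n \<ge> M \<Longrightarrow> inverse (real (Suc n)) < d"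
      using order_tendstoD(2)[OF inv0 d] by (auto simp: eventually_sequentially)
    show "\<exists>N. \<forall>m\<ge>N. \<forall>n\<ge>N. qnorm V (dif V (v m) (v n)) < e"
    proof (intro exI[of _ "max M N"] allI impI)
      fix m n assume mn: "max M N \<le> m" "max M N \<le> n"
      have a: "qnorm ?C (dif ?C (S m) (?i (v m))) < d" "qnorm ?C (dif ?C (S n) (?i (v n))) < d"
        using v(2)[of m] v(2)[of n] M[of m] M[of n] mn by auto
      have "qnorm ?C (dif ?C (S m) (S n)) < d" using N mn by simp
      then have b: "qnorm ?C (dif ?C (S m) (?i (v n))) \<le> K * (d + d)"
        using a(2) K(1)
        by (intro order_trans[OF K(2)[OF SC[of m] SC[of n] iC[OF v(1)[of n]]]] mult_left_mono) auto
      have "qnorm V (dif V (v m) (v n)) \<le> L * qnorm ?C (dif ?C (?i (v m)) (?i (v n)))"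
        by (intro il v)
      also have "\<dots> \<le> L * (K * (qnorm ?C (dif ?C (?i (v m)) (S m)) + qnorm ?C (dif ?C (S m) (?i (v n)))))"
        using L(1) by (intro mult_left_mono K iC v SC) auto
      also have "\<dots> < L * (K * (d + K * (d + d)))"
        using L(1) K(1) a(1) b qnorm_dif_commute[OF qC iC[OF v(1)] SC, of m m]
        by (intro mult_strict_left_mono add_less_le_mono) auto
      also have "\<dots> = d * (L * (K * (1 + K * 2)))" by (simp add: algebra_simps)
      also have "\<dots> = e"
      proof -
        have "L * (K * (1 + K * 2)) \<noteq> 0" using L(1) K(1) by auto
        then show ?thesis by (simp add: d_def)
      qed
      finally show "qnorm V (dif V (v m) (v n)) < e" .
    qed
  qed
  let ?x = "cauchy_class V v"
  have xC: "?x \<in> carr ?C" using vc by (auto simp: completion_carr)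
  have vx: "(\<lambda>n. qnorm ?C (dif ?C (?i (v n)) ?x)) \<longlonglongrightarrow> 0"
  proof (rule LIMSEQ_I)
    fix e :: real assume e: "e > 0"
    obtain N where N: "\<forall>m\<ge>N. \<forall>n\<ge>N. qnorm V (dif V (v m) (v n)) < e / 2"
      using vc e unfolding cauchy_seq_def by (metis half_gt_zero)
    have "qnorm ?C (dif ?C (?i (v n)) ?x) \<le> e / 2" if "n \<ge> N" for n
      unfolding completion_dif[OF cauchy_seq_const[OF v(1)] vc]
      by (rule completion_qnorm_le[where N = N])
        (use N that in \<open>auto intro!: cauchy_seq_dif cauchy_seq_const less_imp_le v vc\<close>)
    then show "\<exists>no. \<forall>n\<ge>no. norm (qnorm ?C (dif ?C (?i (v n)) ?x) - 0) < e"
      using qnorm_nonneg[OF qC dif_in[OF lC iC[OF v(1)] xC]] e by (intro exI[of _ N]) fastforce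
  qed
  show "\<exists>x\<in>carr ?C. (\<lambda>n. qnorm ?C (dif ?C (S n) x)) \<longlonglongrightarrow> 0"
  proof (intro bexI[of _ ?x] xC)
    have "(\<lambda>n. K * (inverse (real (Suc n)) + qnorm ?C (dif ?C (?i (v n)) ?x))) \<longlonglongrightarrow> K * (0 + 0)"
      by (intro tendsto_intros vx inv0)
    moreover have "qnorm ?C (dif ?C (S n) ?x)
        \<le> K * (inverse (real (Suc n)) + qnorm ?C (dif ?C (?i (v n)) ?x))" for n
      by (rule order_trans[OF K(2)[OF SC iC[OF v(1)] xC, of n n]])
        (use K(1) v(2)[of n] in \<open>auto intro!: mult_left_mono less_imp_le\<close>)
    ultimately show "(\<lambda>n. qnorm ?C (dif ?C (S n) ?x)) \<longlonglongrightarrow> 0"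
      using qnorm_nonneg[OF qC dif_in[OF lC SC xC]]
      by - (rule squeeze_zero[of "\<lambda>n. K * (inverse (real (Suc n)) + qnorm ?C (dif ?C (?i (v n)) ?x))"], simp_all)
  qed
qed

end

section \<open>The spaces of p-summable sequences\<close>

lemma powr_add_le:
  fixes a b p :: real
  assumes "0 \<le> a" "0 \<le> b" "0 < p"
  shows "(a + b) powr p \<le> 2 powr p * (a powr p + b powr p)"
proof -
  have "(a + b) powr p \<le> (2 * max a b) powr p" using assms by (intro powr_mono2) auto
  also have "\<dots> = 2 powr p * max a b powr p" using assms by (simp add: powr_mult)
  also have "max a b powr p \<le> a powr p + b powr p" by (simp add: max_def)
  finally show ?thesis by simp
qed

context
  fixes p :: real
  assumes p: "p > 0"
begin

lemma lp_norm_nonneg: "0 \<le> lp_norm p x"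
  by (simp add: lp_norm_def)

lemma lp_norm_powr: "x \<in> lp p \<Longrightarrow> lp_norm p x powr p = (\<Sum>n. norm (x n) powr p)"
  using p by (simp add: lp_norm_def powr_powr lp_def suminf_nonneg)

lemma lp_bound:
  assumes "\<And>N. (\<Sum>n<N. norm (x n) powr p) \<le> r powr p" "r \<ge> 0"
  shows "x \<in> lp p" "lp_norm p x \<le> r"
proof -
  have s: "summable (\<lambda>n. norm (x n) powr p)"
    by (rule summableI_nonneg_bounded[where x = "r powr p"]) (use assms in auto)
  then show "x \<in> lp p" by (simp add: lp_def)
  have "(\<Sum>n. norm (x n) powr p) \<le> r powr p" by (rule suminf_le_const[OF s assms(1)])
  then have "lp_norm p x \<le> (r powr p) powr (1 / p)"
    unfolding lp_norm_def using p s by (intro powr_mono2 suminf_nonneg) auto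
  then show "lp_norm p x \<le> r" using p assms(2) by (simp add: powr_powr)
qed

lemma lp_partial_sum_le:
  assumes "x \<in> lp p" "finite F" shows "(\<Sum>n\<in>F. norm (x n) powr p) \<le> lp_norm p x powr p"
  unfolding lp_norm_powr[OF assms(1)] using assms by (intro sum_le_suminf) (auto simp: lp_def)

lemma norm_le_lp_norm:
  assumes "x \<in> lp p" shows "norm (x n) \<le> lp_norm p x"
proof -
  have "norm (x n) powr p \<le> lp_norm p x powr p" using lp_partial_sum_le[OF assms, of "{n}"] by simp
  then show ?thesis using p powr_less_mono2[of p "lp_norm p x" "norm (x n)"] lp_norm_nonneg[of x] by force
qed

text \<open>Two scalar types are allowed because scalar sequences are later compared with real
  majorants.\<close>

lemma lp_scaled_bound:
  fixes x :: "nat \<Rightarrow> 'k::real_normed_field" and y :: "nat \<Rightarrow> 'l::real_normed_field"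
  assumes "y \<in> lp p" "\<And>n. norm (x n) \<le> M * norm (y n)" "M \<ge> 0"
  shows "x \<in> lp p" "lp_norm p x \<le> M * lp_norm p y"
proof -
  have "(\<Sum>n<N. norm (x n) powr p) \<le> (M * lp_norm p y) powr p" for N
  proof -
    have "(\<Sum>n<N. norm (x n) powr p) \<le> (\<Sum>n<N. M powr p * norm (y n) powr p)"
      using assms p by (intro sum_mono) (auto simp: powr_mult[symmetric] intro!: powr_mono2)
    also have "\<dots> \<le> M powr p * lp_norm p y powr p"
      using lp_partial_sum_le[OF assms(1), of "{..<N}"] by (simp add: sum_distrib_left[symmetric] mult_left_mono)
    finally show ?thesis using assms(3) by (simp add: powr_mult lp_norm_nonneg)
  qed
  from lp_bound[OF this] assms(3) show "x \<in> lp p" "lp_norm p x \<le> M * lp_norm p y"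
    by (simp_all add: lp_norm_nonneg)
qed

lemma lp_norm_cmult:
  assumes "x \<in> lp p" shows "lp_norm p (\<lambda>n. c * x n) = norm c * lp_norm p x"
proof (cases "c = 0")
  case False
  then show ?thesis using p assms
    by (simp add: lp_def lp_norm_def norm_mult powr_mult suminf_mult powr_powr suminf_nonneg)
qed (use p in \<open>simp add: lp_norm_def\<close>)

lemma lp_cmult: "x \<in> lp p \<Longrightarrow> (\<lambda>n. c * x n) \<in> lp p"
  by (rule lp_scaled_bound(1)[of x _ "norm c"]) (auto simp: norm_mult)

text \<open>The pointwise bound \<open>(a + b) powr p \<le> 2 powr p * (a powr p + b powr p)\<close>
  serves all \<open>p > 0\<close> at once, whereas Minkowski's inequality would require
  \<open>p \<ge> 1\<close>; a quasinorm tolerates the crude constant.\<close>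

lemma lp_add:
  assumes "x \<in> lp p" "y \<in> lp p"
  shows "(\<lambda>n. x n + y n) \<in> lp p"
    "lp_norm p (\<lambda>n. x n + y n) \<le> 2 * 2 powr (1 / p) * (lp_norm p x + lp_norm p y)"
proof -
  let ?A = "lp_norm p x" and ?B = "lp_norm p y"
  define r where "r = 2 * 2 powr (1 / p) * (?A + ?B)"
  have r: "r \<ge> 0" by (simp add: r_def lp_norm_nonneg)
  have "(\<Sum>n<N. norm (x n + y n) powr p) \<le> r powr p" for N
  proof -
    have "(\<Sum>n<N. norm (x n + y n) powr p) \<le> (\<Sum>n<N. 2 powr p * (norm (x n) powr p + norm (y n) powr p))"
      using p by (intro sum_mono order_trans[OF powr_mono2 powr_add_le]) (auto intro: norm_triangle_ineq)
    also have "\<dots> \<le> 2 powr p * (?A powr p + ?B powr p)"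
      using lp_partial_sum_le[OF assms(1), of "{..<N}"] lp_partial_sum_le[OF assms(2), of "{..<N}"]
      by (simp add: sum_distrib_left[symmetric] sum.distrib)
    also have "\<dots> \<le> 2 powr p * ((?A + ?B) powr p + (?A + ?B) powr p)"
      using p by (intro mult_left_mono add_mono powr_mono2) (auto simp: lp_norm_nonneg)
    also have "\<dots> = r powr p" using p by (simp add: r_def powr_mult lp_norm_nonneg powr_powr)
    finally show ?thesis .
  qed
  from lp_bound[OF this r] show "(\<lambda>n. x n + y n) \<in> lp p"
    "lp_norm p (\<lambda>n. x n + y n) \<le> 2 * 2 powr (1 / p) * (lp_norm p x + lp_norm p y)" by (simp_all add: r_def)
qed

lemma lp_dif:
  assumes "x \<in> lp p" "y \<in> lp p"
  shows "(\<lambda>n. x n - y n) \<in> lp p"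
    "lp_norm p (\<lambda>n. x n - y n) \<le> 2 * 2 powr (1 / p) * (lp_norm p x + lp_norm p y)"
  using lp_add[OF assms(1) lp_cmult[OF assms(2), of "-1"]] lp_norm_cmult[OF assms(2), of "-1"] by simp_all

lemma lp_zero: "(\<lambda>_. 0) \<in> lp p" "lp_norm p (\<lambda>_. 0) = 0"
  using p by (simp_all add: lp_def lp_norm_def)

lemma dif_lp_module: "dif (lp_module p) x y = (\<lambda>n. x n - y n)"
  by (simp add: dif_def lp_module_def)

lemma quasinormed_lp: "quasinormed (lp_module p :: ('k::real_normed_field, nat \<Rightarrow> 'k) qmodule)"
proof (rule quasinormedI[where K = "2 * 2 powr (1 / p)"])
  show "linear_space (lp_module p :: ('k, nat \<Rightarrow> 'k) qmodule)"
    unfolding linear_space_def dif_lp_module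
    by (auto simp: lp_module_def lp_zero lp_add lp_cmult algebra_simps)
next
  fix x :: "nat \<Rightarrow> 'k" assume x: "x \<in> carr (lp_module p)" "qnorm (lp_module p) x = 0"
  then have "norm (x n) \<le> 0" for n using norm_le_lp_norm[of x n] by (simp add: lp_module_def)
  then show "x = zer (lp_module p)" by (auto simp: lp_module_def)
qed (auto simp: lp_module_def lp_norm_nonneg lp_norm_cmult lp_add)

theorem quasi_banach_lp: "quasi_banach (lp_module p :: ('k::{real_normed_field,banach}, nat \<Rightarrow> 'k) qmodule)"
  unfolding quasi_banach_def
proof (intro conjI allI impI quasinormed_lp)
  fix s assume "cauchy_seq (lp_module p :: ('k, nat \<Rightarrow> 'k) qmodule) s"
  then have s: "\<And>n. s n \<in> lp p"
    and c: "\<And>e. e > 0 \<Longrightarrow> \<exists>N. \<forall>m\<ge>N. \<forall>n\<ge>N. lp_norm p (\<lambda>i. s m i - s n i) < e"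
    by (auto simp: cauchy_seq_def dif_lp_module) (auto simp: lp_module_def)
  have "Cauchy (\<lambda>n. s n i)" for i
  proof (rule metric_CauchyI)
    fix e :: real assume "e > 0"
    then obtain N where N: "\<forall>m\<ge>N. \<forall>n\<ge>N. lp_norm p (\<lambda>i. s m i - s n i) < e" using c by blast
    then show "\<exists>M. \<forall>m\<ge>M. \<forall>n\<ge>M. dist (s m i) (s n i) < e"
      by (intro exI[of _ N]) (auto simp: dist_norm intro: le_less_trans[OF norm_le_lp_norm[OF lp_dif(1)[OF s s]]])
  qed
  then have "\<exists>l. (\<lambda>n. s n i) \<longlonglongrightarrow> l" for i using Cauchy_convergent convergent_def by blast
  then obtain x where x: "\<And>i. (\<lambda>n. s n i) \<longlonglongrightarrow> x i" by metis
  \<comment> \<open>For a fixed number of coordinates the partial sums pass to the limit in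
    \<open>n\<close>, so the Cauchy estimate survives for the pointwise limit.\<close>
  have close: "(\<lambda>i. s m i - x i) \<in> lp p \<and> lp_norm p (\<lambda>i. s m i - x i) \<le> e"
    if N: "\<forall>m\<ge>N. \<forall>n\<ge>N. lp_norm p (\<lambda>i. s m i - s n i) < e" "m \<ge> N" "e > 0" for m N e
  proof -
    have "(\<Sum>i<L. norm (s m i - x i) powr p) \<le> e powr p" for L
    proof (rule LIMSEQ_le_const2)
      show "(\<lambda>n. \<Sum>i<L. norm (s m i - s n i) powr p) \<longlonglongrightarrow> (\<Sum>i<L. norm (s m i - x i) powr p)"
        using p by (intro tendsto_sum tendsto_powr2 tendsto_norm tendsto_diff tendsto_const x) auto
      show "\<exists>M. \<forall>n\<ge>M. (\<Sum>i<L. norm (s m i - s n i) powr p) \<le> e powr p"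
      proof (intro exI[of _ N] allI impI)
        fix n assume n: "n \<ge> N"
        have "(\<Sum>i<L. norm (s m i - s n i) powr p) \<le> lp_norm p (\<lambda>i. s m i - s n i) powr p"
          by (rule lp_partial_sum_le[OF lp_dif(1)[OF s s]]) simp
        also have "\<dots> \<le> e powr p" using N n p by (intro powr_mono2) (auto simp: lp_norm_nonneg less_imp_le)
        finally show "(\<Sum>i<L. norm (s m i - s n i) powr p) \<le> e powr p" .
      qed
    qed
    from lp_bound[OF this] \<open>e > 0\<close> show ?thesis by simp
  qed
  obtain N1 where N1: "\<forall>m\<ge>N1. \<forall>n\<ge>N1. lp_norm p (\<lambda>i. s m i - s n i) < 1" using c[of 1] by auto
  have xlp: "x \<in> lp p" using lp_dif(1)[OF s[of N1], of "\<lambda>i. s N1 i - x i"] close[OF N1, of N1] by simp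
  have "(\<lambda>n. lp_norm p (\<lambda>i. s n i - x i)) \<longlonglongrightarrow> 0"
  proof (rule LIMSEQ_I)
    fix e :: real assume "e > 0"
    then obtain N where N: "\<forall>m\<ge>N. \<forall>n\<ge>N. lp_norm p (\<lambda>i. s m i - s n i) < e / 2" using c[of "e / 2"] by auto
    show "\<exists>no. \<forall>n\<ge>no. norm (lp_norm p (\<lambda>i. s n i - x i) - 0) < e"
      using close[OF N] \<open>e > 0\<close> by (intro exI[of _ N]) (fastforce simp: lp_norm_nonneg)
  qed
  then show "\<exists>x\<in>carr (lp_module p). (\<lambda>n. qnorm (lp_module p) (dif (lp_module p) (s n) x)) \<longlonglongrightarrow> 0"
    using xlp unfolding dif_lp_module by (intro bexI[of _ x]) (simp_all add: lp_module_def)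
qed

lemma fin_supp_lp:
  assumes "x \<in> fin_supp" shows "x \<in> lp p"
proof -
  have "summable (\<lambda>n. norm (x n) powr p)"
    by (rule summable_finite[of "{n. x n \<noteq> 0}"]) (use assms p in \<open>auto simp: fin_supp_def\<close>)
  then show ?thesis by (simp add: lp_def)
qed

lemma lp_norm_finite:
  assumes "finite F" "\<And>n. n \<notin> F \<Longrightarrow> x n = 0"
  shows "lp_norm p x = (\<Sum>n\<in>F. norm (x n) powr p) powr (1 / p)"
  unfolding lp_norm_def using assms p by (subst suminf_finite[of F]) auto

lemma lp_truncation:
  fixes x :: "nat \<Rightarrow> 'k::real_normed_field"
  assumes "x \<in> lp p" "e > 0"
  obtains y :: "nat \<Rightarrow> 'k" where "y \<in> fin_supp" "lp_norm p (\<lambda>n. x n - y n) < e" "lp_norm p y \<le> lp_norm p x"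
proof -
  have s: "summable (\<lambda>n. norm (x n) powr p)" using assms by (simp add: lp_def)
  have "(e / 2) powr p > 0" using assms by simp
  from suminf_exist_split[OF this s] obtain N where
    N: "\<And>n. n \<ge> N \<Longrightarrow> norm (\<Sum>i. norm (x (i + n)) powr p) < (e / 2) powr p" by blast
  define y where "y n = (if n < N then x n else 0)" for n
  have "{n. y n \<noteq> 0} \<subseteq> {..<N}" by (auto simp: y_def)
  then have 1: "y \<in> fin_supp" by (simp add: fin_supp_def finite_subset[OF _ finite_lessThan])
  have 2: "lp_norm p y \<le> lp_norm p x"
    using lp_scaled_bound(2)[OF assms(1), of y 1] by (auto simp: y_def)
  have sh: "summable (\<lambda>i. norm (x (i + N)) powr p)" using s by (rule summable_ignore_initial_segment)
  have "(\<Sum>n<L. norm (x n - y n) powr p) \<le> (e / 2) powr p" for L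
  proof -
    have "(\<Sum>n<L. norm (x n - y n) powr p) \<le> (\<Sum>n<N + L. norm (x n - y n) powr p)"
      by (intro sum_mono2) auto
    also have "\<dots> = (\<Sum>n<N. norm (x n - y n) powr p) + (\<Sum>i<L. norm (x (i + N) - y (i + N)) powr p)"
    proof (induction L)
      case (Suc L)
      then show ?case by (simp add: add.commute)
    qed simp
    also have "\<dots> = (\<Sum>i<L. norm (x (i + N)) powr p)" using p by (simp add: y_def)
    also have "\<dots> \<le> (\<Sum>i. norm (x (i + N)) powr p)" using sh by (intro sum_le_suminf) auto
    also have "\<dots> \<le> (e / 2) powr p" using N[of N] by simp
    finally show ?thesis .
  qed
  from lp_bound(2)[OF this] assms(2) have "lp_norm p (\<lambda>n. x n - y n) < e" by simp
  with 1 2 show thesis using that by blast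
qed

end

lemma linf_norm_bound:
  assumes "a \<in> linf" shows "norm (a n) \<le> linf_norm a"
proof -
  have "bdd_above (range (\<lambda>n. norm (a n)))"
    using assms by (auto simp: linf_def bounded_iff bdd_above_def)
  then show ?thesis unfolding linf_norm_def by (rule cSUP_upper[OF UNIV_I])
qed

lemma linf_norm_nonneg: "a \<in> linf \<Longrightarrow> 0 \<le> linf_norm a"
  using linf_norm_bound[of a 0] norm_ge_zero[of "a 0"] by linarith

lemma linf_norm_least: "(\<And>n. norm (a n) \<le> M) \<Longrightarrow> linf_norm a \<le> M"
  unfolding linf_norm_def by (intro cSUP_least) auto

lemma linfI: "(\<And>n. norm (a n) \<le> M) \<Longrightarrow> a \<in> linf"
  by (auto simp: linf_def bounded_iff)

lemma linf_add: "a \<in> linf \<Longrightarrow> b \<in> linf \<Longrightarrow> (\<lambda>n. a n + b n) \<in> linf"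
  by (rule linfI[of _ "linf_norm a + linf_norm b"])
    (meson add_mono linf_norm_bound norm_triangle_ineq order_trans)

lemma linf_const: "(\<lambda>n. c) \<in> linf"
  by (rule linfI[of _ "norm c"]) simp

lemma linf_mult: "a \<in> linf \<Longrightarrow> b \<in> linf \<Longrightarrow> (\<lambda>n. a n * b n) \<in> linf"
  by (rule linfI[of _ "linf_norm a * linf_norm b"])
    (simp add: norm_mult mult_mono linf_norm_bound linf_norm_nonneg)

lemma linf_dif: "a \<in> linf \<Longrightarrow> b \<in> linf \<Longrightarrow> (\<lambda>n. a n - b n) \<in> linf"
  using linf_add[OF _ linf_mult[OF linf_const[of "-1"]], of a b] by simp

lemma lp_act:
  fixes x :: "nat \<Rightarrow> 'k::real_normed_field"
  assumes "p > 0" "a \<in> linf" "x \<in> lp p"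
  shows "(\<lambda>n. a n * x n) \<in> lp p" "lp_norm p (\<lambda>n. a n * x n) \<le> linf_norm a * lp_norm p x"
proof -
  have b: "norm (a n * x n) \<le> linf_norm a * norm (x n)" for n
    by (simp add: norm_mult mult_right_mono linf_norm_bound assms(2))
  show "(\<lambda>n. a n * x n) \<in> lp p" "lp_norm p (\<lambda>n. a n * x n) \<le> linf_norm a * lp_norm p x"
    using lp_scaled_bound[OF assms(1,3) b linf_norm_nonneg[OF assms(2)]] by auto
qed

section \<open>Centralizers\<close>

lemma fin_supp_mult: "x \<in> fin_supp \<Longrightarrow> (\<lambda>n. a n * x n) \<in> fin_supp"
  by (auto simp: fin_supp_def elim!: rev_finite_subset)

lemma piece_fin_supp: "x \<in> fin_supp \<Longrightarrow> piece B x \<in> fin_supp"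
  by (auto simp: fin_supp_def piece_def elim!: rev_finite_subset)

lemma fin_supp_add:
  assumes "x \<in> fin_supp" "y \<in> fin_supp" shows "(\<lambda>n. x n + y n) \<in> fin_supp"
proof -
  have "{n. x n + y n \<noteq> 0} \<subseteq> {n. x n \<noteq> 0} \<union> {n. y n \<noteq> 0}" by auto
  then show ?thesis using assms by (auto simp: fin_supp_def elim: finite_subset)
qed

lemma fin_supp_diff: "x \<in> fin_supp \<Longrightarrow> y \<in> fin_supp \<Longrightarrow> (\<lambda>n. x n - y n) \<in> fin_supp"
  using fin_supp_add[of x "\<lambda>n. -1 * y n"] fin_supp_mult[of y "\<lambda>_. -1"] by simp

lemma fin_supp_zero: "(\<lambda>_. 0) \<in> fin_supp"
  by (simp add: fin_supp_def)

definition cell :: "nat set set \<Rightarrow> nat \<Rightarrow> nat set" where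
  "cell \<A> n = (THE B. B \<in> \<A> \<and> n \<in> B)"

context
  fixes \<A> :: "nat set set"
  assumes part: "partition_on UNIV \<A>"
begin

lemma cell_ex1: "\<exists>!B. B \<in> \<A> \<and> n \<in> B"
  using part unfolding partition_on_def disjoint_def by (metis UNIV_I UnionE disjoint_iff)

lemma cell_mem: "cell \<A> n \<in> \<A>" "n \<in> cell \<A> n"
  using theI'[OF cell_ex1[of n]] by (simp_all add: cell_def)

lemma cell_eqI: "B \<in> \<A> \<Longrightarrow> n \<in> B \<Longrightarrow> cell \<A> n = B"
  using cell_ex1[of n] cell_mem[of n] by blast

lemma mem_cell_iff: "m \<in> cell \<A> n \<longleftrightarrow> cell \<A> m = cell \<A> n"
  using cell_eqI cell_mem by metis

text \<open>Only the piece on the cell of \<open>n\<close> contributes at \<open>n\<close>. If this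
  piece vanishes it is missing from the index set, but then \<open>x n = 0\<close> too, and whatever
  default value the logarithm takes is multiplied by 0.\<close>

lemma Omega_tilde_nth:
  assumes "x \<in> fin_supp"
  shows "Omega_tilde \<A> p x n = of_real (p / 2 * ln (lp_norm p x / lp_norm p (piece (cell \<A> n) x))) * x n"
proof -
  let ?I = "{B. B \<in> \<A> \<and> piece B x \<noteq> (\<lambda>_. 0)}"
  let ?f = "\<lambda>B. of_real (ln (lp_norm p x / lp_norm p (piece B x))) * piece B x n"
  have "?I \<subseteq> cell \<A> ` {m. x m \<noteq> 0}"
  proof
    fix B assume "B \<in> ?I"
    then obtain m where "B \<in> \<A>" "m \<in> B" "x m \<noteq> 0" by (auto simp: piece_def fun_eq_iff split: if_splits)
    then show "B \<in> cell \<A> ` {m. x m \<noteq> 0}" using cell_eqI[of B m] by blast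
  qed
  then have fin: "finite ?I" using assms by (simp add: fin_supp_def finite_subset)
  have "(\<Sum>B\<in>?I. ?f B) = (\<Sum>B\<in>?I. if B = cell \<A> n then ?f B else 0)"
    using cell_eqI by (intro sum.cong) (auto simp: piece_def)
  also have "\<dots> = (if cell \<A> n \<in> ?I then ?f (cell \<A> n) else 0)" using sum.delta[OF fin, of "cell \<A> n" ?f] by (simp cong: if_cong)
  also have "\<dots> = ?f (cell \<A> n)"
  proof (cases "cell \<A> n \<in> ?I")
    case False
    then have "piece (cell \<A> n) x = (\<lambda>_. 0)" using cell_mem by auto
    then show ?thesis using False by (simp add: fun_eq_iff)
  qed simp
  finally show ?thesis
    using cell_mem(2)[of n] by (simp add: Omega_tilde_def piece_def mult.assoc)
qed

lemma Omega_tilde_fin_supp: "x \<in> fin_supp \<Longrightarrow> Omega_tilde \<A> p x \<in> fin_supp"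
  using fin_supp_mult[of x "\<lambda>n. of_real (p / 2 * ln (lp_norm p x / lp_norm p (piece (cell \<A> n) x)))"]
  by (simp only: Omega_tilde_nth[symmetric])

end

section \<open>Logarithmic estimates for commutators\<close>

lemma lp_norm_pos:
  assumes "p > 0" "x \<in> lp p" "x n \<noteq> 0" shows "lp_norm p x > 0"
  using norm_le_lp_norm[OF assms(1,2), of n] assms(3) by (metis less_le_trans zero_less_norm_iff)

text \<open>The source of every centralizer estimate below: the factor \<open>t\<close> compensates
  the logarithmic singularity at 0.\<close>

lemma abs_ln_mult_le_one:
  fixes t :: real assumes "0 < t" "t \<le> 1" shows "\<bar>ln t\<bar> * t \<le> 1"
proof -
  have "- ln t \<le> 1 / t - 1" using ln_le_minus_one[of "1 / t"] assms by (simp add: ln_div)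
  then have "- ln t * t \<le> (1 / t - 1) * t" using assms by (intro mult_right_mono) auto
  also have "\<dots> = 1 - t" using assms by (simp add: field_simps)
  finally show ?thesis using assms ln_le_zero_iff[of t] by simp
qed

lemma lp_norm_norm: "lp_norm p (\<lambda>n. norm (x n)) = lp_norm p x"
  by (simp add: lp_norm_def)

text \<open>Dividing by \<open>linf_norm a\<close> puts the ratio of the two norms into the interval
  from 0 to 1, where the elementary estimate applies. It is used for whole vectors and for single
  pieces alike.\<close>

lemma lp_norm_ratio_bound:
  fixes x a :: "nat \<Rightarrow> 'k::real_normed_field"
  assumes p: "p > 0" and a: "a \<in> linf" "linf_norm a > 0" and x: "x \<in> lp p" and n: "a n * x n \<noteq> 0"
  defines "t \<equiv> lp_norm p (\<lambda>n. a n * x n) / (linf_norm a * lp_norm p x)"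
  shows "0 < t" "\<bar>ln t\<bar> * lp_norm p (\<lambda>n. a n * x n) \<le> linf_norm a * lp_norm p x"
proof -
  let ?y = "\<lambda>n. a n * x n" and ?A = "linf_norm a"
  have pos: "lp_norm p ?y > 0" "lp_norm p x > 0"
    using lp_norm_pos[OF p lp_act(1)[OF p a(1) x], of n] lp_norm_pos[OF p x, of n] n by auto
  have t: "0 < t" "t \<le> 1" using pos a lp_act(2)[OF p a(1) x] by (auto simp: t_def divide_simps)
  then show "0 < t" by simp
  have "\<bar>ln t\<bar> * t * (?A * lp_norm p x) \<le> 1 * (?A * lp_norm p x)"
    using abs_ln_mult_le_one[OF t] pos a by (intro mult_right_mono) auto
  moreover have "t * (?A * lp_norm p x) = lp_norm p ?y" using pos a by (simp add: t_def)
  ultimately show "\<bar>ln t\<bar> * lp_norm p ?y \<le> ?A * lp_norm p x" by (simp add: mult.assoc)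
qed

text \<open>At \<open>n\<close> the commutator is
  \<open>p / 2 * (ln t - ln (tB B)) * a n * x n\<close>, where \<open>B\<close> is the cell of
  \<open>n\<close> and \<open>t\<close>, \<open>tB B\<close> are the norm ratios of the whole
  vectors and of their pieces; the normalisation by \<open>linf_norm a\<close> cancels in the
  difference. The first term is bounded globally, the second one on each cell, and the cells are
  then added in \<open>p\<close>-th powers.\<close>

lemma Omega_tilde_commutator:
  fixes x a :: "nat \<Rightarrow> 'k::real_normed_field"
  assumes part: "partition_on UNIV \<A>" and p: "p > 0" and a: "a \<in> linf" and x: "x \<in> fin_supp"
  shows "lp_norm p (\<lambda>n. Omega_tilde \<A> p (\<lambda>m. a m * x m) n - a n * Omega_tilde \<A> p x n)
    \<le> p / 2 * (2 * 2 powr (1 / p) * 2) * linf_norm a * lp_norm p x"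
proof (cases "linf_norm a = 0")
  case True
  then have "a n = 0" for n using linf_norm_bound[OF a, of n] by simp
  then show ?thesis using True by (simp add: Omega_tilde_nth[OF part fin_supp_zero] lp_zero[OF p])
next
  case False
  define A where "A = linf_norm a"
  have A: "A > 0" using False linf_norm_nonneg[OF a] by (simp add: A_def)
  define y where "y = (\<lambda>n. a n * x n)"
  have y: "y \<in> fin_supp" unfolding y_def by (rule fin_supp_mult[OF x])
  define F where "F = {n. x n \<noteq> 0}"
  have F: "finite F" "\<And>n. n \<notin> F \<Longrightarrow> x n = 0" "\<And>n. n \<notin> F \<Longrightarrow> y n = 0"
    using x by (auto simp: F_def fin_supp_def y_def)
  define t where "t = lp_norm p y / (A * lp_norm p x)"
  define tB where "tB B = lp_norm p (piece B y) / (A * lp_norm p (piece B x))" for B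
  define u where "u n = \<bar>ln t\<bar> * norm (y n)" for n
  define v where "v n = \<bar>ln (tB (cell \<A> n))\<bar> * norm (y n)" for n
  have pieceB: "piece B y = (\<lambda>n. a n * piece B x n)" for B by (auto simp: piece_def y_def)
  note lx = fin_supp_lp[OF p x] and ly = fin_supp_lp[OF p y]
  have ufin: "u \<in> fin_supp" and vfin: "v \<in> fin_supp"
    using y by (auto simp: u_def v_def fin_supp_def elim!: rev_finite_subset)
  have D: "norm (Omega_tilde \<A> p y n - a n * Omega_tilde \<A> p x n) \<le> p / 2 * norm (u n + v n)" for n
  proof (cases "y n = 0")
    case True
    then have "a n = 0 \<or> x n = 0" by (simp add: y_def)
    with True show ?thesis
      by (auto simp: Omega_tilde_nth[OF part x] Omega_tilde_nth[OF part y] u_def v_def)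
  next
    case False
    let ?B = "cell \<A> n"
    have px: "piece ?B x n = x n" "piece ?B y n = y n" by (simp_all add: piece_def cell_mem[OF part])
    have pos: "lp_norm p x > 0" "lp_norm p y > 0" "lp_norm p (piece ?B x) > 0" "lp_norm p (piece ?B y) > 0"
      using False px lp_norm_pos[OF p lx, of n] lp_norm_pos[OF p ly, of n]
        lp_norm_pos[OF p fin_supp_lp[OF p piece_fin_supp[OF x]], of ?B n]
        lp_norm_pos[OF p fin_supp_lp[OF p piece_fin_supp[OF y]], of ?B n] by (auto simp: y_def)
    have "ln (lp_norm p y / lp_norm p (piece ?B y)) - ln (lp_norm p x / lp_norm p (piece ?B x)) = ln t - ln (tB ?B)"
      using pos A by (simp add: t_def tB_def ln_div ln_mult)
    moreover have "Omega_tilde \<A> p y n - a n * Omega_tilde \<A> p x n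
        = of_real (p / 2 * (ln (lp_norm p y / lp_norm p (piece ?B y)) - ln (lp_norm p x / lp_norm p (piece ?B x)))) * (a n * x n)"
      unfolding Omega_tilde_nth[OF part x] Omega_tilde_nth[OF part y] right_diff_distrib of_real_diff
      by (simp add: y_def algebra_simps)
    ultimately have "Omega_tilde \<A> p y n - a n * Omega_tilde \<A> p x n = of_real (p / 2 * (ln t - ln (tB ?B))) * y n"
      by (simp add: y_def)
    then have "norm (Omega_tilde \<A> p y n - a n * Omega_tilde \<A> p x n) = p / 2 * (\<bar>ln t - ln (tB ?B)\<bar> * norm (y n))"
      using p by (simp only: norm_mult norm_of_real abs_mult)
    also have "\<dots> \<le> p / 2 * ((\<bar>ln t\<bar> + \<bar>ln (tB ?B)\<bar>) * norm (y n))"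
      using p by (intro mult_left_mono mult_right_mono) auto
    also have "(\<bar>ln t\<bar> + \<bar>ln (tB ?B)\<bar>) * norm (y n) = norm (u n + v n)" by (simp add: u_def v_def distrib_right)
    finally show ?thesis .
  qed
  have unorm: "lp_norm p u \<le> A * lp_norm p x"
  proof (cases "\<exists>n. y n \<noteq> 0")
    case True
    then obtain n where "a n * x n \<noteq> 0" by (auto simp: y_def)
    from lp_norm_ratio_bound(2)[OF p a A[unfolded A_def] lx this]
    have "\<bar>ln t\<bar> * lp_norm p y \<le> A * lp_norm p x" by (simp add: t_def y_def A_def)
    moreover have "lp_norm p u \<le> \<bar>ln t\<bar> * lp_norm p y"
      by (rule lp_scaled_bound(2)[OF p ly]) (auto simp: u_def abs_mult)
    ultimately show ?thesis by simp
  next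
    case False
    then have "u = (\<lambda>_. 0)" by (auto simp: u_def)
    then show ?thesis using A lp_norm_nonneg[OF p, of x] by (simp add: lp_zero[OF p])
  qed
  have blk: "(\<Sum>n\<in>{n\<in>F. cell \<A> n = B}. norm (v n) powr p) \<le> (\<Sum>n\<in>{n\<in>F. cell \<A> n = B}. A powr p * norm (x n) powr p)"
    if B: "B \<in> \<A>" for B
  proof -
    let ?G = "{n\<in>F. cell \<A> n = B}"
    have G: "finite ?G" "\<And>n. n \<notin> ?G \<Longrightarrow> piece B x n = 0" "\<And>n. n \<notin> ?G \<Longrightarrow> piece B y n = 0"
      using F cell_eqI[OF part B] by (auto simp: piece_def)
    have inB: "n \<in> B" if "n \<in> ?G" for n using that cell_mem(2)[OF part, of n] by auto
    have np: "lp_norm p (piece B z) powr p = (\<Sum>n\<in>?G. norm (z n) powr p)"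
      if "\<And>n. n \<notin> ?G \<Longrightarrow> piece B z n = 0" for z :: "nat \<Rightarrow> 'k"
    proof -
      have "(\<Sum>n\<in>?G. norm (piece B z n) powr p) = (\<Sum>n\<in>?G. norm (z n) powr p)"
        using inB by (intro sum.cong) (auto simp: piece_def)
      then show ?thesis using lp_norm_finite[OF p G(1) that] p by (simp add: powr_powr sum_nonneg)
    qed
    have "(\<Sum>n\<in>?G. norm (v n) powr p) = \<bar>ln (tB B)\<bar> powr p * (\<Sum>n\<in>?G. norm (y n) powr p)"
      unfolding sum_distrib_left by (intro sum.cong) (auto simp: v_def abs_mult powr_mult)
    also have "\<dots> = (\<bar>ln (tB B)\<bar> * lp_norm p (piece B y)) powr p"
      using np[OF G(3)] by (simp add: powr_mult lp_norm_nonneg[OF p])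
    also have "\<dots> \<le> (A * lp_norm p (piece B x)) powr p"
    proof (cases "\<exists>n. piece B y n \<noteq> 0")
      case True
      then obtain n where "a n * piece B x n \<noteq> 0" by (auto simp: pieceB)
      from lp_norm_ratio_bound(2)[OF p a A[unfolded A_def] fin_supp_lp[OF p piece_fin_supp[OF x]] this]
      have "\<bar>ln (tB B)\<bar> * lp_norm p (piece B y) \<le> A * lp_norm p (piece B x)"
        by (simp add: tB_def pieceB A_def)
      then show ?thesis using p by (intro powr_mono2) (auto simp: lp_norm_nonneg[OF p])
    next
      case False
      then have "piece B y = (\<lambda>_. 0)" by auto
      then show ?thesis by (simp add: lp_zero[OF p])
    qed
    also have "\<dots> = (\<Sum>n\<in>?G. A powr p * norm (x n) powr p)"
      using np[OF G(2)] A by (simp add: powr_mult lp_norm_nonneg[OF p] sum_distrib_left)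
    finally show ?thesis .
  qed
  have "(\<Sum>n\<in>F. norm (v n) powr p) = (\<Sum>B\<in>cell \<A> ` F. \<Sum>n\<in>{n\<in>F. cell \<A> n = B}. norm (v n) powr p)"
    by (rule sum.image_gen[OF F(1)])
  also have "\<dots> \<le> (\<Sum>B\<in>cell \<A> ` F. \<Sum>n\<in>{n\<in>F. cell \<A> n = B}. A powr p * norm (x n) powr p)"
    by (rule sum_mono, rule blk) (use cell_mem(1)[OF part] in auto)
  also have "\<dots> = (\<Sum>n\<in>F. A powr p * norm (x n) powr p)"
    by (rule sum.image_gen[OF F(1), symmetric])
  finally have "(\<Sum>n\<in>F. norm (v n) powr p) \<le> A powr p * (\<Sum>n\<in>F. norm (x n) powr p)"
    by (simp add: sum_distrib_left)
  then have "(\<Sum>n\<in>F. norm (v n) powr p) powr (1 / p) \<le> (A powr p * (\<Sum>n\<in>F. norm (x n) powr p)) powr (1 / p)"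
    using p by (intro powr_mono2) (auto simp: sum_nonneg)
  moreover have "v n = 0" if "n \<notin> F" for n using F(3)[OF that] by (simp add: v_def)
  ultimately have vnorm: "lp_norm p v \<le> A * lp_norm p x"
    using lp_norm_finite[OF p F(1), of v] lp_norm_finite[OF p F(1,2)] p A
    by (simp add: powr_mult powr_powr sum_nonneg)
  note luv = lp_add[OF p fin_supp_lp[OF p ufin] fin_supp_lp[OF p vfin]]
  have "lp_norm p (\<lambda>n. Omega_tilde \<A> p y n - a n * Omega_tilde \<A> p x n) \<le> p / 2 * lp_norm p (\<lambda>n. u n + v n)"
    by (rule lp_scaled_bound(2)[OF p luv(1) D]) (use p in simp)
  also have "\<dots> \<le> p / 2 * (2 * 2 powr (1 / p) * (A * lp_norm p x + A * lp_norm p x))"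
    using luv(2) unorm vnorm p
    by (intro mult_left_mono order_trans[OF luv(2)] add_mono) auto
  finally show ?thesis by (simp add: y_def A_def algebra_simps)
qed

theorem centralizer_Omega_tilde:
  assumes part: "partition_on UNIV \<A>" and p: "p > 0"
  shows "centralizer p (Omega_tilde \<A> p :: (nat \<Rightarrow> 'k::real_normed_field) \<Rightarrow> nat \<Rightarrow> 'k)"
  unfolding centralizer_def
proof (intro conjI allI ballI)
  fix x :: "nat \<Rightarrow> 'k" assume x: "x \<in> fin_supp"
  show "Omega_tilde \<A> p x \<in> lp p"
    by (intro fin_supp_lp[OF p] Omega_tilde_fin_supp[OF part] x)
  fix c :: 'k
  have "piece B (\<lambda>n. c * x n) = (\<lambda>n. c * piece B x n)" for B by (auto simp: piece_def)
  then show "Omega_tilde \<A> p (\<lambda>n. c * x n) = (\<lambda>n. c * Omega_tilde \<A> p x n)"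
    using x fin_supp_mult[OF x, of "\<lambda>_. c"] by (cases "c = 0")
      (simp_all add: fun_eq_iff[of "Omega_tilde _ _ _"] Omega_tilde_nth[OF part] fin_supp_zero
        fin_supp_lp[OF p] lp_norm_cmult[OF p] piece_fin_supp)
next
  show "\<exists>C. \<forall>a\<in>linf. \<forall>x\<in>fin_supp. lp_norm p (\<lambda>n. Omega_tilde \<A> p (\<lambda>m. a m * x m) n - a n * Omega_tilde \<A> p x n)
    \<le> C * linf_norm a * lp_norm p (x :: nat \<Rightarrow> 'k)"
    using Omega_tilde_commutator[OF part p] by blast
qed

text \<open>For the partition into points \<open>Omega_tilde\<close> becomes \<open>Omega\<close>,
  because a one-point piece has norm \<open>norm (x n)\<close>. The centralizer property of
  \<open>Omega\<close> is obtained in this way.\<close>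

lemma partition_singletons: "partition_on UNIV (range (\<lambda>n::nat. {n}))"
  by (auto simp: partition_on_def disjoint_def)

lemma lp_norm_piece_singleton:
  assumes "p > 0" shows "lp_norm p (piece {n} x) = norm (x n)"
  using lp_norm_finite[OF assms, of "{n}" "piece {n} x"] assms by (simp add: piece_def powr_powr)

lemma Omega_eq_Omega_tilde:
  assumes "p > 0" "x \<in> fin_supp" shows "Omega p x = Omega_tilde (range (\<lambda>n. {n})) p x"
proof
  fix n
  have "cell (range (\<lambda>n. {n})) n = {n}" by (rule cell_eqI[OF partition_singletons]) auto
  then show "Omega p x n = Omega_tilde (range (\<lambda>n. {n})) p x n"
    by (simp add: Omega_def Omega_tilde_nth[OF partition_singletons assms(2)] lp_norm_piece_singleton[OF assms(1)])
qed

theorem centralizer_Omega: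
  assumes p: "p > 0"
  shows "centralizer p (Omega p :: (nat \<Rightarrow> 'k::real_normed_field) \<Rightarrow> nat \<Rightarrow> 'k)"
  using centralizer_Omega_tilde[OF partition_singletons p, where 'k = 'k] Omega_eq_Omega_tilde[OF p, where 'a = 'k]
  by (simp add: centralizer_def fin_supp_mult)

lemma centralizer_bound:
  assumes "centralizer p \<Phi>" "p > 0"
  obtains C where "C \<ge> 1" "\<And>a x. a \<in> linf \<Longrightarrow> x \<in> fin_supp \<Longrightarrow>
    lp_norm p (\<lambda>n. \<Phi> (\<lambda>m. a m * x m) n - a n * \<Phi> x n) \<le> C * linf_norm a * lp_norm p x"
proof -
  obtain C where C: "\<And>a x. a \<in> linf \<Longrightarrow> x \<in> fin_supp \<Longrightarrow>
    lp_norm p (\<lambda>n. \<Phi> (\<lambda>m. a m * x m) n - a n * \<Phi> x n) \<le> C * linf_norm a * lp_norm p x"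
    using assms(1) unfolding centralizer_def by blast
  have "C * linf_norm a * lp_norm p x \<le> max C 1 * linf_norm a * lp_norm p x" if "a \<in> linf" for a x
    using that by (intro mult_right_mono) (auto simp: linf_norm_nonneg lp_norm_nonneg[OF assms(2)])
  then show thesis using that[of "max C 1"] C by (meson max.cobounded2 order_trans)
qed

text \<open>Both arguments are bounded multiples of \<open>\<bar>x\<bar> + \<bar>y\<bar>\<close>.\<close>

lemma centralizer_quasilinear:
  fixes \<Phi> :: "(nat \<Rightarrow> 'k::real_normed_field) \<Rightarrow> nat \<Rightarrow> 'k"
  assumes cent: "centralizer p \<Phi>" and p: "p > 0"
  obtains Q where "Q \<ge> 1" "\<And>x y. x \<in> fin_supp \<Longrightarrow> y \<in> fin_supp \<Longrightarrow>
    lp_norm p (\<lambda>n. \<Phi> (\<lambda>m. x m + y m) n - \<Phi> x n - \<Phi> y n) \<le> Q * (lp_norm p x + lp_norm p y)"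
proof -
  obtain C where C: "C \<ge> 1" "\<And>a x. a \<in> linf \<Longrightarrow> x \<in> fin_supp \<Longrightarrow>
    lp_norm p (\<lambda>n. \<Phi> (\<lambda>m. a m * x m) n - a n * \<Phi> x n) \<le> C * linf_norm a * lp_norm p x"
    using centralizer_bound[OF cent p] by metis
  define K where "K = 2 * 2 powr (1 / p)"
  have K: "K \<ge> 1" using ge_one_powr_ge_zero[of 2 "1 / p"] p by (simp add: K_def)
  define Q where "Q = K * (K * (2 * C + C) + C) * K"
  have "lp_norm p (\<lambda>n. \<Phi> (\<lambda>m. x m + y m) n - \<Phi> x n - \<Phi> y n) \<le> Q * (lp_norm p x + lp_norm p y)"
    if x: "x \<in> fin_supp" and y: "y \<in> fin_supp" for x y
  proof -
    define z :: "nat \<Rightarrow> 'k" where "z n = of_real (norm (x n) + norm (y n))" for n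
    define a where "a n = x n / z n" for n
    define b where "b n = y n / z n" for n
    have az: "a n * z n = x n" "b n * z n = y n" for n
    proof -
      have "z n = 0 \<Longrightarrow> x n = 0 \<and> y n = 0"
        unfolding z_def of_real_eq_0_iff by (simp add: add_nonneg_eq_0_iff)
      then show "a n * z n = x n" "b n * z n = y n" by (auto simp: a_def b_def)
    qed
    have nz: "norm (z n) = norm (x n) + norm (y n)" for n
      unfolding z_def norm_of_real by simp
    have ab: "norm (a n) \<le> 1" "norm (b n) \<le> 1" for n
      by (simp_all add: a_def b_def norm_divide nz divide_le_eq_1) (auto simp: add_pos_nonneg add_nonneg_pos order_less_le)
    have abl: "a \<in> linf" "b \<in> linf" using ab by (auto intro: linfI)
    have l1: "linf_norm a \<le> 1" "linf_norm b \<le> 1" using ab by (auto intro: linf_norm_least)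
    have l2: "linf_norm (\<lambda>n. a n + b n) \<le> 2"
      using ab by (intro linf_norm_least) (metis add_mono norm_triangle_ineq one_add_one order_trans)
    have z: "z \<in> fin_supp"
    proof -
      have "{n. z n \<noteq> 0} \<subseteq> {n. x n \<noteq> 0} \<union> {n. y n \<noteq> 0}" by (auto simp: z_def)
      then show ?thesis using x y by (auto simp: fin_supp_def elim: finite_subset)
    qed
    have lz: "lp_norm p z \<le> K * (lp_norm p x + lp_norm p y)"
    proof -
      have "lp_norm p z = lp_norm p (\<lambda>n. norm (x n) + norm (y n))"
        unfolding lp_norm_def nz by simp
      also have "\<dots> \<le> K * (lp_norm p x + lp_norm p y)"
        using lp_add(2)[OF p, of "\<lambda>n. norm (x n)" "\<lambda>n. norm (y n)"] fin_supp_lp[OF p x] fin_supp_lp[OF p y]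
        by (simp add: lp_norm_norm K_def lp_def)
      finally show ?thesis .
    qed
    \<comment> \<open>Commutators at the common argument \<open>z\<close>: the terms
      \<open>c n * \<Phi> z n\<close> are additive in \<open>c\<close> and cancel when the values at
      \<open>a\<close> and \<open>b\<close> are subtracted from the value at their sum, leaving the
      failure of additivity of \<open>\<Phi>\<close>.\<close>
    define E where "E c = (\<lambda>n. \<Phi> (\<lambda>m. c m * z m) n - c n * \<Phi> z n)" for c
    have lin: "c \<in> linf \<Longrightarrow> E c \<in> lp p" for c
      unfolding E_def using cent fin_supp_mult[OF z, of c] z
      by (intro lp_dif[OF p] lp_act[OF p]) (auto simp: centralizer_def)
    have En: "lp_norm p (E c) \<le> C * M * lp_norm p z" if "c \<in> linf" "linf_norm c \<le> M" for c M
      unfolding E_def using that(2) C(1)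
      by (intro order_trans[OF C(2)[OF that(1) z]] mult_left_mono mult_right_mono) (auto simp: lp_norm_nonneg[OF p])
    have abz: "(\<lambda>m. (a m + b m) * z m) = (\<lambda>m. x m + y m)" "(\<lambda>m. a m * z m) = x" "(\<lambda>m. b m * z m) = y"
      by (simp_all add: az distrib_right fun_eq_iff)
    have eq: "(\<lambda>n. \<Phi> (\<lambda>m. x m + y m) n - \<Phi> x n - \<Phi> y n) = (\<lambda>n. E (\<lambda>n. a n + b n) n - E a n - E b n)"
      unfolding E_def abz by (simp add: algebra_simps)
    have labl: "(\<lambda>n. a n + b n) \<in> linf" using abl by (rule linf_add)
    have "lp_norm p (\<lambda>n. E (\<lambda>n. a n + b n) n - E a n - E b n)
        \<le> K * (lp_norm p (\<lambda>n. E (\<lambda>n. a n + b n) n - E a n) + lp_norm p (E b))"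
      unfolding K_def by (intro lp_dif(2)[OF p] lp_dif(1)[OF p] lin labl abl)
    also have "\<dots> \<le> K * (K * (C * 2 * lp_norm p z + C * 1 * lp_norm p z) + C * 1 * lp_norm p z)"
    proof (intro mult_left_mono add_mono)
      have "lp_norm p (\<lambda>n. E (\<lambda>n. a n + b n) n - E a n)
          \<le> K * (lp_norm p (E (\<lambda>n. a n + b n)) + lp_norm p (E a))"
        unfolding K_def by (intro lp_dif(2)[OF p] lin labl abl)
      also have "\<dots> \<le> K * (C * 2 * lp_norm p z + C * 1 * lp_norm p z)"
        using K by (intro mult_left_mono add_mono En labl abl l1 l2) auto
      finally show "lp_norm p (\<lambda>n. E (\<lambda>n. a n + b n) n - E a n) \<le> K * (C * 2 * lp_norm p z + C * 1 * lp_norm p z)" .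
      show "lp_norm p (E b) \<le> C * 1 * lp_norm p z" by (intro En abl l1)
    qed (use K in auto)
    also have "\<dots> = K * (K * (2 * C + C) + C) * lp_norm p z" by (simp add: algebra_simps)
    also have "\<dots> \<le> K * (K * (2 * C + C) + C) * (K * (lp_norm p x + lp_norm p y))"
      using K C(1) by (intro mult_left_mono lz) auto
    finally show ?thesis unfolding eq by (simp add: Q_def mult.assoc)
  qed
  moreover have "Q \<ge> 1"
  proof -
    have "1 \<le> K * (2 * C + C) + C" using K C(1) mult_nonneg_nonneg[of K "2 * C + C"] by linarith
    then have "1 \<le> K * (K * (2 * C + C) + C)" using K by (metis mult_mono' mult_1 zero_le_one)
    then show ?thesis unfolding Q_def using K by (metis mult_mono' mult_1 zero_le_one)
  qed
  ultimately show thesis using that by blast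
qed

lemma centralizer_zero:
  assumes "centralizer p \<Phi>" shows "\<Phi> (\<lambda>_. 0) = (\<lambda>_. 0)"
proof -
  have "\<Phi> (\<lambda>n. 0 * x n) = (\<lambda>n. 0 * \<Phi> x n)" if "x \<in> fin_supp" for x
    using assms that unfolding centralizer_def by blast
  from this[OF fin_supp_zero] show ?thesis by simp
qed

section \<open>Quasi Banach modules\<close>

text \<open>Joint continuity follows from the bilinear bound through
  \<open>b y - a x = b (y - x) + (b - a) x\<close>; taking \<open>d \<le> 1\<close> keeps the size
  of \<open>b\<close> below \<open>linf_norm a + 1\<close>.\<close>

lemma quasi_banach_moduleI:
  fixes M :: "('k::real_normed_field, 'a, 'm) qmodule_scheme"
  assumes M: "quasi_banach M"
    and carr: "\<And>a x. a \<in> linf \<Longrightarrow> x \<in> carr M \<Longrightarrow> act M a x \<in> carr M"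
    and add: "\<And>a x y. a \<in> linf \<Longrightarrow> x \<in> carr M \<Longrightarrow> y \<in> carr M \<Longrightarrow> act M a (add M x y) = add M (act M a x) (act M a y)"
    and plus: "\<And>a b x. a \<in> linf \<Longrightarrow> b \<in> linf \<Longrightarrow> x \<in> carr M \<Longrightarrow> act M (\<lambda>n. a n + b n) x = add M (act M a x) (act M b x)"
    and mult: "\<And>a b x. a \<in> linf \<Longrightarrow> b \<in> linf \<Longrightarrow> x \<in> carr M \<Longrightarrow> act M (\<lambda>n. a n * b n) x = act M a (act M b x)"
    and const: "\<And>c x. x \<in> carr M \<Longrightarrow> act M (\<lambda>n. c) x = scl M c x"
    and bound: "\<And>a x. a \<in> linf \<Longrightarrow> x \<in> carr M \<Longrightarrow> qnorm M (act M a x) \<le> C * linf_norm a * qnorm M x"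
  shows "quasi_banach_module M"
  unfolding quasi_banach_module_def
proof (intro conjI ballI allI impI)
  note qn = quasi_banach_quasinormed[OF M] and l = quasi_banach_linear[OF M]
  obtain K where K: "K \<ge> 1"
    "\<And>x y. x \<in> carr M \<Longrightarrow> y \<in> carr M \<Longrightarrow> qnorm M (add M x y) \<le> K * (qnorm M x + qnorm M y)"
    using quasi_triangle_obtain[OF qn] by metis
  fix a :: "nat \<Rightarrow> 'k" and x and e :: real
  assume a: "a \<in> linf" and x: "x \<in> carr M" and e: "e > 0"
  define D where "D = K * (\<bar>C\<bar> * (linf_norm a + 1) + \<bar>C\<bar> * qnorm M x)"
  have D: "D \<ge> 0" using K(1) linf_norm_nonneg[OF a] qnorm_nonneg[OF qn x] by (simp add: D_def)
  define d where "d = min 1 (e / (D + 1))"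
  have d: "d > 0" "d \<le> 1" "d * D < e"
  proof -
    show "d > 0" "d \<le> 1" using e D by (auto simp: d_def)
    have "d * D \<le> e / (D + 1) * D" using D by (intro mult_right_mono) (auto simp: d_def)
    also have "\<dots> < e" using e D by (simp add: field_simps)
    finally show "d * D < e" .
  qed
  show "\<exists>d>0. \<forall>b\<in>linf. \<forall>y\<in>carr M. linf_norm (\<lambda>n. b n - a n) < d \<longrightarrow> qnorm M (dif M y x) < d \<longrightarrow>
      qnorm M (dif M (act M b y) (act M a x)) < e"
  proof (intro exI[of _ d] conjI ballI impI d(1))
    fix b y assume b: "b \<in> linf" and y: "y \<in> carr M"
      and ba: "linf_norm (\<lambda>n. b n - a n) < d" and yx: "qnorm M (dif M y x) < d"
    have bal: "(\<lambda>n. b n - a n) \<in> linf" using b a by (rule linf_dif)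
    have "norm (b n) \<le> linf_norm a + 1" for n
    proof -
      have "norm (b n) \<le> norm (a n) + norm (b n - a n)" using norm_triangle_ineq[of "a n" "b n - a n"] by simp
      then show ?thesis using linf_norm_bound[OF a, of n] linf_norm_bound[OF bal, of n] ba d(2) by linarith
    qed
    then have bn: "linf_norm b \<le> linf_norm a + 1" by (rule linf_norm_least)
    have "act M b (dif M y x) = add M (act M b y) (act M b (scl M (-1) x))"
      by (simp add: dif_def add b y x scl_in[OF l])
    also have "act M b (scl M (-1) x) = scl M (-1) (act M b x)"
      using mult[OF b linf_const x, of "-1"] mult[OF linf_const b x, of "-1"] by (simp add: const x carr b)
    finally have 1: "act M b (dif M y x) = dif M (act M b y) (act M b x)" by (simp add: dif_def)
    have "act M b x = add M (act M (\<lambda>n. b n - a n) x) (act M a x)"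
      using plus[OF bal a x] by simp
    then have 2: "act M (\<lambda>n. b n - a n) x = dif M (act M b x) (act M a x)"
      by (simp add: add_dif_cancel[OF l] carr bal a x)
    have "dif M (act M b y) (act M a x) = add M (act M b (dif M y x)) (act M (\<lambda>n. b n - a n) x)"
      unfolding 1 2 by (rule dif_add_dif[OF l, symmetric]) (intro carr a b x y)+
    then have "qnorm M (dif M (act M b y) (act M a x))
        \<le> K * (qnorm M (act M b (dif M y x)) + qnorm M (act M (\<lambda>n. b n - a n) x))"
      using K(2)[OF carr[OF b dif_in[OF l y x]] carr[OF bal x]] by simp
    also have "\<dots> \<le> K * (\<bar>C\<bar> * (linf_norm a + 1) * d + \<bar>C\<bar> * d * qnorm M x)"
    proof (intro mult_left_mono add_mono)
      have "qnorm M (act M b (dif M y x)) \<le> C * linf_norm b * qnorm M (dif M y x)"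
        by (intro bound b dif_in[OF l] x y)
      also have "\<dots> \<le> \<bar>C\<bar> * (linf_norm a + 1) * d"
        using bn yx linf_norm_nonneg[OF b] linf_norm_nonneg[OF a] qnorm_nonneg[OF qn dif_in[OF l y x]]
        by (intro mult_mono) auto
      finally show "qnorm M (act M b (dif M y x)) \<le> \<bar>C\<bar> * (linf_norm a + 1) * d" .
      have "qnorm M (act M (\<lambda>n. b n - a n) x) \<le> C * linf_norm (\<lambda>n. b n - a n) * qnorm M x"
        by (intro bound bal x)
      also have "\<dots> \<le> \<bar>C\<bar> * d * qnorm M x"
        using ba linf_norm_nonneg[OF bal] qnorm_nonneg[OF qn x] by (intro mult_mono) auto
      finally show "qnorm M (act M (\<lambda>n. b n - a n) x) \<le> \<bar>C\<bar> * d * qnorm M x" .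
    qed (use K in auto)
    also have "\<dots> = d * D" by (simp add: D_def algebra_simps)
    finally show "qnorm M (dif M (act M b y) (act M a x)) < e" using d(3) by simp
  qed
qed (auto intro: assms)

text \<open>Conversely, continuity at the origin and homogeneity give a bound uniform over the unit
  ball of bounded sequences. The sequence is scaled by \<open>d / 2\<close> and the element to size
  \<open>d / 2\<close>, whence \<open>4 / d\<^sup>2\<close>. The uniformity makes restrictions to
  all sets \<open>T\<close> equibounded.\<close>

lemma quasi_banach_module_bound:
  fixes M :: "('k::real_normed_field, 'a, 'm) qmodule_scheme"
  assumes "quasi_banach_module M"
  obtains C where "C \<ge> 0" "\<And>a x. a \<in> linf \<Longrightarrow> linf_norm a \<le> 1 \<Longrightarrow> x \<in> carr M \<Longrightarrow> qnorm M (act M a x) \<le> C * qnorm M x"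
proof -
  have M: "quasi_banach M"
    and carr: "\<And>a x. a \<in> linf \<Longrightarrow> x \<in> carr M \<Longrightarrow> act M a x \<in> carr M"
    and mult: "\<And>a b x. a \<in> linf \<Longrightarrow> b \<in> linf \<Longrightarrow> x \<in> carr M \<Longrightarrow> act M (\<lambda>n. a n * b n) x = act M a (act M b x)"
    and const: "\<And>c x. x \<in> carr M \<Longrightarrow> act M (\<lambda>n. c) x = scl M c x"
    and cont: "\<And>a x e. a \<in> linf \<Longrightarrow> x \<in> carr M \<Longrightarrow> e > 0 \<Longrightarrow> \<exists>d>0. \<forall>b\<in>linf. \<forall>y\<in>carr M.
        linf_norm (\<lambda>n. b n - a n) < d \<longrightarrow> qnorm M (dif M y x) < d \<longrightarrow>
        qnorm M (dif M (act M b y) (act M a x)) < e"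
    using assms unfolding quasi_banach_module_def by blast+
  note qn = quasi_banach_quasinormed[OF M] and l = quasi_banach_linear[OF M]
  obtain d where d: "d > 0" "\<And>b y. b \<in> linf \<Longrightarrow> y \<in> carr M \<Longrightarrow> linf_norm b < d \<Longrightarrow> qnorm M y < d \<Longrightarrow>
      qnorm M (act M b y) < 1"
    using cont[OF linf_const[of 0] zer_in[OF l], of 1]
    by (auto simp: const zer_in[OF l] scl_zer[OF l] dif_zer[OF l] carr)
  have "qnorm M (act M a x) \<le> 4 / d\<^sup>2 * qnorm M x" if a: "a \<in> linf" "linf_norm a \<le> 1" and x: "x \<in> carr M" for a x
  proof (cases "x = zer M")
    case True
    have "act M a (zer M) = act M (\<lambda>n. a n * 0) (zer M)"
      using mult[OF a(1) linf_const[of 0] zer_in[OF l]] const[OF zer_in[OF l], of 0] by (simp add: scl_zer[OF l])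
    then show ?thesis using const[OF zer_in[OF l], of 0] True by (simp add: scl_zer[OF l] qnorm_zer[OF qn])
  next
    case False
    have npos: "qnorm M x > 0" using False qnorm_nonneg[OF qn x] qnorm_eq_zero_iff[OF qn x] by linarith
    define c :: 'k where "c = of_real (d / 2)"
    define c' :: 'k where "c' = of_real (d / (2 * qnorm M x))"
    have nc: "norm c = d / 2" "norm c' = d / (2 * qnorm M x)"
      unfolding c_def c'_def norm_of_real using d npos by simp_all
    have bl: "(\<lambda>n. c * a n) \<in> linf" by (intro linf_mult linf_const a)
    have "linf_norm (\<lambda>n. c * a n) \<le> d / 2"
    proof (rule linf_norm_least)
      fix n
      have "norm (a n) \<le> 1" using linf_norm_bound[OF a(1), of n] a(2) by simp
      then show "norm (c * a n) \<le> d / 2" using d by (simp add: norm_mult nc mult_left_le)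
    qed
    moreover have "qnorm M (scl M c' x) = d / 2" using npos by (simp add: qnorm_scl[OF qn x] nc)
    ultimately have "qnorm M (act M (\<lambda>n. c * a n) (scl M c' x)) < 1"
      using d by (intro d(2) bl scl_in[OF l] x) auto
    also have "act M (\<lambda>n. c * a n) (scl M c' x) = scl M c (scl M c' (act M a x))"
      using mult[OF linf_const a(1) scl_in[OF l x], of c c'] mult[OF a(1) linf_const x, of c']
        mult[OF linf_const a(1) x, of c'] by (simp add: const carr a x scl_in[OF l] mult.commute)
    finally have "(d / 2) * (d / (2 * qnorm M x)) * qnorm M (act M a x) < 1"
      by (simp add: qnorm_scl[OF qn] scl_in[OF l] carr a x nc)
    then show ?thesis using npos d by (simp add: field_simps power2_eq_square)
  qed
  then show thesis using that[of "4 / d\<^sup>2"] by auto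
qed

lemma qlimit_add:
  fixes V :: "('k::real_normed_field, 'a, 'm) qspace_scheme"
  assumes V: "quasinormed V" and c: "x \<in> carr V" "y \<in> carr V" "\<And>n. s n \<in> carr V" "\<And>n. t n \<in> carr V"
    and lim: "(\<lambda>n. qnorm V (dif V (s n) x)) \<longlonglongrightarrow> 0" "(\<lambda>n. qnorm V (dif V (t n) y)) \<longlonglongrightarrow> 0"
  shows "(\<lambda>n. qnorm V (dif V (add V (s n) (t n)) (add V x y))) \<longlonglongrightarrow> 0"
proof -
  note l = quasinormed_linear[OF V]
  obtain K where K: "K \<ge> 1"
    "\<And>x y. x \<in> carr V \<Longrightarrow> y \<in> carr V \<Longrightarrow> qnorm V (add V x y) \<le> K * (qnorm V x + qnorm V y)"
    using quasi_triangle_obtain[OF V] by metis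
  have "(\<lambda>n. K * (qnorm V (dif V (s n) x) + qnorm V (dif V (t n) y))) \<longlonglongrightarrow> K * (0 + 0)"
    by (intro tendsto_intros lim)
  moreover have "qnorm V (dif V (add V (s n) (t n)) (add V x y)) \<le> K * (qnorm V (dif V (s n) x) + qnorm V (dif V (t n) y))" for n
    by (simp add: dif_add_add[OF l] c K dif_in[OF l])
  ultimately show ?thesis
    using qnorm_nonneg[OF V dif_in[OF l add_in[OF l c(3,4)] add_in[OF l c(1,2)]]]
    by - (rule squeeze_zero[of "\<lambda>n. K * (qnorm V (dif V (s n) x) + qnorm V (dif V (t n) y))"], simp_all)
qed

lemma qlimit_operator:
  assumes V: "quasinormed V" and W: "quasinormed W" and f: "bdd_operator V W f"
    and c: "x \<in> carr V" "\<And>n. s n \<in> carr V" and lim: "(\<lambda>n. qnorm V (dif V (s n) x)) \<longlonglongrightarrow> 0"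
  shows "(\<lambda>n. qnorm W (dif W (f (s n)) (f x))) \<longlonglongrightarrow> 0"
proof -
  note l = quasinormed_linear[OF V] and lW = quasinormed_linear[OF W]
  obtain B where B: "B \<ge> 1" "\<And>x. x \<in> carr V \<Longrightarrow> qnorm W (f x) \<le> B * qnorm V x"
    using bdd_operator_bound[OF f V] by metis
  have "(\<lambda>n. B * qnorm V (dif V (s n) x)) \<longlonglongrightarrow> B * 0" by (intro tendsto_intros lim)
  moreover have "qnorm W (dif W (f (s n)) (f x)) \<le> B * qnorm V (dif V (s n) x)" for n
    using B(2)[OF dif_in[OF l c(2,1)]] by (simp add: bdd_operator_dif[OF f l] c)
  ultimately show ?thesis
    using qnorm_nonneg[OF W dif_in[OF lW bdd_operator_carr[OF f c(2)] bdd_operator_carr[OF f c(1)]]]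
    by - (rule squeeze_zero[of "\<lambda>n. B * qnorm V (dif V (s n) x)"], simp_all)
qed

section \<open>Twisted sums\<close>

context
  fixes p :: real and \<Phi> :: "(nat \<Rightarrow> 'k::{real_normed_field,banach}) \<Rightarrow> nat \<Rightarrow> 'k"
  assumes p: "p > 0" and cent: "centralizer p \<Phi>"
begin

private abbreviation "T \<equiv> twisted_pairs p \<Phi>"
private abbreviation "L \<equiv> lp_module p :: ('k, nat \<Rightarrow> 'k) qmodule"
private abbreviation "Z \<equiv> Z_space p \<Phi>"

lemma Phi_lp: "x \<in> fin_supp \<Longrightarrow> \<Phi> x \<in> lp p"
  and Phi_cmult: "x \<in> fin_supp \<Longrightarrow> \<Phi> (\<lambda>n. c * x n) = (\<lambda>n. c * \<Phi> x n)"
  using cent unfolding centralizer_def by blast+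

lemma carr_T: "v \<in> carr T \<longleftrightarrow> fst v \<in> lp p \<and> snd v \<in> fin_supp"
  by (cases v) (simp add: twisted_pairs_def)

lemma qnorm_T: "qnorm T v = lp_norm p (\<lambda>n. fst v n - \<Phi> (snd v) n) + lp_norm p (snd v)"
  by (simp add: twisted_pairs_def)

lemma dif_T: "dif T v w = (\<lambda>n. fst v n - fst w n, \<lambda>n. snd v n - snd w n)"
  by (simp add: dif_def twisted_pairs_def)

lemma carr_L: "carr L = lp p" and qnorm_L: "qnorm L = lp_norm p" and zer_L: "zer L = (\<lambda>_. 0)"
  and add_L: "add L x y = (\<lambda>n. x n + y n)" and scl_L: "scl L c x = (\<lambda>n. c * x n)"
  and act_L: "act L a x = (\<lambda>n. a n * x n)"
  by (simp_all add: lp_module_def)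

lemma dif_L: "dif L x y = (\<lambda>n. x n - y n)"
  by (rule dif_lp_module[OF p])

text \<open>Quasilinearity enters in the triangle inequality: the first terms of the quasinorms of
  two pairs combine up to \<open>\<Phi> (x + y) - \<Phi> x - \<Phi> y\<close>.\<close>

lemma quasinormed_T: "quasinormed T"
proof -
  obtain Q where Q: "Q \<ge> 1" "\<And>x y. x \<in> fin_supp \<Longrightarrow> y \<in> fin_supp \<Longrightarrow>
    lp_norm p (\<lambda>n. \<Phi> (\<lambda>m. x m + y m) n - \<Phi> x n - \<Phi> y n) \<le> Q * (lp_norm p x + lp_norm p y)"
    using centralizer_quasilinear[OF cent p] by metis
  define K where "K = 2 * 2 powr (1 / p)"
  have K: "K \<ge> 1" using ge_one_powr_ge_zero[of 2 "1 / p"] p by (simp add: K_def)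
  show ?thesis
  proof (rule quasinormedI[where K = "K * K + K * Q + K"])
    show "linear_space T"
      unfolding linear_space_def dif_T
      by (auto simp: twisted_pairs_def lp_zero[OF p] lp_add[OF p] lp_cmult[OF p] fin_supp_zero fin_supp_add
          fin_supp_mult algebra_simps)
  next
    fix v assume v: "v \<in> carr T"
    then have lv: "fst v \<in> lp p" "snd v \<in> fin_supp" by (simp_all add: carr_T)
    show "0 \<le> qnorm T v" by (simp add: qnorm_T lp_norm_nonneg[OF p])
    show "qnorm T (scl T c v) = norm c * qnorm T v" for c
    proof -
      have "(\<lambda>n. c * fst v n - \<Phi> (\<lambda>n. c * snd v n) n) = (\<lambda>n. c * (fst v n - \<Phi> (snd v) n))"
        by (simp add: Phi_cmult lv algebra_simps)
      then show ?thesis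
        by (simp add: twisted_pairs_def lp_norm_cmult[OF p lp_dif(1)[OF p lv(1) Phi_lp[OF lv(2)]]]
            lp_norm_cmult[OF p fin_supp_lp[OF p lv(2)]] distrib_left)
    qed
    show "v = zer T" if "qnorm T v = 0"
    proof -
      have z: "lp_norm p (\<lambda>n. fst v n - \<Phi> (snd v) n) = 0" "lp_norm p (snd v) = 0"
        using that lp_norm_nonneg[OF p, of "snd v"] lp_norm_nonneg[OF p, of "\<lambda>n. fst v n - \<Phi> (snd v) n"]
        by (simp_all add: qnorm_T add_nonneg_eq_0_iff)
      have s: "snd v = (\<lambda>_. 0)" using norm_le_lp_norm[OF p fin_supp_lp[OF p lv(2)]] z by auto
      then have "fst v = (\<lambda>_. 0)"
        using norm_le_lp_norm[OF p lp_dif(1)[OF p lv(1) Phi_lp[OF lv(2)]]] z centralizer_zero[OF cent] by auto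
      then show ?thesis using s by (simp add: twisted_pairs_def prod_eq_iff)
    qed
    fix w assume w: "w \<in> carr T"
    then have lw: "fst w \<in> lp p" "snd w \<in> fin_supp" by (simp_all add: carr_T)
    let ?a = "\<lambda>n. fst v n - \<Phi> (snd v) n" and ?b = "\<lambda>n. fst w n - \<Phi> (snd w) n"
    let ?q = "\<lambda>n. \<Phi> (\<lambda>m. snd v m + snd w m) n - \<Phi> (snd v) n - \<Phi> (snd w) n"
    have al: "?a \<in> lp p" "?b \<in> lp p" "(\<lambda>n. ?a n + ?b n) \<in> lp p" "?q \<in> lp p"
      using lv lw by (auto intro!: lp_dif(1)[OF p] lp_add(1)[OF p] Phi_lp fin_supp_add)
    have eq: "(\<lambda>n. fst v n + fst w n - \<Phi> (\<lambda>n. snd v n + snd w n) n) = (\<lambda>n. (?a n + ?b n) - ?q n)" by auto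
    have "lp_norm p (\<lambda>n. fst v n + fst w n - \<Phi> (\<lambda>n. snd v n + snd w n) n)
        \<le> K * (lp_norm p (\<lambda>n. ?a n + ?b n) + lp_norm p ?q)"
      unfolding eq K_def by (rule lp_dif(2)[OF p al(3,4)])
    also have "\<dots> \<le> K * (K * (lp_norm p ?a + lp_norm p ?b) + Q * (lp_norm p (snd v) + lp_norm p (snd w)))"
      using K lp_add(2)[OF p al(1,2)] Q(2)[OF lv(2) lw(2)] by (intro mult_left_mono add_mono) (auto simp: K_def)
    finally have 1: "lp_norm p (\<lambda>n. fst v n + fst w n - \<Phi> (\<lambda>n. snd v n + snd w n) n)
        \<le> K * K * (lp_norm p ?a + lp_norm p ?b) + K * Q * (lp_norm p (snd v) + lp_norm p (snd w))"
      by (simp add: algebra_simps)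
    have 2: "lp_norm p (\<lambda>n. snd v n + snd w n) \<le> K * (lp_norm p (snd v) + lp_norm p (snd w))"
      unfolding K_def by (intro lp_add(2)[OF p] fin_supp_lp[OF p] lv lw)
    have "K * K * (lp_norm p ?a + lp_norm p ?b) \<le> (K * K + K * Q + K) * (lp_norm p ?a + lp_norm p ?b)"
      "K * Q * (lp_norm p (snd v) + lp_norm p (snd w)) + K * (lp_norm p (snd v) + lp_norm p (snd w))
        \<le> (K * K + K * Q + K) * (lp_norm p (snd v) + lp_norm p (snd w))"
      unfolding distrib_right[symmetric] using K Q(1)
      by (intro mult_right_mono; simp add: lp_norm_nonneg[OF p])+
    then show "qnorm T (add T v w) \<le> (K * K + K * Q + K) * (qnorm T v + qnorm T w)"
      using 1 2 unfolding qnorm_T by (simp add: twisted_pairs_def) (simp add: algebra_simps)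
  qed
qed

lemma quasi_banach_Z: "quasi_banach Z"
  unfolding Z_space_def by (rule quasi_banach_completion[OF quasinormed_T])

lemma bdd_operator_snd: "bdd_operator T L snd"
  unfolding bdd_operator_def
  by (intro conjI exI[of _ 1])
    (auto simp: lp_module_def twisted_pairs_def lp_norm_nonneg[OF p] fin_supp_lp[OF p])

text \<open>Boundedness of the action is the centralizer estimate in disguise:
  \<open>a y - \<Phi> (a x)\<close> differs from \<open>a (y - \<Phi> x)\<close> by a
  commutator.\<close>

lemma twisted_pairs_act:
  obtains C where "C \<ge> 0" "\<And>a. a \<in> linf \<Longrightarrow> bdd_operator T T (\<lambda>v. (\<lambda>m. a m * fst v m, \<lambda>m. a m * snd v m))"
    "\<And>a v. a \<in> linf \<Longrightarrow> v \<in> carr T \<Longrightarrow>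
      qnorm T (\<lambda>m. a m * fst v m, \<lambda>m. a m * snd v m) \<le> C * linf_norm a * qnorm T v"
proof -
  obtain C where C: "C \<ge> 1" "\<And>a x. a \<in> linf \<Longrightarrow> x \<in> fin_supp \<Longrightarrow>
    lp_norm p (\<lambda>n. \<Phi> (\<lambda>m. a m * x m) n - a n * \<Phi> x n) \<le> C * linf_norm a * lp_norm p x"
    using centralizer_bound[OF cent p] by metis
  define K where "K = 2 * 2 powr (1 / p)"
  have K: "K \<ge> 1" using ge_one_powr_ge_zero[of 2 "1 / p"] p by (simp add: K_def)
  define D where "D = K * C + 1"
  have D: "D \<ge> K" "D \<ge> 0" using K C(1) by (simp_all add: D_def add_nonneg_nonneg add_increasing2)
  have b: "qnorm T (\<lambda>m. a m * fst v m, \<lambda>m. a m * snd v m) \<le> D * linf_norm a * qnorm T v"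
    if a: "a \<in> linf" and v: "v \<in> carr T" for a v
  proof -
    have lv: "fst v \<in> lp p" "snd v \<in> fin_supp" using v by (simp_all add: carr_T)
    let ?A = "linf_norm a"
    let ?d = "\<lambda>n. fst v n - \<Phi> (snd v) n"
    let ?e = "\<lambda>n. \<Phi> (\<lambda>m. a m * snd v m) n - a n * \<Phi> (snd v) n"
    have dl: "?d \<in> lp p" by (intro lp_dif(1)[OF p] lv Phi_lp)
    have el: "?e \<in> lp p" by (intro lp_dif(1)[OF p] lp_act(1)[OF p] a lv Phi_lp fin_supp_mult)
    have eq: "(\<lambda>n. a n * fst v n - \<Phi> (\<lambda>m. a m * snd v m) n) = (\<lambda>n. a n * ?d n - ?e n)"
      by (simp add: algebra_simps)
    have "lp_norm p (\<lambda>n. a n * fst v n - \<Phi> (\<lambda>m. a m * snd v m) n)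
        \<le> K * (lp_norm p (\<lambda>n. a n * ?d n) + lp_norm p ?e)"
      unfolding eq K_def by (rule lp_dif(2)[OF p lp_act(1)[OF p a dl] el])
    also have "\<dots> \<le> K * (?A * lp_norm p ?d + C * ?A * lp_norm p (snd v))"
      using K lp_act(2)[OF p a dl] C(2)[OF a lv(2)] by (intro mult_left_mono add_mono) auto
    finally have "qnorm T (\<lambda>m. a m * fst v m, \<lambda>m. a m * snd v m)
        \<le> K * (?A * lp_norm p ?d + C * ?A * lp_norm p (snd v)) + ?A * lp_norm p (snd v)"
      using lp_act(2)[OF p a fin_supp_lp[OF p lv(2)]] by (simp add: qnorm_T)
    also have "\<dots> = K * (?A * lp_norm p ?d) + D * (?A * lp_norm p (snd v))" by (simp add: D_def algebra_simps)
    also have "\<dots> \<le> D * (?A * lp_norm p ?d) + D * (?A * lp_norm p (snd v))"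
      using D linf_norm_nonneg[OF a] lp_norm_nonneg[OF p, of ?d] by (intro add_right_mono mult_right_mono) auto
    also have "\<dots> = D * ?A * qnorm T v" by (simp add: qnorm_T algebra_simps)
    finally show ?thesis .
  qed
  moreover have "bdd_operator T T (\<lambda>v. (\<lambda>m. a m * fst v m, \<lambda>m. a m * snd v m))" if a: "a \<in> linf" for a
  proof -
    have "\<exists>C. \<forall>x\<in>carr T. qnorm T (\<lambda>m. a m * fst x m, \<lambda>m. a m * snd x m) \<le> C * qnorm T x"
      using b[OF a] by blast
    then show ?thesis unfolding bdd_operator_def
      by (simp add: carr_T lp_act[OF p a] fin_supp_mult) (simp add: twisted_pairs_def algebra_simps)
  qed
  ultimately show thesis using that D by blast
qed

text \<open>The canonical map into the completion. The explicit lift of the spliced sequence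
  consists of elements of this form, so that its computation takes place on pairs.\<close>

definition emb :: "'k pair \<Rightarrow> (nat \<Rightarrow> 'k pair) set" where
  "emb v = cauchy_class T (\<lambda>_. v)"

lemma emb_carr: "v \<in> carr T \<Longrightarrow> emb v \<in> carr Z"
  unfolding emb_def Z_space_def completion_carr[OF quasinormed_T] using cauchy_seq_const[OF quasinormed_T] by blast

lemma emb_add: "v \<in> carr T \<Longrightarrow> w \<in> carr T \<Longrightarrow> emb (add T v w) = add Z (emb v) (emb w)"
  by (simp add: emb_def Z_space_def completion_add[OF quasinormed_T] cauchy_seq_const[OF quasinormed_T])

lemma emb_scl: "v \<in> carr T \<Longrightarrow> emb (scl T c v) = scl Z c (emb v)"
  by (simp add: emb_def Z_space_def completion_scl[OF quasinormed_T] cauchy_seq_const[OF quasinormed_T])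

lemma emb_qnorm: "v \<in> carr T \<Longrightarrow> qnorm Z (emb v) \<le> qnorm T v"
  unfolding emb_def Z_space_def
  by (rule completion_qnorm_le[OF quasinormed_T cauchy_seq_const[OF quasinormed_T], of _ 0]) auto

lemma emb_eq_iff: "v \<in> carr T \<Longrightarrow> w \<in> carr T \<Longrightarrow> emb v = emb w \<longleftrightarrow> v = w"
  unfolding emb_def
  by (subst cauchy_class_eq_iff[OF quasinormed_T])
    (simp_all add: cauchy_seq_const[OF quasinormed_T] LIMSEQ_const_iff qnorm_eq_zero_iff[OF quasinormed_T]
      dif_in[OF quasinormed_linear[OF quasinormed_T]] dif_eq_zer_iff[OF quasinormed_linear[OF quasinormed_T]])

lemma Z_incl_emb: "Z_incl p \<Phi> y = emb (y, \<lambda>_. 0)"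
  by (simp add: Z_incl_def emb_def)

lemma qnorm_T_incl: "qnorm T (y, \<lambda>_. 0) = lp_norm p y"
  by (simp add: qnorm_T centralizer_zero[OF cent] lp_zero[OF p])

lemma carr_T_incl: "y \<in> lp p \<Longrightarrow> (y, \<lambda>_. 0) \<in> carr T"
  by (simp add: carr_T fin_supp_zero)

lemma bdd_operator_Z_incl: "bdd_operator L Z (Z_incl p \<Phi>)"
  unfolding bdd_operator_def
proof (intro conjI ballI allI exI[of _ 1])
  fix x assume "x \<in> carr L"
  then have x: "x \<in> lp p" by (simp add: carr_L)
  show "Z_incl p \<Phi> x \<in> carr Z" by (simp add: Z_incl_emb emb_carr carr_T_incl x)
  show "qnorm Z (Z_incl p \<Phi> x) \<le> 1 * qnorm L x"
    using emb_qnorm[OF carr_T_incl[OF x]] by (simp add: Z_incl_emb qnorm_T_incl qnorm_L)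
  show "Z_incl p \<Phi> (scl L c x) = scl Z c (Z_incl p \<Phi> x)" for c
    using emb_scl[OF carr_T_incl[OF x], of c] by (simp add: Z_incl_emb scl_L) (simp add: twisted_pairs_def)
  fix y assume "y \<in> carr L"
  then have y: "y \<in> lp p" by (simp add: carr_L)
  show "Z_incl p \<Phi> (add L x y) = add Z (Z_incl p \<Phi> x) (Z_incl p \<Phi> y)"
    using emb_add[OF carr_T_incl[OF x] carr_T_incl[OF y]] by (simp add: Z_incl_emb add_L) (simp add: twisted_pairs_def)
qed

lemma Z_incl_inj: "x \<in> lp p \<Longrightarrow> y \<in> lp p \<Longrightarrow> Z_incl p \<Phi> x = Z_incl p \<Phi> y \<longleftrightarrow> x = y"
  by (simp add: Z_incl_emb emb_eq_iff carr_T_incl)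

lemma Z_carr_cases:
  assumes "c \<in> carr Z" obtains s where "cauchy_seq T s" "c = cauchy_class T s"
  using assms by (auto simp: Z_space_def completion_carr[OF quasinormed_T])

private abbreviation "lim_snd s x \<equiv> (\<lambda>n. lp_norm p (\<lambda>m. snd (s n) m - x m)) \<longlonglongrightarrow> 0"

lemma lim_snd_L: "lim_snd s x = (\<lambda>n. qnorm L (dif L (snd (s n)) x)) \<longlonglongrightarrow> 0"
  by (simp add: dif_L qnorm_L)

lemma snd_carr: "cauchy_seq T s \<Longrightarrow> snd (s n) \<in> carr L"
  using bdd_operator_carr[OF bdd_operator_snd cauchy_seq_carr[OF quasinormed_T]] .

lemma lim_snd_ex:
  assumes "cauchy_seq T s" obtains x where "x \<in> lp p" "lim_snd s x"
  using bdd_operator_cauchy[OF quasinormed_T assms bdd_operator_snd] quasi_banach_lp[OF p, where 'k = 'k]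
  unfolding quasi_banach_def lim_snd_L carr_L by blast

lemma lim_snd_unique:
  assumes "cauchy_seq T s" "x \<in> lp p" "y \<in> lp p" "lim_snd s x" "lim_snd s y"
  shows "x = y"
  by (rule qlimit_unique[OF quasinormed_lp[OF p], where s = "\<lambda>n. snd (s n)"])
    (use assms snd_carr[OF assms(1)] in \<open>auto simp: carr_L lim_snd_L\<close>)

lemma lim_snd_class:
  assumes "cauchy_seq T s" "t \<in> cauchy_class T s" "x \<in> lp p" "lim_snd s x" shows "lim_snd t x"
proof -
  have t: "cauchy_seq T t" "(\<lambda>n. qnorm T (dif T (t n) (s n))) \<longlonglongrightarrow> 0"
    using assms(2) by (simp_all add: cauchy_class_def)
  have zero: "(\<lambda>n. qnorm L (dif L (dif L (snd (t n)) (snd (s n))) (zer L))) \<longlonglongrightarrow> 0"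
    using bdd_operator_close[OF quasinormed_T quasinormed_lp[OF p] t(1) assms(1) bdd_operator_snd t(2)]
    by (simp add: dif_L zer_L)
  note lin = quasinormed_linear[OF quasinormed_lp[OF p]]
  have "(\<lambda>n. qnorm L (dif L (add L (dif L (snd (t n)) (snd (s n))) (snd (s n))) (add L (zer L) x))) \<longlonglongrightarrow> 0"
    by (rule qlimit_add[OF quasinormed_lp[OF p] zer_in[OF lin] _ dif_in[OF lin snd_carr[OF t(1)] snd_carr[OF assms(1)]]
          snd_carr[OF assms(1)] zero]) (use assms in \<open>simp_all add: carr_L lim_snd_L\<close>)
  then show ?thesis by (simp add: dif_L add_L zer_L qnorm_L)
qed

text \<open>The description in \<open>Z_quot\<close> asks for a limit common to all representatives;
  the limit is constant on a class, so any one representative computes it.\<close>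

lemma Z_quot_eqI:
  assumes "cauchy_seq T s" "x \<in> lp p" "lim_snd s x" shows "Z_quot p (cauchy_class T s) = x"
  unfolding Z_quot_def
proof (rule the_equality)
  show "x \<in> lp p \<and> (\<forall>t\<in>cauchy_class T s. lim_snd t x)" using lim_snd_class assms by blast
  show "y = x" if "y \<in> lp p \<and> (\<forall>t\<in>cauchy_class T s. lim_snd t y)" for y
    using lim_snd_unique[OF assms(1)] that assms cauchy_class_self[OF quasinormed_T assms(1)] by blast
qed

lemma Z_quot_emb: "v \<in> carr T \<Longrightarrow> Z_quot p (emb v) = snd v"
  unfolding emb_def
  by (rule Z_quot_eqI) (auto simp: cauchy_seq_const[OF quasinormed_T] carr_T fin_supp_lp[OF p] lp_zero[OF p])

lemma bdd_operator_Z_quot: "bdd_operator Z L (Z_quot p)"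
proof -
  define K where "K = 2 * 2 powr (1 / p)"
  have K: "K \<ge> 1" using ge_one_powr_ge_zero[of 2 "1 / p"] p by (simp add: K_def)
  note qL = quasinormed_lp[OF p, where 'k = 'k]
  note lin = quasinormed_linear[OF qL]
  show ?thesis
    unfolding bdd_operator_def
  proof (intro conjI ballI allI exI[of _ K])
    fix c assume "c \<in> carr Z"
    then obtain s where s: "cauchy_seq T s" "c = cauchy_class T s" by (rule Z_carr_cases)
    obtain x where x: "x \<in> lp p" "lim_snd s x" using lim_snd_ex[OF s(1)] .
    have qc: "Z_quot p c = x" unfolding s(2) by (rule Z_quot_eqI[OF s(1) x])
    show "Z_quot p c \<in> carr L" by (simp add: qc x carr_L)
    show "Z_quot p (scl Z k c) = scl L k (Z_quot p c)" for k
      unfolding qc unfolding s(2) Z_space_def completion_scl[OF quasinormed_T s(1)]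
    proof (rule Z_quot_eqI[OF cauchy_seq_scl[OF quasinormed_T s(1)]])
      show "scl L k x \<in> lp p" using x by (simp add: scl_L lp_cmult[OF p])
      have "(\<lambda>n. qnorm L (dif L (scl L k (snd (s n))) (scl L k x))) \<longlonglongrightarrow> 0"
        by (rule qlimit_operator[OF qL qL bdd_operator_scl_self[OF qL]])
          (use x snd_carr[OF s(1)] in \<open>auto simp: carr_L lim_snd_L\<close>)
      then show "lim_snd (\<lambda>n. scl T k (s n)) (scl L k x)"
        by (simp add: dif_L qnorm_L scl_L) (simp add: twisted_pairs_def)
    qed
    show "qnorm L (Z_quot p c) \<le> K * qnorm Z c"
    proof (rule field_le_epsilon)
      fix e :: real assume e: "e > 0"
      define d where "d = e / (2 * K)"
      have d: "d > 0" using e K by (simp add: d_def)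
      then have "qnorm Z c < qnorm Z c + d" by simp
      then obtain t where t: "t \<in> cauchy_class T s" "\<And>n. qnorm T (t n) \<le> qnorm Z c + d"
        using completion_qnorm_approx[OF quasinormed_T s(1)] unfolding Z_space_def s(2) by metis
      have tc: "cauchy_seq T t" using t(1) by (simp add: cauchy_class_def)
      have "lim_snd t x" by (rule lim_snd_class[OF s(1) t(1) x])
      from order_tendstoD(2)[OF this d] obtain n where n: "lp_norm p (\<lambda>m. snd (t n) m - x m) < d"
        by (auto simp: eventually_sequentially)
      have sl: "snd (t n) \<in> lp p" using snd_carr[OF tc] by (simp add: carr_L)
      have "lp_norm p x = lp_norm p (\<lambda>m. snd (t n) m - (snd (t n) m - x m))" by simp
      also have "\<dots> \<le> K * (lp_norm p (snd (t n)) + lp_norm p (\<lambda>m. snd (t n) m - x m))"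
        unfolding K_def by (intro lp_dif[OF p] sl x)
      also have "\<dots> \<le> K * ((qnorm Z c + d) + d)"
      proof -
        have "lp_norm p (snd (t n)) \<le> qnorm T (t n)" by (simp add: qnorm_T lp_norm_nonneg[OF p])
        then show ?thesis using K n t(2)[of n] by (intro mult_left_mono add_mono) auto
      qed
      also have "\<dots> = K * qnorm Z c + e" using K by (simp add: d_def field_simps)
      finally show "qnorm L (Z_quot p c) \<le> K * qnorm Z c + e" by (simp add: qc qnorm_L)
    qed
    fix c' assume "c' \<in> carr Z"
    then obtain s' where s': "cauchy_seq T s'" "c' = cauchy_class T s'" by (rule Z_carr_cases)
    obtain x' where x': "x' \<in> lp p" "lim_snd s' x'" using lim_snd_ex[OF s'(1)] .
    have qc': "Z_quot p c' = x'" unfolding s'(2) by (rule Z_quot_eqI[OF s'(1) x'])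
    show "Z_quot p (add Z c c') = add L (Z_quot p c) (Z_quot p c')"
      unfolding qc qc' unfolding s(2) s'(2) Z_space_def completion_add[OF quasinormed_T s(1) s'(1)]
    proof (rule Z_quot_eqI[OF cauchy_seq_add[OF quasinormed_T s(1) s'(1)]])
      show "add L x x' \<in> lp p" using x x' by (simp add: add_L lp_add[OF p])
      have "(\<lambda>n. qnorm L (dif L (add L (snd (s n)) (snd (s' n))) (add L x x'))) \<longlonglongrightarrow> 0"
        by (rule qlimit_add[OF qL]) (use x x' snd_carr[OF s(1)] snd_carr[OF s'(1)] in \<open>auto simp: carr_L lim_snd_L\<close>)
      then show "lim_snd (\<lambda>n. add T (s n) (s' n)) (add L x x')"
        by (simp add: dif_L qnorm_L add_L) (simp add: twisted_pairs_def)
    qed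
  qed
qed

text \<open>A finitely supported \<open>y\<close> lifts to \<open>(\<Phi> y, y)\<close>, whose first
  term in the quasinorm is 0. Lifting truncations thus solves the equation with arbitrarily small
  relative error and with constant 1.\<close>

lemma Z_quot_surj: "Z_quot p ` carr Z = lp p"
proof
  show "Z_quot p ` carr Z \<subseteq> lp p" using bdd_operator_carr[OF bdd_operator_Z_quot] by (auto simp: carr_L)
  have "\<exists>D\<ge>1. \<forall>w\<in>lp p. \<exists>v\<in>carr Z. Z_quot p v = w \<and> qnorm Z v \<le> D * qnorm L w"
  proof (rule surjective_by_approximation[OF quasi_banach_Z quasinormed_lp[OF p] bdd_operator_Z_quot, of "lp p" 1])
    show "lp p \<subseteq> carr L" by (simp add: carr_L)
    show "dif L w (Z_quot p v) \<in> lp p" if "w \<in> lp p" "v \<in> carr Z" for w v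
      using that bdd_operator_carr[OF bdd_operator_Z_quot, of v] by (simp add: dif_L lp_dif[OF p] carr_L)
    fix w :: "nat \<Rightarrow> 'k" and \<delta> :: real assume w: "w \<in> lp p" "w \<noteq> zer L" and \<delta>: "0 < \<delta>"
    then obtain n where "w n \<noteq> 0" by (auto simp: zer_L)
    then have "\<delta> * lp_norm p w > 0" using \<delta> lp_norm_pos[OF p w(1)] by simp
    then obtain y :: "nat \<Rightarrow> 'k" where y: "y \<in> fin_supp" "lp_norm p (\<lambda>n. w n - y n) < \<delta> * lp_norm p w" "lp_norm p y \<le> lp_norm p w"
      using lp_truncation[OF p w(1)] by metis
    have v: "(\<Phi> y, y) \<in> carr T" by (simp add: carr_T Phi_lp y)
    show "\<exists>v\<in>carr Z. qnorm Z v \<le> 1 * qnorm L w \<and> qnorm L (dif L w (Z_quot p v)) \<le> \<delta> * qnorm L w"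
    proof (intro bexI[of _ "emb (\<Phi> y, y)"] conjI emb_carr v)
      show "qnorm Z (emb (\<Phi> y, y)) \<le> 1 * qnorm L w"
        using emb_qnorm[OF v] y(3) by (simp add: qnorm_T lp_zero[OF p] qnorm_L)
      show "qnorm L (dif L w (Z_quot p (emb (\<Phi> y, y)))) \<le> \<delta> * qnorm L w"
        using y(2) by (simp add: Z_quot_emb[OF v] dif_L qnorm_L)
    qed
  qed (auto simp: carr_L)
  then show "lp p \<subseteq> Z_quot p ` carr Z" by (metis image_eqI subsetI)
qed

lemma Z_quot_incl: "y \<in> lp p \<Longrightarrow> Z_quot p (Z_incl p \<Phi> y) = (\<lambda>_. 0)"
  by (simp add: Z_incl_emb Z_quot_emb carr_T_incl)

lemma null_seq_cauchy:
  assumes "\<And>n. s n \<in> carr T" "(\<lambda>n. qnorm T (s n)) \<longlonglongrightarrow> 0" shows "cauchy_seq T s"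
  unfolding cauchy_seq_def
proof (intro conjI allI impI)
  show "range s \<subseteq> carr T" using assms by auto
  obtain K where K: "K \<ge> 1"
    "\<And>x y. x \<in> carr T \<Longrightarrow> y \<in> carr T \<Longrightarrow> qnorm T (dif T x y) \<le> K * (qnorm T x + qnorm T y)"
    using quasi_triangle_obtain[OF quasinormed_T] by metis
  fix e :: real assume "e > 0"
  then have "e / (2 * K) > 0" using K by simp
  from order_tendstoD(2)[OF assms(2) this] obtain N where N: "\<And>n. n \<ge> N \<Longrightarrow> qnorm T (s n) < e / (2 * K)"
    by (auto simp: eventually_sequentially)
  show "\<exists>N. \<forall>m\<ge>N. \<forall>n\<ge>N. qnorm T (dif T (s m) (s n)) < e"
  proof (intro exI[of _ N] allI impI)
    fix m n assume "m \<ge> N" "n \<ge> N"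
    then have "K * (qnorm T (s m) + qnorm T (s n)) < K * (e / (2 * K) + e / (2 * K))"
      using N[of m] N[of n] K(1) by (intro mult_strict_left_mono add_strict_mono) auto
    then show "qnorm T (dif T (s m) (s n)) < e" using K(2)[OF assms(1) assms(1), of m n] K(1) by simp
  qed
qed

text \<open>If the second components \<open>x\<close> tend to 0, so do the pairs
  \<open>(\<Phi> x, x)\<close>. Subtracting this null sequence does not change the class and leaves
  pairs with second component 0, whose first components converge in \<open>lp p\<close>.\<close>

lemma Z_quot_kernel:
  assumes "c \<in> carr Z" "Z_quot p c = (\<lambda>_. 0)" shows "c \<in> Z_incl p \<Phi> ` lp p"
proof -
  note l = quasinormed_linear[OF quasinormed_T]
  obtain s where s: "cauchy_seq T s" "c = cauchy_class T s" using assms(1) by (rule Z_carr_cases)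
  obtain x where x: "x \<in> lp p" "lim_snd s x" using lim_snd_ex[OF s(1)] .
  have "x = (\<lambda>_. 0)" using Z_quot_eqI[OF s(1) x] assms(2) s(2) by simp
  then have s0: "(\<lambda>n. lp_norm p (snd (s n))) \<longlonglongrightarrow> 0" using x(2) by simp
  have sT: "fst (s n) \<in> lp p" "snd (s n) \<in> fin_supp" for n
    using cauchy_seq_carr[OF quasinormed_T s(1), of n] by (simp_all add: carr_T)
  define w where "w n = (\<Phi> (snd (s n)), snd (s n))" for n
  have wT: "w n \<in> carr T" for n by (simp add: w_def carr_T Phi_lp sT)
  have wn: "qnorm T (w n) = lp_norm p (snd (s n))" for n by (simp add: w_def qnorm_T lp_zero[OF p])
  have wc: "cauchy_seq T w" by (rule null_seq_cauchy[OF wT]) (simp add: wn s0)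
  define y where "y n = (\<lambda>m. fst (s n) m - \<Phi> (snd (s n)) m)" for n
  define u where "u n = (y n, (\<lambda>_. 0) :: nat \<Rightarrow> 'k)" for n
  have u: "u n = dif T (s n) (w n)" for n by (simp add: u_def y_def w_def dif_T)
  have uc: "cauchy_seq T u" unfolding u by (rule cauchy_seq_dif[OF quasinormed_T s(1) wc])
  have yl: "y n \<in> lp p" for n by (simp add: y_def lp_dif[OF p] sT Phi_lp)
  have du: "qnorm T (dif T (u m) (v, \<lambda>_. 0)) = qnorm L (dif L (y m) v)" for m v
    by (simp add: u_def dif_T qnorm_T_incl dif_L qnorm_L)
  have "cauchy_seq L y"
    using uc yl du[of _ "y _", folded u_def] unfolding cauchy_seq_def by (auto simp: carr_L)
  then obtain v where v: "v \<in> lp p" "(\<lambda>n. qnorm L (dif L (y n) v)) \<longlonglongrightarrow> 0"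
    using quasi_banach_lp[OF p, where 'k = 'k] unfolding quasi_banach_def carr_L by blast
  have "cauchy_class T s = cauchy_class T u"
  proof (subst cauchy_class_eq_iff[OF quasinormed_T s(1) uc])
    have "dif T (s n) (u n) = w n" for n by (simp add: u_def y_def w_def dif_T)
    then show "(\<lambda>n. qnorm T (dif T (s n) (u n))) \<longlonglongrightarrow> 0" by (simp add: wn s0)
  qed
  also have "\<dots> = Z_incl p \<Phi> v"
    unfolding Z_incl_def
    by (subst cauchy_class_eq_iff[OF quasinormed_T uc cauchy_seq_const[OF quasinormed_T carr_T_incl[OF v(1)]]])
      (simp add: du v)
  finally show ?thesis using v s by auto
qed

lemma Z_module_simps:
  "carr (Z_module p \<Phi>) = carr Z" "zer (Z_module p \<Phi>) = zer Z" "add (Z_module p \<Phi>) = add Z"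
  "scl (Z_module p \<Phi>) = scl Z" "qnorm (Z_module p \<Phi>) = qnorm Z"
  by (simp_all add: Z_module_def qspace.defs qmodule.defs)

private abbreviation "pact a v \<equiv> (\<lambda>m. a m * fst v m, \<lambda>m. a m * snd v m)"

lemma pact_bdd: "a \<in> linf \<Longrightarrow> bdd_operator T T (pact a)"
  by (rule twisted_pairs_act) blast

lemma Z_act_class:
  "a \<in> linf \<Longrightarrow> cauchy_seq T s \<Longrightarrow> act (Z_module p \<Phi>) a (cauchy_class T s) = cauchy_class T (\<lambda>n. pact a (s n))"
  using lift_operator_class[OF quasinormed_T _ pact_bdd] by (simp add: Z_module_def qspace.defs qmodule.defs)

lemma Z_act_emb: "a \<in> linf \<Longrightarrow> v \<in> carr T \<Longrightarrow> act (Z_module p \<Phi>) a (emb v) = emb (pact a v)"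
  by (simp add: emb_def Z_act_class cauchy_seq_const[OF quasinormed_T])

lemma quasi_banach_cong:
  assumes "carr V = carr W" "zer V = zer W" "add V = add W" "scl V = scl W" "qnorm V = qnorm W"
  shows "quasi_banach V = quasi_banach W"
  using assms by (simp add: quasi_banach_def quasinormed_def linear_space_def cauchy_seq_def dif_def)

lemma quasi_banach_module_Z: "quasi_banach_module (Z_module p \<Phi>)"
proof -
  obtain C where C: "C \<ge> 0" "\<And>a v. a \<in> linf \<Longrightarrow> v \<in> carr T \<Longrightarrow> qnorm T (pact a v) \<le> C * linf_norm a * qnorm T v"
    by (rule twisted_pairs_act) blast
  note pc = bdd_operator_cauchy[OF quasinormed_T _ pact_bdd]
  show ?thesis
  proof (rule quasi_banach_moduleI[where C = C])
    show "quasi_banach (Z_module p \<Phi>)"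
      using quasi_banach_Z quasi_banach_cong[of "Z_module p \<Phi>" Z] by (simp add: Z_module_simps)
  next
    fix a :: "nat \<Rightarrow> 'k" and x assume a: "a \<in> linf" and "x \<in> carr (Z_module p \<Phi>)"
    then have "x \<in> carr Z" by (simp add: Z_module_simps)
    then obtain s where s: "cauchy_seq T s" "x = cauchy_class T s" by (rule Z_carr_cases)
    show "act (Z_module p \<Phi>) a x \<in> carr (Z_module p \<Phi>)"
      using pc[OF s(1) a] by (auto simp: s Z_act_class a Z_module_simps Z_space_def completion_carr[OF quasinormed_T])
    have "qnorm Z (cauchy_class T (\<lambda>n. pact a (s n))) \<le> C * linf_norm a * qnorm Z (cauchy_class T s)"
      unfolding Z_space_def
      by (rule lift_operator_bound[OF quasinormed_T s(1) pact_bdd[OF a]]) (auto simp: C a linf_norm_nonneg)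
    then show "qnorm (Z_module p \<Phi>) (act (Z_module p \<Phi>) a x) \<le> C * linf_norm a * qnorm (Z_module p \<Phi>) x"
      by (simp add: s Z_act_class a Z_module_simps)
    show "act (Z_module p \<Phi>) a (add (Z_module p \<Phi>) x y)
        = add (Z_module p \<Phi>) (act (Z_module p \<Phi>) a x) (act (Z_module p \<Phi>) a y)"
      if "y \<in> carr (Z_module p \<Phi>)" for y
    proof -
      have "y \<in> carr Z" using that by (simp add: Z_module_simps)
      then obtain t where t: "cauchy_seq T t" "y = cauchy_class T t" by (rule Z_carr_cases)
      show ?thesis
        using bdd_operator_add[OF pact_bdd[OF a] cauchy_seq_carr[OF quasinormed_T s(1)] cauchy_seq_carr[OF quasinormed_T t(1)]]
        by (simp add: s t Z_module_simps Z_space_def completion_add[OF quasinormed_T] Z_act_class a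
            cauchy_seq_add[OF quasinormed_T] pc)
    qed
    fix b :: "nat \<Rightarrow> 'k" assume b: "b \<in> linf"
    show "act (Z_module p \<Phi>) (\<lambda>n. a n + b n) x
        = add (Z_module p \<Phi>) (act (Z_module p \<Phi>) a x) (act (Z_module p \<Phi>) b x)"
      using pc[OF s(1) a] pc[OF s(1) b]
      by (simp add: s Z_module_simps Z_space_def completion_add[OF quasinormed_T] Z_act_class a b linf_add)
        (simp add: twisted_pairs_def distrib_right)
    show "act (Z_module p \<Phi>) (\<lambda>n. a n * b n) x = act (Z_module p \<Phi>) a (act (Z_module p \<Phi>) b x)"
      using pc[OF s(1) b] by (simp add: s Z_act_class a b linf_mult mult.assoc)
  next
    fix c :: 'k and x assume "x \<in> carr (Z_module p \<Phi>)"
    then have "x \<in> carr Z" by (simp add: Z_module_simps)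
    then obtain s where s: "cauchy_seq T s" "x = cauchy_class T s" by (rule Z_carr_cases)
    show "act (Z_module p \<Phi>) (\<lambda>n. c) x = scl (Z_module p \<Phi>) c x"
      by (simp add: s Z_act_class linf_const Z_module_simps Z_space_def completion_scl[OF quasinormed_T])
        (simp add: twisted_pairs_def)
  qed
qed

lemma bdd_operator_act_L: "a \<in> linf \<Longrightarrow> bdd_operator L L (act L a)"
  unfolding bdd_operator_def
  by (auto simp: carr_L qnorm_L add_L scl_L act_L lp_act(1)[OF p] distrib_left mult.left_commute
      intro: lp_act(2)[OF p])

lemma quasi_banach_module_lp: "quasi_banach_module L"
  by (rule quasi_banach_moduleI[OF quasi_banach_lp[OF p], where C = 1])
    (auto simp: carr_L qnorm_L add_L scl_L act_L lp_act[OF p] algebra_simps)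

lemma Z_quot_act:
  assumes "a \<in> linf" "c \<in> carr Z" shows "Z_quot p (act (Z_module p \<Phi>) a c) = (\<lambda>n. a n * Z_quot p c n)"
proof -
  obtain s where s: "cauchy_seq T s" "c = cauchy_class T s" using assms(2) by (rule Z_carr_cases)
  obtain x where x: "x \<in> lp p" "lim_snd s x" using lim_snd_ex[OF s(1)] .
  have "Z_quot p c = x" unfolding s(2) by (rule Z_quot_eqI[OF s(1) x])
  moreover have "Z_quot p (cauchy_class T (\<lambda>n. pact a (s n))) = act L a x"
  proof (rule Z_quot_eqI[OF bdd_operator_cauchy[OF quasinormed_T s(1) pact_bdd[OF assms(1)]]])
    show "act L a x \<in> lp p" using x assms by (simp add: act_L lp_act[OF p])
    have "(\<lambda>n. qnorm L (dif L (act L a (snd (s n))) (act L a x))) \<longlonglongrightarrow> 0"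
      by (rule qlimit_operator[OF quasinormed_lp[OF p] quasinormed_lp[OF p] bdd_operator_act_L[OF assms(1)]])
        (use x snd_carr[OF s(1)] in \<open>auto simp: carr_L lim_snd_L\<close>)
    then show "lim_snd (\<lambda>n. pact a (s n)) (act L a x)" by (simp add: dif_L qnorm_L act_L)
  qed
  ultimately show ?thesis by (simp add: s Z_act_class assms act_L)
qed

lemma Z_incl_act:
  "a \<in> linf \<Longrightarrow> y \<in> lp p \<Longrightarrow> Z_incl p \<Phi> (\<lambda>n. a n * y n) = act (Z_module p \<Phi>) a (Z_incl p \<Phi> y)"
  by (simp add: Z_incl_emb Z_act_emb carr_T_incl)

end

section \<open>Transport of structure and exactness of the spliced sequence\<close>

text \<open>A relation between structures of possibly different record types, so that one set of
  transport lemmas serves spaces, modules and the space underlying a module.\<close>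

definition is_copy ::
  "('a \<Rightarrow> 'b) \<Rightarrow> ('b \<Rightarrow> 'a) \<Rightarrow> ('k::real_normed_field, 'a, 'm) qspace_scheme \<Rightarrow> ('k, 'b, 'n) qspace_scheme \<Rightarrow> bool" where
  "is_copy f g V W \<longleftrightarrow> (\<forall>x. g (f x) = x) \<and> carr W = f ` carr V \<and> zer W = f (zer V) \<and>
     (\<forall>x y. add W x y = f (add V (g x) (g y))) \<and> (\<forall>c x. scl W c x = f (scl V c (g x))) \<and>
     (\<forall>x. qnorm W x = qnorm V (g x))"

lemma is_copy_dif: "is_copy f g V W \<Longrightarrow> dif W x y = f (dif V (g x) (g y))"
  by (simp add: is_copy_def dif_def)

lemma is_copy_quasinormed:
  assumes c: "is_copy f g V W" and V: "quasinormed V" shows "quasinormed W"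
proof -
  note l = quasinormed_linear[OF V]
  obtain K where K: "\<And>x y. x \<in> carr V \<Longrightarrow> y \<in> carr V \<Longrightarrow> qnorm V (add V x y) \<le> K * (qnorm V x + qnorm V y)"
    using quasi_triangle_obtain[OF V] by metis
  have gf: "g (f x) = x" for x using c by (simp add: is_copy_def)
  have s: "carr W = f ` carr V" "zer W = f (zer V)" "add W x y = f (add V (g x) (g y))"
     "scl W a x = f (scl V a (g x))" "qnorm W x = qnorm V (g x)" for x y a using c by (simp_all add: is_copy_def)
  show ?thesis
  proof (rule quasinormedI[where K = K])
    show "linear_space W"
      unfolding linear_space_def is_copy_dif[OF c]
      by (auto simp: s gf zer_in[OF l] add_in[OF l] scl_in[OF l] add_assoc[OF l] zer_add[OF l] dif_self[OF l]
          scl_add[OF l] scl_plus[OF l] scl_scl[OF l] scl_one[OF l] intro: arg_cong[where f = f] add_commute[OF l])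
  qed (auto simp: s gf qnorm_nonneg[OF V] qnorm_scl[OF V] qnorm_eq_zero_iff[OF V] K)
qed

lemma is_copy_quasi_banach:
  assumes c: "is_copy f g V W" and V: "quasi_banach V" shows "quasi_banach W"
  unfolding quasi_banach_def
proof (intro conjI allI impI is_copy_quasinormed[OF c] quasi_banach_quasinormed[OF V])
  have gf: "g (f x) = x" for x using c by (simp add: is_copy_def)
  have s: "carr W = f ` carr V" "qnorm W x = qnorm V (g x)" for x using c by (simp_all add: is_copy_def)
  fix t assume t: "cauchy_seq W t"
  have "t n \<in> f ` carr V" for n using t s by (auto simp: cauchy_seq_def)
  then have "g (t n) \<in> carr V" for n using gf by (metis imageE)
  then have "cauchy_seq V (\<lambda>n. g (t n))"
    using t by (auto simp: cauchy_seq_def s is_copy_dif[OF c] gf)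
  then obtain x where "x \<in> carr V" "(\<lambda>n. qnorm V (dif V (g (t n)) x)) \<longlonglongrightarrow> 0"
    using V unfolding quasi_banach_def by blast
  then show "\<exists>x\<in>carr W. (\<lambda>n. qnorm W (dif W (t n) x)) \<longlonglongrightarrow> 0"
    by (intro bexI[of _ "f x"]) (auto simp: s is_copy_dif[OF c] gf)
qed

lemma is_copy_bdd_operator:
  assumes c: "is_copy f g V W" and c': "is_copy f' g' V' W'" and h: "bdd_operator V V' h"
  shows "bdd_operator W W' (\<lambda>u. f' (h (g u)))"
  using c c' h unfolding bdd_operator_def is_copy_def by auto

lemma bdd_operator_compose:
  assumes f: "bdd_operator U V f" and g: "bdd_operator V W g" and U: "quasinormed U" and V: "quasinormed V"
  shows "bdd_operator U W (\<lambda>x. g (f x))"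
proof -
  obtain A where A: "A \<ge> 1" "\<And>x. x \<in> carr U \<Longrightarrow> qnorm V (f x) \<le> A * qnorm U x" using bdd_operator_bound[OF f U] by metis
  obtain B where B: "B \<ge> 1" "\<And>x. x \<in> carr V \<Longrightarrow> qnorm W (g x) \<le> B * qnorm V x" using bdd_operator_bound[OF g V] by metis
  have "qnorm W (g (f x)) \<le> (B * A) * qnorm U x" if x: "x \<in> carr U" for x
  proof -
    have "qnorm W (g (f x)) \<le> B * qnorm V (f x)" using B(2) bdd_operator_carr[OF f x] .
    also have "\<dots> \<le> B * (A * qnorm U x)" using A(2)[OF x] B(1) by (intro mult_left_mono) auto
    finally show ?thesis by simp
  qed
  then show ?thesis using f g unfolding bdd_operator_def by auto
qed

lemma copy_module_simps:
  "carr (copy_module f g M) = f ` carr M" "zer (copy_module f g M) = f (zer M)"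
  "add (copy_module f g M) x y = f (add M (g x) (g y))" "scl (copy_module f g M) c x = f (scl M c (g x))"
  "qnorm (copy_module f g M) x = qnorm M (g x)" "act (copy_module f g M) a x = f (act M a (g x))"
  by (simp_all add: copy_module_def copy_space_def qspace.defs qmodule.defs)

lemma is_copy_copy_space: "(\<And>x. g (f x) = x) \<Longrightarrow> is_copy f g V (copy_space f g V)"
  by (simp add: is_copy_def copy_space_def)

lemma is_copy_copy_module: "(\<And>x. g (f x) = x) \<Longrightarrow> is_copy f g M (copy_module f g M)"
  by (simp add: is_copy_def copy_module_simps)

lemma quasi_banach_module_copy:
  assumes gf: "\<And>x. g (f x) = x" and M: "quasi_banach_module M"
  shows "quasi_banach_module (copy_module f g M)"
proof -
  have "quasi_banach (copy_module f g M)"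
    using is_copy_quasi_banach[OF is_copy_copy_module[of g f, OF gf]] M by (auto simp: quasi_banach_module_def)
  then show ?thesis
    using M unfolding quasi_banach_module_def is_copy_dif[OF is_copy_copy_module[of g f, OF gf]]
    by (simp add: copy_module_simps gf)
qed

lemma is_copy_truncate: "(\<And>x. g (f x) = x) \<Longrightarrow> is_copy f g M (copy_space f g (qspace.truncate M))"
  by (simp add: is_copy_def copy_space_def qspace.defs)

lemma module_hom_copy:
  assumes "\<And>x. g (f x) = x" "\<And>x. g' (f' x) = x" "module_hom M N h"
  shows "module_hom (copy_module f g M) (copy_module f' g' N) (\<lambda>u. f' (h (g u)))"
  using is_copy_bdd_operator[OF is_copy_copy_module[of g f] is_copy_copy_module[of g' f']] assms
  by (auto simp: module_hom_def copy_module_simps)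

lemma ell_space_simps:
  "carr (ell_space p) = Sq ` lp p" "zer (ell_space p) = Sq (\<lambda>_. 0)"
  "add (ell_space p) (Sq x) (Sq y) = Sq (\<lambda>n. x n + y n)" "scl (ell_space p) c (Sq x) = Sq (\<lambda>n. c * x n)"
  "qnorm (ell_space p) (Sq x) = lp_norm p x"
  by (simp_all add: ell_space_def copy_space_def lp_module_def qspace.defs)

lemma ell_module_simps:
  "carr (ell_module p) = Sq ` lp p" "zer (ell_module p) = Sq (\<lambda>_. 0)"
  "add (ell_module p) (Sq x) (Sq y) = Sq (\<lambda>n. x n + y n)" "scl (ell_module p) c (Sq x) = Sq (\<lambda>n. c * x n)"
  "qnorm (ell_module p) (Sq x) = lp_norm p x" "act (ell_module p) a (Sq x) = Sq (\<lambda>n. a n * x n)"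
  by (simp_all add: ell_module_def copy_module_simps lp_module_def)

context
  fixes p :: real and \<Phi> \<Psi> :: "(nat \<Rightarrow> 'k::{real_normed_field,banach}) \<Rightarrow> nat \<Rightarrow> 'k"
  assumes p: "p > 0" and \<Phi>: "centralizer p \<Phi>" and \<Psi>: "centralizer p \<Psi>"
begin

text \<open>Exactness concerns carriers and zeros only, so the space and the module version share
  it. The middle arrow has the kernel of the first quotient map, because the second inclusion is
  injective, and the image of the second inclusion, because the first quotient map is onto.\<close>

private lemma splice_kernels:
  "{y \<in> Sq ` lp p. Cl (Z_incl p \<Phi> (un_Sq y)) = Cl (zer (Z_space p \<Phi>))} = {Sq (\<lambda>_. 0)}"
  "{e \<in> Cl ` carr (Z_space p \<Phi>). Cl (Z_incl p \<Psi> (Z_quot p (un_Cl e))) = Cl (zer (Z_space p \<Psi>))}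
    = (\<lambda>u. Cl (Z_incl p \<Phi> (un_Sq u))) ` Sq ` lp p"
  "{e \<in> Cl ` carr (Z_space p \<Psi>). Sq (Z_quot p (un_Cl e)) = Sq (\<lambda>_. 0)}
    = (\<lambda>u. Cl (Z_incl p \<Psi> (Z_quot p (un_Cl u)))) ` Cl ` carr (Z_space p \<Phi>)"
  "Sq ` lp p = (\<lambda>u. Sq (Z_quot p (un_Cl u))) ` Cl ` carr (Z_space p \<Psi>)"
proof -
  have zer: "zer (Z_space p \<Theta>) = Z_incl p \<Theta> (\<lambda>_. 0)" if "centralizer p \<Theta>" for \<Theta> :: "(nat \<Rightarrow> 'k) \<Rightarrow> nat \<Rightarrow> 'k"
    using bdd_operator_zer[OF bdd_operator_Z_incl[OF p that] quasi_banach_linear[OF quasi_banach_lp[OF p]]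
        quasi_banach_linear[OF quasi_banach_Z[OF p that]]] by (simp add: zer_L[OF p that])
  have quot: "Z_quot p c \<in> lp p" if "centralizer p \<Theta>" "c \<in> carr (Z_space p \<Theta>)" for c and \<Theta> :: "(nat \<Rightarrow> 'k) \<Rightarrow> nat \<Rightarrow> 'k"
    using Z_quot_surj[OF p that(1)] that(2) by blast
  have incl: "Z_incl p \<Theta> y \<in> carr (Z_space p \<Theta>)" if "centralizer p \<Theta>" "y \<in> lp p" for y and \<Theta> :: "(nat \<Rightarrow> 'k) \<Rightarrow> nat \<Rightarrow> 'k"
    using bdd_operator_carr[OF bdd_operator_Z_incl[OF p that(1)], of y] that by (simp add: carr_L[OF p that(1)])
  have ker: "Z_quot p c = (\<lambda>_. 0) \<longleftrightarrow> c \<in> Z_incl p \<Theta> ` lp p"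
    if "centralizer p \<Theta>" "c \<in> carr (Z_space p \<Theta>)" for c and \<Theta> :: "(nat \<Rightarrow> 'k) \<Rightarrow> nat \<Rightarrow> 'k"
    using Z_quot_kernel[OF p that] Z_quot_incl[OF p that(1)] by auto
  show "{y \<in> Sq ` lp p. Cl (Z_incl p \<Phi> (un_Sq y)) = Cl (zer (Z_space p \<Phi>))} = {Sq (\<lambda>_. 0)}"
    by (auto simp: zer[OF \<Phi>] Z_incl_inj[OF p \<Phi>] lp_zero[OF p])
  show "{e \<in> Cl ` carr (Z_space p \<Phi>). Cl (Z_incl p \<Psi> (Z_quot p (un_Cl e))) = Cl (zer (Z_space p \<Psi>))}
    = (\<lambda>u. Cl (Z_incl p \<Phi> (un_Sq u))) ` Sq ` lp p"
    using quot[OF \<Phi>] incl[OF \<Phi>] ker[OF \<Phi>]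
    by (auto simp: zer[OF \<Psi>] Z_incl_inj[OF p \<Psi>] lp_zero[OF p] image_image Z_quot_incl[OF p \<Phi>])
  have "(\<lambda>u. Cl (Z_incl p \<Psi> (Z_quot p (un_Cl u)))) ` Cl ` carr (Z_space p \<Phi>)
      = (\<lambda>y. Cl (Z_incl p \<Psi> y)) ` Z_quot p ` carr (Z_space p \<Phi>)"
    by (simp add: image_image)
  also have "\<dots> = Cl ` Z_incl p \<Psi> ` lp p" unfolding Z_quot_surj[OF p \<Phi>] by (simp add: image_image)
  also have "\<dots> = {e \<in> Cl ` carr (Z_space p \<Psi>). Sq (Z_quot p (un_Cl e)) = Sq (\<lambda>_. 0)}"
    using incl[OF \<Psi>] ker[OF \<Psi>] by auto
  finally show "{e \<in> Cl ` carr (Z_space p \<Psi>). Sq (Z_quot p (un_Cl e)) = Sq (\<lambda>_. 0)}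
    = (\<lambda>u. Cl (Z_incl p \<Psi> (Z_quot p (un_Cl u)))) ` Cl ` carr (Z_space p \<Phi>)" ..
  show "Sq ` lp p = (\<lambda>u. Sq (Z_quot p (un_Cl u))) ` Cl ` carr (Z_space p \<Psi>)"
    using Z_quot_surj[OF p \<Psi>] by (simp add: image_image) (metis image_image)
qed

theorem four_exact_splice_space:
  "four_exact quasi_banach bdd_operator (ell_space p :: ('k, ('k, 'u) univ) qspace) (ell_space p) (splice_space p \<Phi> \<Psi>)"
proof -
  have cl: "is_copy Sq un_Sq (lp_module p :: ('k, nat \<Rightarrow> 'k) qmodule) (ell_space p :: ('k, ('k, 'u) univ) qspace)"
    unfolding ell_space_def by (rule is_copy_truncate) simp
  have cz: "is_copy Cl un_Cl (Z_space p \<Theta>) (copy_space Cl un_Cl (Z_space p \<Theta>) :: ('k, ('k, 'u) univ) qspace)"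
    for \<Theta> :: "(nat \<Rightarrow> 'k) \<Rightarrow> nat \<Rightarrow> 'k" by (rule is_copy_copy_space) simp
  have s: "carr (copy_space Cl un_Cl V) = Cl ` carr V" "zer (copy_space Cl un_Cl V) = Cl (zer V)" for V :: "('k, (nat \<Rightarrow> 'k pair) set) qspace"
    by (simp_all add: copy_space_def)
  note qZ = quasi_banach_quasinormed[OF quasi_banach_Z[OF p \<Phi>]]
  show ?thesis
    unfolding four_exact_def splice_space_def
    by (simp add: is_copy_quasi_banach[OF cl] quasi_banach_lp[OF p] is_copy_quasi_banach[OF cz] quasi_banach_Z[OF p] \<Phi> \<Psi>
        is_copy_bdd_operator[OF cl cz] bdd_operator_Z_incl[OF p] is_copy_bdd_operator[OF cz cl] bdd_operator_Z_quot[OF p]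
        is_copy_bdd_operator[OF cz cz bdd_operator_compose[OF bdd_operator_Z_quot bdd_operator_Z_incl]] p qZ
        quasinormed_lp s ell_space_simps splice_kernels[unfolded univ.inject] del: image_image)
qed

theorem four_exact_splice_module:
  "four_exact quasi_banach_module module_hom (ell_module p :: ('k, ('k, 'u) univ) qmodule) (ell_module p) (splice_module p \<Phi> \<Psi>)"
proof -
  have bm: "bdd_operator V W f \<longleftrightarrow> bdd_operator V' W' f"
    if "carr V = carr V'" "add V = add V'" "scl V = scl V'" "qnorm V = qnorm V'"
       "carr W = carr W'" "add W = add W'" "scl W = scl W'" "qnorm W = qnorm W'"
    for V :: "('k, 'c, 'd) qspace_scheme" and V' :: "('k, 'c, 'dd) qspace_scheme"
      and W :: "('k, 'e, 'f) qspace_scheme" and W' :: "('k, 'e, 'ff) qspace_scheme" and f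
    using that by (simp add: bdd_operator_def)
  have hi: "module_hom (lp_module p) (Z_module p \<Theta>) (Z_incl p \<Theta>)" if c: "centralizer p \<Theta>" for \<Theta> :: "(nat \<Rightarrow> 'k) \<Rightarrow> nat \<Rightarrow> 'k"
    using bdd_operator_Z_incl[OF p c] bm[of "lp_module p" "lp_module p" "Z_module p \<Theta>" "Z_space p \<Theta>"]
    by (simp add: module_hom_def Z_module_simps[OF p c] carr_L[OF p c] act_L[OF p c] Z_incl_act[OF p c])
  have hq: "module_hom (Z_module p \<Theta>) (lp_module p) (Z_quot p)" if c: "centralizer p \<Theta>" for \<Theta> :: "(nat \<Rightarrow> 'k) \<Rightarrow> nat \<Rightarrow> 'k"
    using bdd_operator_Z_quot[OF p c] bm[of "Z_module p \<Theta>" "Z_space p \<Theta>" "lp_module p" "lp_module p"]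
    by (simp add: module_hom_def Z_module_simps[OF p c] act_L[OF p c] Z_quot_act[OF p c])
  have hc: "module_hom (Z_module p \<Phi>) (Z_module p \<Psi>) (\<lambda>u. Z_incl p \<Psi> (Z_quot p u))"
    using hi[OF \<Psi>] hq[OF \<Phi>] bdd_operator_compose[of "Z_module p \<Phi>" "lp_module p" "Z_quot p" "Z_module p \<Psi>" "Z_incl p \<Psi>"]
      quasi_banach_module_Z[OF p \<Phi>] quasinormed_lp[OF p, where 'k = 'k]
    by (auto simp: module_hom_def quasi_banach_module_def quasi_banach_quasinormed bdd_operator_carr)
  have un: "un_Sq (Sq x) = x" "un_Cl (Cl y) = y" for x :: "nat \<Rightarrow> 'k" and y :: "(nat \<Rightarrow> 'k pair) set" by simp_all
  have mZ: "quasi_banach_module (copy_module Cl un_Cl (Z_module p \<Theta>) :: ('k, ('k, 'u) univ) qmodule)"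
    if c: "centralizer p \<Theta>" for \<Theta> :: "(nat \<Rightarrow> 'k) \<Rightarrow> nat \<Rightarrow> 'k"
    by (rule quasi_banach_module_copy[of un_Cl Cl, OF un(2) quasi_banach_module_Z[OF p c]])
  have mL: "quasi_banach_module (ell_module p :: ('k, ('k, 'u) univ) qmodule)"
    unfolding ell_module_def by (rule quasi_banach_module_copy[of un_Sq Sq, OF un(1) quasi_banach_module_lp[OF p \<Phi>]])
  show ?thesis
    unfolding four_exact_def splice_module_def
    using mZ[OF \<Phi>] mZ[OF \<Psi>] mL module_hom_copy[of un_Sq Sq un_Cl Cl, OF un(1) un(2) hi[OF \<Phi>]] module_hom_copy[of un_Cl Cl un_Cl Cl, OF un(2) un(2) hc]
      module_hom_copy[of un_Cl Cl un_Sq Sq, OF un(2) un(1) hq[OF \<Psi>]]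
    by (simp add: copy_module_simps ell_module_simps Z_module_simps[OF p \<Phi>] Z_module_simps[OF p \<Psi>] splice_kernels[unfolded univ.inject]
        del: image_image) (simp add: ell_module_def)
qed

end

section \<open>An obstruction to triviality\<close>

lemma kernel_closed:
  assumes W: "quasinormed W" and U: "quasinormed U" and g: "bdd_operator W U g"
    and s: "\<And>n. s n \<in> carr W" "\<And>n. g (s n) = zer U" and w: "w \<in> carr W"
    and lim: "(\<lambda>n. qnorm W (dif W (s n) w)) \<longlonglongrightarrow> 0"
  shows "g w = zer U"
proof (rule qlimit_unique[OF U, where s = "\<lambda>n. g (s n)"])
  note l = quasinormed_linear[OF U]
  show "(\<lambda>n. qnorm U (dif U (g (s n)) (g w))) \<longlonglongrightarrow> 0" by (rule qlimit_operator[OF W U g w s(1) lim])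
  show "(\<lambda>n. qnorm U (dif U (g (s n)) (zer U))) \<longlonglongrightarrow> 0"
    by (simp add: s dif_self[OF l] zer_in[OF l] qnorm_zer[OF U])
qed (auto simp: bdd_operator_carr[OF g] w s zer_in[OF quasinormed_linear[OF U]])

text \<open>Exactness identifies the range with the kernel of a bounded operator, which is closed,
  as the open mapping theorem requires.\<close>

lemma exact_open_mapping:
  assumes V: "quasi_banach V" and W: "quasi_banach W" and U: "quasi_banach U"
    and f: "bdd_operator V W f" and g: "bdd_operator W U g"
    and ex: "{w \<in> carr W. g w = zer U} = f ` carr V"
  obtains D where "D \<ge> 1"
    "\<And>w. w \<in> carr W \<Longrightarrow> g w = zer U \<Longrightarrow> \<exists>v\<in>carr V. f v = w \<and> qnorm V v \<le> D * qnorm W w"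
proof -
  obtain D where D: "D \<ge> 1" "\<And>w. w \<in> f ` carr V \<Longrightarrow> \<exists>v\<in>carr V. f v = w \<and> qnorm V v \<le> D * qnorm W w"
  proof (rule open_mapping[OF V W f])
    fix s w assume "range s \<subseteq> f ` carr V" and w: "w \<in> carr W" "(\<lambda>n. qnorm W (dif W (s n) w)) \<longlonglongrightarrow> 0"
    then have "s n \<in> {w \<in> carr W. g w = zer U}" for n using ex by auto
    then have "g w = zer U"
      by (intro kernel_closed[OF quasi_banach_quasinormed[OF W] quasi_banach_quasinormed[OF U] g _ _ w]) auto
    then show "w \<in> f ` carr V" using ex w by auto
  qed blast
  show thesis by (rule that[OF D(1)], rule D(2)) (use ex in blast)
qed

lemma surjective_open_mapping:
  assumes V: "quasi_banach V" and W: "quasi_banach W" and f: "bdd_operator V W f" and ex: "carr W = f ` carr V"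
  obtains D where "D \<ge> 1" "\<And>w. w \<in> carr W \<Longrightarrow> \<exists>v\<in>carr V. f v = w \<and> qnorm V v \<le> D * qnorm W w"
  by (rule open_mapping[OF V W f]) (auto simp: ex[symmetric] that)

text \<open>Lifting finitely supported elements \<open>x\<close> of \<open>X\<close> to a four-term sequence. A lift consists of a
  bounded choice of preimages \<open>g x\<close> in the second middle term, and of bounded preimages \<open>k x T\<close> in the
  first one of the defects \<open>rel g x T\<close> of a restriction identity satisfied by \<open>pt\<close>. The combination \<open>syz\<close>
  annihilates every \<open>rel g\<close>, so that \<open>syz k\<close> takes values in the image of \<open>Y\<close>. For modules \<open>\<alpha> T\<close> is
  multiplication by half the indicator of \<open>T\<close> and \<open>sig\<close> is the identity; for spaces \<open>\<alpha> T\<close> is multiplication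
  by one half and \<open>sig T\<close> changes the signs off \<open>T\<close>.\<close>

locale test_complex =
  fixes obj :: "('k::real_normed_field, 'a, 'm) qspace_scheme \<Rightarrow> bool"
    and hom :: "('k, 'a, 'm) qspace_scheme \<Rightarrow> ('k, 'a, 'm) qspace_scheme \<Rightarrow> ('a \<Rightarrow> 'a) \<Rightarrow> bool"
    and \<alpha> :: "('k, 'a, 'm) qspace_scheme \<Rightarrow> nat set \<Rightarrow> 'a \<Rightarrow> 'a"
    and sig :: "nat set \<Rightarrow> (nat \<Rightarrow> 'k) \<Rightarrow> nat \<Rightarrow> 'k"
    and X :: "('k, 'a, 'm) qspace_scheme" and pt :: "(nat \<Rightarrow> 'k) \<Rightarrow> 'a"
  assumes obj_quasi_banach: "obj V \<Longrightarrow> quasi_banach V"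
    and hom_bdd: "hom V W f \<Longrightarrow> bdd_operator V W f"
    and alpha_in: "obj V \<Longrightarrow> v \<in> carr V \<Longrightarrow> \<alpha> V T v \<in> carr V"
    and alpha_add: "obj V \<Longrightarrow> v \<in> carr V \<Longrightarrow> w \<in> carr V \<Longrightarrow> \<alpha> V T (add V v w) = add V (\<alpha> V T v) (\<alpha> V T w)"
    and alpha_scl: "obj V \<Longrightarrow> v \<in> carr V \<Longrightarrow> \<alpha> V T (scl V c v) = scl V c (\<alpha> V T v)"
    and alpha_bound: "obj V \<Longrightarrow> \<exists>C\<ge>0. \<forall>T. \<forall>v\<in>carr V. qnorm V (\<alpha> V T v) \<le> C * qnorm V v"
    and alpha_alpha: "obj V \<Longrightarrow> v \<in> carr V \<Longrightarrow> e \<in> T \<Longrightarrow> \<alpha> V {e} (\<alpha> V T v) = scl V (1/2) (\<alpha> V {e} v)"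
    and alpha_hom: "obj V \<Longrightarrow> obj W \<Longrightarrow> hom V W f \<Longrightarrow> v \<in> carr V \<Longrightarrow> f (\<alpha> V T v) = \<alpha> W T (f v)"
    and sig_fin_supp: "x \<in> fin_supp \<Longrightarrow> sig T x \<in> fin_supp"
    and sig_commute: "sig S (sig T x) = sig T (sig S x)"
    and piece_sig: "piece T (sig S x) = sig S (piece T x)"
    and piece_sig_mem: "e \<in> T \<Longrightarrow> piece {e} (sig T x) = piece {e} x"
    and obj_X: "obj X"
    and pt_in: "x \<in> fin_supp \<Longrightarrow> pt x \<in> carr X"
    and qnorm_pt_sig: "x \<in> fin_supp \<Longrightarrow> qnorm X (pt (sig T x)) \<le> qnorm X (pt x)"
    and qnorm_pt_piece: "x \<in> fin_supp \<Longrightarrow> qnorm X (pt (piece T x)) \<le> qnorm X (pt x)"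
    and pt_rel: "x \<in> fin_supp \<Longrightarrow> \<alpha> X T (add X (pt x) (pt (sig T x))) = pt (piece T x)"
begin

lemma obj_quasinormed: "obj V \<Longrightarrow> quasinormed V" and obj_linear: "obj V \<Longrightarrow> linear_space V"
  using obj_quasi_banach quasi_banach_quasinormed quasi_banach_linear by blast+

lemma alpha_dif: "obj V \<Longrightarrow> v \<in> carr V \<Longrightarrow> w \<in> carr V \<Longrightarrow> \<alpha> V T (dif V v w) = dif V (\<alpha> V T v) (\<alpha> V T w)"
  by (simp add: dif_def alpha_add alpha_scl scl_in obj_linear)

abbreviation "N x \<equiv> qnorm X (pt x)"

lemma N_nonneg: "x \<in> fin_supp \<Longrightarrow> 0 \<le> N x"
  by (simp add: qnorm_nonneg obj_quasinormed obj_X pt_in)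

text \<open>In the module case this is \<open>1_T (g x) - g (1_T x)\<close>. Without multiplication
  by indicators, the projection is imitated by \<open>(x + sig T x) / 2\<close>, which uses scalars
  and a sign change only and again equals \<open>piece T x\<close>.\<close>

definition rel where
  "rel V g x T = dif V (\<alpha> V T (add V (g x) (g (sig T x)))) (g (piece T x))"

text \<open>In the module case this is \<open>1_e (k x T) + k (1_T x) {e} - k x {e}\<close>, a
  relation between relations. For spaces, averages over \<open>sig {e}\<close> and
  \<open>sig T\<close> take the place of the indicators.\<close>

definition syz where
  "syz V k x T e = dif V (add V (\<alpha> V {e} (add V (k x T) (k (sig {e} x) T))) (k (piece T x) {e}))
     (scl V (1/2) (add V (k x {e}) (k (sig T x) {e})))"

context
  fixes V assumes V: "obj V"
begin

private lemmas l = obj_linear[OF V]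

lemma rel_in: "(\<And>x. x \<in> fin_supp \<Longrightarrow> g x \<in> carr V) \<Longrightarrow> x \<in> fin_supp \<Longrightarrow> rel V g x T \<in> carr V"
  by (simp add: rel_def dif_in[OF l] add_in[OF l] alpha_in[OF V] sig_fin_supp piece_fin_supp)

lemma syz_in: "(\<And>x T. x \<in> fin_supp \<Longrightarrow> k x T \<in> carr V) \<Longrightarrow> x \<in> fin_supp \<Longrightarrow> syz V k x T e \<in> carr V"
  by (simp add: syz_def dif_in[OF l] add_in[OF l] scl_in[OF l] alpha_in[OF V] sig_fin_supp piece_fin_supp)

lemma rel_dif:
  assumes "\<And>x. x \<in> fin_supp \<Longrightarrow> g x \<in> carr V" "\<And>x. x \<in> fin_supp \<Longrightarrow> g' x \<in> carr V" "x \<in> fin_supp"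
  shows "rel V (\<lambda>x. dif V (g x) (g' x)) x T = dif V (rel V g x T) (rel V g' x T)"
  using assms
  by (simp add: rel_def dif_dif_dif[OF l] dif_add_add[OF l, symmetric] alpha_dif[OF V] dif_in[OF l] add_in[OF l]
      alpha_in[OF V] sig_fin_supp piece_fin_supp)

lemma syz_dif:
  assumes "\<And>x T. x \<in> fin_supp \<Longrightarrow> k x T \<in> carr V" "\<And>x T. x \<in> fin_supp \<Longrightarrow> k' x T \<in> carr V" "x \<in> fin_supp"
  shows "syz V (\<lambda>x T. dif V (k x T) (k' x T)) x T e = dif V (syz V k x T e) (syz V k' x T e)"
  using assms
  by (simp add: syz_def dif_def alpha_add[OF V] alpha_scl[OF V] scl_add[OF l] scl_scl[OF l] carr_add_ac[OF l]
      add_in[OF l] scl_in[OF l] alpha_in[OF V] sig_fin_supp piece_fin_supp)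

text \<open>The three terms are \<open>P - Q\<close>, \<open>Q - R\<close> and \<open>P - R\<close>.
  The factor one half in \<open>P\<close> comes from \<open>alpha_alpha\<close> in the first term
  and from the mean over \<open>sig T\<close> in the third; there the two copies of \<open>R\<close>
  agree because \<open>sig T\<close> fixes the coordinate \<open>e\<close>.\<close>

lemma syz_rel:
  assumes g: "\<And>x. x \<in> fin_supp \<Longrightarrow> g x \<in> carr V" and x: "x \<in> fin_supp" and e: "e \<in> T"
  shows "syz V (rel V g) x T e = zer V"
proof -
  note fs = sig_fin_supp piece_fin_supp
  have pp: "piece {e} (piece T x) = piece {e} x" using e by (auto simp: piece_def)
  define P where "P = scl V (1/2) (add V (\<alpha> V {e} (add V (g x) (g (sig {e} x))))
    (\<alpha> V {e} (add V (g (sig T x)) (g (sig {e} (sig T x))))))"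
  define Q where "Q = \<alpha> V {e} (add V (g (piece T x)) (g (sig {e} (piece T x))))"
  define R where "R = g (piece {e} x)"
  have c: "P \<in> carr V" "Q \<in> carr V" "R \<in> carr V"
    by (simp_all add: P_def Q_def R_def g x fs alpha_in[OF V] add_in[OF l] scl_in[OF l])
  have "\<alpha> V {e} (add V (rel V g x T) (rel V g (sig {e} x) T)) = dif V P Q"
    by (simp add: rel_def P_def Q_def g x fs alpha_in[OF V] add_in[OF l] scl_in[OF l] dif_add_add[OF l, symmetric]
        alpha_dif[OF V] alpha_add[OF V] alpha_alpha[OF V _ e] scl_add[OF l] carr_add_ac[OF l] piece_sig sig_commute[of T "{e}"])
  moreover have "rel V g (piece T x) {e} = dif V Q R" by (simp add: rel_def Q_def R_def pp)
  moreover have "scl V (1/2) (add V (rel V g x {e}) (rel V g (sig T x) {e})) = dif V P R"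
  proof -
    have "scl V (1/2) (add V R R) = scl V (1/2 + 1/2) R" by (simp only: scl_add[OF l c(3) c(3)] scl_plus[OF l c(3)])
    then have RR: "scl V (1/2) (add V R R) = R" by (simp add: scl_one[OF l c(3)])
    have "add V (rel V g x {e}) (rel V g (sig T x) {e})
        = dif V (add V (\<alpha> V {e} (add V (g x) (g (sig {e} x)))) (\<alpha> V {e} (add V (g (sig T x)) (g (sig {e} (sig T x)))))) (add V R R)"
      by (simp add: rel_def R_def piece_sig_mem[OF e] dif_add_add[OF l] g x fs alpha_in[OF V] add_in[OF l])
    then show ?thesis
      by (simp add: scl_dif[OF l] P_def RR g x fs alpha_in[OF V] add_in[OF l] c)
  qed
  ultimately show ?thesis
    by (simp add: syz_def dif_add_dif[OF l] c dif_self[OF l] dif_in[OF l])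
qed

text \<open>\<open>D\<close> depends on \<open>V\<close> alone. Uniformity in \<open>T\<close> is
  essential, since the sets in the final argument are chosen adaptively.\<close>

lemma rel_bound:
  obtains D where "D \<ge> 0" "\<And>g C x T. (\<And>x. x \<in> fin_supp \<Longrightarrow> g x \<in> carr V) \<Longrightarrow>
    (\<And>x. x \<in> fin_supp \<Longrightarrow> qnorm V (g x) \<le> C * N x) \<Longrightarrow> C \<ge> 0 \<Longrightarrow> x \<in> fin_supp \<Longrightarrow> qnorm V (rel V g x T) \<le> D * C * N x"
proof -
  obtain K where K: "K \<ge> 1"
    "\<And>x y. x \<in> carr V \<Longrightarrow> y \<in> carr V \<Longrightarrow> qnorm V (add V x y) \<le> K * (qnorm V x + qnorm V y)"
    "\<And>x y. x \<in> carr V \<Longrightarrow> y \<in> carr V \<Longrightarrow> qnorm V (dif V x y) \<le> K * (qnorm V x + qnorm V y)"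
    using quasi_triangle_obtain[OF obj_quasinormed[OF V]] by metis
  obtain A where A: "A \<ge> 0" "\<And>T v. v \<in> carr V \<Longrightarrow> qnorm V (\<alpha> V T v) \<le> A * qnorm V v" using alpha_bound[OF V] by blast
  have "qnorm V (rel V g x T) \<le> (K * (A * (K * 2) + 1)) * C * N x"
    if g: "\<And>x. x \<in> fin_supp \<Longrightarrow> g x \<in> carr V" "\<And>x. x \<in> fin_supp \<Longrightarrow> qnorm V (g x) \<le> C * N x"
      and C: "C \<ge> 0" and x: "x \<in> fin_supp" for g C x T
  proof -
    have 1: "qnorm V (g y) \<le> C * N x" if "y = x \<or> y = sig T x \<or> y = piece T x" for y
      using that g(2)[of y] mult_left_mono[OF qnorm_pt_sig[OF x, of T] C] mult_left_mono[OF qnorm_pt_piece[OF x, of T] C]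
        x sig_fin_supp[OF x, of T] piece_fin_supp[OF x, of T] by auto
    have gc: "g x \<in> carr V" "g (sig T x) \<in> carr V" "g (piece T x) \<in> carr V"
      by (simp_all add: g x sig_fin_supp piece_fin_supp)
    have "qnorm V (rel V g x T) \<le> K * (qnorm V (\<alpha> V T (add V (g x) (g (sig T x)))) + qnorm V (g (piece T x)))"
      unfolding rel_def by (intro K(3) alpha_in[OF V] add_in[OF l] gc)
    also have "\<dots> \<le> K * (A * (K * (C * N x + C * N x)) + C * N x)"
    proof (intro mult_left_mono add_mono)
      have "qnorm V (\<alpha> V T (add V (g x) (g (sig T x)))) \<le> A * qnorm V (add V (g x) (g (sig T x)))"
        by (intro A(2) add_in[OF l] gc)
      also have "\<dots> \<le> A * (K * (qnorm V (g x) + qnorm V (g (sig T x))))"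
        by (intro mult_left_mono K(2) gc A)
      also have "\<dots> \<le> A * (K * (C * N x + C * N x))"
        using K(1) by (intro mult_left_mono add_mono 1 A) auto
      finally show "qnorm V (\<alpha> V T (add V (g x) (g (sig T x)))) \<le> A * (K * (C * N x + C * N x))" .
      show "qnorm V (g (piece T x)) \<le> C * N x" by (intro 1) simp
    qed (use K in auto)
    finally show ?thesis by (simp add: algebra_simps)
  qed
  moreover have "K * (A * (K * 2) + 1) \<ge> 0" using K(1) A(1) by simp
  ultimately show thesis using that by blast
qed

end

lemma rel_hom:
  assumes "obj V" "obj W" "hom V W f" "\<And>x. x \<in> fin_supp \<Longrightarrow> g x \<in> carr V" "x \<in> fin_supp"
  shows "f (rel V g x T) = rel W (\<lambda>x. f (g x)) x T"
  using assms
  by (simp add: rel_def bdd_operator_dif[OF hom_bdd[OF assms(3)]] bdd_operator_add[OF hom_bdd[OF assms(3)]]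
      alpha_hom[OF assms(1-3)] alpha_in add_in obj_linear sig_fin_supp piece_fin_supp)

lemma syz_hom:
  assumes "obj V" "obj W" "hom V W f" "\<And>x T. x \<in> fin_supp \<Longrightarrow> k x T \<in> carr V" "x \<in> fin_supp"
  shows "f (syz V k x T e) = syz W (\<lambda>x T. f (k x T)) x T e"
  using assms
  by (simp add: syz_def bdd_operator_dif[OF hom_bdd[OF assms(3)]] bdd_operator_add[OF hom_bdd[OF assms(3)]]
      bdd_operator_scl[OF hom_bdd[OF assms(3)]]
      alpha_hom[OF assms(1-3)] alpha_in add_in scl_in obj_linear sig_fin_supp piece_fin_supp)

lemma rel_cong: "(\<And>x. x \<in> fin_supp \<Longrightarrow> g x = g' x) \<Longrightarrow> x \<in> fin_supp \<Longrightarrow> rel V g x T = rel V g' x T"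
  by (simp add: rel_def sig_fin_supp piece_fin_supp)

lemma syz_cong: "(\<And>x T. x \<in> fin_supp \<Longrightarrow> k x T = k' x T) \<Longrightarrow> x \<in> fin_supp \<Longrightarrow> syz V k x T e = syz V k' x T e"
  by (simp add: syz_def sig_fin_supp piece_fin_supp)

section \<open>Bounded lifts and their transport along arrows\<close>

definition is_lift where
  "is_lift E C g k \<longleftrightarrow> C \<ge> 0 \<and>
     (\<forall>x\<in>fin_supp. g x \<in> carr (mid2 E) \<and> qnorm (mid2 E) (g x) \<le> C * N x \<and> arr3 E (g x) = pt x) \<and>
     (\<forall>x\<in>fin_supp. \<forall>T. k x T \<in> carr (mid1 E) \<and> qnorm (mid1 E) (k x T) \<le> C * N x \<and>
        arr2 E (k x T) = rel (mid2 E) g x T)"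

text \<open>Asking for some lift with vanishing \<open>syz\<close> avoids any reference to
  \<open>Y\<close>. In this form the property can be carried along an arrow in both directions, as
  the generated equivalence relation demands.\<close>

definition unobstructed where
  "unobstructed E \<longleftrightarrow> (\<exists>C g k. is_lift E C g k \<and>
     (\<forall>x\<in>fin_supp. \<forall>T. \<forall>e\<in>T. syz (mid1 E) k x T e = zer (mid1 E)))"

lemma is_liftD:
  assumes "is_lift E C g k"
  shows "C \<ge> 0" "x \<in> fin_supp \<Longrightarrow> g x \<in> carr (mid2 E)" "x \<in> fin_supp \<Longrightarrow> qnorm (mid2 E) (g x) \<le> C * N x"
    "x \<in> fin_supp \<Longrightarrow> arr3 E (g x) = pt x" "x \<in> fin_supp \<Longrightarrow> k x T \<in> carr (mid1 E)"
    "x \<in> fin_supp \<Longrightarrow> qnorm (mid1 E) (k x T) \<le> C * N x" "x \<in> fin_supp \<Longrightarrow> arr2 E (k x T) = rel (mid2 E) g x T"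
  using assms by (auto simp: is_lift_def)

lemma bound_weaken: "a \<le> C * N x \<Longrightarrow> C \<le> D \<Longrightarrow> x \<in> fin_supp \<Longrightarrow> a \<le> D * N x"
  by (meson N_nonneg mult_right_mono order_trans)

text \<open>The last arrow is the identity, so \<open>pt\<close> itself is a lift, and its defects
  vanish by \<open>pt_rel\<close>.\<close>

lemma unobstructed_zero_seq:
  assumes Y: "obj Y" shows "unobstructed (zero_seq X Y)"
proof -
  note qY = obj_quasinormed[OF Y] and lY = obj_linear[OF Y] and lX = obj_linear[OF obj_X]
  have z: "\<alpha> Y T (zer Y) = zer Y" for T
    using alpha_scl[OF Y zer_in[OF lY], of T 0] by (simp add: scl_zer[OF lY] scl_zero[OF lY] alpha_in[OF Y] zer_in[OF lY])
  have "is_lift (zero_seq X Y) 1 pt (\<lambda>_ _. zer Y)"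
    by (simp add: is_lift_def zero_seq_def pt_in zer_in[OF lY] qnorm_zer[OF qY] N_nonneg rel_def pt_rel
        dif_self[OF lX] piece_fin_supp)
  moreover have "syz Y (\<lambda>_ _. zer Y) x T e = zer Y" for x T e
    by (simp add: syz_def zer_add[OF lY] zer_in[OF lY] z scl_zer[OF lY] dif_self[OF lY])
  ultimately show ?thesis unfolding unobstructed_def by (metis zero_seq_def fourterm.select_convs(1))
qed

lemma unobstructed_forward:
  assumes ar: "four_arrow obj hom X Y E F" and E: "unobstructed E"
  shows "unobstructed F"
proof -
  obtain C g k where L: "is_lift E C g k" and S: "\<And>x T e. x \<in> fin_supp \<Longrightarrow> e \<in> T \<Longrightarrow> syz (mid1 E) k x T e = zer (mid1 E)"
    using E by (auto simp: unobstructed_def)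
  from ar obtain u1 u2 where u: "hom (mid1 E) (mid1 F) u1" "hom (mid2 E) (mid2 F) u2"
    "\<And>e. e \<in> carr (mid1 E) \<Longrightarrow> u2 (arr2 E e) = arr2 F (u1 e)" "\<And>e. e \<in> carr (mid2 E) \<Longrightarrow> arr3 F (u2 e) = arr3 E e"
    and o: "obj (mid1 E)" "obj (mid2 E)" "obj (mid1 F)" "obj (mid2 F)"
    by (auto simp: four_arrow_def four_exact_def)
  obtain B1 where B1: "B1 \<ge> 1" "\<And>x. x \<in> carr (mid1 E) \<Longrightarrow> qnorm (mid1 F) (u1 x) \<le> B1 * qnorm (mid1 E) x"
    using bdd_operator_bound[OF hom_bdd[OF u(1)] obj_quasinormed[OF o(1)]] by metis
  obtain B2 where B2: "B2 \<ge> 1" "\<And>x. x \<in> carr (mid2 E) \<Longrightarrow> qnorm (mid2 F) (u2 x) \<le> B2 * qnorm (mid2 E) x"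
    using bdd_operator_bound[OF hom_bdd[OF u(2)] obj_quasinormed[OF o(2)]] by metis
  note D = is_liftD[OF L]
  have "is_lift F (B1 * C + B2 * C) (\<lambda>x. u2 (g x)) (\<lambda>x T. u1 (k x T))"
    unfolding is_lift_def
  proof (intro conjI ballI allI)
    show "0 \<le> B1 * C + B2 * C" using B1(1) B2(1) D(1) by simp
    fix x :: "nat \<Rightarrow> 'k" assume x: "x \<in> fin_supp"
    show "u2 (g x) \<in> carr (mid2 F)" by (rule bdd_operator_carr[OF hom_bdd[OF u(2)] D(2)[OF x]])
    have "qnorm (mid2 F) (u2 (g x)) \<le> (B2 * C) * N x"
      unfolding mult.assoc
      by (rule order_trans[OF B2(2)[OF D(2)[OF x]] mult_left_mono[OF D(3)[OF x]]]) (use B2(1) in simp)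
    then show "qnorm (mid2 F) (u2 (g x)) \<le> (B1 * C + B2 * C) * N x"
      by (rule bound_weaken) (use x B1(1) D(1) in auto)
    show "arr3 F (u2 (g x)) = pt x" using u(4)[OF D(2)[OF x]] D(4)[OF x] by simp
    fix T
    show "u1 (k x T) \<in> carr (mid1 F)" by (rule bdd_operator_carr[OF hom_bdd[OF u(1)] D(5)[OF x]])
    have "qnorm (mid1 F) (u1 (k x T)) \<le> (B1 * C) * N x"
      unfolding mult.assoc
      by (rule order_trans[OF B1(2)[OF D(5)[OF x]] mult_left_mono[OF D(6)[OF x]]]) (use B1(1) in simp)
    then show "qnorm (mid1 F) (u1 (k x T)) \<le> (B1 * C + B2 * C) * N x"
      by (rule bound_weaken) (use x B2(1) D(1) in auto)
    show "arr2 F (u1 (k x T)) = rel (mid2 F) (\<lambda>x. u2 (g x)) x T"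
      using u(3)[OF D(5)[OF x, of T]] D(7)[OF x] rel_hom[OF o(2,4) u(2) D(2) x] by simp
  qed
  moreover have "syz (mid1 F) (\<lambda>x T. u1 (k x T)) x T e = zer (mid1 F)" if "x \<in> fin_supp" "e \<in> T" for x T e
    using syz_hom[where k = k and T = T and e = e, OF o(1,3) u(1) D(5) that(1)] S[OF that]
      bdd_operator_zer[OF hom_bdd[OF u(1)] obj_linear[OF o(1)] obj_linear[OF o(3)]] by simp
  ultimately show ?thesis unfolding unobstructed_def by blast
qed

text \<open>The pushed-forward lift of \<open>E\<close> is compared with an unobstructed lift of
  \<open>F\<close>. The two choices of \<open>g\<close> differ by the image of a bounded
  \<open>l\<close>; the two choices of \<open>k\<close> then differ by \<open>rel l\<close>, which
  \<open>syz\<close> annihilates, and by the image of a bounded \<open>h\<close> with values in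
  \<open>Y\<close>. The resulting equation in \<open>F\<close> comes back to \<open>E\<close>
  because \<open>syz k\<close> already comes from \<open>Y\<close> there and \<open>arr1 F\<close>
  is injective.\<close>

lemma lift_coboundary:
  assumes ar: "four_arrow obj hom X Y E F" and F: "unobstructed F" and L: "is_lift E C g k"
  obtains D h where "D \<ge> 0" "\<And>x T. x \<in> fin_supp \<Longrightarrow> h x T \<in> carr Y" "\<And>x T. x \<in> fin_supp \<Longrightarrow> qnorm Y (h x T) \<le> D * N x"
    "\<And>x T e. x \<in> fin_supp \<Longrightarrow> e \<in> T \<Longrightarrow> syz (mid1 E) k x T e = arr1 E (syz Y h x T e)"
proof -
  obtain C' g' k' where L': "is_lift F C' g' k'" and S: "\<And>x T e. x \<in> fin_supp \<Longrightarrow> e \<in> T \<Longrightarrow> syz (mid1 F) k' x T e = zer (mid1 F)"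
    using F by (auto simp: unobstructed_def)
  from ar obtain u1 u2 where u: "hom (mid1 E) (mid1 F) u1" "hom (mid2 E) (mid2 F) u2"
    "\<And>y. y \<in> carr Y \<Longrightarrow> u1 (arr1 E y) = arr1 F y"
    "\<And>e. e \<in> carr (mid1 E) \<Longrightarrow> u2 (arr2 E e) = arr2 F (u1 e)" "\<And>e. e \<in> carr (mid2 E) \<Longrightarrow> arr3 F (u2 e) = arr3 E e"
    and o: "obj (mid1 E)" "obj (mid2 E)" "obj (mid1 F)" "obj (mid2 F)" "obj Y"
    and hE: "hom Y (mid1 E) (arr1 E)" "hom (mid1 E) (mid2 E) (arr2 E)" "hom (mid2 E) X (arr3 E)"
    and hF: "hom Y (mid1 F) (arr1 F)" "hom (mid1 F) (mid2 F) (arr2 F)" "hom (mid2 F) X (arr3 F)"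
    and e1: "{e \<in> carr (mid1 E). arr2 E e = zer (mid2 E)} = arr1 E ` carr Y"
    and f0: "{y \<in> carr Y. arr1 F y = zer (mid1 F)} = {zer Y}"
    and f1: "{e \<in> carr (mid1 F). arr2 F e = zer (mid2 F)} = arr1 F ` carr Y"
    and f2: "{e \<in> carr (mid2 F). arr3 F e = zer X} = arr2 F ` carr (mid1 F)"
    by (auto simp: four_arrow_def four_exact_def)
  note D = is_liftD[OF L] and D' = is_liftD[OF L']
  note lm = obj_linear[OF o(1)] obj_linear[OF o(2)] obj_linear[OF o(3)] obj_linear[OF o(4)]
  note lX = obj_linear[OF obj_X]
  obtain K1 where K1: "K1 \<ge> 1"
    "\<And>x y. x \<in> carr (mid1 F) \<Longrightarrow> y \<in> carr (mid1 F) \<Longrightarrow> qnorm (mid1 F) (dif (mid1 F) x y) \<le> K1 * (qnorm (mid1 F) x + qnorm (mid1 F) y)"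
    using quasi_triangle_obtain[OF obj_quasinormed[OF o(3)]] by metis
  obtain K2 where K2: "K2 \<ge> 1"
    "\<And>x y. x \<in> carr (mid2 F) \<Longrightarrow> y \<in> carr (mid2 F) \<Longrightarrow> qnorm (mid2 F) (dif (mid2 F) x y) \<le> K2 * (qnorm (mid2 F) x + qnorm (mid2 F) y)"
    using quasi_triangle_obtain[OF obj_quasinormed[OF o(4)]] by metis
  obtain B1 where B1: "B1 \<ge> 1" "\<And>x. x \<in> carr (mid1 E) \<Longrightarrow> qnorm (mid1 F) (u1 x) \<le> B1 * qnorm (mid1 E) x"
    using bdd_operator_bound[OF hom_bdd[OF u(1)] obj_quasinormed[OF o(1)]] by metis
  obtain B2 where B2: "B2 \<ge> 1" "\<And>x. x \<in> carr (mid2 E) \<Longrightarrow> qnorm (mid2 F) (u2 x) \<le> B2 * qnorm (mid2 E) x"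
    using bdd_operator_bound[OF hom_bdd[OF u(2)] obj_quasinormed[OF o(2)]] by metis
  obtain M1 where M1: "M1 \<ge> 1" "\<And>w. w \<in> carr (mid1 F) \<Longrightarrow> arr2 F w = zer (mid2 F) \<Longrightarrow>
      \<exists>v\<in>carr Y. arr1 F v = w \<and> qnorm Y v \<le> M1 * qnorm (mid1 F) w"
    using exact_open_mapping[OF obj_quasi_banach[OF o(5)] obj_quasi_banach[OF o(3)] obj_quasi_banach[OF o(4)]
        hom_bdd[OF hF(1)] hom_bdd[OF hF(2)] f1] by metis
  obtain M2 where M2: "M2 \<ge> 1" "\<And>w. w \<in> carr (mid2 F) \<Longrightarrow> arr3 F w = zer X \<Longrightarrow>
      \<exists>v\<in>carr (mid1 F). arr2 F v = w \<and> qnorm (mid1 F) v \<le> M2 * qnorm (mid2 F) w"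
    using exact_open_mapping[OF obj_quasi_banach[OF o(3)] obj_quasi_banach[OF o(4)] obj_quasi_banach[OF obj_X]
        hom_bdd[OF hF(2)] hom_bdd[OF hF(3)] f2] by metis
  define C2 where "C2 = M2 * (K2 * (B2 * C + C'))"
  have C2: "C2 \<ge> 0" using M2(1) K2(1) B2(1) D(1) D'(1) by (simp add: C2_def)
  have ug: "u2 (g x) \<in> carr (mid2 F)" if "x \<in> fin_supp" for x
    by (rule bdd_operator_carr[OF hom_bdd[OF u(2)] D(2)[OF that]])
  have uk: "u1 (k x T) \<in> carr (mid1 F)" if "x \<in> fin_supp" for x T
    by (rule bdd_operator_carr[OF hom_bdd[OF u(1)] D(5)[OF that]])
  have "\<exists>v\<in>carr (mid1 F). arr2 F v = dif (mid2 F) (u2 (g x)) (g' x) \<and> qnorm (mid1 F) v \<le> C2 * N x" if x: "x \<in> fin_supp" for x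
  proof -
    let ?w = "dif (mid2 F) (u2 (g x)) (g' x)"
    have w: "?w \<in> carr (mid2 F)" by (intro dif_in[OF lm(4)] ug D'(2) x)
    have "arr3 F ?w = zer X"
      using bdd_operator_dif[OF hom_bdd[OF hF(3)] lm(4) ug[OF x] D'(2)[OF x]] u(5)[OF D(2)[OF x]] D(4)[OF x] D'(4)[OF x]
        dif_self[OF lX pt_in[OF x]] by simp
    then obtain v where v: "v \<in> carr (mid1 F)" "arr2 F v = ?w" "qnorm (mid1 F) v \<le> M2 * qnorm (mid2 F) ?w"
      using M2(2)[OF w] by blast
    have "qnorm (mid2 F) ?w \<le> K2 * (qnorm (mid2 F) (u2 (g x)) + qnorm (mid2 F) (g' x))"
      by (intro K2(2) ug D'(2) x)
    also have "\<dots> \<le> K2 * (B2 * (C * N x) + C' * N x)"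
      using K2(1) B2(1) by (intro mult_left_mono add_mono order_trans[OF B2(2)[OF D(2)[OF x]]] D(3) D'(3) x) auto
    finally have "M2 * qnorm (mid2 F) ?w \<le> M2 * (K2 * (B2 * (C * N x) + C' * N x))"
      using M2(1) by (intro mult_left_mono) auto
    also have "\<dots> = C2 * N x" by (simp add: C2_def algebra_simps)
    finally show ?thesis using v by (meson order_trans)
  qed
  then obtain l where l: "\<And>x. x \<in> fin_supp \<Longrightarrow> l x \<in> carr (mid1 F)"
    "\<And>x. x \<in> fin_supp \<Longrightarrow> arr2 F (l x) = dif (mid2 F) (u2 (g x)) (g' x)" "\<And>x. x \<in> fin_supp \<Longrightarrow> qnorm (mid1 F) (l x) \<le> C2 * N x"
    by metis
  obtain R where R: "R \<ge> 0" "\<And>x T. x \<in> fin_supp \<Longrightarrow> qnorm (mid1 F) (rel (mid1 F) l x T) \<le> R * C2 * N x"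
    using rel_bound[OF o(3)] l C2 by metis
  \<comment> \<open>What is left of the difference of the two \<open>k\<close> after removing the
    part caused by the different choices of \<open>g\<close>; it lies in the kernel of
    \<open>arr2 F\<close>.\<close>
  define W where "W x T = dif (mid1 F) (dif (mid1 F) (u1 (k x T)) (k' x T)) (rel (mid1 F) l x T)" for x T
  have Wc: "W x T \<in> carr (mid1 F)" if x: "x \<in> fin_supp" for x T
    unfolding W_def by (intro dif_in[OF lm(3)] uk D'(5) x rel_in[OF o(3)] l)
  have Wz: "arr2 F (W x T) = zer (mid2 F)" if x: "x \<in> fin_supp" for x T
  proof -
    note d = bdd_operator_dif[OF hom_bdd[OF hF(2)] lm(3)]
    have "arr2 F (W x T) = dif (mid2 F) (dif (mid2 F) (arr2 F (u1 (k x T))) (arr2 F (k' x T))) (arr2 F (rel (mid1 F) l x T))"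
      unfolding W_def by (simp add: d dif_in[OF lm(3)] uk D'(5) x rel_in[OF o(3)] l)
    also have "arr2 F (u1 (k x T)) = rel (mid2 F) (\<lambda>x. u2 (g x)) x T"
      using u(4)[OF D(5)[OF x, of T]] D(7)[OF x] rel_hom[OF o(2,4) u(2) D(2) x] by simp
    also have "arr2 F (k' x T) = rel (mid2 F) g' x T" by (rule D'(7)[OF x])
    also have "arr2 F (rel (mid1 F) l x T) = rel (mid2 F) (\<lambda>x. dif (mid2 F) (u2 (g x)) (g' x)) x T"
      using rel_hom[OF o(3,4) hF(2) l(1) x, where T = T] rel_cong[OF l(2) x] by simp
    also have "\<dots> = dif (mid2 F) (rel (mid2 F) (\<lambda>x. u2 (g x)) x T) (rel (mid2 F) g' x T)"
      by (rule rel_dif[OF o(4) ug D'(2) x])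
    finally show ?thesis
      by (simp add: dif_self[OF lm(4)] dif_in[OF lm(4)] rel_in[OF o(4)] ug D'(2) x)
  qed
  define C3 where "C3 = M1 * (K1 * (K1 * (B1 * C + C') + R * C2))"
  have C3: "C3 \<ge> 0" using M1(1) K1(1) B1(1) D(1) D'(1) R(1) C2 by (simp add: C3_def)
  have "\<exists>v\<in>carr Y. arr1 F v = W x T \<and> qnorm Y v \<le> C3 * N x" if x: "x \<in> fin_supp" for x T
  proof -
    obtain v where v: "v \<in> carr Y" "arr1 F v = W x T" "qnorm Y v \<le> M1 * qnorm (mid1 F) (W x T)"
      using M1(2)[OF Wc[OF x] Wz[OF x]] by blast
    have "qnorm (mid1 F) (W x T) \<le> K1 * (qnorm (mid1 F) (dif (mid1 F) (u1 (k x T)) (k' x T)) + qnorm (mid1 F) (rel (mid1 F) l x T))"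
      unfolding W_def by (intro K1(2) dif_in[OF lm(3)] uk D'(5) x rel_in[OF o(3)] l)
    also have "\<dots> \<le> K1 * (K1 * (B1 * (C * N x) + C' * N x) + R * C2 * N x)"
    proof (intro mult_left_mono add_mono R(2) x)
      have "qnorm (mid1 F) (dif (mid1 F) (u1 (k x T)) (k' x T)) \<le> K1 * (qnorm (mid1 F) (u1 (k x T)) + qnorm (mid1 F) (k' x T))"
        by (intro K1(2) uk D'(5) x)
      also have "\<dots> \<le> K1 * (B1 * (C * N x) + C' * N x)"
        using K1(1) B1(1) by (intro mult_left_mono add_mono order_trans[OF B1(2)[OF D(5)[OF x]]] D(6) D'(6) x) auto
      finally show "qnorm (mid1 F) (dif (mid1 F) (u1 (k x T)) (k' x T)) \<le> K1 * (B1 * (C * N x) + C' * N x)" .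
    qed (use K1 in auto)
    finally have "M1 * qnorm (mid1 F) (W x T) \<le> M1 * (K1 * (K1 * (B1 * (C * N x) + C' * N x) + R * C2 * N x))"
      using M1(1) by (intro mult_left_mono) auto
    also have "\<dots> = C3 * N x" by (simp add: C3_def algebra_simps)
    finally show ?thesis using v by (meson order_trans)
  qed
  then obtain h where h: "\<And>x T. x \<in> fin_supp \<Longrightarrow> h x T \<in> carr Y" "\<And>x T. x \<in> fin_supp \<Longrightarrow> arr1 F (h x T) = W x T"
    "\<And>x T. x \<in> fin_supp \<Longrightarrow> qnorm Y (h x T) \<le> C3 * N x"
    by metis
  have main: "syz (mid1 E) k x T e = arr1 E (syz Y h x T e)" if x: "x \<in> fin_supp" and e: "e \<in> T" for x T e
  proof -
    have "arr2 E (syz (mid1 E) k x T e) = zer (mid2 E)"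
      using syz_hom[OF o(1,2) hE(2) D(5) x, where T = T and e = e] syz_cong[OF D(7) x] syz_rel[OF o(2) D(2) x e] by simp
    then have "syz (mid1 E) k x T e \<in> {e \<in> carr (mid1 E). arr2 E e = zer (mid2 E)}"
      using syz_in[OF o(1) D(5) x, where T = T and e = e] by simp
    then obtain y where y: "y \<in> carr Y" "syz (mid1 E) k x T e = arr1 E y" unfolding e1 by (rule imageE)
    have "arr1 F y = u1 (syz (mid1 E) k x T e)" using u(3)[OF y(1)] y(2) by simp
    also have "\<dots> = syz (mid1 F) (\<lambda>x T. u1 (k x T)) x T e" by (rule syz_hom[OF o(1,3) u(1) D(5) x])
    also have "\<dots> = syz (mid1 F) W x T e"
    proof -
      have "syz (mid1 F) W x T e = dif (mid1 F) (dif (mid1 F) (syz (mid1 F) (\<lambda>x T. u1 (k x T)) x T e) (syz (mid1 F) k' x T e))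
          (syz (mid1 F) (rel (mid1 F) l) x T e)"
        unfolding W_def
        by (simp add: syz_dif[OF o(3)] dif_in[OF lm(3)] uk D'(5) x rel_in[OF o(3)] l)
      then show ?thesis
        by (simp add: S[OF x e] syz_rel[OF o(3) l(1) x e] dif_zer[OF lm(3)] dif_in[OF lm(3)] zer_in[OF lm(3)] syz_in[OF o(3)] uk x)
    qed
    also have "\<dots> = arr1 F (syz Y h x T e)"
      using syz_hom[OF o(5,3) hF(1) h(1) x, where T = T and e = e] syz_cong[OF h(2) x] by simp
    finally have eq: "arr1 F y = arr1 F (syz Y h x T e)" .
    have sy: "syz Y h x T e \<in> carr Y" by (rule syz_in[OF o(5) h(1) x])
    have lY: "linear_space Y" by (rule obj_linear[OF o(5)])
    have "arr1 F (dif Y y (syz Y h x T e)) = zer (mid1 F)"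
      using bdd_operator_dif[OF hom_bdd[OF hF(1)] lY y(1) sy] eq
        dif_self[OF lm(3) bdd_operator_carr[OF hom_bdd[OF hF(1)] sy]] by simp
    then have "dif Y y (syz Y h x T e) \<in> {y \<in> carr Y. arr1 F y = zer (mid1 F)}" using dif_in[OF lY y(1) sy] by simp
    then have "dif Y y (syz Y h x T e) = zer Y" unfolding f0 by simp
    then show ?thesis using y dif_eq_zer_iff[OF lY y(1) sy] by simp
  qed
  show thesis by (rule that[OF C3 h(1) h(3) main])
qed

text \<open>Both selections are bounded by open mapping: \<open>g\<close> for the surjection onto
  \<open>X\<close>, and \<open>k\<close> because the defects of \<open>g\<close> lie in the kernel
  of \<open>arr3 E\<close> by \<open>pt_rel\<close>.\<close>

lemma lift_exists:
  assumes ex: "four_exact obj hom X Y E" obtains C g k where "is_lift E C g k"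
proof -
  have o: "obj (mid1 E)" "obj (mid2 E)" and h: "hom (mid1 E) (mid2 E) (arr2 E)" "hom (mid2 E) X (arr3 E)"
    and e2: "{e \<in> carr (mid2 E). arr3 E e = zer X} = arr2 E ` carr (mid1 E)" and e3: "carr X = arr3 E ` carr (mid2 E)"
    using ex by (simp_all add: four_exact_def)
  obtain M1 where M1: "M1 \<ge> 1" "\<And>w. w \<in> carr (mid2 E) \<Longrightarrow> arr3 E w = zer X \<Longrightarrow>
      \<exists>v\<in>carr (mid1 E). arr2 E v = w \<and> qnorm (mid1 E) v \<le> M1 * qnorm (mid2 E) w"
    using exact_open_mapping[OF obj_quasi_banach[OF o(1)] obj_quasi_banach[OF o(2)] obj_quasi_banach[OF obj_X]
        hom_bdd[OF h(1)] hom_bdd[OF h(2)] e2] by metis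
  obtain M2 where M2: "M2 \<ge> 1" "\<And>w. w \<in> carr X \<Longrightarrow> \<exists>v\<in>carr (mid2 E). arr3 E v = w \<and> qnorm (mid2 E) v \<le> M2 * qnorm X w"
    using surjective_open_mapping[OF obj_quasi_banach[OF o(2)] obj_quasi_banach[OF obj_X] hom_bdd[OF h(2)] e3] by metis
  obtain g where g: "\<And>x. x \<in> fin_supp \<Longrightarrow> g x \<in> carr (mid2 E)" "\<And>x. x \<in> fin_supp \<Longrightarrow> arr3 E (g x) = pt x"
    "\<And>x. x \<in> fin_supp \<Longrightarrow> qnorm (mid2 E) (g x) \<le> M2 * N x"
    using M2(2)[OF pt_in] by metis
  obtain R where R: "R \<ge> 0" "\<And>x T. x \<in> fin_supp \<Longrightarrow> qnorm (mid2 E) (rel (mid2 E) g x T) \<le> R * M2 * N x"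
  proof (rule rel_bound[OF o(2)])
    fix R assume "R \<ge> 0" and R: "\<And>g C x T. (\<And>x. x \<in> fin_supp \<Longrightarrow> g x \<in> carr (mid2 E)) \<Longrightarrow>
      (\<And>x. x \<in> fin_supp \<Longrightarrow> qnorm (mid2 E) (g x) \<le> C * N x) \<Longrightarrow> C \<ge> 0 \<Longrightarrow> x \<in> fin_supp \<Longrightarrow>
      qnorm (mid2 E) (rel (mid2 E) g x T) \<le> R * C * N x"
    have "M2 \<ge> 0" using M2(1) by simp
    then show thesis using that[OF \<open>R \<ge> 0\<close>] R[OF g(1,3)] by blast
  qed
  have z: "arr3 E (rel (mid2 E) g x T) = zer X" if x: "x \<in> fin_supp" for x T
    using rel_hom[where g = g and T = T, OF o(2) obj_X h(2) g(1) x]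
      rel_cong[where g = "\<lambda>x. arr3 E (g x)" and g' = pt and V = X and T = T, OF g(2) x]
    by (simp add: rel_def pt_rel x dif_self obj_linear obj_X pt_in piece_fin_supp)
  obtain k where k: "\<And>x T. x \<in> fin_supp \<Longrightarrow> k x T \<in> carr (mid1 E)" "\<And>x T. x \<in> fin_supp \<Longrightarrow> arr2 E (k x T) = rel (mid2 E) g x T"
    "\<And>x T. x \<in> fin_supp \<Longrightarrow> qnorm (mid1 E) (k x T) \<le> M1 * qnorm (mid2 E) (rel (mid2 E) g x T)"
    using M1(2)[OF rel_in[OF o(2) g(1)] z] by metis
  define C where "C = M1 * (R * M2) + M2"
  have "qnorm (mid1 E) (k x T) \<le> C * N x" if x: "x \<in> fin_supp" for x T
  proof (rule bound_weaken[OF _ _ x])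
    show "qnorm (mid1 E) (k x T) \<le> (M1 * (R * M2)) * N x"
      unfolding mult.assoc
      by (rule order_trans[OF k(3)[OF x] mult_left_mono[OF R(2)[OF x, unfolded mult.assoc]]]) (use M1(1) in simp)
    show "M1 * (R * M2) \<le> C" using M2(1) by (simp add: C_def)
  qed
  moreover have "qnorm (mid2 E) (g x) \<le> C * N x" if x: "x \<in> fin_supp" for x
    by (rule bound_weaken[OF g(3)[OF x] _ x]) (use M1(1) M2(1) R(1) in \<open>simp add: C_def\<close>)
  moreover have "C \<ge> 0" using M1(1) M2(1) R(1) by (simp add: C_def)
  ultimately have "is_lift E C g k" using g k by (simp add: is_lift_def)
  then show thesis using that by blast
qed

text \<open>Take any lift of \<open>E\<close> and correct it: subtracting
  \<open>arr1 E (h x T)\<close> from \<open>k x T\<close> preserves its image under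
  \<open>arr2 E\<close> and its boundedness, and it cancels \<open>syz\<close>.\<close>

lemma unobstructed_backward:
  assumes ar: "four_arrow obj hom X Y E F" and F: "unobstructed F"
  shows "unobstructed E"
proof -
  have ex: "four_exact obj hom X Y E" using ar by (simp add: four_arrow_def)
  obtain C g k where L: "is_lift E C g k" using lift_exists[OF ex] .
  obtain D h where h: "D \<ge> 0" "\<And>x T. x \<in> fin_supp \<Longrightarrow> h x T \<in> carr Y" "\<And>x T. x \<in> fin_supp \<Longrightarrow> qnorm Y (h x T) \<le> D * N x"
    "\<And>x T e. x \<in> fin_supp \<Longrightarrow> e \<in> T \<Longrightarrow> syz (mid1 E) k x T e = arr1 E (syz Y h x T e)"
    using lift_coboundary[OF ar F L] by metis
  have o: "obj Y" "obj (mid1 E)" "obj (mid2 E)" and hom: "hom Y (mid1 E) (arr1 E)" "hom (mid1 E) (mid2 E) (arr2 E)"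
    and e1: "{e \<in> carr (mid1 E). arr2 E e = zer (mid2 E)} = arr1 E ` carr Y"
    using ex by (simp_all add: four_exact_def)
  note I = is_liftD[OF L] and lE = obj_linear[OF o(2)]
  obtain K where K: "K \<ge> 1"
    "\<And>x y. x \<in> carr (mid1 E) \<Longrightarrow> y \<in> carr (mid1 E) \<Longrightarrow> qnorm (mid1 E) (dif (mid1 E) x y) \<le> K * (qnorm (mid1 E) x + qnorm (mid1 E) y)"
    using quasi_triangle_obtain[OF obj_quasinormed[OF o(2)]] by metis
  obtain B where B: "B \<ge> 1" "\<And>x. x \<in> carr Y \<Longrightarrow> qnorm (mid1 E) (arr1 E x) \<le> B * qnorm Y x"
    using bdd_operator_bound[OF hom_bdd[OF hom(1)] obj_quasinormed[OF o(1)]] by metis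
  have ah: "arr1 E (h x T) \<in> carr (mid1 E)" "arr2 E (arr1 E (h x T)) = zer (mid2 E)" if "x \<in> fin_supp" for x T
  proof -
    have "arr1 E (h x T) \<in> {e \<in> carr (mid1 E). arr2 E e = zer (mid2 E)}"
      unfolding e1 by (intro imageI h that)
    then show "arr1 E (h x T) \<in> carr (mid1 E)" "arr2 E (arr1 E (h x T)) = zer (mid2 E)" by simp_all
  qed
  define k' where "k' x T = dif (mid1 E) (k x T) (arr1 E (h x T))" for x T
  have "is_lift E (K * (C + B * D) + C) g k'"
    unfolding is_lift_def
  proof (intro conjI ballI allI)
    show "0 \<le> K * (C + B * D) + C" using K(1) I(1) B(1) h(1) by simp
    fix x :: "nat \<Rightarrow> 'k" assume x: "x \<in> fin_supp"
    show "g x \<in> carr (mid2 E)" "arr3 E (g x) = pt x" using I x by auto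
    show "qnorm (mid2 E) (g x) \<le> (K * (C + B * D) + C) * N x"
      by (rule bound_weaken[OF I(3)[OF x] _ x]) (use K(1) I(1) B(1) h(1) in simp)
    fix T
    show "k' x T \<in> carr (mid1 E)" unfolding k'_def by (intro dif_in[OF lE] I(5) ah x)
    have "qnorm (mid1 E) (k' x T) \<le> K * (qnorm (mid1 E) (k x T) + qnorm (mid1 E) (arr1 E (h x T)))"
      unfolding k'_def by (intro K(2) I(5) ah x)
    also have "\<dots> \<le> K * (C * N x + B * (D * N x))"
      using K(1) B(1) by (intro mult_left_mono add_mono I(6) x order_trans[OF B(2)[OF h(2)[OF x]]] h(3)) auto
    also have "\<dots> = (K * (C + B * D)) * N x" by (simp add: algebra_simps)
    finally show "qnorm (mid1 E) (k' x T) \<le> (K * (C + B * D) + C) * N x"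
      by (rule bound_weaken) (use x I(1) in auto)
    show "arr2 E (k' x T) = rel (mid2 E) g x T"
      using bdd_operator_dif[OF hom_bdd[OF hom(2)] lE I(5)[OF x] ah(1)[OF x], of T T] I(7)[OF x, of T] ah(2)[OF x, of T]
        dif_zer[OF obj_linear[OF o(3)] rel_in[OF o(3) I(2) x]] by (simp add: k'_def)
  qed
  moreover have "syz (mid1 E) k' x T e = zer (mid1 E)" if x: "x \<in> fin_supp" and e: "e \<in> T" for x T e
  proof -
    have "syz (mid1 E) k' x T e = dif (mid1 E) (syz (mid1 E) k x T e) (syz (mid1 E) (\<lambda>x T. arr1 E (h x T)) x T e)"
      unfolding k'_def by (rule syz_dif[OF o(2) I(5) ah(1) x])
    also have "syz (mid1 E) (\<lambda>x T. arr1 E (h x T)) x T e = arr1 E (syz Y h x T e)"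
      using syz_hom[OF o(1,2) hom(1) h(2) x] by simp
    also have "arr1 E (syz Y h x T e) = syz (mid1 E) k x T e" using h(4)[OF x e] ..
    finally show ?thesis using dif_self[OF lE syz_in[OF o(2) I(5) x, where T = T and e = e]] by simp
  qed
  ultimately show ?thesis unfolding unobstructed_def by blast
qed

theorem trivial_unobstructed:
  assumes Y: "obj Y" and tr: "equivclp (four_arrow obj hom X Y) (zero_seq X Y) E"
  shows "unobstructed E"
  using tr
proof (induction rule: equivclp_induct)
  case base
  show ?case by (rule unobstructed_zero_seq[OF Y])
next
  case (step F G)
  then show ?case using unobstructed_forward unobstructed_backward by blast
qed

text \<open>Being unobstructed concerns some lift. Comparison along the identity arrow of
  \<open>E\<close> transfers the conclusion to any prescribed lift, in particular to an explicit
  one.\<close>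

theorem trivial_coboundary:
  assumes ex: "four_exact obj hom X Y E" and tr: "four_class obj hom X Y E = four_class obj hom X Y (zero_seq X Y)"
    and hom_id: "\<And>V. obj V \<Longrightarrow> hom V V (\<lambda>v. v)" and L: "is_lift E C g k"
  obtains D h where "D \<ge> 0" "\<And>x T. x \<in> fin_supp \<Longrightarrow> h x T \<in> carr Y" "\<And>x T. x \<in> fin_supp \<Longrightarrow> qnorm Y (h x T) \<le> D * N x"
    "\<And>x T e. x \<in> fin_supp \<Longrightarrow> e \<in> T \<Longrightarrow> syz (mid1 E) k x T e = arr1 E (syz Y h x T e)"
proof -
  have Y: "obj Y" and o: "obj (mid1 E)" "obj (mid2 E)" using ex by (simp_all add: four_exact_def)
  have "E \<in> four_class obj hom X Y (zero_seq X Y)" unfolding tr[symmetric] by (simp add: four_class_def)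
  then have "unobstructed E" using trivial_unobstructed[OF Y] by (simp add: four_class_def)
  moreover have "four_arrow obj hom X Y E E"
    unfolding four_arrow_def using ex hom_id[OF o(1)] hom_id[OF o(2)] by blast
  ultimately show thesis using lift_coboundary[OF _ _ L] that by metis
qed

end

section \<open>The coboundary equation for the spliced sequence\<close>

text \<open>The logarithms see absolute values only. Hence sign changes commute with these
  centralizers exactly, not merely up to a bounded error.\<close>

lemma Omega_tilde_unimodular:
  fixes x u :: "nat \<Rightarrow> 'k::real_normed_field"
  assumes "partition_on UNIV \<A>" "x \<in> fin_supp" "\<And>n. norm (u n) = 1"
  shows "Omega_tilde \<A> p (\<lambda>n. u n * x n) = (\<lambda>n. u n * Omega_tilde \<A> p x n)"
proof
  fix n
  have "lp_norm p (piece B (\<lambda>n. u n * x n)) = lp_norm p (piece B x)" for B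
    unfolding lp_norm_def piece_def by (simp add: norm_mult assms(3) if_distrib[of norm] cong: if_cong)
  moreover have "lp_norm p (\<lambda>n. u n * x n) = lp_norm p x"
    unfolding lp_norm_def by (simp add: norm_mult assms(3))
  ultimately show "Omega_tilde \<A> p (\<lambda>n. u n * x n) n = u n * Omega_tilde \<A> p x n"
    by (simp add: Omega_tilde_nth[OF assms(1)] fin_supp_mult assms(2) mult.left_commute)
qed

lemma Omega_unimodular:
  fixes x u :: "nat \<Rightarrow> 'k::real_normed_field"
  assumes "p > 0" "x \<in> fin_supp" "\<And>n. norm (u n) = 1"
  shows "Omega p (\<lambda>n. u n * x n) = (\<lambda>n. u n * Omega p x n)"
  using Omega_tilde_unimodular[OF partition_singletons assms(2,3)] assms
  by (simp add: Omega_eq_Omega_tilde fin_supp_mult)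

lemma Omega_fin_supp: "p > 0 \<Longrightarrow> x \<in> fin_supp \<Longrightarrow> Omega p x \<in> fin_supp"
  by (simp add: Omega_eq_Omega_tilde Omega_tilde_fin_supp[OF partition_singletons])

text \<open>Where such a vector does not vanish, its piece is the whole vector and the logarithm is
  0. This removes the terms of \<open>syz\<close> in which \<open>{e}\<close> takes the place of
  \<open>T\<close>.\<close>

lemma Omega_tilde_supported_at_point:
  assumes "partition_on UNIV \<A>" "x \<in> fin_supp" "\<And>n. n \<noteq> e \<Longrightarrow> x n = 0"
  shows "Omega_tilde \<A> p x = (\<lambda>_. 0)"
proof
  fix n
  have "x n \<noteq> 0 \<Longrightarrow> piece (cell \<A> n) x = x"
    using assms(3) cell_mem(2)[OF assms(1), of n] by (auto simp: piece_def fun_eq_iff) metis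
  then show "Omega_tilde \<A> p x n = 0"
    by (cases "x n = 0"; cases "lp_norm p x = 0") (auto simp: Omega_tilde_nth[OF assms(1,2)])
qed

text \<open>The first component of \<open>rel\<close> for the lift
  \<open>x \<mapsto> (\<Omega> x, x)\<close>; the second component of \<open>rel\<close> is 0
  there.\<close>

definition defect :: "real \<Rightarrow> (nat \<Rightarrow> 'k::real_normed_field) \<Rightarrow> nat set \<Rightarrow> nat \<Rightarrow> 'k" where
  "defect p x T = (\<lambda>n. piece T (Omega p x) n - Omega p (piece T x) n)"

lemma defect_fin_supp: "p > 0 \<Longrightarrow> x \<in> fin_supp \<Longrightarrow> defect p x T \<in> fin_supp"
  unfolding defect_def by (intro fin_supp_diff piece_fin_supp Omega_fin_supp) auto

lemma defect_bound:
  assumes p: "p > 0"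
  obtains C where "C \<ge> 1" "\<And>(x :: nat \<Rightarrow> 'k::real_normed_field) T. x \<in> fin_supp \<Longrightarrow> lp_norm p (defect p x T) \<le> C * lp_norm p x"
proof -
  obtain C where C: "C \<ge> 1" "\<And>a x :: nat \<Rightarrow> 'k. a \<in> linf \<Longrightarrow> x \<in> fin_supp \<Longrightarrow>
    lp_norm p (\<lambda>n. Omega p (\<lambda>m. a m * x m) n - a n * Omega p x n) \<le> C * linf_norm a * lp_norm p x"
    using centralizer_bound[OF centralizer_Omega[OF p] p] by metis
  have "lp_norm p (defect p x T) \<le> C * lp_norm p x" if x: "x \<in> fin_supp" for x :: "nat \<Rightarrow> 'k" and T
  proof -
    define a :: "nat \<Rightarrow> 'k" where "a n = (if n \<in> T then 1 else 0)" for n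
    have a: "a \<in> linf" "linf_norm a \<le> 1"
      by (auto simp: a_def intro!: linfI[of _ 1] linf_norm_least)
    have pa: "piece T y = (\<lambda>n. a n * y n)" for y by (auto simp: piece_def a_def)
    have l: "(\<lambda>n. Omega p (piece T x) n - piece T (Omega p x) n) \<in> lp p"
      by (intro fin_supp_lp[OF p] fin_supp_diff piece_fin_supp Omega_fin_supp[OF p] x)
    have "lp_norm p (defect p x T) = lp_norm p (\<lambda>n. Omega p (piece T x) n - piece T (Omega p x) n)"
      unfolding defect_def using lp_norm_cmult[OF p l, of "-1"] by simp
    also have "\<dots> \<le> C * linf_norm a * lp_norm p x" unfolding pa by (rule C(2)[OF a(1) x])
    also have "\<dots> \<le> C * 1 * lp_norm p x"
      using a(2) C(1) by (intro mult_right_mono mult_left_mono) (auto simp: lp_norm_nonneg[OF p])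
    finally show ?thesis by simp
  qed
  then show thesis using that C(1) by blast
qed

text \<open>Common frame for both categories. The operator \<open>\<alpha> T\<close> multiplies by
  \<open>c T\<close> and \<open>sig T\<close> by a unimodular \<open>u T\<close>, subject to
  \<open>c T (1 + u T) = 1_T\<close>: half the indicator and 1 for modules, the constant one half
  and a sign for spaces. Describing the terms of \<open>E\<close> through \<open>is_copy\<close>
  lets both record types fit.\<close>

locale splice_complex =
  test_complex obj hom \<alpha> sig X Sq
  for obj :: "('k::{real_normed_field,banach}, ('k, 'u) univ, 'm) qspace_scheme \<Rightarrow> bool" and hom \<alpha> sig X +
  fixes p :: real and \<A> :: "nat set set" and E :: "(('k, ('k, 'u) univ, 'm) qspace_scheme, ('k, 'u) univ) fourterm"
    and c :: "nat set \<Rightarrow> nat \<Rightarrow> 'k" and u :: "nat set \<Rightarrow> nat \<Rightarrow> 'k"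
  assumes p: "p > 0" and part: "partition_on UNIV \<A>"
    and copy_X: "is_copy Sq un_Sq (lp_module p) X"
    and copy_mid1: "is_copy Cl un_Cl (Z_space p (Omega_tilde \<A> p)) (mid1 E)"
    and copy_mid2: "is_copy Cl un_Cl (Z_space p (Omega p)) (mid2 E)"
    and arr1_E: "arr1 E = (\<lambda>u. Cl (Z_incl p (Omega_tilde \<A> p) (un_Sq u)))"
    and arr2_E: "arr2 E = (\<lambda>u. Cl (Z_incl p (Omega p) (Z_quot p (un_Cl u))))"
    and arr3_E: "arr3 E = (\<lambda>u. Sq (Z_quot p (un_Cl u)))"
    and exact: "four_exact obj hom X X E"
    and hom_id: "obj V \<Longrightarrow> hom V V (\<lambda>v. v)"
    and alpha_X: "x \<in> lp p \<Longrightarrow> \<alpha> X T (Sq x) = Sq (\<lambda>n. c T n * x n)"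
    and alpha_mid1: "v \<in> lp p \<times> fin_supp \<Longrightarrow> \<alpha> (mid1 E) T (Cl (emb p (Omega_tilde \<A> p) v))
      = Cl (emb p (Omega_tilde \<A> p) (\<lambda>n. c T n * fst v n, \<lambda>n. c T n * snd v n))"
    and alpha_mid2: "v \<in> lp p \<times> fin_supp \<Longrightarrow> \<alpha> (mid2 E) T (Cl (emb p (Omega p) v))
      = Cl (emb p (Omega p) (\<lambda>n. c T n * fst v n, \<lambda>n. c T n * snd v n))"
    and sig_eq: "sig T x = (\<lambda>n. u T n * x n)" and norm_u: "norm (u T n) = 1"
    and c_bound: "norm (c T n) \<le> 1"
    and c_u: "c T n * (z + u T n * z) = (if n \<in> T then z else 0)" and u_mem: "n \<in> T \<Longrightarrow> u T n = 1"
begin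

abbreviation "\<Phi> \<equiv> Omega_tilde \<A> p :: (nat \<Rightarrow> 'k) \<Rightarrow> nat \<Rightarrow> 'k"
abbreviation "\<Psi> \<equiv> Omega p :: (nat \<Rightarrow> 'k) \<Rightarrow> nat \<Rightarrow> 'k"

lemma cent: "centralizer p \<Phi>" "centralizer p \<Psi>"
  by (rule centralizer_Omega_tilde[OF part p], rule centralizer_Omega[OF p])

lemma copy_pairs:
  fixes M and \<Theta> :: "(nat \<Rightarrow> 'k) \<Rightarrow> nat \<Rightarrow> 'k"
  assumes cp: "is_copy Cl un_Cl (Z_space p \<Theta>) M" and ct: "centralizer p \<Theta>"
    and v: "v \<in> lp p \<times> fin_supp" and w: "w \<in> lp p \<times> fin_supp"
  shows "Cl (emb p \<Theta> v) \<in> carr M"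
    "add M (Cl (emb p \<Theta> v)) (Cl (emb p \<Theta> w)) = Cl (emb p \<Theta> (\<lambda>n. fst v n + fst w n, \<lambda>n. snd v n + snd w n))"
    "scl M a (Cl (emb p \<Theta> v)) = Cl (emb p \<Theta> (\<lambda>n. a * fst v n, \<lambda>n. a * snd v n))"
    "dif M (Cl (emb p \<Theta> v)) (Cl (emb p \<Theta> w)) = Cl (emb p \<Theta> (\<lambda>n. fst v n - fst w n, \<lambda>n. snd v n - snd w n))"
    "qnorm M (Cl (emb p \<Theta> v)) \<le> lp_norm p (\<lambda>n. fst v n - \<Theta> (snd v) n) + lp_norm p (snd v)"
proof -
  let ?T = "twisted_pairs p \<Theta>"
  have T: "x \<in> carr ?T \<longleftrightarrow> x \<in> lp p \<times> fin_supp" for x by (simp add: twisted_pairs_def)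
  have add: "add M (Cl (emb p \<Theta> v)) (Cl (emb p \<Theta> w)) = Cl (emb p \<Theta> (\<lambda>n. fst v n + fst w n, \<lambda>n. snd v n + snd w n))"
    if "v \<in> lp p \<times> fin_supp" "w \<in> lp p \<times> fin_supp" for v w
    using cp emb_add[OF p ct, of v w] that by (simp add: is_copy_def T) (simp add: twisted_pairs_def)
  have scl: "scl M a (Cl (emb p \<Theta> v)) = Cl (emb p \<Theta> (\<lambda>n. a * fst v n, \<lambda>n. a * snd v n))"
    if "v \<in> lp p \<times> fin_supp" for v a
    using cp emb_scl[OF p ct, of v a] that by (simp add: is_copy_def T) (simp add: twisted_pairs_def)
  show "Cl (emb p \<Theta> v) \<in> carr M" using cp emb_carr[OF p ct, of v] v by (simp add: is_copy_def T)
  show "qnorm M (Cl (emb p \<Theta> v)) \<le> lp_norm p (\<lambda>n. fst v n - \<Theta> (snd v) n) + lp_norm p (snd v)"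
    using cp emb_qnorm[OF p ct, of v] v by (simp add: is_copy_def T) (simp add: twisted_pairs_def)
  show "add M (Cl (emb p \<Theta> v)) (Cl (emb p \<Theta> w)) = Cl (emb p \<Theta> (\<lambda>n. fst v n + fst w n, \<lambda>n. snd v n + snd w n))"
    "scl M a (Cl (emb p \<Theta> v)) = Cl (emb p \<Theta> (\<lambda>n. a * fst v n, \<lambda>n. a * snd v n))"
    using add scl v w by auto
  have "(\<lambda>n. -1 * fst w n, \<lambda>n. -1 * snd w n) \<in> lp p \<times> fin_supp"
    using w lp_cmult[OF p, of "fst w" "-1"] fin_supp_mult[of "snd w" "\<lambda>_. -1"] by auto
  from add[OF v this] show "dif M (Cl (emb p \<Theta> v)) (Cl (emb p \<Theta> w)) = Cl (emb p \<Theta> (\<lambda>n. fst v n - fst w n, \<lambda>n. snd v n - snd w n))"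
    using scl[OF w, of "-1"] by (simp add: dif_def)
qed

lemma c_linf: "c T \<in> linf"
  by (rule linfI[OF c_bound])

lemma pairs_closed:
  assumes "v \<in> lp p \<times> fin_supp" "w \<in> lp p \<times> fin_supp"
  shows "(\<lambda>n. fst v n + fst w n, \<lambda>n. snd v n + snd w n) \<in> lp p \<times> fin_supp"
    "(\<lambda>n. a * fst v n, \<lambda>n. a * snd v n) \<in> lp p \<times> fin_supp"
    "(\<lambda>n. fst v n - fst w n, \<lambda>n. snd v n - snd w n) \<in> lp p \<times> fin_supp"
    "(\<lambda>n. c T n * fst v n, \<lambda>n. c T n * snd v n) \<in> lp p \<times> fin_supp"
  using assms by (auto simp: lp_add[OF p] fin_supp_add lp_cmult[OF p] fin_supp_mult lp_dif[OF p] fin_supp_diff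
      lp_act[OF p c_linf])

lemma rel_mid2:
  assumes g: "\<And>x. x \<in> fin_supp \<Longrightarrow> g x \<in> lp p \<times> fin_supp" and x: "x \<in> fin_supp"
  shows "rel (mid2 E) (\<lambda>x. Cl (emb p \<Psi> (g x))) x T = Cl (emb p \<Psi>
    (\<lambda>n. c T n * (fst (g x) n + fst (g (sig T x)) n) - fst (g (piece T x)) n,
     \<lambda>n. c T n * (snd (g x) n + snd (g (sig T x)) n) - snd (g (piece T x)) n))"
proof -
  note m = copy_pairs[OF copy_mid2 cent(2)]
  have gc: "g x \<in> lp p \<times> fin_supp" "g (sig T x) \<in> lp p \<times> fin_supp" "g (piece T x) \<in> lp p \<times> fin_supp"
    by (intro g x sig_fin_supp piece_fin_supp)+
  show ?thesis
    unfolding rel_def m(2)[OF gc(1,2)] alpha_mid2[OF pairs_closed(1)[OF gc(1,2)]]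
      m(4)[OF pairs_closed(4)[OF pairs_closed(1)[OF gc(1,2)] gc(1)] gc(3)] by simp
qed

lemma syz_mid1:
  assumes k: "\<And>x T. x \<in> fin_supp \<Longrightarrow> k x T \<in> lp p \<times> fin_supp" and x: "x \<in> fin_supp"
  shows "syz (mid1 E) (\<lambda>x T. Cl (emb p \<Phi> (k x T))) x T e = Cl (emb p \<Phi>
    (\<lambda>n. c {e} n * (fst (k x T) n + fst (k (sig {e} x) T) n) + fst (k (piece T x) {e}) n
        - 1/2 * (fst (k x {e}) n + fst (k (sig T x) {e}) n),
     \<lambda>n. c {e} n * (snd (k x T) n + snd (k (sig {e} x) T) n) + snd (k (piece T x) {e}) n
        - 1/2 * (snd (k x {e}) n + snd (k (sig T x) {e}) n)))"
proof -
  note m = copy_pairs[OF copy_mid1 cent(1)]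
  have kc: "k x T \<in> lp p \<times> fin_supp" "k (sig {e} x) T \<in> lp p \<times> fin_supp" "k (piece T x) {e} \<in> lp p \<times> fin_supp"
    "k x {e} \<in> lp p \<times> fin_supp" "k (sig T x) {e} \<in> lp p \<times> fin_supp"
    by (intro k x sig_fin_supp piece_fin_supp)+
  note a = pairs_closed(1)[OF kc(1,2)] and b = pairs_closed(1)[OF kc(4,5)]
  note d = pairs_closed(4)[OF a a, of "{e}"]
  note f = pairs_closed(1)[OF d kc(3)] and h = pairs_closed(2)[OF b b, of "1/2"]
  show ?thesis
    unfolding syz_def m(2)[OF kc(1,2)] m(2)[OF kc(4,5)] alpha_mid1[OF a] m(2)[OF d kc(3)] m(3)[OF b b] m(4)[OF f h] by simp
qed

lemma syz_X:
  assumes k: "\<And>x T. x \<in> fin_supp \<Longrightarrow> k x T \<in> lp p" and x: "x \<in> fin_supp"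
  shows "syz X (\<lambda>x T. Sq (k x T)) x T e = Sq
    (\<lambda>n. c {e} n * (k x T n + k (sig {e} x) T n) + k (piece T x) {e} n - 1/2 * (k x {e} n + k (sig T x) {e} n))"
proof -
  have kc: "k x T \<in> lp p" "k (sig {e} x) T \<in> lp p" by (intro k x sig_fin_supp)+
  have "add X (Sq a) (Sq b) = Sq (\<lambda>n. a n + b n)" "scl X s (Sq a) = Sq (\<lambda>n. s * a n)"
    "dif X (Sq a) (Sq b) = Sq (\<lambda>n. a n - b n)" for a b s
    using copy_X is_copy_dif[OF copy_X, of "Sq a" "Sq b"] dif_lp_module[OF p, of a b]
    by (simp_all add: is_copy_def lp_module_def)
  then show ?thesis by (simp add: syz_def alpha_X lp_add[OF p] kc)
qed

lemma N_eq: "qnorm X (Sq x) = lp_norm p x"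
  using copy_X by (simp add: is_copy_def lp_module_def)

lemma sig_Omega: "x \<in> fin_supp \<Longrightarrow> \<Psi> (sig T x) = sig T (\<Psi> x)"
  by (simp add: sig_eq Omega_unimodular[OF p _ norm_u])

lemma sig_Omega_tilde: "x \<in> fin_supp \<Longrightarrow> \<Phi> (sig T x) = sig T (\<Phi> x)"
  by (simp add: sig_eq Omega_tilde_unimodular[OF part _ norm_u])

lemma c_sig: "c T n * (z n + sig T z n) = piece T z n"
  by (simp add: sig_eq c_u piece_def)

lemma defect_sig:
  assumes "x \<in> fin_supp" shows "defect p (sig S x) T = sig S (defect p x T)"
  unfolding defect_def
  by (auto simp: sig_Omega assms piece_sig piece_fin_supp) (auto simp: sig_eq piece_def algebra_simps)

text \<open>A pair of the form \<open>(\<Theta> y, y)\<close> has twisted quasinorm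
  \<open>lp_norm p y\<close>, so these choices are bounded because \<open>defect p x T\<close> is
  bounded by a multiple of \<open>x\<close>.\<close>

definition gl where "gl x = (\<Psi> x, x)"
definition kl where "kl x T = (\<Phi> (defect p x T), defect p x T)"

lemma gl_closed: "x \<in> fin_supp \<Longrightarrow> gl x \<in> lp p \<times> fin_supp"
  by (simp add: gl_def fin_supp_lp[OF p] Omega_fin_supp[OF p])

lemma kl_closed: "x \<in> fin_supp \<Longrightarrow> kl x T \<in> lp p \<times> fin_supp"
  by (simp add: kl_def fin_supp_lp[OF p] defect_fin_supp[OF p] Omega_tilde_fin_supp[OF part])

lemma splice_lift: "\<exists>C. is_lift E C (\<lambda>x. Cl (emb p \<Psi> (gl x))) (\<lambda>x T. Cl (emb p \<Phi> (kl x T)))"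
proof -
  obtain C where C: "C \<ge> 1" "\<And>(x :: nat \<Rightarrow> 'k) T. x \<in> fin_supp \<Longrightarrow> lp_norm p (defect p x T) \<le> C * lp_norm p x"
    using defect_bound[OF p] by metis
  have "is_lift E C (\<lambda>x. Cl (emb p \<Psi> (gl x))) (\<lambda>x T. Cl (emb p \<Phi> (kl x T)))"
    unfolding is_lift_def
  proof (intro conjI ballI allI)
    show "0 \<le> C" using C(1) by simp
    fix x :: "nat \<Rightarrow> 'k" assume x: "x \<in> fin_supp"
    note m2 = copy_pairs[OF copy_mid2 cent(2) gl_closed[OF x] gl_closed[OF x]]
    show "Cl (emb p \<Psi> (gl x)) \<in> carr (mid2 E)" by (rule m2(1))
    have "qnorm (mid2 E) (Cl (emb p \<Psi> (gl x))) \<le> lp_norm p x"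
      using m2(5) by (simp add: gl_def lp_zero[OF p])
    also have "\<dots> \<le> C * lp_norm p x" using C(1) lp_norm_nonneg[OF p, of x] by (simp add: mult_le_cancel_right1)
    finally show "qnorm (mid2 E) (Cl (emb p \<Psi> (gl x))) \<le> C * qnorm X (Sq x)" by (simp add: N_eq)
    show "arr3 E (Cl (emb p \<Psi> (gl x))) = Sq x"
      using Z_quot_emb[OF p cent(2), of "gl x"] gl_closed[OF x] by (simp add: arr3_E carr_T[OF p cent(2)] gl_def)
    fix T
    note m1 = copy_pairs[OF copy_mid1 cent(1) kl_closed[OF x, of T] kl_closed[OF x, of T]]
    show "Cl (emb p \<Phi> (kl x T)) \<in> carr (mid1 E)" by (rule m1(1))
    show "qnorm (mid1 E) (Cl (emb p \<Phi> (kl x T))) \<le> C * qnorm X (Sq x)"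
      using m1(5) C(2)[OF x, of T] by (simp add: kl_def lp_zero[OF p] N_eq)
    have "arr2 E (Cl (emb p \<Phi> (kl x T))) = Cl (emb p \<Psi> (defect p x T, \<lambda>_. 0))"
      using Z_quot_emb[OF p cent(1), of "kl x T"] kl_closed[OF x, of T]
      by (simp add: arr2_E carr_T[OF p cent(1)] kl_def Z_incl_emb[OF p cent(2)])
    also have "\<dots> = rel (mid2 E) (\<lambda>x. Cl (emb p \<Psi> (gl x))) x T"
      by (subst rel_mid2[where g = gl], rule gl_closed, assumption, rule x)
        (simp add: gl_def sig_Omega[OF x] c_sig defect_def)
    finally show "arr2 E (Cl (emb p \<Phi> (kl x T))) = rel (mid2 E) (\<lambda>x. Cl (emb p \<Psi> (gl x))) x T" .
  qed
  then show ?thesis by blast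
qed

text \<open>The second components telescope: the terms with \<open>Omega p x\<close>, with
  \<open>Omega p (piece T x)\<close> and with \<open>Omega p (piece {e} x)\<close> each occur twice
  with opposite signs. In the first component the one-point defects are killed by
  \<open>\<Phi>\<close>, which leaves the term with \<open>T\<close>.\<close>

lemma splice_syz:
  assumes x: "x \<in> fin_supp" and e: "e \<in> T"
  shows "syz (mid1 E) (\<lambda>x T. Cl (emb p \<Phi> (kl x T))) x T e = arr1 E (Sq (piece {e} (\<Phi> (defect p x T))))"
proof -
  have point: "\<Phi> (defect p y {e}) = (\<lambda>_. 0)" if "y \<in> fin_supp" for y
    by (rule Omega_tilde_supported_at_point[OF part defect_fin_supp[OF p that], of e])
      (simp add: defect_def piece_def Omega_def)
  have d: "defect p (sig T x) {e} = defect p x {e}"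
  proof
    fix n
    have "n \<noteq> e \<Longrightarrow> defect p x {e} n = 0" by (simp add: defect_def piece_def Omega_def)
    then show "defect p (sig T x) {e} n = defect p x {e} n"
      unfolding defect_sig[OF x] using u_mem[OF e] by (cases "n = e") (simp_all add: sig_eq)
  qed
  have pp: "piece {e} (piece T x) = piece {e} x" using e by (auto simp: piece_def)
  have y: "defect p x T \<in> fin_supp" by (rule defect_fin_supp[OF p x])
  have "syz (mid1 E) (\<lambda>x T. Cl (emb p \<Phi> (kl x T))) x T e
      = Cl (emb p \<Phi> (piece {e} (\<Phi> (defect p x T)), \<lambda>n. piece {e} (defect p x T) n + defect p (piece T x) {e} n - defect p x {e} n))"
    by (subst syz_mid1[where k = kl], rule kl_closed, assumption, rule x)
      (simp add: kl_def defect_sig[OF x, of "{e}"] sig_Omega_tilde[OF y] c_sig d point x piece_fin_supp)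
  also have "(\<lambda>n. piece {e} (defect p x T) n + defect p (piece T x) {e} n - defect p x {e} n) = (\<lambda>_. 0)"
    using e by (auto simp: defect_def pp) (auto simp: piece_def Omega_def)
  finally show ?thesis by (simp add: arr1_E Z_incl_emb[OF p cent(1)])
qed

text \<open>Injectivity of the inclusion turns the coboundary identity into one between sequences;
  it is evaluated at \<open>e\<close>, the only coordinate where the side coming from
  \<open>\<Phi>\<close> can be nonzero.\<close>

theorem trivial_equation:
  assumes tr: "four_class obj hom X X E = four_class obj hom X X (zero_seq X X)"
  obtains D and \<eta> :: "(nat \<Rightarrow> 'k) \<Rightarrow> nat set \<Rightarrow> nat \<Rightarrow> 'k" where "D \<ge> 0"
    "\<And>x T. x \<in> fin_supp \<Longrightarrow> \<eta> x T \<in> lp p" "\<And>x T. x \<in> fin_supp \<Longrightarrow> lp_norm p (\<eta> x T) \<le> D * lp_norm p x"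
    "\<And>x T e. x \<in> fin_supp \<Longrightarrow> e \<in> T \<Longrightarrow>
      c {e} e * (\<eta> x T e + \<eta> (sig {e} x) T e) + \<eta> (piece T x) {e} e - 1/2 * (\<eta> x {e} e + \<eta> (sig T x) {e} e)
      = \<Phi> (defect p x T) e"
proof -
  obtain C where L: "is_lift E C (\<lambda>x. Cl (emb p \<Psi> (gl x))) (\<lambda>x T. Cl (emb p \<Phi> (kl x T)))" using splice_lift by blast
  obtain D h where h: "D \<ge> 0" "\<And>x T. x \<in> fin_supp \<Longrightarrow> h x T \<in> carr X" "\<And>x T. x \<in> fin_supp \<Longrightarrow> qnorm X (h x T) \<le> D * qnorm X (Sq x)"
    "\<And>x T e. x \<in> fin_supp \<Longrightarrow> e \<in> T \<Longrightarrow> syz (mid1 E) (\<lambda>x T. Cl (emb p \<Phi> (kl x T))) x T e = arr1 E (syz X h x T e)"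
    using trivial_coboundary[OF exact tr hom_id L] by blast
  define \<eta> where "\<eta> x T = un_Sq (h x T)" for x T
  have carrX: "carr X = Sq ` lp p" using copy_X by (simp add: is_copy_def lp_module_def)
  have hS: "h x T = Sq (\<eta> x T)" and \<eta>: "\<eta> x T \<in> lp p" if "x \<in> fin_supp" for x T
    using h(2)[OF that, of T] by (auto simp: carrX \<eta>_def)
  show thesis
  proof (rule that[OF h(1) \<eta>])
    show "lp_norm p (\<eta> x T) \<le> D * lp_norm p x" if "x \<in> fin_supp" for x T
      using h(3)[OF that, of T] by (simp add: hS[OF that] N_eq)
    fix x :: "nat \<Rightarrow> 'k" and T :: "nat set" and e :: nat assume x: "x \<in> fin_supp" and e: "e \<in> T"
    let ?s = "\<lambda>n. c {e} n * (\<eta> x T n + \<eta> (sig {e} x) T n) + \<eta> (piece T x) {e} n - 1/2 * (\<eta> x {e} n + \<eta> (sig T x) {e} n)"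
    have s: "syz X h x T e = Sq ?s"
      using syz_X[where k = \<eta> and T = T and e = e, OF \<eta> x] syz_cong[where k = h and k' = "\<lambda>x T. Sq (\<eta> x T)" and V = X and T = T and e = e, OF hS x] by simp
    have "syz X h x T e \<in> carr X" by (rule syz_in[OF obj_X h(2) x])
    then have sl: "?s \<in> lp p" by (auto simp: s carrX)
    have fl: "piece {e} (\<Phi> (defect p x T)) \<in> lp p"
      by (intro fin_supp_lp[OF p] piece_fin_supp Omega_tilde_fin_supp[OF part] defect_fin_supp[OF p] x)
    have "arr1 E (Sq (piece {e} (\<Phi> (defect p x T)))) = arr1 E (Sq ?s)"
      using splice_syz[OF x e] h(4)[OF x e] s by simp
    then have "piece {e} (\<Phi> (defect p x T)) = ?s"
      using Z_incl_inj[OF p cent(1) fl sl] by (simp add: arr1_E)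
    then have "piece {e} (\<Phi> (defect p x T)) e = ?s e" by (rule fun_cong)
    then show "?s e = \<Phi> (defect p x T) e" by (simp add: piece_def)
  qed
qed

end

text \<open>The coboundary equation at the indicator of \<open>S\<close>, whose norm to the power
  \<open>p\<close> is \<open>card S\<close>; \<open>H S T\<close> stands for the solution at that
  vector. All finite \<open>S\<close> and all subsets \<open>T\<close> are included because the
  descent chooses its sets depending on where the error is small.\<close>

definition cell_cocycle :: "real \<Rightarrow> nat set set \<Rightarrow> real \<Rightarrow> (nat set \<Rightarrow> nat set \<Rightarrow> nat \<Rightarrow> 'k::real_normed_field) \<Rightarrow> bool" where
  "cell_cocycle p \<A> C H \<longleftrightarrow> C \<ge> 0 \<and>
     (\<forall>S T. finite S \<longrightarrow> T \<subseteq> S \<longrightarrow> (\<Sum>i\<in>T. norm (H S T i) powr p) \<le> C * real (card S)) \<and>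
     (\<forall>S T e. finite S \<longrightarrow> T \<subseteq> S \<longrightarrow> e \<in> T \<longrightarrow> H S T e + H T {e} e - H S {e} e
        = of_real (ln (card S / card T) * ln (card T / card (T \<inter> cell \<A> e)) / 4))"

section \<open>Evaluation on sign vectors and averaging\<close>

definition signed :: "nat set \<Rightarrow> nat set \<Rightarrow> nat \<Rightarrow> 'k::real_normed_field" where
  "signed S A = (\<lambda>n. if n \<in> S then if n \<in> A then -1 else 1 else 0)"

lemma signed_fin_supp: "finite S \<Longrightarrow> signed S A \<in> fin_supp"
  by (auto simp: fin_supp_def signed_def elim: rev_finite_subset)

lemma lp_norm_signed:
  assumes "p > 0" "finite S"
  shows "lp_norm p (signed S A :: nat \<Rightarrow> 'k::real_normed_field) = real (card S) powr (1 / p)"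
proof -
  have "(\<Sum>n\<in>S. norm (signed S A n :: 'k) powr p) = (\<Sum>n\<in>S. 1)" by (intro sum.cong) (auto simp: signed_def)
  moreover have "signed S A n = (0 :: 'k)" if "n \<notin> S" for n using that by (simp add: signed_def)
  ultimately show ?thesis using lp_norm_finite[OF assms, of "signed S A :: nat \<Rightarrow> 'k"] by simp
qed

lemma piece_signed: "piece T (signed S A) = signed (S \<inter> T) A"
  by (auto simp: piece_def signed_def)

text \<open>For a sign vector on \<open>R\<close>, \<open>p / 2 * ln (card R powr (1 / p))\<close>
  is \<open>ln (card R) / 2\<close>, whatever \<open>p\<close> is. So the defect is a sign vector on
  \<open>T\<close> times \<open>(ln (card S) - ln (card T)) / 2\<close>, and
  \<open>Omega_tilde\<close> contributes a second logarithm, again with one half; hence the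
  4.\<close>

lemma Omega_tilde_defect_signed:
  assumes part: "partition_on UNIV \<A>" and p: "p > 0" and S: "finite S" "T \<subseteq> S" and e: "e \<in> T"
  shows "Omega_tilde \<A> p (defect p (signed S A) T) e
    = (signed S A e :: 'k::real_normed_field) * of_real (ln (card S / card T) * ln (card T / card (T \<inter> cell \<A> e)) / 4)"
proof -
  have T: "finite T" "S \<inter> T = T" using S finite_subset by auto
  have card: "card S > 0" "card T > 0" "card (T \<inter> cell \<A> e) > 0"
    using S T e cell_mem(2)[OF part, of e] by (auto simp: card_gt_0_iff)
  have Om: "Omega p (signed R A) n = of_real (ln (card R) / 2) * (signed R A n :: 'k)" if "finite R" for R n
  proof (cases "n \<in> R")
    case True
    then have "card R > 0" using that by (auto simp: card_gt_0_iff)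
    moreover have "norm (signed R A n :: 'k) = 1" using True by (simp add: signed_def)
    ultimately show ?thesis using p by (simp add: Omega_def lp_norm_signed[OF p that] ln_powr)
  qed (simp add: Omega_def signed_def)
  define s where "s = ln (card S / card T) / 2"
  have d: "defect p (signed S A) T = (\<lambda>n. of_real s * (signed T A n :: 'k))"
  proof
    fix n
    have "s = ln (card S) / 2 - ln (card T) / 2" using card by (simp add: s_def ln_div diff_divide_distrib)
    moreover have "n \<in> T \<Longrightarrow> signed S A n = (signed T A n :: 'k)" using S(2) by (auto simp: signed_def)
    moreover have "n \<notin> T \<Longrightarrow> signed T A n = (0 :: 'k)" by (simp add: signed_def)
    moreover have "defect p (signed S A) T n = (if n \<in> T then of_real (ln (card S) / 2) * signed S A n else 0)
        - of_real (ln (card T) / 2) * (signed T A n :: 'k)"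
      unfolding defect_def piece_signed T(2) Om[OF T(1)] by (simp only: piece_def Om[OF S(1)])
    ultimately show "defect p (signed S A) T n = of_real s * (signed T A n :: 'k)"
      by (cases "n \<in> T") (simp_all add: left_diff_distrib)
  qed
  have "Omega_tilde \<A> p (\<lambda>n. of_real s * (signed T A n :: 'k)) = (\<lambda>n. of_real s * Omega_tilde \<A> p (signed T A) n)"
    using centralizer_Omega_tilde[OF part p, where 'k = 'k] signed_fin_supp[OF T(1)] unfolding centralizer_def by blast
  then have "Omega_tilde \<A> p (defect p (signed S A) T) e = of_real s * (Omega_tilde \<A> p (signed T A) e :: 'k)"
    by (simp add: d)
  also have "Omega_tilde \<A> p (signed T A) e = of_real (ln (card T / card (T \<inter> cell \<A> e)) / 2) * (signed T A e :: 'k)"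
  proof -
    have "p * ln (real (card T) powr (1 / p) / real (card (T \<inter> cell \<A> e)) powr (1 / p)) = ln (card T / card (T \<inter> cell \<A> e))"
      using card p by (simp add: ln_div ln_powr field_simps)
    then show ?thesis
      by (simp add: Omega_tilde_nth[OF part signed_fin_supp[OF T(1)]] piece_signed lp_norm_signed[OF p] T)
  qed
  also have "signed T A e = (signed S A e :: 'k)" using e S by (auto simp: signed_def)
  finally show ?thesis by (simp add: s_def)
qed

text \<open>Jensen's inequality is applied to the positive terms. Averaging over all
  \<open>n\<close> terms instead of the \<open>m\<close> positive ones multiplies the left side by
  \<open>(m / n) powr p\<close> and the right side by \<open>m / n\<close>, which is at least as
  large since \<open>p \<ge> 1\<close>.\<close>

lemma mean_powr_le:
  fixes t :: "'i \<Rightarrow> real"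
  assumes "finite A" "A \<noteq> {}" "\<And>i. i \<in> A \<Longrightarrow> t i \<ge> 0" "p \<ge> 1"
  shows "((\<Sum>i\<in>A. t i) / card A) powr p \<le> (\<Sum>i\<in>A. t i powr p) / card A"
proof -
  define P where "P = {i\<in>A. t i > 0}"
  have P: "finite P" "P \<subseteq> A" using assms(1) by (auto simp: P_def)
  have z: "t i = 0" if "i \<in> A - P" for i using that assms(3)[of i] by (auto simp: P_def)
  have s: "(\<Sum>i\<in>A. t i) = (\<Sum>i\<in>P. t i)" "(\<Sum>i\<in>A. t i powr p) = (\<Sum>i\<in>P. t i powr p)"
    using z assms(4) by (auto intro!: sum.mono_neutral_right assms(1) P)
  show ?thesis
  proof (cases "P = {}")
    case True
    then show ?thesis using assms(4) by (simp add: s)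
  next
    case False
    define n m where "n = real (card A)" and "m = real (card P)"
    have nm: "0 < m" "m \<le> n" using False P assms(1) by (auto simp: n_def m_def card_gt_0_iff card_mono)
    have "(\<Sum>i\<in>P. (1 / m) *\<^sub>R t i) powr p \<le> (\<Sum>i\<in>P. 1 / m * t i powr p)"
      by (rule convex_on_sum[OF P(1) False powr_convex[OF assms(4)], where a = "\<lambda>_. 1 / m"])
        (use nm in \<open>auto simp: m_def P_def\<close>)
    then have j: "((\<Sum>i\<in>P. t i) / m) powr p \<le> (\<Sum>i\<in>P. t i powr p) / m"
      by (simp add: sum_divide_distrib)
    have "((\<Sum>i\<in>P. t i) / n) powr p = (m / n) powr p * ((\<Sum>i\<in>P. t i) / m) powr p"
      using nm assms(3) P by (subst powr_mult[symmetric]) (auto simp: sum_nonneg intro!: divide_nonneg_pos sum_nonneg)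
    also have "\<dots> \<le> (m / n) * ((\<Sum>i\<in>P. t i powr p) / m)"
    proof (intro mult_mono j)
      have "(m / n) powr p \<le> (m / n) powr 1" using nm assms(4) by (intro powr_mono') auto
      then show "(m / n) powr p \<le> m / n" using nm by simp
    qed (use nm in auto)
    also have "\<dots> = (\<Sum>i\<in>P. t i powr p) / n" using nm by simp
    finally show ?thesis by (simp add: s n_def)
  qed
qed

text \<open>Symmetric difference with \<open>B\<close> is an involution of the power set; it encodes
  multiplying a sign vector by another one.\<close>

lemma sum_Pow_symdiff:
  assumes "B \<subseteq> S"
  shows "(\<Sum>A\<in>Pow S. f ((A - B) \<union> (B - A))) = (\<Sum>A\<in>Pow S. f A)"
  by (rule sum.reindex_bij_witness[where i = "\<lambda>A. (A - B) \<union> (B - A)" and j = "\<lambda>A. (A - B) \<union> (B - A)"])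
    (use assms in \<open>auto intro!: arg_cong[where f = f]\<close>)

text \<open>Every subset of \<open>T\<close> is the trace of \<open>2 ^ card (S - T)\<close> subsets
  of \<open>S\<close>. So a mean over signs on \<open>S\<close> that only sees \<open>T\<close> is a
  mean over signs on \<open>T\<close>, which identifies the averaged \<open>piece T\<close> term
  with \<open>H T\<close>.\<close>

lemma sum_Pow_restrict:
  fixes f :: "nat set \<Rightarrow> 'b::real_normed_field"
  assumes "finite S" "T \<subseteq> S"
  shows "(\<Sum>A\<in>Pow S. f (A \<inter> T)) / 2 ^ card S = (\<Sum>A\<in>Pow T. f A) / 2 ^ card T"
proof -
  have fin: "finite T" "finite (S - T)" using assms finite_subset by auto
  have "(\<Sum>A\<in>Pow S. f (A \<inter> T)) = (\<Sum>(B, C)\<in>Pow T \<times> Pow (S - T). f B)"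
    by (rule sum.reindex_bij_witness[where i = "\<lambda>(B, C). B \<union> C" and j = "\<lambda>A. (A \<inter> T, A - T)"])
      (use assms in \<open>auto intro!: arg_cong[where f = f]\<close>)
  also have "\<dots> = 2 ^ card (S - T) * (\<Sum>A\<in>Pow T. f A)"
    by (simp add: sum.cartesian_product[symmetric] card_Pow fin sum_distrib_left)
  also have "card (S - T) = card S - card T" by (rule card_Diff_subset[OF fin(1) assms(2)])
  finally have "(\<Sum>A\<in>Pow S. f (A \<inter> T)) = 2 ^ (card S - card T) * (\<Sum>A\<in>Pow T. f A)" .
  moreover have "(2::'b) ^ card S = 2 ^ (card S - card T) * 2 ^ card T"
    using card_mono[OF assms] by (simp flip: power_add)
  ultimately show ?thesis by simp
qed

text \<open>Averaging over all sign changes makes the solution of the coboundary equation equivariant; this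
  is where local convexity is needed.\<close>

lemma cell_cocycle_average:
  fixes \<eta> :: "(nat \<Rightarrow> 'k::real_normed_field) \<Rightarrow> nat set \<Rightarrow> nat \<Rightarrow> 'k"
  assumes part: "partition_on UNIV \<A>" and p: "p \<ge> 1" and D: "D \<ge> 0"
    and \<eta>: "\<And>x T. x \<in> fin_supp \<Longrightarrow> \<eta> x T \<in> lp p" "\<And>x T. x \<in> fin_supp \<Longrightarrow> lp_norm p (\<eta> x T) \<le> D * lp_norm p x"
    and eq: "\<And>x T e. x \<in> fin_supp \<Longrightarrow> e \<in> T \<Longrightarrow>
      1/2 * (\<eta> x T e + \<eta> (\<lambda>n. (if n \<in> {e} then 1 else -1) * x n) T e) + \<eta> (piece T x) {e} e
       - 1/2 * (\<eta> x {e} e + \<eta> (\<lambda>n. (if n \<in> T then 1 else -1) * x n) {e} e) = Omega_tilde \<A> p (defect p x T) e"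
  shows "\<exists>C H. cell_cocycle p \<A> C (H :: nat set \<Rightarrow> nat set \<Rightarrow> nat \<Rightarrow> 'k)"
proof -
  have p0: "p > 0" using p by simp
  define sg :: "nat set \<Rightarrow> nat \<Rightarrow> 'k" where "sg A n = (if n \<in> A then -1 else 1)" for A n
  \<comment> \<open>The factor \<open>sg A i\<close> undoes the sign that the vector carries at
    \<open>i\<close>, so the mean extracts the equivariant part of the solution.\<close>
  define H where "H S T i = (\<Sum>A\<in>Pow S. sg A i * \<eta> (signed S A) T i) / 2 ^ card S" for S T i
  have nsg: "norm (sg A n) = 1" for A n by (simp add: sg_def)
  have "(\<Sum>i\<in>T. norm (H S T i) powr p) \<le> D powr p * real (card S)" if S: "finite S" "T \<subseteq> S" for S T
  proof -
    have T: "finite T" using S finite_subset by auto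
    have fs: "signed S A \<in> fin_supp" for A by (rule signed_fin_supp[OF S(1)])
    have "norm (H S T i) powr p \<le> (\<Sum>A\<in>Pow S. norm (\<eta> (signed S A) T i) powr p) / 2 ^ card S" for i
    proof -
      have "norm (H S T i) \<le> (\<Sum>A\<in>Pow S. norm (\<eta> (signed S A) T i)) / 2 ^ card S"
        unfolding H_def norm_divide norm_power
        by (simp add: divide_right_mono sum_norm_le norm_mult nsg)
      then have "norm (H S T i) powr p \<le> ((\<Sum>A\<in>Pow S. norm (\<eta> (signed S A) T i)) / 2 ^ card S) powr p"
        using p by (intro powr_mono2) auto
      also have "\<dots> \<le> (\<Sum>A\<in>Pow S. norm (\<eta> (signed S A) T i) powr p) / 2 ^ card S"
        using mean_powr_le[of "Pow S" "\<lambda>A. norm (\<eta> (signed S A) T i)" p] S p by (auto simp: card_Pow)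
      finally show ?thesis .
    qed
    then have "(\<Sum>i\<in>T. norm (H S T i) powr p)
        \<le> (\<Sum>i\<in>T. (\<Sum>A\<in>Pow S. norm (\<eta> (signed S A) T i) powr p) / 2 ^ card S)" by (rule sum_mono)
    also have "\<dots> = (\<Sum>A\<in>Pow S. \<Sum>i\<in>T. norm (\<eta> (signed S A) T i) powr p) / 2 ^ card S"
      by (subst sum.swap) (simp add: sum_divide_distrib)
    also have "\<dots> \<le> (\<Sum>A\<in>Pow S. D powr p * real (card S)) / 2 ^ card S"
    proof (intro divide_right_mono sum_mono)
      fix A
      have "(\<Sum>i\<in>T. norm (\<eta> (signed S A) T i) powr p) \<le> lp_norm p (\<eta> (signed S A) T) powr p"
        by (rule lp_partial_sum_le[OF p0 \<eta>(1)[OF fs] T])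
      also have "\<dots> \<le> (D * real (card S) powr (1 / p)) powr p"
        using \<eta>(2)[OF fs, of A T] p by (intro powr_mono2) (auto simp: lp_norm_signed[OF p0 S(1)] lp_norm_nonneg[OF p0])
      also have "\<dots> = D powr p * real (card S)" using D p by (simp add: powr_mult powr_powr)
      finally show "(\<Sum>i\<in>T. norm (\<eta> (signed S A) T i) powr p) \<le> D powr p * real (card S)" .
    qed auto
    also have "\<dots> = D powr p * real (card S)" using S by (simp add: card_Pow)
    finally show ?thesis .
  qed
  moreover have "H S T e + H T {e} e - H S {e} e = of_real (ln (card S / card T) * ln (card T / card (T \<inter> cell \<A> e)) / 4)"
    if S: "finite S" "T \<subseteq> S" and e: "e \<in> T" for S T e
  proof -
    let ?w = "of_real (ln (card S / card T) * ln (card T / card (T \<inter> cell \<A> e)) / 4) :: 'k"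
    have flip: "(\<lambda>n. (if n \<in> R then 1 else -1) * (signed S A n :: 'k)) = signed S ((A - (S - R)) \<union> ((S - R) - A))" for R A
      by (auto simp: signed_def)
    \<comment> \<open>A sign change off a set containing \<open>e\<close> permutes the sign vectors
      and leaves \<open>sg A e\<close> alone, so the two terms of each half-sum in the equation have
      equal means.\<close>
    have flip_sum: "(\<Sum>A\<in>Pow S. sg A e * \<eta> (\<lambda>n. (if n \<in> R then 1 else -1) * signed S A n) T' e)
        = (\<Sum>A\<in>Pow S. sg A e * \<eta> (signed S A) T' e)" if "e \<in> R" for R T'
    proof -
      have "sg A e = sg ((A - (S - R)) \<union> ((S - R) - A)) e" for A using that by (auto simp: sg_def)
      then have "(\<Sum>A\<in>Pow S. sg A e * \<eta> (\<lambda>n. (if n \<in> R then 1 else -1) * signed S A n) T' e)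
          = (\<Sum>A\<in>Pow S. sg ((A - (S - R)) \<union> ((S - R) - A)) e * \<eta> (signed S ((A - (S - R)) \<union> ((S - R) - A))) T' e)"
        unfolding flip by (intro sum.cong) auto
      also have "\<dots> = (\<Sum>A\<in>Pow S. sg A e * \<eta> (signed S A) T' e)"
        by (rule sum_Pow_symdiff[where f = "\<lambda>A. sg A e * \<eta> (signed S A) T' e"]) auto
      finally show ?thesis .
    qed
    have ps: "piece T (signed S A) = (signed T (A \<inter> T) :: nat \<Rightarrow> 'k)" for A
      using S(2) by (auto simp: piece_def signed_def fun_eq_iff)
    have "(\<Sum>A\<in>Pow S. sg A e * \<eta> (piece T (signed S A)) {e} e) = (\<Sum>A\<in>Pow S. sg (A \<inter> T) e * \<eta> (signed T (A \<inter> T)) {e} e)"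
      unfolding ps using e by (intro sum.cong) (auto simp: sg_def)
    then have restr: "(\<Sum>A\<in>Pow S. sg A e * \<eta> (piece T (signed S A)) {e} e) / 2 ^ card S = H T {e} e"
      using sum_Pow_restrict[OF S, of "\<lambda>A. sg A e * \<eta> (signed T A) {e} e"] by (simp add: H_def)
    have eqA: "sg A e * (1/2 * (\<eta> (signed S A) T e + \<eta> (\<lambda>n. (if n \<in> {e} then 1 else -1) * signed S A n) T e)
        + \<eta> (piece T (signed S A)) {e} e
        - 1/2 * (\<eta> (signed S A) {e} e + \<eta> (\<lambda>n. (if n \<in> T then 1 else -1) * signed S A n) {e} e)) = ?w" for A
    proof -
      have "sg A e * signed S A e = (1 :: 'k)" using e S(2) by (auto simp: sg_def signed_def)
      then show ?thesis
        unfolding eq[OF signed_fin_supp[OF S(1)] e] Omega_tilde_defect_signed[OF part p0 S e]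
        by (simp only: mult.assoc[symmetric] mult_1)
    qed
    have "(\<Sum>A\<in>Pow S. sg A e * (1/2 * (\<eta> (signed S A) T e + \<eta> (\<lambda>n. (if n \<in> {e} then 1 else -1) * signed S A n) T e)
        + \<eta> (piece T (signed S A)) {e} e
        - 1/2 * (\<eta> (signed S A) {e} e + \<eta> (\<lambda>n. (if n \<in> T then 1 else -1) * signed S A n) {e} e)))
      = 1/2 * ((\<Sum>A\<in>Pow S. sg A e * \<eta> (signed S A) T e)
          + (\<Sum>A\<in>Pow S. sg A e * \<eta> (\<lambda>n. (if n \<in> {e} then 1 else -1) * signed S A n) T e))
        + (\<Sum>A\<in>Pow S. sg A e * \<eta> (piece T (signed S A)) {e} e)
        - 1/2 * ((\<Sum>A\<in>Pow S. sg A e * \<eta> (signed S A) {e} e)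
          + (\<Sum>A\<in>Pow S. sg A e * \<eta> (\<lambda>n. (if n \<in> T then 1 else -1) * signed S A n) {e} e))"
      unfolding distrib_left right_diff_distrib sum.distrib sum_subtractf sum_distrib_left
      by (simp only: mult.left_commute)
    also have "\<dots> = (\<Sum>A\<in>Pow S. sg A e * \<eta> (signed S A) T e) + (\<Sum>A\<in>Pow S. sg A e * \<eta> (piece T (signed S A)) {e} e)
        - (\<Sum>A\<in>Pow S. sg A e * \<eta> (signed S A) {e} e)"
      unfolding flip_sum[OF e] flip_sum[OF singletonI] by simp
    finally have "(\<Sum>A\<in>Pow S. sg A e * \<eta> (signed S A) T e) + (\<Sum>A\<in>Pow S. sg A e * \<eta> (piece T (signed S A)) {e} e)
        - (\<Sum>A\<in>Pow S. sg A e * \<eta> (signed S A) {e} e) = 2 ^ card S * ?w"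
      unfolding eqA using S by (simp add: card_Pow)
    then have "((\<Sum>A\<in>Pow S. sg A e * \<eta> (signed S A) T e) + (\<Sum>A\<in>Pow S. sg A e * \<eta> (piece T (signed S A)) {e} e)
        - (\<Sum>A\<in>Pow S. sg A e * \<eta> (signed S A) {e} e)) / 2 ^ card S = ?w" by simp
    then show ?thesis unfolding add_divide_distrib diff_divide_distrib restr H_def[symmetric] .
  qed
  ultimately have "cell_cocycle p \<A> (D powr p) H" by (simp add: cell_cocycle_def)
  then show ?thesis by blast
qed

text \<open>With a module action the equation contains no sign changes. Indicators suffice, no
  convexity enters, and all \<open>p > 0\<close> are covered.\<close>

lemma cell_cocycle_direct:
  fixes \<eta> :: "(nat \<Rightarrow> 'k::real_normed_field) \<Rightarrow> nat set \<Rightarrow> nat \<Rightarrow> 'k"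
  assumes part: "partition_on UNIV \<A>" and p: "p > 0" and D: "D \<ge> 0"
    and \<eta>: "\<And>x T. x \<in> fin_supp \<Longrightarrow> \<eta> x T \<in> lp p" "\<And>x T. x \<in> fin_supp \<Longrightarrow> lp_norm p (\<eta> x T) \<le> D * lp_norm p x"
    and eq: "\<And>x T e. x \<in> fin_supp \<Longrightarrow> e \<in> T \<Longrightarrow>
      \<eta> x T e + \<eta> (piece T x) {e} e - \<eta> x {e} e = Omega_tilde \<A> p (defect p x T) e"
  shows "\<exists>C H. cell_cocycle p \<A> C (H :: nat set \<Rightarrow> nat set \<Rightarrow> nat \<Rightarrow> 'k)"
proof -
  define H where "H S = \<eta> (signed S {})" for S
  have "(\<Sum>i\<in>T. norm (H S T i) powr p) \<le> D powr p * real (card S)" if S: "finite S" "T \<subseteq> S" for S T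
  proof -
    have fs: "signed S {} \<in> fin_supp" by (rule signed_fin_supp[OF S(1)])
    have "(\<Sum>i\<in>T. norm (H S T i) powr p) \<le> lp_norm p (\<eta> (signed S {}) T) powr p"
      unfolding H_def using S finite_subset by (intro lp_partial_sum_le[OF p \<eta>(1)[OF fs]]) auto
    also have "\<dots> \<le> (D * real (card S) powr (1 / p)) powr p"
      using \<eta>(2)[OF fs, of T] p by (intro powr_mono2) (auto simp: lp_norm_signed[OF p S(1)] lp_norm_nonneg[OF p])
    also have "\<dots> = D powr p * real (card S)" using D p by (simp add: powr_mult powr_powr)
    finally show ?thesis .
  qed
  moreover have "H S T e + H T {e} e - H S {e} e = of_real (ln (card S / card T) * ln (card T / card (T \<inter> cell \<A> e)) / 4)"
    if S: "finite S" "T \<subseteq> S" and e: "e \<in> T" for S T e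
  proof -
    have ps: "piece T (signed S {}) = (signed T {} :: nat \<Rightarrow> 'k)" using S(2) by (auto simp: piece_def signed_def fun_eq_iff)
    have "signed S {} e = (1 :: 'k)" using e S(2) by (auto simp: signed_def)
    then show ?thesis
      using eq[OF signed_fin_supp[OF S(1), of "{}"] e] Omega_tilde_defect_signed[OF part p S e, of "{}", where 'k = 'k]
      by (simp only: H_def ps mult_1)
  qed
  ultimately have "cell_cocycle p \<A> (D powr p) H" by (simp add: cell_cocycle_def)
  then show ?thesis by blast
qed

section \<open>From triviality in Ext to a cocycle\<close>

lemma bdd_operator_id: "bdd_operator V V (\<lambda>v. v)" and module_hom_id: "module_hom M M (\<lambda>v. v)"
  unfolding module_hom_def bdd_operator_def by (auto intro!: exI[of _ 1])

theorem trivial_space_cell_cocycle: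
  assumes part: "partition_on UNIV \<A>" and p: "p \<ge> 1"
    and tr: "Ext2_class (ell_space p :: ('k::{real_normed_field,banach}, ('k, 'u) univ) qspace) (ell_space p)
        (splice_space p (Omega_tilde \<A> p) (Omega p)) = Ext2_zero (ell_space p) (ell_space p)"
  shows "\<exists>C H. cell_cocycle p \<A> C (H :: nat set \<Rightarrow> nat set \<Rightarrow> nat \<Rightarrow> 'k)"
proof -
  have p0: "p > 0" using p by simp
  note cO = centralizer_Omega_tilde[OF part p0, where 'k = 'k] centralizer_Omega[OF p0, where 'k = 'k]
  let ?X = "ell_space p :: ('k, ('k, 'u) univ) qspace"
  let ?E = "splice_space p (Omega_tilde \<A> p) (Omega p) :: (('k, ('k, 'u) univ) qspace, ('k, 'u) univ) fourterm"
  have cX: "is_copy Sq un_Sq (lp_module p) ?X"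
    unfolding ell_space_def by (rule is_copy_truncate) simp
  have qX: "quasi_banach ?X" by (rule is_copy_quasi_banach[OF cX quasi_banach_lp[OF p0]])
  have emb: "scl (copy_space Cl un_Cl (Z_space p \<Theta>)) a (Cl (emb p \<Theta> v)) = Cl (emb p \<Theta> (\<lambda>n. a * fst v n, \<lambda>n. a * snd v n))"
    if "centralizer p \<Theta>" "v \<in> lp p \<times> fin_supp" for \<Theta> :: "(nat \<Rightarrow> 'k) \<Rightarrow> nat \<Rightarrow> 'k" and v a
    using emb_scl[OF p0 that(1), of v a] that(2) by (simp add: copy_space_def carr_T[OF p0 that(1)] mem_Times_iff) (simp add: twisted_pairs_def)
  interpret splice_complex quasi_banach bdd_operator "\<lambda>V T v. scl V (1/2) v" "\<lambda>T x n. (if n \<in> T then 1 else -1) * x n"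
    ?X p \<A> ?E "\<lambda>T n. 1/2" "\<lambda>T n. if n \<in> T then 1 else -1"
  proof
    fix V :: "('k, ('k, 'u) univ) qspace" and v w T c e
    assume V: "quasi_banach V"
    note q = quasi_banach_quasinormed[OF V] and l = quasi_banach_linear[OF V]
    show "v \<in> carr V \<Longrightarrow> scl V (1/2) v \<in> carr V" by (rule scl_in[OF l])
    show "v \<in> carr V \<Longrightarrow> w \<in> carr V \<Longrightarrow> scl V (1/2) (add V v w) = add V (scl V (1/2) v) (scl V (1/2) w)"
      by (rule scl_add[OF l])
    show "v \<in> carr V \<Longrightarrow> scl V (1/2) (scl V c v) = scl V c (scl V (1/2) v)"
      by (simp add: scl_scl[OF l] mult.commute)
    show "\<exists>C\<ge>0. \<forall>T. \<forall>v\<in>carr V. qnorm V (scl V (1/2) v) \<le> C * qnorm V v"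
      by (intro exI[of _ "norm (1/2 :: 'k)"]) (auto simp: qnorm_scl[OF q])
    show "bdd_operator V V (\<lambda>v. v)" by (rule bdd_operator_id)
  next
    fix x :: "nat \<Rightarrow> 'k" and T assume x: "x \<in> fin_supp"
    show "(\<lambda>n. (if n \<in> T then 1 else -1) * x n) \<in> fin_supp" by (rule fin_supp_mult[OF x])
    show "Sq x \<in> carr ?X" by (simp add: ell_space_simps fin_supp_lp[OF p0 x])
    show "qnorm ?X (Sq (\<lambda>n. (if n \<in> T then 1 else -1) * x n)) \<le> qnorm ?X (Sq x)"
      using lp_scaled_bound(2)[OF p0 fin_supp_lp[OF p0 x], of "\<lambda>n. (if n \<in> T then 1 else -1) * x n" 1]
      by (simp add: ell_space_simps norm_mult)
    show "qnorm ?X (Sq (piece T x)) \<le> qnorm ?X (Sq x)"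
      using lp_scaled_bound(2)[OF p0 fin_supp_lp[OF p0 x], of "piece T x" 1]
      by (simp add: ell_space_simps piece_def)
    show "scl ?X (1/2) (add ?X (Sq x) (Sq (\<lambda>n. (if n \<in> T then 1 else -1) * x n))) = Sq (piece T x)"
      by (auto simp: ell_space_simps piece_def)
  next
    show "four_exact quasi_banach bdd_operator ?X ?X ?E"
      by (rule four_exact_splice_space[OF p0 cO])
  qed (auto simp: piece_def fun_eq_iff bdd_operator_scl part p0 cX qX splice_space_def is_copy_copy_space
      ell_space_simps emb cO norm_divide)
  obtain D \<eta> where "D \<ge> 0" "\<And>x T. x \<in> fin_supp \<Longrightarrow> \<eta> x T \<in> lp p" "\<And>x T. x \<in> fin_supp \<Longrightarrow> lp_norm p (\<eta> x T) \<le> D * lp_norm p x"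
    "\<And>x T e. x \<in> fin_supp \<Longrightarrow> e \<in> T \<Longrightarrow>
      1/2 * (\<eta> x T e + \<eta> (\<lambda>n. (if n \<in> {e} then 1 else -1) * x n) T e) + \<eta> (piece T x) {e} e
      - 1/2 * (\<eta> x {e} e + \<eta> (\<lambda>n. (if n \<in> T then 1 else -1) * x n) {e} e) = Omega_tilde \<A> p (defect p x T :: nat \<Rightarrow> 'k) e"
    using trivial_equation tr unfolding Ext2_class_def Ext2_zero_def by blast
  then show ?thesis by (rule cell_cocycle_average[OF assms(1,2)])
qed

theorem trivial_module_cell_cocycle:
  assumes part: "partition_on UNIV \<A>" and p: "p > 0"
    and tr: "Ext2_mod_class (ell_module p :: ('k::{real_normed_field,banach}, ('k, 'u) univ) qmodule) (ell_module p)
        (splice_module p (Omega_tilde \<A> p) (Omega p)) = Ext2_mod_zero (ell_module p) (ell_module p)"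
  shows "\<exists>C H. cell_cocycle p \<A> C (H :: nat set \<Rightarrow> nat set \<Rightarrow> nat \<Rightarrow> 'k)"
proof -
  note cO = centralizer_Omega_tilde[OF part p, where 'k = 'k] centralizer_Omega[OF p, where 'k = 'k]
  let ?X = "ell_module p :: ('k, ('k, 'u) univ) qmodule"
  let ?E = "splice_module p (Omega_tilde \<A> p) (Omega p) :: (('k, ('k, 'u) univ) qmodule, ('k, 'u) univ) fourterm"
  \<comment> \<open>Half the indicator, because \<open>rel\<close> adds \<open>g x\<close> and
    \<open>g (sig T x)\<close>, which coincide here.\<close>
  define a :: "nat set \<Rightarrow> nat \<Rightarrow> 'k" where "a T n = (if n \<in> T then 1/2 else 0)" for T n
  have al: "a T \<in> linf" "linf_norm (a T) \<le> 1" for T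
    by (auto simp: a_def norm_divide intro!: linfI[of _ 1] linf_norm_least)
  have cX: "is_copy Sq un_Sq (lp_module p) ?X"
    unfolding ell_module_def by (rule is_copy_copy_module) simp
  have cZ: "is_copy Cl un_Cl (Z_space p \<Theta>) (copy_module Cl un_Cl (Z_module p \<Theta>) :: ('k, ('k, 'u) univ) qmodule)"
    if "centralizer p \<Theta>" for \<Theta> :: "(nat \<Rightarrow> 'k) \<Rightarrow> nat \<Rightarrow> 'k"
    by (simp add: is_copy_def copy_module_simps Z_module_simps[OF p that])
  have qX: "quasi_banach_module ?X"
    unfolding ell_module_def by (rule quasi_banach_module_copy[OF _ quasi_banach_module_lp[OF p cO(1)]]) simp
  have emb: "act (copy_module Cl un_Cl (Z_module p \<Theta>)) (a T) (Cl (emb p \<Theta> v)) = Cl (emb p \<Theta> (\<lambda>n. a T n * fst v n, \<lambda>n. a T n * snd v n))"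
    if "centralizer p \<Theta>" "v \<in> lp p \<times> fin_supp" for \<Theta> :: "(nat \<Rightarrow> 'k) \<Rightarrow> nat \<Rightarrow> 'k" and v T
    using Z_act_emb[OF p that(1) al(1), of v T] that(2) by (simp add: copy_module_simps carr_T[OF p that(1)] mem_Times_iff)
  interpret splice_complex quasi_banach_module module_hom "\<lambda>V T v. act V (a T) v" "\<lambda>T x. x"
    ?X p \<A> ?E a "\<lambda>T n. 1"
  proof
    fix V :: "('k, ('k, 'u) univ) qmodule" and v w T c e
    assume V: "quasi_banach_module V"
    show qV: "quasi_banach V" using V by (simp add: quasi_banach_module_def)
    note l = quasi_banach_linear[OF qV]
    have act: "\<And>a x. a \<in> linf \<Longrightarrow> x \<in> carr V \<Longrightarrow> act V a x \<in> carr V"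
      "\<And>a b x. a \<in> linf \<Longrightarrow> b \<in> linf \<Longrightarrow> x \<in> carr V \<Longrightarrow> act V (\<lambda>n. a n * b n) x = act V a (act V b x)"
      "\<And>c x. x \<in> carr V \<Longrightarrow> act V (\<lambda>n. c) x = scl V c x"
      "\<And>a x y. a \<in> linf \<Longrightarrow> x \<in> carr V \<Longrightarrow> y \<in> carr V \<Longrightarrow> act V a (add V x y) = add V (act V a x) (act V a y)"
      using V unfolding quasi_banach_module_def by blast+
    show "v \<in> carr V \<Longrightarrow> act V (a T) v \<in> carr V" by (rule act(1)[OF al(1)])
    show "v \<in> carr V \<Longrightarrow> w \<in> carr V \<Longrightarrow> act V (a T) (add V v w) = add V (act V (a T) v) (act V (a T) w)"
      by (rule act(4)[OF al(1)])
    have sc: "act V b (scl V c v) = scl V c (act V b v)" "scl V c (act V b v) = act V (\<lambda>n. c * b n) v" if "b \<in> linf" "v \<in> carr V" for b c v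
      using act(2)[OF that(1) linf_const that(2), of c] act(2)[OF linf_const that, of c]
      by (simp_all add: act(3) act(1) that mult.commute)
    show "v \<in> carr V \<Longrightarrow> act V (a T) (scl V c v) = scl V c (act V (a T) v)" by (rule sc(1)[OF al(1)])
    show "\<exists>C\<ge>0. \<forall>T. \<forall>v\<in>carr V. qnorm V (act V (a T) v) \<le> C * qnorm V v"
      using quasi_banach_module_bound[OF V] al by metis
    show "act V (a {e}) (act V (a T) v) = scl V (1/2) (act V (a {e}) v)" if "v \<in> carr V" "e \<in> T"
    proof -
      have "(\<lambda>n. a {e} n * a T n) = (\<lambda>n. 1/2 * a {e} n)" using that(2) by (auto simp: a_def)
      then show ?thesis using act(2)[OF al(1) al(1) that(1), of "{e}" T] sc(2)[OF al(1) that(1)] by simp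
    qed
    show "module_hom V V (\<lambda>v. v)" by (rule module_hom_id)
  next
    fix V W :: "('k, ('k, 'u) univ) qmodule" and f v T assume "module_hom V W f" "v \<in> carr V"
    then show "f (act V (a T) v) = act W (a T) (f v)" using al(1) by (simp add: module_hom_def)
  next
    fix V W :: "('k, ('k, 'u) univ) qmodule" and f assume "module_hom V W f"
    then show "bdd_operator V W f" by (simp add: module_hom_def)
  next
    fix x :: "nat \<Rightarrow> 'k" and T assume x: "x \<in> fin_supp"
    show "Sq x \<in> carr ?X" by (simp add: ell_module_simps fin_supp_lp[OF p x])
    show "qnorm ?X (Sq (piece T x)) \<le> qnorm ?X (Sq x)"
      using lp_scaled_bound(2)[OF p fin_supp_lp[OF p x], of "piece T x" 1]
      by (simp add: ell_module_simps piece_def)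
    show "act ?X (a T) (add ?X (Sq x) (Sq x)) = Sq (piece T x)"
      by (auto simp: ell_module_simps piece_def a_def)
  next
    show "four_exact quasi_banach_module module_hom ?X ?X ?E"
      by (rule four_exact_splice_module[OF p cO])
  next
    show "is_copy Cl un_Cl (Z_space p (Omega_tilde \<A> p)) (mid1 ?E)" "is_copy Cl un_Cl (Z_space p (Omega p)) (mid2 ?E)"
      by (simp_all add: splice_module_def cZ cO)
  qed (auto simp: piece_def fun_eq_iff part p cX qX splice_module_def
      ell_module_simps emb cO norm_divide a_def)
  obtain D \<eta> where e: "D \<ge> 0" "\<And>x T. x \<in> fin_supp \<Longrightarrow> \<eta> x T \<in> lp p" "\<And>x T. x \<in> fin_supp \<Longrightarrow> lp_norm p (\<eta> x T) \<le> D * lp_norm p x"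
    "\<And>x T e. x \<in> fin_supp \<Longrightarrow> e \<in> T \<Longrightarrow>
      a {e} e * (\<eta> x T e + \<eta> x T e) + \<eta> (piece T x) {e} e
      - 1/2 * (\<eta> x {e} e + \<eta> x {e} e) = Omega_tilde \<A> p (defect p x T :: nat \<Rightarrow> 'k) e"
    using trivial_equation tr unfolding Ext2_mod_class_def Ext2_mod_zero_def by blast
  have "\<eta> x T e + \<eta> (piece T x) {e} e - \<eta> x {e} e = Omega_tilde \<A> p (defect p x T) e" if "x \<in> fin_supp" "e \<in> T" for x T e
    using e(4)[OF that] by (simp add: a_def)
  with e(1-3) show ?thesis by (rule cell_cocycle_direct[OF part p])
qed

section \<open>Large partitions admit no cocycle\<close>

text \<open>The two facts together let linear arithmetic deal with the truncated
  subtraction.\<close>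

lemma card_compl: "finite S \<Longrightarrow> U \<subseteq> S \<Longrightarrow> card (S - U) = card S - card U \<and> card U \<le> card S"
  by (simp add: card_Diff_subset finite_subset card_mono)

lemma card_sum_cells:
  assumes part: "partition_on UNIV \<A>" and R: "R \<subseteq> \<A>" "finite R" and S: "finite S" "S \<subseteq> \<Union>R"
  shows "card S = (\<Sum>B\<in>R. card (S \<inter> B))"
proof -
  have "card (\<Union>B\<in>R. S \<inter> B) = (\<Sum>B\<in>R. card (S \<inter> B))"
  proof (rule card_UN_disjoint)
    show "\<forall>i\<in>R. \<forall>j\<in>R. i \<noteq> j \<longrightarrow> (S \<inter> i) \<inter> (S \<inter> j) = {}"
      using part R unfolding partition_on_def disjoint_def by blast
  qed (use R S in auto)
  moreover have "(\<Union>B\<in>R. S \<inter> B) = S" using S by auto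
  ultimately show ?thesis by simp
qed

section \<open>Good points and the two descents\<close>

context
  fixes \<psi> :: "nat set \<Rightarrow> nat \<Rightarrow> real" and C p :: real and \<A> :: "nat set set"
  assumes p: "p > 0" and C: "C \<ge> 0" and part: "partition_on UNIV \<A>"
    and single: "\<And>e. \<psi> {e} e = 0"
    and main: "\<And>S T. finite S \<Longrightarrow> T \<subseteq> S \<Longrightarrow>
      (\<Sum>e\<in>T. \<bar>\<psi> S e - \<psi> T e - ln (card S / card T) * ln (card T / card (T \<inter> cell \<A> e)) / 4\<bar> powr p) \<le> C * card S"
begin

private definition "pred S T e = ln (card S / card T) * ln (card T / card (T \<inter> cell \<A> e)) / 4"

text \<open>With \<open>262144 = 256 * 1024\<close>, the error bound and
  \<open>card S \<le> 1024 * card T\<close> leave at most \<open>card T / 256\<close> points whose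
  error exceeds \<open>t\<close>. The added 1 keeps \<open>t\<close> positive when
  \<open>C = 0\<close>.\<close>

private definition "t = (262144 * C + 1) powr (1 / p)"

private definition "good S T = {e\<in>T. \<bar>\<psi> S e - \<psi> T e - pred S T e\<bar> \<le> t}"

private lemma t_pos: "t > 0" using C by (simp add: t_def)

text \<open>Markov's inequality for the \<open>p\<close>-th powers of the error.\<close>

private lemma good_bound:
  assumes S: "finite S" "T \<subseteq> S" and r: "card S \<le> 1024 * card T"
  shows "256 * card (T - good S T) \<le> card T"
proof -
  have T: "finite T" using S finite_subset by auto
  define b where "b = real (card (T - good S T))"
  have tp: "t powr p = 262144 * C + 1" using p C by (simp add: t_def powr_powr)
  have "b * (262144 * C + 1) = (\<Sum>e\<in>T - good S T. t powr p)" by (simp add: b_def tp)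
  also have "\<dots> \<le> (\<Sum>e\<in>T - good S T. \<bar>\<psi> S e - \<psi> T e - pred S T e\<bar> powr p)"
    using t_pos p by (intro sum_mono powr_mono2) (auto simp: good_def)
  also have "\<dots> \<le> (\<Sum>e\<in>T. \<bar>\<psi> S e - \<psi> T e - pred S T e\<bar> powr p)" using T by (intro sum_mono2) auto
  also have "\<dots> \<le> C * card S" using main[OF S] by (simp add: pred_def)
  also have "\<dots> \<le> C * (1024 * card T)" using C r by (intro mult_left_mono) linarith+
  finally have "256 * b * (1024 * C + 1 / 256) \<le> card T * (1024 * C)" by (simp add: algebra_simps)
  also have "\<dots> \<le> card T * (1024 * C + 1 / 256)" by (intro mult_left_mono) auto
  finally have "256 * b \<le> card T" by (rule mult_right_le_imp_le) (use C in simp)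
  then show ?thesis unfolding b_def by linarith
qed

private lemma good_card:
  assumes "finite S" "T \<subseteq> S" "card S \<le> 1024 * card T"
  shows "card T \<le> 256 * card (good S T)" "good S T \<subseteq> T"
proof -
  show sub: "good S T \<subseteq> T" by (auto simp: good_def)
  have "card (T - good S T) = card T - card (good S T) \<and> card (good S T) \<le> card T"
    by (rule card_compl[OF finite_subset[OF assms(2,1)] sub])
  then show "card T \<le> 256 * card (good S T)" using good_bound[OF assms] by linarith
qed

private lemma pred_nonneg:
  assumes S: "finite S" "T \<subseteq> S" and e: "e \<in> T" shows "pred S T e \<ge> 0"
proof -
  have T: "finite T" using S finite_subset by auto
  have c: "card T > 0" "card (T \<inter> cell \<A> e) > 0" using T e cell_mem(2)[OF part, of e] by (auto simp: card_gt_0_iff)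
  have "card T \<le> card S" "card (T \<inter> cell \<A> e) \<le> card T" using S T by (auto intro: card_mono)
  then have "ln (card S / card T) \<ge> 0" "ln (card T / card (T \<inter> cell \<A> e)) \<ge> 0"
    using c by (auto simp: ln_ge_zero_iff)
  then show ?thesis by (simp add: pred_def)
qed

text \<open>Pass to a subset \<open>T\<close> of \<open>U\<close> with at most half as many points
  as \<open>S\<close> and recurse into the good points of \<open>T\<close>; about
  \<open>log 2 (card S)\<close> steps cost \<open>t\<close> each. The predicted increments are
  nonnegative, whence the lower bound, and they vanish inside a single cell, whence the upper
  one.\<close>

private lemma halving:
  assumes "finite S" "U \<subseteq> S" "S \<noteq> {}" "card S \<le> 256 * card U"
  shows "\<exists>e\<in>U. - t * (1 + log 2 (card S)) \<le> \<psi> S e \<and> (\<forall>B\<in>\<A>. S \<subseteq> B \<longrightarrow> \<psi> S e \<le> t * (1 + log 2 (card S)))"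
  using assms
proof (induction "card S" arbitrary: S U rule: less_induct)
  case less
  have cS: "card S \<ge> 1" using less.prems by (simp add: Suc_le_eq card_gt_0_iff)
  have cU: "card U \<ge> 1" using less.prems(4) cS by linarith
  show ?case
  proof (cases "card S = 1")
    case True
    then obtain e where e: "S = {e}" by (auto simp: card_1_singleton_iff)
    then have "U = {e}" using cU less.prems(2) by (auto simp: subset_singleton_iff)
    then show ?thesis using t_pos by (simp add: e single)
  next
    case False
    then have c2: "card S \<ge> 2" using cS by linarith
    \<comment> \<open>At most half of \<open>card S\<close>, so the binary logarithm drops by at
      least 1, and still at least \<open>card S / 1024\<close>, as the count of good points
      requires.\<close>
    define m where "m = min (card U) (card S div 2)"
    have m: "1 \<le> m" "2 * m \<le> card S" "card S \<le> 1024 * m" using c2 cU less.prems(4) by (auto simp: m_def min_def)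
    obtain T where T: "T \<subseteq> U" "card T = m" "finite T"
      using obtain_subset_with_card_n[of m U] by (auto simp: m_def)
    have TS: "T \<subseteq> S" using T less.prems by auto
    note g = good_card[OF less.prems(1) TS, unfolded T(2), OF m(3)]
    have "\<exists>e\<in>good S T. - t * (1 + log 2 (card T)) \<le> \<psi> T e \<and> (\<forall>B\<in>\<A>. T \<subseteq> B \<longrightarrow> \<psi> T e \<le> t * (1 + log 2 (card T)))"
    proof (rule less.hyps)
      show "card T < card S" "T \<noteq> {}" using T m by auto
      show "card T \<le> 256 * card (good S T)" using g(1) T(2) by simp
    qed (use T g(2) in auto)
    then obtain e where e: "e \<in> good S T" "- t * (1 + log 2 (card T)) \<le> \<psi> T e"
      "\<And>B. B \<in> \<A> \<Longrightarrow> T \<subseteq> B \<Longrightarrow> \<psi> T e \<le> t * (1 + log 2 (card T))" by blast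
    have eT: "e \<in> T" using e(1) by (simp add: good_def)
    have er: "\<bar>\<psi> S e - \<psi> T e - pred S T e\<bar> \<le> t" using e(1) by (simp add: good_def)
    have "real m \<le> card S / 2" using m(2) by linarith
    then have "log 2 m \<le> log 2 (card S / 2)" using m(1) by simp
    also have "\<dots> = log 2 (card S) - 1" using cS by (simp add: log_divide)
    finally have "t * (1 + log 2 (card T)) \<le> t * log 2 (card S)" using t_pos T(2) by (intro mult_left_mono) auto
    then have lt: "t * (1 + log 2 (card T)) + t \<le> t * (1 + log 2 (card S))" by (simp add: distrib_left)
    have "\<psi> S e \<le> t * (1 + log 2 (card S))" if B: "B \<in> \<A>" "S \<subseteq> B" for B
    proof -
      have "cell \<A> e = B" using cell_eqI[OF part B(1)] B(2) TS eT by auto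
      then have "T \<inter> cell \<A> e = T" using B(2) TS by auto
      then have "pred S T e = 0" using T m by (simp add: pred_def)
      moreover have "\<psi> T e \<le> t * (1 + log 2 (card T))" using e(3)[OF B(1)] B(2) TS by blast
      ultimately show ?thesis using er lt by (simp add: abs_le_iff)
    qed
    moreover have "- t * (1 + log 2 (card S)) \<le> \<psi> S e"
      using er e(2) lt pred_nonneg[OF less.prems(1) TS eT] by (simp add: abs_le_iff)
    moreover have "e \<in> U" using eT T by auto
    ultimately show ?thesis by blast
  qed
qed

text \<open>Upper estimate, halving the number of cells at each step. The number 1024 arises here:
  \<open>U\<close> has at least 1/256 of the points of \<open>S\<close>, the better half of the
  cells at least half of those, and removing sparse cells costs another factor 2. In a cell that is
  not sparse the second ratio is at most \<open>2 ^ (a + 1)\<close>, which bounds the prediction.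
  The last cell is left to \<open>halving\<close>.\<close>

private lemma few_cells:
  assumes "R \<subseteq> \<A>" "finite R" "card R \<le> 2 ^ a" "finite S" "S \<subseteq> \<Union>R" "S \<noteq> {}" "U \<subseteq> S" "card S \<le> 256 * card U"
  shows "\<exists>e\<in>U. \<psi> S e \<le> real a * (t + ln 1024 * ln 2 / 4 * (real a + 1)) + t * (1 + log 2 (card S))"
  using assms
proof (induction a arbitrary: R S U)
  case 0
  then have "card R = 1" by (auto simp: le_Suc_eq card_eq_0_iff)
  then obtain B where B: "R = {B}" by (auto simp: card_1_singleton_iff)
  then have "B \<in> \<A>" "S \<subseteq> B" using 0 by auto
  then show ?case using halving[of S U] 0 by auto
next
  case (Suc a)
  define c where "c = ln 1024 * ln 2 / (4 :: real)"
  have c: "c \<ge> 0" by (simp add: c_def)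
  obtain R1 where R1: "R1 \<subseteq> R" "card R1 = min (card R) (2 ^ a)"
    using obtain_subset_with_card_n[of "min (card R) (2 ^ a)" R] by auto
  have R2: "card (R - R1) \<le> 2 ^ a"
    using R1 Suc.prems(2,3) by (simp add: card_Diff_subset finite_subset)
  have fU: "finite U" using Suc.prems finite_subset by auto
  have "card U \<le> card (U \<inter> \<Union>R1) + card (U \<inter> \<Union>(R - R1))"
  proof -
    have "U = (U \<inter> \<Union>R1) \<union> (U \<inter> \<Union>(R - R1))" using Suc.prems by blast
    then show ?thesis by (metis card_Un_le)
  qed
  then obtain Q where Q: "Q \<subseteq> R" "card Q \<le> 2 ^ a" "card U \<le> 2 * card (U \<inter> \<Union>Q)"
    using R1 R2 by (cases "card U \<le> 2 * card (U \<inter> \<Union>R1)") (auto intro: that)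
  define W where "W = U \<inter> \<Union>Q"
  have W: "finite W" "W \<subseteq> S" "card U \<le> 2 * card W" using fU Q Suc.prems by (auto simp: W_def)
  have QA: "Q \<subseteq> \<A>" "finite Q" using Q(1) Suc.prems(1) finite_subset[OF Q(1) Suc.prems(2)] by auto
  \<comment> \<open>Cells with a share of \<open>W\<close> below \<open>1 / 2 ^ (a + 1)\<close> are
    dropped. At most \<open>2 ^ a\<close> cells are present, so at most half of \<open>W\<close> is
    lost.\<close>
  define T where "T = {e\<in>W. card W \<le> 2 * 2 ^ a * card (W \<inter> cell \<A> e)}"
  have TW: "T \<subseteq> W" by (auto simp: T_def)
  have "card (W - T) = (\<Sum>B\<in>Q. card ((W - T) \<inter> B))"
    by (rule card_sum_cells[OF part QA]) (use W in \<open>auto simp: W_def\<close>)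
  also have "2 * 2 ^ a * \<dots> \<le> (\<Sum>B\<in>Q. card W)"
    unfolding sum_distrib_left
  proof (rule sum_mono)
    fix B assume B: "B \<in> Q"
    show "2 * 2 ^ a * card ((W - T) \<inter> B) \<le> card W"
    proof (cases "(W - T) \<inter> B = {}")
      case False
      then obtain e where e: "e \<in> W" "e \<notin> T" "e \<in> B" by auto
      have "cell \<A> e = B" using cell_eqI[OF part] B QA e by auto
      then have "2 * 2 ^ a * card (W \<inter> B) \<le> card W" using e by (simp add: T_def)
      moreover have "card ((W - T) \<inter> B) \<le> card (W \<inter> B)" using W by (intro card_mono) auto
      ultimately show ?thesis by (meson mult_le_mono2 order_trans)
    qed simp
  qed
  also have "\<dots> \<le> 2 ^ a * card W" using Q by simp
  finally have "2 * card (W - T) \<le> card W" by simp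
  moreover have "card (W - T) = card W - card T \<and> card T \<le> card W" by (rule card_compl[OF W(1) TW])
  ultimately have "card W \<le> 2 * card T" by linarith
  then have r: "card S \<le> 1024 * card T" using W Suc.prems(8) by linarith
  have TS: "T \<subseteq> S" using TW W by auto
  have fT: "finite T" by (rule finite_subset[OF TS Suc.prems(4)])
  have cS: "card S > 0" using Suc.prems by (simp add: card_gt_0_iff)
  then have cT: "card T > 0" using r by linarith
  note g = good_card[OF Suc.prems(4) TS r]
  have "\<exists>e\<in>good S T. \<psi> T e \<le> real a * (t + ln 1024 * ln 2 / 4 * (real a + 1)) + t * (1 + log 2 (card T))"
    using Suc.IH[OF QA Q(2) fT _ _ g(2,1)] TW cT by (force simp: W_def)
  then obtain e where e: "e \<in> good S T" "\<psi> T e \<le> real a * (t + c * (real a + 1)) + t * (1 + log 2 (card T))"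
    by (auto simp: c_def)
  have eT: "e \<in> T" using e(1) by (simp add: good_def)
  \<comment> \<open>Whether a point is kept depends on its cell only, so \<open>T\<close> contains
    the full trace of \<open>W\<close> on the cell of \<open>e\<close>.\<close>
  have eq: "T \<inter> cell \<A> e = W \<inter> cell \<A> e"
    using eT mem_cell_iff[OF part] by (auto simp: T_def)
  have "pred S T e \<le> c * (real a + 1)"
  proof -
    have ce: "card (T \<inter> cell \<A> e) > 0" using fT eT cell_mem(2)[OF part, of e] by (auto simp: card_gt_0_iff)
    have "card T \<le> 2 * 2 ^ a * card (T \<inter> cell \<A> e)"
      unfolding eq using eT card_mono[OF W(1) TW] by (simp add: T_def)
    then have "real (card T) \<le> real (2 * 2 ^ a * card (T \<inter> cell \<A> e))" by (rule of_nat_mono)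
    then have "card T / card (T \<inter> cell \<A> e) \<le> 2 ^ (a + 1)" using ce by (simp add: field_simps)
    then have "ln (card T / card (T \<inter> cell \<A> e)) \<le> ln (2 ^ (a + 1))" using ce cT by (subst ln_le_cancel_iff) auto
    moreover have "ln (2 ^ (a + 1)) = (real a + 1) * ln 2" by (subst ln_realpow) auto
    ultimately have l1: "ln (card T / card (T \<inter> cell \<A> e)) \<le> (real a + 1) * ln 2" by simp
    have "real (card S) \<le> 1024 * real (card T)" using r by linarith
    then have "card S / card T \<le> 1024" using cT by (simp add: field_simps)
    then have l2: "ln (card S / card T) \<le> ln 1024" using cS cT by (subst ln_le_cancel_iff) auto
    have "card (T \<inter> cell \<A> e) \<le> card T" using fT by (intro card_mono) auto
    then have "0 \<le> ln (card T / card (T \<inter> cell \<A> e))" using ce by (auto simp: ln_ge_zero_iff)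
    then have "ln (card S / card T) * ln (card T / card (T \<inter> cell \<A> e)) \<le> ln 1024 * ((real a + 1) * ln 2)"
      using l1 l2 by (intro mult_mono) auto
    then show ?thesis by (simp add: pred_def c_def mult.assoc mult.commute[of "ln 2"])
  qed
  moreover have "\<bar>\<psi> S e - \<psi> T e - pred S T e\<bar> \<le> t" using e(1) by (simp add: good_def)
  moreover have "t * (1 + log 2 (card T)) \<le> t * (1 + log 2 (card S))"
    using t_pos card_mono[OF Suc.prems(4) TS] cT by (intro mult_left_mono) auto
  ultimately have "\<psi> S e \<le> real a * (t + c * (real a + 1)) + c * (real a + 1) + t + t * (1 + log 2 (card S))"
    using e(2) by (simp add: abs_le_iff)
  also have "real a * (t + c * (real a + 1)) + c * (real a + 1) + t \<le> real (Suc a) * (t + c * (real (Suc a) + 1))"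
    using c by (simp add: algebra_simps)
  finally have "\<psi> S e \<le> real (Suc a) * (t + c * (real (Suc a) + 1)) + t * (1 + log 2 (card S))" by simp
  moreover have "e \<in> U" using eT TW by (auto simp: W_def)
  ultimately show ?case unfolding c_def by blast
qed

text \<open>Lower estimate, halving all cells simultaneously. As \<open>U\<close> misses at most
  1/256 of \<open>S\<close>, at most 1/128 of the cells keep fewer than half of their points in
  \<open>U\<close>, and these are discarded; so at least \<open>\<rho>\<close> cells survive all
  \<open>j\<close> steps, and each step gains \<open>ln 2 * ln \<rho> / 4 - t\<close>. The good
  points miss at most 1/256 of the new set, which restores the hypothesis on \<open>U\<close>. When
  one point per cell remains, \<open>halving\<close> finishes.\<close>

private lemma shrinking_cells:
  assumes "R \<subseteq> \<A>" "finite R" "finite S" "S \<subseteq> \<Union>R" "\<And>B. B \<in> R \<Longrightarrow> card (S \<inter> B) = 2 ^ j"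
    "U \<subseteq> S" "256 * card (S - U) \<le> card S" "1 \<le> \<rho>" "\<rho> \<le> real (card R) * (127 / 128) ^ j"
  shows "\<exists>e\<in>U. real j * (ln 2 * ln \<rho> / 4 - t) - t * (1 + log 2 (card R)) \<le> \<psi> S e"
  using assms
proof (induction j arbitrary: R S U)
  case 0
  have cS: "card S = card R" using card_sum_cells[OF part 0(1-4)] 0(5) by simp
  have cR: "real (card R) \<ge> 1" using 0 by simp
  then have S: "S \<noteq> {}" using cS by auto
  have "card (S - U) = card S - card U \<and> card U \<le> card S" by (rule card_compl[OF 0(3,6)])
  then have "card S \<le> 256 * card U" using 0(7) by linarith
  then show ?case using halving[OF 0(3,6) S] cS by auto
next
  case (Suc j)
  have disj: "B \<inter> B' = {}" if "B \<in> R" "B' \<in> R" "B \<noteq> B'" for B B'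
    using part Suc.prems(1) that unfolding partition_on_def disjoint_def by blast
  have cS: "card S = card R * 2 ^ Suc j" using card_sum_cells[OF part Suc.prems(1-4)] Suc.prems(5) by simp
  define Q where "Q = {B\<in>R. 2 ^ j \<le> card (U \<inter> B)}"
  have Q: "Q \<subseteq> R" "finite Q" using Suc.prems(2) by (auto simp: Q_def)
  have fU: "finite U" using Suc.prems finite_subset by auto
  have "card (R - Q) * 2 ^ j = (\<Sum>B\<in>R - Q. 2 ^ j)" by simp
  also have "\<dots> \<le> (\<Sum>B\<in>R - Q. card ((S - U) \<inter> B))"
  proof (rule sum_mono)
    fix B assume B: "B \<in> R - Q"
    have "card ((S - U) \<inter> B) = card (S \<inter> B) - card (U \<inter> B)"
    proof -
      have "(S - U) \<inter> B = S \<inter> B - U \<inter> B" by auto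
      moreover have "U \<inter> B \<subseteq> S \<inter> B" using Suc.prems(6) by auto
      ultimately show ?thesis using fU by (simp add: card_Diff_subset)
    qed
    then show "2 ^ j \<le> card ((S - U) \<inter> B)" using B Suc.prems(5)[of B] by (auto simp: Q_def)
  qed
  also have "\<dots> \<le> (\<Sum>B\<in>R. card ((S - U) \<inter> B))" using Suc.prems(2) by (intro sum_mono2) auto
  also have "\<dots> = card (S - U)"
    by (rule card_sum_cells[OF part Suc.prems(1,2), symmetric]) (use Suc.prems in auto)
  finally have "256 * (card (R - Q) * 2 ^ j) \<le> card R * 2 ^ Suc j" using Suc.prems(7) cS by linarith
  then have "128 * card (R - Q) \<le> card R" by simp
  moreover have "card (R - Q) = card R - card Q \<and> card Q \<le> card R" by (rule card_compl[OF Suc.prems(2) Q(1)])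
  ultimately have cQ: "127 * card R \<le> 128 * card Q" "card Q \<le> card R" by linarith+
  have "\<exists>V\<subseteq>U \<inter> B. card V = 2 ^ j" if "B \<in> Q" for B
  proof -
    have "2 ^ j \<le> card (U \<inter> B)" using that by (simp add: Q_def)
    from obtain_subset_with_card_n[OF this] show ?thesis by metis
  qed
  then obtain V where V: "\<And>B. B \<in> Q \<Longrightarrow> V B \<subseteq> U \<inter> B" "\<And>B. B \<in> Q \<Longrightarrow> card (V B) = 2 ^ j" by metis
  define T where "T = (\<Union>B\<in>Q. V B)"
  have TU: "T \<subseteq> U" using V by (auto simp: T_def)
  have TB: "T \<inter> B = V B" if B: "B \<in> Q" for B
  proof
    show "V B \<subseteq> T \<inter> B" using V(1)[OF B] B by (auto simp: T_def)
    show "T \<inter> B \<subseteq> V B"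
    proof
      fix x assume "x \<in> T \<inter> B"
      then obtain B' where B': "B' \<in> Q" "x \<in> V B'" "x \<in> B" by (auto simp: T_def)
      then have "B' = B" using disj[of B' B] V(1)[OF B'(1)] B Q(1) by blast
      then show "x \<in> V B" using B' by simp
    qed
  qed
  have TS: "T \<subseteq> S" using TU Suc.prems(6) by auto
  have fT: "finite T" using TU fU finite_subset by auto
  have QA: "Q \<subseteq> \<A>" using Q Suc.prems by auto
  have TQ: "T \<subseteq> \<Union>Q" using V by (auto simp: T_def)
  have cT: "card T = card Q * 2 ^ j" using card_sum_cells[OF part QA Q(2) fT TQ] TB V(2) by simp
  have r: "card S \<le> 1024 * card T"
  proof -
    have "card R \<le> 512 * card Q" using cQ by linarith
    then have "card R * 2 ^ j \<le> 512 * card Q * 2 ^ j" by simp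
    then show ?thesis unfolding cS cT by simp
  qed
  have "\<rho> \<le> real (card R) * (127 / 128) * (127 / 128) ^ j" using Suc.prems(9) by simp
  also have "\<dots> \<le> real (card Q) * (127 / 128) ^ j" using cQ(1) by (intro mult_right_mono) auto
  finally have \<rho>: "\<rho> \<le> real (card Q) * (127 / 128) ^ j" .
  also have "\<dots> \<le> real (card Q) * 1" by (intro mult_left_mono power_le_one) auto
  finally have \<rho>Q: "\<rho> \<le> real (card Q)" by simp
  have "\<exists>e\<in>good S T. real j * (ln 2 * ln \<rho> / 4 - t) - t * (1 + log 2 (card Q)) \<le> \<psi> T e"
    by (rule Suc.IH[OF QA Q(2) fT TQ _ _ good_bound[OF Suc.prems(3) TS r] Suc.prems(8) \<rho>])
      (auto simp: TB V(2) good_def)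
  then obtain e where e: "e \<in> good S T" "real j * (ln 2 * ln \<rho> / 4 - t) - t * (1 + log 2 (card Q)) \<le> \<psi> T e" by blast
  have eT: "e \<in> T" using e(1) by (simp add: good_def)
  then obtain B where B: "B \<in> Q" "e \<in> B" using TQ by auto
  have "cell \<A> e = B" using cell_eqI[OF part _ B(2)] B(1) QA by auto
  then have cc: "card (T \<inter> cell \<A> e) = 2 ^ j" using TB[OF B(1)] V(2)[OF B(1)] by simp
  have Qpos: "real (card Q) \<ge> 1" using \<rho>Q Suc.prems(8) by simp
  \<comment> \<open>The set shrinks at least by the factor 2, and since all surviving cells have
    \<open>2 ^ j\<close> points, the second ratio is their number.\<close>
  have "pred S T e \<ge> ln 2 * ln \<rho> / 4"
  proof -
    have "real (2 * card T) \<le> real (card S)" unfolding of_nat_le_iff cS cT using cQ(2) by simp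
    then have "card S / card T \<ge> 2" using Qpos cT by (simp add: field_simps)
    then have "ln (card S / card T) \<ge> ln 2" by (subst ln_le_cancel_iff) auto
    moreover from this have "ln (card S / card T) \<ge> 0" using ln_ge_zero[of "2 :: real"] by linarith
    moreover have "card T / card (T \<inter> cell \<A> e) = card Q" by (simp add: cT cc)
    moreover have "ln (real (card Q)) \<ge> ln \<rho>" using \<rho>Q Suc.prems(8) by (subst ln_le_cancel_iff) auto
    ultimately have "ln 2 * ln \<rho> \<le> ln (card S / card T) * ln (card T / card (T \<inter> cell \<A> e))"
      using Suc.prems(8) ln_ge_zero[of 2] by (auto intro!: mult_mono)
    then show ?thesis by (simp add: pred_def)
  qed
  moreover have "\<bar>\<psi> S e - \<psi> T e - pred S T e\<bar> \<le> t" using e(1) by (simp add: good_def)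
  moreover have "t * (1 + log 2 (card Q)) \<le> t * (1 + log 2 (card R))"
    using t_pos cQ(2) Qpos by (intro mult_left_mono) auto
  ultimately have "real (Suc j) * (ln 2 * ln \<rho> / 4 - t) - t * (1 + log 2 (card R)) \<le> \<psi> S e"
    using e(2) by (simp add: abs_le_iff algebra_simps)
  moreover have "e \<in> U" using eT TU by auto
  ultimately show ?case by blast
qed

text \<open>On a grid of \<open>2 ^ a\<close> cells with \<open>2 ^ (32 * a)\<close> points each, reaching single points by first
  thinning out the cells gives a larger value of \<open>\<psi>\<close>, by a multiple of \<open>a\<^sup>2\<close>, than by first discarding cells,
  while the errors are linear in \<open>a\<close>.\<close>

private lemma grid_bounds:
  assumes R: "R \<subseteq> \<A>" "finite R" "card R = 2 ^ a" and S: "finite S" "S \<subseteq> \<Union>R" "\<And>B. B \<in> R \<Longrightarrow> card (S \<inter> B) = 2 ^ (32 * a)"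
  shows "3 / 2 * (ln 2)\<^sup>2 * real a * real a \<le> (5 / 2 * (ln 2)\<^sup>2 + 67 * t) * real a + 2 * t"
proof -
  have cS: "card S = 2 ^ (33 * a)"
    using card_sum_cells[OF part R(1,2) S(1,2)] S(3) R(3) by (simp flip: power_add)
  \<comment> \<open>The lower estimate after \<open>32 * a\<close> halvings with at least
    \<open>(3 / 2) ^ a\<close> surviving cells.\<close>
  define b where "b = real (32 * a) * (ln 2 * ln ((3 / 2) ^ a) / 4 - t) - t * (1 + log 2 (card R))"
  define G where "G = {e\<in>S. b \<le> \<psi> S e}"
  \<comment> \<open>Otherwise \<open>S - G\<close> would be admissible as \<open>U\<close> in the
    lower estimate and would have to meet \<open>G\<close>. Hence \<open>G\<close> is large enough
    to be the set \<open>U\<close> of the upper estimate.\<close>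
  have "card S \<le> 256 * card G"
  proof (rule ccontr)
    assume "\<not> card S \<le> 256 * card G"
    moreover have "S - (S - G) = G" by (auto simp: G_def)
    ultimately have c: "256 * card (S - (S - G)) \<le> card S" by simp
    \<comment> \<open>Over 32 steps at least the fraction \<open>1 - 32 / 128\<close> of the cells
      survives, so \<open>2 ^ a\<close> cells leave at least \<open>(2 * (3 / 4)) ^ a\<close> after
      \<open>32 * a\<close> steps.\<close>
    have "(3 / 4 :: real) \<le> (127 / 128) ^ 32" using Bernoulli_inequality[of "- 1 / 128 :: real" 32] by simp
    then have "2 * (3 / 4) \<le> 2 * (127 / 128 :: real) ^ 32" by simp
    then have "(2 * (3 / 4)) ^ a \<le> (2 * (127 / 128 :: real) ^ 32) ^ a" by (intro power_mono) auto
    then have "(3 / 2) ^ a \<le> real (card R) * (127 / 128) ^ (32 * a)"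
      by (simp add: R(3) power_mult_distrib power_mult)
    from shrinking_cells[OF R(1,2) S _ c _ this] obtain e where "e \<in> S - G" "b \<le> \<psi> S e"
      by (auto simp: b_def)
    then show False by (simp add: G_def)
  qed
  moreover have "G \<subseteq> S" "S \<noteq> {}" using cS by (auto simp: G_def)
  ultimately obtain e where e: "e \<in> G" "\<psi> S e \<le> real a * (t + ln 1024 * ln 2 / 4 * (real a + 1)) + t * (1 + log 2 (card S))"
    using few_cells[OF R(1,2) _ S(1,2), of a G] R(3) by auto
  define l where "l = ln (2::real)"
  have l1024: "ln (1024::real) = 10 * l" using ln_realpow[of 2 10] by (simp add: l_def)
  \<comment> \<open>This is \<open>2 \<le> 9 / 4\<close>. It makes the gain
    \<open>8 * a\<^sup>2 * l * ln (3 / 2)\<close> at least \<open>4 * a\<^sup>2 * l\<^sup>2\<close>,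
    against \<open>5 / 2 * a\<^sup>2 * l\<^sup>2\<close> for the upper estimate; the factor 32 is
    large enough for this.\<close>
  have "l \<le> 2 * ln (3 / 2)"
  proof -
    have "l \<le> ln ((3 / 2) ^ 2)" unfolding l_def by (subst ln_le_cancel_iff) (auto simp: power2_eq_square)
    then show ?thesis by (simp add: ln_realpow)
  qed
  then have "real a * real a * l * l \<le> real a * real a * l * (2 * ln (3 / 2))"
    by (intro mult_left_mono) (auto simp: l_def)
  moreover have "b = 8 * (real a * real a * l * ln (3 / 2)) - 32 * real a * t - t * (1 + real a)"
    by (simp add: b_def R(3) ln_realpow log_nat_power l_def algebra_simps)
  ultimately have "4 * (real a * real a * l * l) - 32 * real a * t - t * (1 + real a) \<le> \<psi> S e"
    using e(1) by (simp add: G_def)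
  also have "\<dots> \<le> real a * (t + 10 * l * l / 4 * (real a + 1)) + t * (1 + 33 * real a)"
    using e(2) by (simp add: cS log_nat_power l1024 l_def)
  finally have f: "4 * (real a * real a * l * l) - 32 * real a * t - t * (1 + real a)
      \<le> real a * (t + 10 * l * l / 4 * (real a + 1)) + t * (1 + 33 * real a)" .
  define x y z where "x = real a * real a * l * l" and "y = real a * l * l" and "z = real a * t"
  have "4 * x - 32 * z - t - z \<le> z + 5 / 2 * x + 5 / 2 * y + t + 33 * z"
    using f unfolding x_def y_def z_def by (simp add: algebra_simps add_divide_distrib)
  then have "3 / 2 * x \<le> 5 / 2 * y + 67 * z + 2 * t" by linarith
  then show ?thesis by (simp add: x_def y_def z_def l_def power2_eq_square algebra_simps)
qed

text \<open>The single number \<open>2 ^ (32 * a)\<close> in the largeness condition yields both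
  enough cells and enough points in each, so grids exist for every \<open>a\<close>; a quadratic
  function of \<open>a\<close> cannot stay below a linear one.\<close>

lemma not_large_partition: "\<not> large_partition \<A>"
proof
  assume large: "large_partition \<A>"
  have ineq: "3 / 2 * (ln 2)\<^sup>2 * real a * real a \<le> (5 / 2 * (ln 2)\<^sup>2 + 67 * t) * real a + 2 * t" for a
  proof -
    obtain \<B> where \<B>: "\<B> \<subseteq> \<A>" "finite \<B>" "card \<B> = 2 ^ (32 * a)" "\<And>B. B \<in> \<B> \<Longrightarrow> infinite B \<or> 2 ^ (32 * a) \<le> card B"
      using large unfolding large_partition_def by metis
    have "(2::nat) ^ a \<le> card \<B>" unfolding \<B>(3) by (intro power_increasing) auto
    then obtain R where R: "R \<subseteq> \<B>" "card R = 2 ^ a" "finite R" using obtain_subset_with_card_n by metis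
    have "\<exists>V\<subseteq>B. card V = 2 ^ (32 * a) \<and> finite V" if "B \<in> R" for B
    proof (cases "infinite B")
      case True
      then show ?thesis using infinite_arbitrarily_large[of B "2 ^ (32 * a)"] by blast
    next
      case False
      then have "2 ^ (32 * a) \<le> card B" using \<B>(4)[of B] that R by auto
      from obtain_subset_with_card_n[OF this] show ?thesis by metis
    qed
    then obtain V where V: "\<And>B. B \<in> R \<Longrightarrow> V B \<subseteq> B" "\<And>B. B \<in> R \<Longrightarrow> card (V B) = 2 ^ (32 * a)" "\<And>B. B \<in> R \<Longrightarrow> finite (V B)"
      by metis
    have RA: "R \<subseteq> \<A>" using R \<B> by auto
    have "(\<Union>B\<in>R. V B) \<inter> B = V B" if B: "B \<in> R" for B
    proof
      show "V B \<subseteq> (\<Union>B\<in>R. V B) \<inter> B" using V(1)[OF B] B by auto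
      show "(\<Union>B\<in>R. V B) \<inter> B \<subseteq> V B"
      proof
        fix x assume "x \<in> (\<Union>B\<in>R. V B) \<inter> B"
        then obtain B' where B': "B' \<in> R" "x \<in> V B'" "x \<in> B" by auto
        then have "x \<in> B'" using V(1) by auto
        then have "B' = B" using cell_eqI[OF part, of B' x] cell_eqI[OF part, of B x] B' B RA by auto
        then show "x \<in> V B" using B' by simp
      qed
    qed
    then show ?thesis
      using V R by (intro grid_bounds[of R a "\<Union>B\<in>R. V B"] RA) auto
  qed
  define l where "l = (ln (2::real))\<^sup>2"
  have l: "l > 0" by (simp add: l_def)
  \<comment> \<open>The coefficient 69 instead of 67 absorbs the constant term \<open>2 * t\<close>
    as soon as \<open>a \<ge> 1\<close>.\<close>
  obtain a :: nat where a: "(5 / 2 * l + 69 * t) / (3 / 2 * l) < a" using reals_Archimedean2 by blast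
  then have a1: "5 / 2 * l + 69 * t < 3 / 2 * l * a" using l by (simp add: field_simps)
  have "a \<ge> 1"
  proof (rule ccontr)
    assume "\<not> a \<ge> 1"
    then have "a = 0" by simp
    then show False using a1 l t_pos by simp
  qed
  have "(5 / 2 * l + 69 * t) * a < 3 / 2 * l * a * a" using a1 \<open>a \<ge> 1\<close> by (intro mult_strict_right_mono) auto
  also have "\<dots> \<le> (5 / 2 * l + 67 * t) * a + 2 * t" using ineq[of a] by (simp add: l_def)
  also have "\<dots> \<le> (5 / 2 * l + 69 * t) * a" using \<open>a \<ge> 1\<close> t_pos by (simp add: algebra_simps)
  finally show False by simp
qed

end

text \<open>Pairing with 1 is the real part, for real and for complex scalars. The terms with
  \<open>{e}\<close> form a difference of values of \<open>\<psi> S e = - re (H S {e} e)\<close>,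
  and \<open>H S T e\<close> is the error whose \<open>p\<close>-th powers are controlled. The
  equation for \<open>S = T = {e}\<close> gives \<open>\<psi> {e} e = 0\<close>.\<close>

theorem no_cell_cocycle:
  fixes H :: "nat set \<Rightarrow> nat set \<Rightarrow> nat \<Rightarrow> 'k::{real_normed_field,euclidean_space}"
  assumes p: "p > 0" and large: "large_partition \<A>"
  shows "\<not> cell_cocycle p \<A> C H"
proof
  assume H: "cell_cocycle p \<A> C H"
  have part: "partition_on UNIV \<A>" using large by (simp add: large_partition_def)
  define re :: "'k \<Rightarrow> real" where "re z = z \<bullet> 1" for z
  have re_of_real: "re (of_real r) = r" for r
    by (simp add: re_def of_real_def dot_square_norm)
  have re_le: "\<bar>re z\<bar> \<le> norm z" for z using Cauchy_Schwarz_ineq2[of z 1] by (simp add: re_def)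
  define \<psi> where "\<psi> S e = - re (H S {e} e)" for S e
  have eq: "H S T e + H T {e} e - H S {e} e = of_real (ln (card S / card T) * ln (card T / card (T \<inter> cell \<A> e)) / 4)"
    if "finite S" "T \<subseteq> S" "e \<in> T" for S T e using H that unfolding cell_cocycle_def by blast
  have err: "\<psi> S e - \<psi> T e - ln (card S / card T) * ln (card T / card (T \<inter> cell \<A> e)) / 4 = - re (H S T e)"
    if "finite S" "T \<subseteq> S" "e \<in> T" for S T e
  proof -
    have "re (H S T e + H T {e} e - H S {e} e) = ln (card S / card T) * ln (card T / card (T \<inter> cell \<A> e)) / 4"
      unfolding eq[OF that] re_of_real ..
    then show ?thesis by (simp add: \<psi>_def re_def inner_add_left inner_diff_left)
  qed
  have "\<psi> {e} e = 0" for e using eq[of "{e}" "{e}" e] by (simp add: \<psi>_def re_def)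
  moreover have "(\<Sum>e\<in>T. \<bar>\<psi> S e - \<psi> T e - ln (card S / card T) * ln (card T / card (T \<inter> cell \<A> e)) / 4\<bar> powr p) \<le> C * card S"
    if S: "finite S" "T \<subseteq> S" for S T
  proof -
    have "(\<Sum>e\<in>T. \<bar>\<psi> S e - \<psi> T e - ln (card S / card T) * ln (card T / card (T \<inter> cell \<A> e)) / 4\<bar> powr p)
        \<le> (\<Sum>e\<in>T. norm (H S T e) powr p)"
      using p re_le by (intro sum_mono powr_mono2) (auto simp: err[OF S])
    also have "\<dots> \<le> C * card S" using H S unfolding cell_cocycle_def by blast
    finally show ?thesis .
  qed
  moreover have "C \<ge> 0" using H by (simp add: cell_cocycle_def)
  ultimately have "\<not> large_partition \<A>" by (intro not_large_partition[OF p _ part, of C \<psi>]) auto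
  then show False using large by simp
qed

text \<open>The rows of a pairing function are infinitely many infinite sets. The final nonvanishing
  assertion mentions no partition and needs one to exist.\<close>

lemma large_partition_exists: "\<exists>\<A>. large_partition \<A>"
proof -
  define A where "A i = {n. fst (prod_decode n) = i}" for i :: nat
  have inf: "infinite (A i)" for i
  proof -
    have "range (\<lambda>j. prod_encode (i, j)) \<subseteq> A i" by (auto simp: A_def)
    moreover have "inj (\<lambda>j. prod_encode (i, j))" by (auto simp: inj_def)
    ultimately show ?thesis using range_inj_infinite finite_subset by blast
  qed
  have enc: "prod_encode (i, j) \<in> A k \<longleftrightarrow> i = k" for i j k by (simp add: A_def)
  have inj: "inj A" by (rule injI) (metis enc)
  have "partition_on UNIV (range A)"
    unfolding partition_on_def disjoint_def
  proof (intro conjI ballI impI)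
    show "\<Union> (range A) = UNIV" by (auto simp: A_def)
    show "{} \<notin> range A" using enc by (metis empty_iff imageE)
    fix X Y assume "X \<in> range A" "Y \<in> range A" "X \<noteq> Y"
    then show "X \<inter> Y = {}" by (auto simp: A_def)
  qed
  moreover have "\<exists>\<B>\<subseteq>range A. finite \<B> \<and> card \<B> = n \<and> (\<forall>B\<in>\<B>. infinite B \<or> n \<le> card B)" for n
    using inf inj by (intro exI[of _ "A ` {..<n}"]) (auto simp: card_image inj_on_subset[OF inj subset_UNIV])
  ultimately show ?thesis unfolding large_partition_def by blast
qed

theorem mainTheorem7:
  shows "(\<forall>\<A>. large_partition \<A> \<longrightarrow>
      (\<forall>p>0.
        centralizer p (Omega p :: (nat \<Rightarrow> 'k::{real_normed_field,euclidean_space}) \<Rightarrow> nat \<Rightarrow> 'k) \<and>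
        centralizer p (Omega_tilde \<A> p :: (nat \<Rightarrow> 'k) \<Rightarrow> nat \<Rightarrow> 'k)) \<and>
      (\<forall>p\<ge>1.
        Ext2_class (ell_space p :: ('k, ('k, 'u) univ) qspace) (ell_space p)
            (splice_space p (Omega_tilde \<A> p) (Omega p))
          \<in> Ext2 (ell_space p) (ell_space p) - {Ext2_zero (ell_space p) (ell_space p)}) \<and>
      (\<forall>p>0.
        Ext2_mod_class (ell_module p :: ('k, ('k, 'u) univ) qmodule) (ell_module p)
            (splice_module p (Omega_tilde \<A> p) (Omega p))
          \<in> Ext2_mod (ell_module p) (ell_module p) - {Ext2_mod_zero (ell_module p) (ell_module p)})) \<and>
    (\<forall>p>0. Ext2_mod (ell_module p :: ('k, ('k, 'u) univ) qmodule) (ell_module p)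
        \<noteq> {Ext2_mod_zero (ell_module p) (ell_module p)})"
proof -
  have cent: "centralizer p (Omega p :: (nat \<Rightarrow> 'k) \<Rightarrow> nat \<Rightarrow> 'k)"
      "centralizer p (Omega_tilde \<A> p :: (nat \<Rightarrow> 'k) \<Rightarrow> nat \<Rightarrow> 'k)" if "large_partition \<A>" "p > 0" for \<A> p
    using that centralizer_Omega centralizer_Omega_tilde by (auto simp: large_partition_def)
  have sp: "Ext2_class (ell_space p :: ('k, ('k, 'u) univ) qspace) (ell_space p) (splice_space p (Omega_tilde \<A> p) (Omega p))
      \<in> Ext2 (ell_space p) (ell_space p) - {Ext2_zero (ell_space p) (ell_space p)}" if l: "large_partition \<A>" and p: "p \<ge> 1" for \<A> p
  proof -
    have p0: "p > 0" using p by simp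
    have part: "partition_on UNIV \<A>" using l by (simp add: large_partition_def)
    show ?thesis
      using four_exact_splice_space[OF p0 cent(2)[OF l p0] cent(1)[OF l p0], where 'u = 'u]
        trivial_space_cell_cocycle[OF part p, where 'k = 'k and 'u = 'u] no_cell_cocycle[OF p0 l, where 'k = 'k]
      unfolding Ext2_def by blast
  qed
  have md: "Ext2_mod_class (ell_module p :: ('k, ('k, 'u) univ) qmodule) (ell_module p) (splice_module p (Omega_tilde \<A> p) (Omega p))
      \<in> Ext2_mod (ell_module p) (ell_module p) - {Ext2_mod_zero (ell_module p) (ell_module p)}" if l: "large_partition \<A>" and p: "p > 0" for \<A> p
  proof -
    have part: "partition_on UNIV \<A>" using l by (simp add: large_partition_def)
    show ?thesis
      using four_exact_splice_module[OF p cent(2)[OF l p] cent(1)[OF l p], where 'u = 'u]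
        trivial_module_cell_cocycle[OF part p, where 'k = 'k and 'u = 'u] no_cell_cocycle[OF p l, where 'k = 'k]
      unfolding Ext2_mod_def by blast
  qed
  obtain \<A>0 where "large_partition \<A>0" using large_partition_exists by blast
  then have "Ext2_mod (ell_module p :: ('k, ('k, 'u) univ) qmodule) (ell_module p)
      \<noteq> {Ext2_mod_zero (ell_module p) (ell_module p)}" if "p > 0" for p
    using md[OF _ that] by blast
  then show ?thesis using cent sp md by blast
qed

end
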